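(* Let $(a,b,c)$ be integers with $abc\neq 0$, $\gcd(a,b,c)=1$ and $a^{13}+b^{13}=3c^{7}$. Then $13\mid a+b$ and $4\mid a+b$. *)

theory Defs
  imports Main
begin

end

theory Submission
  imports Defs "HOL-Analysis.Analysis" "HOL-Number_Theory.Cong" "HOL-Computational_Algebra.Nth_Powers"
begin

text \<open>
  Write \<omega> for a primitive 13th root of unity and \<Phi> = (a^13 + b^13) / (a + b). Since gcd(a + b, \<Phi>)
  divides 13, the equation splits: a + b = 3 u^7 and \<Phi> = v^7 if 13 does not divide a + b, and
  a + b = 3 13^6 u^7, \<Phi> = 13 v^7 otherwise. Over the real subring of degree 6, \<Phi> is the product of
  the conjugates of Q = (a + b)^2 - \<mu> a b, where \<mu> = (1 - \<omega>)(1 - \<omega>^-1). This subring and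
  the analogous one of degree 4 are principal ideal domains, by a Dedekind--Hasse argument.

  In degree 4, \<Phi> is a product of four conjugate cubic forms in a, b. Each is a unit times a seventh
  power (up to the prime above 13), and the quotient of two complex conjugate ones is a seventh power up
  to sign, because all conjugates of the unit involved have absolute value 1. Comparing with Frobenius
  modulo 49 gives a finite computation that forces 49 | a + b.

  In degree 6 it follows that the unit in the factorisation Q = unit \<cdot> \<alpha>^7 is congruent to a seventh
  power modulo 49 (up to the unit 13 / \<mu>^6 if 13 does not divide a + b), hence is a seventh power up to
  that unit: the unit rank is at most 5, and the Fermat quotients at 7 of five cyclotomic units are
  independent modulo 7. If 13 | a + b and a + b were odd, then \<mu> times a
  seventh power would be 1 modulo 2, so that \<mu>^9 = 1 modulo 2, which is false. Hence u is even.

  If 13 does not divide a + b, subtracting multiples of two conjugates of Q gives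
  A^7 - B^7 = unit \<cdot> (3 u^7)^2, where 7 | u. Then (A^7 - B^7) / (A - B) = 7 \<cdot> unit \<cdot> square, where the
  unit is totally positive, hence a square. Modulo the prime \<mu> above 13 the left side is a nonzero
  square, so 7 would be a square modulo 13.
\<close>

section \<open>Cyclotomic integers of conductor 13\<close>

text \<open>One test explains both uses of 49. As 7 is unramified, x^7 = sg 7 x modulo 7, and
  another seventh power gains a factor 7: every z = x^7 satisfies z^7 = sg 7 z modulo 49. The
  condition is multiplicative, so the unknown unit in a factorisation is the only obstacle to
  applying it. In the quartic ring that unit cancels against its complex conjugate up to sign, which
  is why 49 | a + b is obtained there. In the real ring conjugation does not help; the unit becomes
  accessible only because 49 | a + b makes Q and Phi explicit modulo 49. Both subrings are small
  enough that the Dedekind--Hasse argument involves few primes: up to 31 in degree 6 and up to 7 in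
  degree 4. The two endings are computations in residue fields: modulo 2 the real ring has 64
  elements and 63 = 7 * 9, so non-zero seventh powers are the elements with x^9 = 1; modulo \<mu> it
  has 13 elements, among which 7 is not a square.\<close>

definition om :: complex where "om = cis (2 * pi / 13)"

abbreviation ev :: "int poly \<Rightarrow> complex \<Rightarrow> complex"
  where "ev p z \<equiv> poly (map_poly of_int p) z"

lemma ev_pCons: "ev (pCons a p) z = of_int a + z * ev p z"
  by (simp add: map_poly_pCons)

lemma ev_add: "ev (p + q) z = ev p z + ev q z"
  by (induction p q rule: poly_induct2) (simp_all add: map_poly_pCons algebra_simps)

lemma ev_smult: "ev (smult a q) z = of_int a * ev q z"
  by (induction q) (simp_all add: map_poly_pCons algebra_simps)

lemma ev_mult: "ev (p * q) z = ev p z * ev q z"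
  by (induction p) (simp_all add: ev_add ev_smult map_poly_pCons algebra_simps)

lemma ev_uminus: "ev (- p) z = - ev p z"
  using ev_smult[of "-1" p z] by simp

lemma ev_diff: "ev (p - q) z = ev p z - ev q z"
  using ev_add[of p "- q" z] by (simp add: ev_uminus)

lemma ev_monom: "ev (monom 1 n) z = z ^ n"
  by (simp add: map_poly_monom poly_monom)

lemma ev_pcompose: "ev (pcompose p q) z = ev p (ev q z)"
  by (induction p) (simp_all add: pcompose_pCons ev_add ev_mult map_poly_pCons algebra_simps)

lemma om_pow_13: "om ^ 13 = 1"
  by (simp add: om_def Complex.DeMoivre)

lemma om_pow_mod: "om ^ (k mod 13) = om ^ k"
proof -
  have "om ^ k = om ^ (13 * (k div 13) + k mod 13)"
    by simp
  also have "\<dots> = om ^ (k mod 13)"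
    by (simp only: power_add power_mult om_pow_13) simp
  finally show ?thesis by simp
qed

lemma om_pow_cong: "[k = l] (mod 13) \<Longrightarrow> om ^ k = om ^ l"
  by (metis om_pow_mod cong_def)

lemma om_pow_eq_1_iff: "om ^ k = 1 \<longleftrightarrow> 13 dvd k"
proof
  assume "13 dvd k"
  then show "om ^ k = 1"
    by (metis om_pow_mod dvd_imp_mod_0 power_0)
next
  assume h: "om ^ k = 1"
  define j where "j = k mod 13"
  have "j < 13" by (simp add: j_def)
  have "om ^ j = 1" using h om_pow_mod by (simp add: j_def)
  then have "cis (2 * pi * real j / 13) = 1"
    by (simp add: om_def Complex.DeMoivre mult_ac)
  then have "cos (2 * pi * real j / 13) = 1"
    by (simp add: cis.code complex_eq_iff)
  then obtain n :: int where "2 * pi * real j / 13 = real_of_int n * 2 * pi"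
    by (auto simp: cos_one_2pi_int)
  then have "real j = 13 * real_of_int n"
    by (simp add: field_simps)
  then have "int j = 13 * n" by linarith
  then have "13 dvd j" by presburger
  then show "13 dvd k" by (simp add: j_def dvd_mod_iff)
qed

lemma om_nonzero [simp]: "om \<noteq> 0" by (simp add: om_def)

lemma norm_om [simp]: "norm om = 1" by (simp add: om_def)

lemma cnj_om_pow: "cnj (om ^ k) = om ^ (12 * k)"
proof -
  have "om ^ k * om ^ (12 * k) = 1"
    by (simp only: power_add[symmetric]) (simp add: om_pow_eq_1_iff)
  moreover have "om ^ k * cnj (om ^ k) = 1"
    using complex_norm_square[of "om ^ k"] by (simp add: norm_power)
  ultimately show ?thesis
    by (metis mult_cancel_left om_nonzero power_not_zero)
qed

lemma om_pow_sum:
  assumes "\<not> 13 dvd k"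
  shows "(\<Sum>j=0..12. om ^ (j * k)) = 0"
proof -
  have "(om ^ k - 1) * (\<Sum>j<13. (om ^ k) ^ j) = (om ^ k) ^ 13 - 1"
    by (rule power_diff_1_eq[symmetric])
  also have "\<dots> = 0" by (simp add: power_mult[symmetric] om_pow_eq_1_iff)
  finally have "(\<Sum>j<13. (om ^ k) ^ j) = 0"
    using assms by (simp add: om_pow_eq_1_iff)
  moreover have "{..<13} = {0..12::nat}" by auto
  ultimately show ?thesis by (simp add: power_mult[symmetric] mult.commute)
qed

section \<open>Coordinates in a normal basis\<close>

text \<open>The basis om, ..., om^12 is preferred to 1, ..., om^11 because the Galois group permutes
  it: \<open>val c k\<close> is the conjugate of \<open>val c 1\<close> under om -> om^k, and
  elements of a fixed ring have coefficients constant on orbits. The price is that an integer n has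
  all its coefficients equal to -n.\<close>

definition val :: "(nat \<Rightarrow> int) \<Rightarrow> nat \<Rightarrow> complex"
  where "val c k = (\<Sum>j=1..12. of_int (c j) * om ^ (j * k))"

lemma om_pow_sum': "\<not> 13 dvd k \<Longrightarrow> (\<Sum>j=1..12. om ^ (j * k)) = -1"
  using om_pow_sum[of k] by (simp add: sum.atLeast_Suc_atMost[of 0] add_eq_0_iff)

lemma val_const: "\<not> 13 dvd k \<Longrightarrow> val (\<lambda>_. - a) k = of_int a"
  using om_pow_sum'[of k] unfolding val_def by (simp only: sum_distrib_left[symmetric]) simp

lemma val_add: "val c k + val d k = val (\<lambda>j. c j + d j) k"
  by (simp add: val_def sum.distrib algebra_simps)

lemma val_smult: "of_int n * val c k = val (\<lambda>j. n * c j) k"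
  by (simp add: val_def sum_distrib_left algebra_simps)

lemma val_diff: "val c k - val d k = val (\<lambda>j. c j - d j) k"
  by (simp add: val_def sum_subtractf algebra_simps)

text \<open>The overflow om^13 = 1 is rewritten as minus the sum of the basis, hence the correction
  by \<open>c 12\<close> in every coordinate.\<close>

lemma val_om:
  assumes "\<not> 13 dvd k"
  shows "om ^ k * val c k = val (\<lambda>j. (if j = 1 then 0 else c (j - 1)) - c 12) k"
proof -
  have "om ^ k * val c k = (\<Sum>j=1..12. of_int (c j) * om ^ (Suc j * k))"
    by (simp add: val_def sum_distrib_left power_add mult_ac)
  also have "\<dots> = (\<Sum>j=2..13. of_int (c (j - 1)) * om ^ (j * k))"
    by (rule sum.reindex_bij_witness[of _ "\<lambda>j. j - 1" Suc]) auto
  also have "{2..13::nat} = insert 13 {2..12}" by auto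
  also have "(\<Sum>j\<in>insert 13 {2..12}. of_int (c (j - 1)) * om ^ (j * k)) =
      of_int (c 12) + (\<Sum>j=2..12. of_int (c (j - 1)) * om ^ (j * k))"
    by (subst sum.insert) (auto simp: om_pow_eq_1_iff)
  also have "(\<Sum>j=2..12. of_int (c (j - 1)) * om ^ (j * k)) =
      (\<Sum>j=1..12. of_int (if j = 1 then 0 else c (j - 1)) * om ^ (j * k))"
    by (subst (2) sum.atLeast_Suc_atMost) (auto simp: numeral_2_eq_2 intro!: sum.cong)
  also have "of_int (c 12) = val (\<lambda>_. - c 12) k" using val_const[OF assms] by simp
  also have "val (\<lambda>_. - c 12) k + (\<Sum>j=1..12. of_int (if j = 1 then 0 else c (j - 1)) * om ^ (j * k)) =
      val (\<lambda>j. (if j = 1 then 0 else c (j - 1)) - c 12) k"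
    by (simp add: val_def sum.distrib[symmetric] algebra_simps)
  finally show ?thesis .
qed

text \<open>It matters that one c serves all k: once coordinates are known to be unique, an equality
  at om carries over to every conjugate.\<close>

lemma ev_val: "\<exists>c. \<forall>k. \<not> 13 dvd k \<longrightarrow> ev p (om ^ k) = val c k"
proof (induction p)
  case 0
  have "val (\<lambda>_. 0) k = 0" for k by (simp add: val_def)
  then show ?case by (metis map_poly_0 poly_0)
next
  case (pCons a p)
  then obtain c where c: "\<And>k. \<not> 13 dvd k \<Longrightarrow> ev p (om ^ k) = val c k" by blast
  have "ev (pCons a p) (om ^ k) = val (\<lambda>j. - a + ((if j = 1 then 0 else c (j - 1)) - c 12)) k"
    if "\<not> 13 dvd k" for k
    using that by (simp only: ev_pCons c val_om val_add[symmetric] val_const not_False_eq_True)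
  then show ?case by blast
qed

definition Zom :: "complex set" where "Zom = {x. \<exists>p. x = ev p om}"

lemma Zom_ev [simp]: "ev p om \<in> Zom" by (auto simp: Zom_def)

lemma Zom_val: assumes "x \<in> Zom" obtains c where "x = val c 1"
proof -
  obtain p where "x = ev p om" using assms by (auto simp: Zom_def)
  moreover obtain c where "\<forall>k. \<not> 13 dvd k \<longrightarrow> ev p (om ^ k) = val c k" using ev_val by blast
  then have "ev p (om ^ 1) = val c 1" by (metis nat_dvd_1_iff_1 numeral_eq_one_iff semiring_norm(85) semiring_norm(86) numeral_One)
  ultimately show ?thesis using that by simp
qed

lemma Zom_add [simp, intro]: "x \<in> Zom \<Longrightarrow> y \<in> Zom \<Longrightarrow> x + y \<in> Zom"
  by (auto simp: Zom_def ev_add[symmetric])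
lemma Zom_mult [simp, intro]: "x \<in> Zom \<Longrightarrow> y \<in> Zom \<Longrightarrow> x * y \<in> Zom"
  by (auto simp: Zom_def ev_mult[symmetric])
lemma Zom_uminus [simp, intro]: "x \<in> Zom \<Longrightarrow> - x \<in> Zom"
  by (auto simp: Zom_def ev_uminus[symmetric])
lemma Zom_diff [simp, intro]: "x \<in> Zom \<Longrightarrow> y \<in> Zom \<Longrightarrow> x - y \<in> Zom"
  by (auto simp: Zom_def ev_diff[symmetric])
lemma Zom_of_int [simp]: "of_int n \<in> Zom"
  using Zom_ev[of "[:n:]"] by (simp add: map_poly_pCons)
lemma Zom_of_nat [simp]: "of_nat n \<in> Zom" by (metis Zom_of_int of_int_of_nat_eq)
lemma Zom_numeral [simp]: "numeral n \<in> Zom" by (metis Zom_of_int of_int_numeral)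
lemma Zom_1 [simp]: "1 \<in> Zom" by (metis Zom_of_int of_int_1)
lemma Zom_0 [simp]: "0 \<in> Zom" by (metis Zom_of_int of_int_0)
lemma Zom_om [simp]: "om \<in> Zom" using Zom_ev[of "monom 1 1"] by (simp add: ev_monom)
lemma Zom_power [simp, intro]: "x \<in> Zom \<Longrightarrow> x ^ n \<in> Zom" by (induction n) auto
lemma Zom_sum [intro]: "(\<And>i. i \<in> I \<Longrightarrow> f i \<in> Zom) \<Longrightarrow> sum f I \<in> Zom"
  by (induction I rule: infinite_finite_induct) auto
lemma Zom_prod [intro]: "(\<And>i. i \<in> I \<Longrightarrow> f i \<in> Zom) \<Longrightarrow> prod f I \<in> Zom"
  by (induction I rule: infinite_finite_induct) auto
lemma val_in_Zom [simp]: "val c k \<in> Zom" unfolding val_def by (intro Zom_sum) auto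

text \<open>If 13 y = 1, then 1 is an eigenvalue of 13 times an integer matrix, whose characteristic polynomial at 1 is 1 modulo 13.\<close>

lemma not_unit_13:
  assumes "y \<in> Zom" shows "13 * y \<noteq> 1"
proof
  assume y: "13 * y = 1"
  have "\<exists>c. om ^ Suc i * y = val c 1" for i
    using Zom_val[of "om ^ Suc i * y"] assms by (metis Zom_mult Zom_om Zom_power)
  then obtain A :: "nat \<Rightarrow> nat \<Rightarrow> int" where A: "\<And>i. om ^ Suc i * y = val (A i) 1" by metis
  obtain f :: "12 \<Rightarrow> nat" where f: "bij_betw f UNIV {1..12}"
    using finite_same_card_bij[of "UNIV :: 12 set" "{1..12::nat}"] by auto
  define M :: "int^12^12" where "M = (\<chi> i j. (if i = j then 1 else 0) - 13 * A (f i - 1) (f j))"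
  define Mc :: "complex^12^12" where "Mc = (\<chi> i j. of_int (M $ i $ j))"
  define v :: "complex^12" where "v = (\<chi> j. om ^ f j)"
  have fpos: "f i \<ge> 1" for i using f by (auto simp: bij_betw_def)
  have "(Mc *v v) $ i = 0" for i
  proof -
    have "(Mc *v v) $ i = (\<Sum>j\<in>UNIV. ((if i = j then 1 else 0) - 13 * of_int (A (f i - 1) (f j))) * om ^ f j)"
      unfolding matrix_vector_mult_def Mc_def M_def v_def by (auto intro!: sum.cong)
    also have "\<dots> = (\<Sum>j\<in>UNIV. (if i = j then om ^ f j else 0)) - 13 * (\<Sum>j\<in>UNIV. of_int (A (f i - 1) (f j)) * om ^ f j)"
      unfolding sum_distrib_left sum_subtractf[symmetric] by (intro sum.cong) (auto simp: algebra_simps)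
    also have "(\<Sum>j\<in>UNIV. of_int (A (f i - 1) (f j)) * om ^ f j) = (\<Sum>j=1..12. of_int (A (f i - 1) j) * om ^ j)"
      using sum.reindex_bij_betw[OF f, of "\<lambda>j. of_int (A (f i - 1) j) * om ^ j"] by simp
    also have "\<dots> = om ^ f i * y" using A[of "f i - 1"] fpos[of i] by (simp add: val_def)
    also have "(\<Sum>j\<in>UNIV. (if i = j then om ^ f j else 0)) = om ^ f i" by simp
    also have "om ^ f i - 13 * (om ^ f i * y) = om ^ f i * (1 - 13 * y)" by (simp add: algebra_simps)
    also have "\<dots> = 0" using y by simp
    finally show ?thesis .
  qed
  then have "Mc *v v = 0" by (simp add: vec_eq_iff)
  moreover have "v \<noteq> 0" by (auto simp: v_def vec_eq_iff)
  ultimately have "\<not> invertible Mc"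
    by (metis invertible_def matrix_left_invertible_ker)
  then have "det Mc = 0" by (simp add: invertible_det_nz)
  moreover have "det Mc = of_int (det M)" by (simp add: det_def Mc_def)
  ultimately have "det M = 0" by simp
  moreover have "[det M = det (mat 1 :: int^12^12)] (mod 13)"
    unfolding det_def
  proof (intro cong_sum cong_mult cong_refl cong_prod)
    fix p and i :: 12
    show "[M $ i $ p i = (mat 1 :: int^12^12) $ i $ p i] (mod 13)"
      by (auto simp: M_def mat_def cong_iff_dvd_diff)
  qed
  ultimately show False by (auto simp: cong_def)
qed

section \<open>The prime 1 - om above 13\<close>

text \<open>Modulo 1 - om the root om becomes 1, so the value of a polynomial at om has the residue
  \<open>poly p 1\<close>.\<close>

lemma lam_dvd_ev: "\<exists>y\<in>Zom. ev p om - of_int (poly p 1) = (1 - om) * y"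
proof (induction p)
  case 0
  then show ?case by (auto intro!: bexI[of _ 0])
next
  case (pCons a p)
  then obtain y where y: "y \<in> Zom" "ev p om - of_int (poly p 1) = (1 - om) * y" by blast
  have "ev (pCons a p) om - of_int (poly (pCons a p) 1) = (om - 1) * ev p om + (ev p om - of_int (poly p 1))"
    by (simp add: map_poly_pCons algebra_simps)
  also have "\<dots> = (1 - om) * (y - ev p om)"
    by (simp add: y algebra_simps)
  finally show ?case using y by (auto intro!: bexI[of _ "y - ev p om"])
qed

lemma om_sum_0: "(\<Sum>j\<le>12. om ^ j) = 0"
  using om_pow_sum[of 1] by (simp add: atMost_atLeast0)

lemma lam_dvd_13: "\<exists>y\<in>Zom. 13 = (1 - om) * y"
proof -
  define p where "p = (\<Sum>j\<le>12. monom (1::int) j)"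
  have "ev p om = (\<Sum>j\<le>12. om ^ j)"
    unfolding p_def by (simp add: map_poly_monom poly_monom ev_add numeral_eq_Suc)
  then have "ev p om = 0" by (simp add: om_sum_0)
  moreover have "poly p 1 = 13" by (simp add: p_def poly_sum poly_monom)
  ultimately obtain y where "y \<in> Zom" "- 13 = (1 - om) * y" using lam_dvd_ev[of p] by auto
  then show ?thesis by (intro bexI[of _ "- y"]) (auto simp: algebra_simps)
qed

lemma lam_pow_12: "\<exists>y\<in>Zom. (1 - om) ^ 12 = 13 * (-1 + (1 - om) * y)"
proof -
  \<comment> \<open>The quotient of (1 - X)^12 - (1 + X + ... + X^12) by 13; its value at 1 is -13 /
    13 = -1.\<close>
  define p where "p = [:0, -1, 5, -17, 38, -61, 71, -61, 38, -17, 5, -1, 0::int:]"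
  have "(1 - om) ^ 12 = (\<Sum>j\<le>12. om ^ j) + 13 * ev p om"
    unfolding p_def by (simp add: map_poly_pCons numeral_eq_Suc algebra_simps)
  then have "(1 - om) ^ 12 = 13 * ev p om" by (simp add: om_sum_0)
  moreover have "poly p 1 = -1" by (simp add: p_def)
  ultimately show ?thesis using lam_dvd_ev[of p]
    by (metis (no_types, lifting) add.commute diff_add_cancel of_int_minus of_int_1 uminus_add_conv_diff diff_minus_eq_add)
qed

text \<open>Otherwise 1 - om would divide 1; then so would (1 - om)^12, and with it 13, against
  \<open>not_unit_13\<close>.\<close>

lemma lam_dvd_int:
  assumes "z \<in> Zom" "of_int n = (1 - om) * z"
  shows "13 dvd n"
proof (rule ccontr)
  assume "\<not> 13 dvd n"
  moreover have "prime (13::int)" by simp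
  ultimately have "coprime n 13" by (metis coprime_commute prime_imp_coprime)
  then obtain s t where st: "s * n + t * 13 = 1" by (metis bezout_int coprime_iff_gcd_eq_1)
  obtain y where y: "y \<in> Zom" "13 = (1 - om) * y" using lam_dvd_13 by blast
  obtain w where w: "w \<in> Zom" "(1 - om) ^ 12 = 13 * (-1 + (1 - om) * w)" using lam_pow_12 by blast
  have "(1::complex) = of_int (s * n + t * 13)" by (simp add: st)
  also have "\<dots> = of_int s * of_int n + of_int t * 13" by simp
  also have "\<dots> = (1 - om) * (of_int s * z + of_int t * y)"
    by (simp add: assms(2)) (simp add: y(2) algebra_simps)
  finally have "1 = (1 - om) ^ 12 * (of_int s * z + of_int t * y) ^ 12"
    by (metis power_one power_mult_distrib)
  then have "13 * ((-1 + (1 - om) * w) * (of_int s * z + of_int t * y) ^ 12) = 1"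
    by (simp only: w(2) mult.assoc)
  moreover have "(-1 + (1 - om) * w) * (of_int s * z + of_int t * y) ^ 12 \<in> Zom"
    using assms w y by (intro Zom_mult Zom_power Zom_add Zom_diff Zom_uminus) auto
  ultimately show False using not_unit_13 by blast
qed

text \<open>The prime \<lambda> = 1 - \<omega> has \<lambda>^12 = 13 \<cdot> unit, so an integer relation among the powers of \<lambda> has all coefficients
  divisible by 13; infinite descent then gives linear independence.\<close>

lemma lam_coeffs_dvd:
  fixes b :: "nat \<Rightarrow> int"
  assumes "(\<Sum>l\<le>11. of_int (b l) * (1 - om) ^ l) = 0" "i \<le> 11"
  shows "13 dvd b i"
  using assms(2)
proof (induction i rule: less_induct)
  case (less i)
  define L where "L = 1 - om"
  have L: "L \<in> Zom" "L \<noteq> 0" using om_pow_eq_1_iff[of 1] by (auto simp: L_def)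
  obtain w where w: "w \<in> Zom" "L ^ 12 = 13 * (-1 + L * w)" using lam_pow_12 by (auto simp: L_def)
  have "\<forall>l<i. \<exists>d. b l = 13 * d" using less by (auto simp: dvd_def)
  then obtain d where d: "\<And>l. l < i \<Longrightarrow> b l = 13 * d l" by metis
  have split: "{..11} = {..<i} \<union> {i} \<union> {Suc i..11}" using less.prems by auto
  \<comment> \<open>After multiplication by L^(11 - i) the terms below i carry a factor 13 by
    induction, term i sits at L^11, and the terms above i contain L^12, which is divisible by 13.
    One more factor L then turns L^11 into 13 times an element congruent to -1 modulo L.\<close>
  have "0 = L ^ (11 - i) * (\<Sum>l\<le>11. of_int (b l) * L ^ l)" using assms(1) by (simp add: L_def)
  also have "\<dots> = L ^ (11 - i) * ((\<Sum>l<i. of_int (b l) * L ^ l) + of_int (b i) * L ^ i + (\<Sum>l\<in>{Suc i..11}. of_int (b l) * L ^ l))"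
    unfolding split by (subst sum.union_disjoint; (subst sum.union_disjoint)?) auto
  also have "(\<Sum>l<i. of_int (b l) * L ^ l) = 13 * (\<Sum>l<i. of_int (d l) * L ^ l)"
    unfolding sum_distrib_left by (rule sum.cong) (auto simp: d)
  also have "(\<Sum>l\<in>{Suc i..11}. of_int (b l) * L ^ l) = L ^ Suc i * (\<Sum>l\<in>{Suc i..11}. of_int (b l) * L ^ (l - Suc i))"
    unfolding sum_distrib_left
  proof (rule sum.cong, goal_cases)
    case (2 l)
    then have "L ^ l = L ^ Suc i * L ^ (l - Suc i)" by (simp only: power_add[symmetric]) simp
    then show ?case by (simp only: mult_ac)
  qed simp
  finally have "0 = 13 * (L ^ (11 - i) * (\<Sum>l<i. of_int (d l) * L ^ l)) + of_int (b i) * (L ^ (11 - i) * L ^ i)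
      + (L ^ (11 - i) * L ^ Suc i) * (\<Sum>l\<in>{Suc i..11}. of_int (b l) * L ^ (l - Suc i))"
    by (simp only: algebra_simps)
  moreover have "L ^ (11 - i) * L ^ i = L ^ 11" "L ^ (11 - i) * L ^ Suc i = L ^ 12"
    using less.prems by (simp_all only: power_add[symmetric]) auto
  ultimately have "0 = 13 * (L ^ (11 - i) * (\<Sum>l<i. of_int (d l) * L ^ l)) + of_int (b i) * L ^ 11
      + 13 * ((-1 + L * w) * (\<Sum>l\<in>{Suc i..11}. of_int (b l) * L ^ (l - Suc i)))"
    by (simp only: w mult.assoc)
  moreover define u where "u = - (L ^ (11 - i) * (\<Sum>l<i. of_int (d l) * L ^ l) + (-1 + L * w) * (\<Sum>l\<in>{Suc i..11}. of_int (b l) * L ^ (l - Suc i)))"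
  moreover have "x = 13 * - (P + R)" if "0 = 13 * P + x + 13 * R" for P x R :: complex
    using that by algebra
  ultimately have "of_int (b i) * L ^ 11 = 13 * u" by blast
  moreover have u: "u \<in> Zom" unfolding u_def using L w
    by (intro Zom_uminus Zom_add Zom_mult Zom_sum Zom_power) auto
  ultimately have "of_int (b i) * L ^ 12 = 13 * (L * u)"
    by (simp add: power_Suc eval_nat_numeral algebra_simps)
  then have "13 * (of_int (b i) * (-1 + L * w)) = 13 * (L * u)" by (simp only: w(2) mult_ac)
  then have "of_int (b i) * (-1 + L * w) = L * u" by (metis mult_cancel_left zero_neq_numeral)
  then have "of_int (b i) = L * (of_int (b i) * w - u)" by (simp add: algebra_simps)
  then show ?case using lam_dvd_int[of "of_int (b i) * w - u"] u w by (auto simp: L_def)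
qed

lemma ev_sum: "ev p z = (\<Sum>i\<le>degree p. of_int (coeff p i) * z ^ i)"
  by (simp add: poly_altdef coeff_map_poly degree_map_poly)

lemma ev_eq_0_imp:
  assumes "ev p om = 0" "degree p \<le> 11"
  shows "p = 0"
proof -
  \<comment> \<open>Dividing a non-zero relation by 13 decreases the sum of the absolute values of
    its coefficients, which is the measure of the descent.\<close>
  have main: "q = 0" if "ev q (1 - om) = 0" "degree q \<le> 11" for q
    using that
  proof (induction "nat (\<Sum>i\<le>11. \<bar>coeff q i\<bar>)" arbitrary: q rule: less_induct)
    case less
    have "ev q (1 - om) = (\<Sum>l\<le>11. of_int (coeff q l) * (1 - om) ^ l)"
      unfolding ev_sum using less.prems(2)
      by (intro sum.mono_neutral_left) (auto simp: coeff_eq_0)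
    then have "13 dvd coeff q i" if "i \<le> 11" for i
      using lam_coeffs_dvd[of "coeff q" i] less.prems that by simp
    then have "13 dvd coeff q i" for i
      using less.prems(2) by (cases "i \<le> 11") (auto simp: coeff_eq_0)
    then have "[:13:] dvd q" by (simp add: const_poly_dvd_iff)
    then obtain r where r: "q = smult 13 r" by (auto elim!: dvdE)
    show "q = 0"
    proof (rule ccontr)
      assume "q \<noteq> 0"
      then have "r \<noteq> 0" "degree r = degree q" using r by auto
      have c: "coeff q i = 13 * coeff r i" for i by (simp add: r)
      have "\<bar>coeff r (degree r)\<bar> \<le> (\<Sum>i\<le>11. \<bar>coeff r i\<bar>)"
        by (rule member_le_sum) (use \<open>degree r = degree q\<close> less.prems in auto)
      then have pos: "(\<Sum>i\<le>11. \<bar>coeff r i\<bar>) > 0" using \<open>r \<noteq> 0\<close> leading_coeff_0_iff[of r] by linarith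
      have "(\<Sum>i\<le>11. \<bar>coeff q i\<bar>) = 13 * (\<Sum>i\<le>11. \<bar>coeff r i\<bar>)"
        by (simp add: c abs_mult sum_distrib_left)
      then have "nat (\<Sum>i\<le>11. \<bar>coeff r i\<bar>) < nat (\<Sum>i\<le>11. \<bar>coeff q i\<bar>)" using pos by simp
      moreover have "ev r (1 - om) = 0" using less.prems(1) by (simp add: r ev_smult)
      ultimately have "r = 0" using less.hyps less.prems \<open>degree r = degree q\<close> by simp
      then show False using \<open>r \<noteq> 0\<close> by simp
    qed
  qed
  define q where "q = pcompose p [:1, -1:]"
  have "ev q (1 - om) = 0" using assms(1) by (simp add: q_def ev_pcompose map_poly_pCons)
  moreover have "degree q \<le> 11" using assms(2) by (simp add: q_def degree_pcompose)
  ultimately have "q = 0" by (rule main)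
  then show ?thesis by (simp add: q_def pcompose_eq_0_iff)
qed

lemma val_eq_0_imp:
  assumes "val c 1 = 0" "j \<in> {1..12}"
  shows "c j = 0"
proof -
  define p where "p = Poly (map (\<lambda>i. c (Suc i)) [0..<12])"
  have cp: "coeff p i = (if i < 12 then c (Suc i) else 0)" for i
    by (auto simp: p_def nth_default_def)
  have "degree p \<le> 11" by (rule degree_le) (auto simp: cp)
  have "ev p om = (\<Sum>i\<le>11. of_int (coeff p i) * om ^ i)"
    unfolding ev_sum using \<open>degree p \<le> 11\<close>
    by (intro sum.mono_neutral_left) (auto simp: coeff_eq_0)
  also have "\<dots> = (\<Sum>i\<le>11. of_int (c (Suc i)) * om ^ i)" by (intro sum.cong) (auto simp: cp)
  finally have "om * ev p om = (\<Sum>i\<le>11. of_int (c (Suc i)) * om ^ Suc i)"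
    by (simp add: sum_distrib_left mult_ac)
  also have "\<dots> = (\<Sum>j=1..12. of_int (c j) * om ^ j)"
    by (rule sum.reindex_bij_witness[of _ "\<lambda>j. j - 1" Suc]) auto
  also have "\<dots> = 0" using assms by (simp add: val_def)
  finally have "p = 0" using ev_eq_0_imp[of p] \<open>degree p \<le> 11\<close> by simp
  then show ?thesis using cp[of "j - 1"] assms by (auto split: if_splits)
qed

lemma val_inj: "val c 1 = val d 1 \<Longrightarrow> j \<in> {1..12} \<Longrightarrow> c j = d j"
  using val_eq_0_imp[of "\<lambda>j. c j - d j" j] by (simp add: val_diff[symmetric])

lemma ev_wd:
  assumes "ev p om = ev q om" "\<not> 13 dvd k"
  shows "ev p (om ^ k) = ev q (om ^ k)"
proof -
  obtain c where c: "\<And>k. \<not> 13 dvd k \<Longrightarrow> ev (p - q) (om ^ k) = val c k" using ev_val by blast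
  have "val c 1 = 0" using c[of 1] assms by (simp add: ev_diff)
  then have "val c k = 0" using val_eq_0_imp[of c] by (simp add: val_def)
  then show ?thesis using c[OF assms(2)] by (simp add: ev_diff)
qed

text \<open>The Galois action \<omega> \<mapsto> \<omega>^k. It is specified only on Zom and for k prime to 13, where the chosen
  polynomial does not matter.\<close>

definition sg :: "nat \<Rightarrow> complex \<Rightarrow> complex"
  where "sg k x = ev (SOME p. x = ev p om) (om ^ k)"

lemma sg_ev: "\<not> 13 dvd k \<Longrightarrow> sg k (ev p om) = ev p (om ^ k)"
  unfolding sg_def by (rule ev_wd[symmetric], rule someI[of "\<lambda>q. ev p om = ev q om"]) auto

lemma sg_add [simp]: "\<not> 13 dvd k \<Longrightarrow> x \<in> Zom \<Longrightarrow> y \<in> Zom \<Longrightarrow> sg k (x + y) = sg k x + sg k y"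
  by (auto simp: Zom_def sg_ev ev_add[symmetric])
lemma sg_mult [simp]: "\<not> 13 dvd k \<Longrightarrow> x \<in> Zom \<Longrightarrow> y \<in> Zom \<Longrightarrow> sg k (x * y) = sg k x * sg k y"
  by (auto simp: Zom_def sg_ev ev_mult[symmetric])
lemma sg_diff [simp]: "\<not> 13 dvd k \<Longrightarrow> x \<in> Zom \<Longrightarrow> y \<in> Zom \<Longrightarrow> sg k (x - y) = sg k x - sg k y"
  by (auto simp: Zom_def sg_ev ev_diff[symmetric])
lemma sg_uminus [simp]: "\<not> 13 dvd k \<Longrightarrow> x \<in> Zom \<Longrightarrow> sg k (- x) = - sg k x"
  by (auto simp: Zom_def sg_ev ev_uminus[symmetric])
lemma sg_of_int [simp]: "\<not> 13 dvd k \<Longrightarrow> sg k (of_int n) = of_int n"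
  using sg_ev[of k "[:n:]"] by (simp add: map_poly_pCons)
lemma sg_of_nat [simp]: "\<not> 13 dvd k \<Longrightarrow> sg k (of_nat n) = of_nat n"
  by (metis of_int_of_nat_eq sg_of_int)
lemma sg_numeral [simp]: "\<not> 13 dvd k \<Longrightarrow> sg k (numeral n) = numeral n"
  by (metis of_int_numeral sg_of_int)
lemma sg_1 [simp]: "\<not> 13 dvd k \<Longrightarrow> sg k 1 = 1" by (metis of_int_1 sg_of_int)
lemma sg_0 [simp]: "\<not> 13 dvd k \<Longrightarrow> sg k 0 = 0" by (metis of_int_0 sg_of_int)
lemma sg_om [simp]: "\<not> 13 dvd k \<Longrightarrow> sg k om = om ^ k"
  using sg_ev[of k "monom 1 1"] by (simp add: ev_monom)
lemma sg_power [simp]: "\<not> 13 dvd k \<Longrightarrow> x \<in> Zom \<Longrightarrow> sg k (x ^ n) = sg k x ^ n"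
  by (induction n) auto
lemma sg_sum: "\<not> 13 dvd k \<Longrightarrow> (\<And>i. i \<in> I \<Longrightarrow> f i \<in> Zom) \<Longrightarrow> sg k (sum f I) = (\<Sum>i\<in>I. sg k (f i))"
  by (induction I rule: infinite_finite_induct) (auto simp: Zom_sum)
lemma sg_prod: "\<not> 13 dvd k \<Longrightarrow> (\<And>i. i \<in> I \<Longrightarrow> f i \<in> Zom) \<Longrightarrow> sg k (prod f I) = (\<Prod>i\<in>I. sg k (f i))"
  by (induction I rule: infinite_finite_induct) (auto simp: Zom_prod)

lemma sg_in [simp, intro]: "\<not> 13 dvd k \<Longrightarrow> x \<in> Zom \<Longrightarrow> sg k x \<in> Zom"
proof -
  assume a: "\<not> 13 dvd k" "x \<in> Zom"
  then obtain p where "x = ev p om" by (auto simp: Zom_def)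
  then have "sg k x = ev (pcompose p (monom 1 k)) om" by (simp add: a sg_ev ev_pcompose ev_monom)
  then show ?thesis by simp
qed

lemma sg_sg: "\<not> 13 dvd k \<Longrightarrow> \<not> 13 dvd l \<Longrightarrow> x \<in> Zom \<Longrightarrow> sg k (sg l x) = sg (k * l) x"
proof -
  assume a: "\<not> 13 dvd k" "\<not> 13 dvd l" "x \<in> Zom"
  then obtain p where p: "x = ev p om" by (auto simp: Zom_def)
  have "\<not> 13 dvd k * l" using a prime_dvd_mult_iff[of "13::nat" k l] by simp
  have "sg l x = ev (pcompose p (monom 1 l)) om" by (simp add: p a sg_ev ev_pcompose ev_monom)
  then have "sg k (sg l x) = ev (pcompose p (monom 1 l)) (om ^ k)" by (simp only: sg_ev a not_False_eq_True)
  also have "\<dots> = ev p (om ^ (k * l))" by (simp add: ev_pcompose ev_monom power_mult)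
  also have "\<dots> = sg (k * l) x" using \<open>\<not> 13 dvd k * l\<close> by (simp add: p sg_ev)
  finally show ?thesis .
qed

lemma sg_id [simp]: "x \<in> Zom \<Longrightarrow> sg 1 x = x" "x \<in> Zom \<Longrightarrow> sg (Suc 0) x = x"
  using sg_ev[of 1] by (auto simp: Zom_def)

lemma sg_mod: "sg (k mod 13) x = sg k x"
  by (simp add: sg_def om_pow_mod)

lemma sg_cong: "[k = l] (mod 13) \<Longrightarrow> sg k x = sg l x"
  by (metis sg_mod cong_def)

lemma sg_val: "\<not> 13 dvd k \<Longrightarrow> sg k (val c 1) = val c k"
  unfolding val_def by (subst sg_sum) (auto simp: power_mult[symmetric] mult.commute)

lemma cnj_sg:
  assumes "\<not> 13 dvd k" "x \<in> Zom" shows "cnj (sg k x) = sg (12 * k) x"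
proof -
  obtain c where x: "x = val c 1" using Zom_val assms by blast
  have "\<not> 13 dvd 12 * k" using assms prime_dvd_mult_iff[of "13::nat" 12 k] by simp
  then show ?thesis unfolding x using assms(1)
    by (simp only: sg_val \<open>\<not> 13 dvd 12 * k\<close>  not_False_eq_True) (simp add: val_def cnj_om_pow mult_ac del: complex_cnj_power)
qed

text \<open>The integer a has all coordinates equal to -a, so b x = a forces b to divide a, by
  uniqueness of coordinates.\<close>

lemma Zom_rat:
  assumes "x \<in> Zom" "of_int b * x = of_int a" "b \<noteq> 0"
  shows "\<exists>n. x = of_int n"
proof -
  obtain c where x: "x = val c 1" using Zom_val assms by blast
  have "val (\<lambda>j. b * c j) 1 = val (\<lambda>j. - a) 1"
    using assms(2) val_const[of 1 a] by (simp add: x val_smult)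
  then have "b * c j = - a" if "j \<in> {1..12}" for j using val_inj that by fastforce
  from this[of 1] have "of_int a = of_int b * (of_int (- c 1) :: complex)"
    by (metis add.inverse_inverse atLeastAtMost_iff le_numeral_extra(4) mult_minus_right of_int_mult one_le_numeral)
  then have "of_int b * x = of_int b * of_int (- c 1)" using assms(2) by metis
  then have "x = of_int (- c 1)" using assms(3) by (metis mult_cancel_left of_int_eq_0_iff)
  then show ?thesis by blast
qed

section \<open>Norms and fixed rings\<close>

lemma not_dvd_13: "k \<in> {1..12} \<Longrightarrow> \<not> 13 dvd (k::nat)"
  by (auto dest: dvd_imp_le)

lemma not_dvd_13_mult: "\<not> 13 dvd (k::nat) \<Longrightarrow> \<not> 13 dvd l \<Longrightarrow> \<not> 13 dvd k * l"
  using prime_dvd_mult_iff[of "13::nat" k l] by simp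

lemma mod_13_in: "\<not> 13 dvd (k::nat) \<Longrightarrow> k mod 13 \<in> {1..12}"
  by (auto simp: Suc_le_eq dvd_eq_mod_eq_0 less_Suc_eq_le[symmetric])

lemma bij_mult_mod_13:
  assumes "\<not> 13 dvd (m::nat)"
  shows "bij_betw (\<lambda>k. m * k mod 13) {1..12} {1..12}"
proof -
  have "inj_on (\<lambda>k. m * k mod 13) {1..12}"
  proof (rule inj_onI)
    fix k l assume kl: "k \<in> {1..12}" "l \<in> {1..12}" "m * k mod 13 = m * l mod 13"
    have "coprime m 13" using assms prime_imp_coprime[of 13 m] by (simp add: coprime_commute)
    then have "[k = l] (mod 13)" using kl(3) by (metis cong_def cong_mult_lcancel_nat)
    then show "k = l" using kl by (auto simp: cong_def)
  qed
  moreover have "(\<lambda>k. m * k mod 13) ` {1..12} \<subseteq> {1..12}"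
    using mod_13_in[OF not_dvd_13_mult[OF assms not_dvd_13]] by blast
  ultimately show ?thesis
    by (simp add: bij_betw_def endo_inj_surj)
qed

lemma sum_mult_mod_13: "\<not> 13 dvd (m::nat) \<Longrightarrow> (\<Sum>k=1..12. f (m * k mod 13)) = (\<Sum>k=1..12. f k)"
  by (rule sum.reindex_bij_betw[OF bij_mult_mod_13])

lemma prod_mult_mod_13: "\<not> 13 dvd (m::nat) \<Longrightarrow> (\<Prod>k=1..12. f (m * k mod 13)) = (\<Prod>k=1..12. f k)"
  by (rule prod.reindex_bij_betw[OF bij_mult_mod_13])

text \<open>The trace of such an x is 12 x, while the coordinates show that every trace is a
  rational integer.\<close>

lemma sg_fixed_all:
  assumes "x \<in> Zom" "\<And>k. k \<in> {1..12} \<Longrightarrow> sg k x = x"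
  shows "\<exists>n. x = of_int n"
proof -
  obtain c where x: "x = val c 1" using Zom_val assms by blast
  have "12 * x = (\<Sum>k=1..12. sg k x)" using assms(2) by simp
  also have "\<dots> = (\<Sum>k=1..12. val c k)"
    unfolding x by (intro sum.cong refl sg_val not_dvd_13)
  also have "\<dots> = (\<Sum>j=1..12. of_int (c j) * (\<Sum>k=1..12. om ^ (k * j)))"
    unfolding val_def by (subst sum.swap) (simp add: sum_distrib_left mult.commute)
  also have "\<dots> = (\<Sum>j=1..12. of_int (- c j))"
    by (intro sum.cong refl) (use om_pow_sum'[OF not_dvd_13] in simp)
  finally have "of_int 12 * x = of_int (\<Sum>j=1..12. - c j)" by (simp only: of_int_sum of_int_numeral)
  then show ?thesis using Zom_rat[OF assms(1)] by fastforce
qed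

text \<open>The norm runs over all 12 conjugates also for elements of the subrings, where it is a
  power of the norm of the subring; thus one function measures size in every fixed ring.\<close>

definition NN :: "complex \<Rightarrow> complex" where "NN x = (\<Prod>k=1..12. sg k x)"

lemma NN_int: assumes "x \<in> Zom" shows "\<exists>n. NN x = of_int n"
proof (rule sg_fixed_all)
  show "NN x \<in> Zom" unfolding NN_def using assms not_dvd_13 by (intro Zom_prod) auto
  fix m :: nat assume m: "m \<in> {1..12}"
  have "sg m (NN x) = (\<Prod>k=1..12. sg m (sg k x))"
    unfolding NN_def using assms not_dvd_13 m by (intro sg_prod) auto
  also have "\<dots> = (\<Prod>k=1..12. sg (m * k mod 13) x)"
    by (intro prod.cong refl) (simp add: sg_mod sg_sg assms not_dvd_13[OF m] not_dvd_13)
  also have "\<dots> = NN x" unfolding NN_def using not_dvd_13[OF m] by (rule prod_mult_mod_13)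
  finally show "sg m (NN x) = NN x" .
qed

lemma NN_mult: "x \<in> Zom \<Longrightarrow> y \<in> Zom \<Longrightarrow> NN (x * y) = NN x * NN y"
  unfolding NN_def prod.distrib[symmetric] by (intro prod.cong refl sg_mult not_dvd_13)

lemma NN_of_int: "NN (of_int n) = of_int n ^ 12"
proof -
  have "NN (of_int n) = (\<Prod>k=(1::nat)..12. of_int n)"
    unfolding NN_def by (intro prod.cong refl sg_of_int not_dvd_13)
  then show ?thesis by simp
qed

lemma NN_1 [simp]: "NN 1 = 1" using NN_of_int[of 1] by simp

lemma sg_inverse_ex:
  assumes "\<not> 13 dvd k" obtains l where "\<not> 13 dvd l" "\<And>x. x \<in> Zom \<Longrightarrow> sg l (sg k x) = x"
proof -
  have "coprime k 13" using assms prime_imp_coprime[of 13 k] by (simp add: coprime_commute)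
  then obtain l where l: "[k * l = 1] (mod 13)" using cong_solve_coprime_nat by auto
  have "\<not> 13 dvd l"
  proof
    assume "13 dvd l"
    then have "[k * l = 0] (mod 13)" by (simp add: cong_0_iff)
    then show False using l cong_trans[OF cong_sym] by (fastforce simp: cong_def)
  qed
  moreover have "sg l (sg k x) = x" if "x \<in> Zom" for x
    using sg_cong[of "l * k" 1 x] l that \<open>\<not> 13 dvd l\<close> assms by (simp add: sg_sg mult.commute)
  ultimately show ?thesis using that by blast
qed

lemma sg_eq_0_iff:
  assumes "\<not> 13 dvd k" "x \<in> Zom" shows "sg k x = 0 \<longleftrightarrow> x = 0"
  using assms sg_inverse_ex[OF assms(1)] by (metis sg_0)

lemma NN_eq_0_iff: "x \<in> Zom \<Longrightarrow> NN x = 0 \<longleftrightarrow> x = 0"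
proof -
  assume "x \<in> Zom"
  then have "NN x = 0 \<longleftrightarrow> (\<exists>k\<in>{1..12}. sg k x = 0)" by (simp add: NN_def)
  also have "\<dots> \<longleftrightarrow> (\<exists>k\<in>{1..12::nat}. x = 0)" using \<open>x \<in> Zom\<close> sg_eq_0_iff not_dvd_13 by (intro bex_cong) auto
  finally show ?thesis by auto
qed

lemma norm_NN_ge_1: "x \<in> Zom \<Longrightarrow> x \<noteq> 0 \<Longrightarrow> norm (NN x) \<ge> 1"
proof -
  assume "x \<in> Zom" "x \<noteq> 0"
  then obtain n where "NN x = of_int n" "n \<noteq> 0" using NN_int NN_eq_0_iff by (metis of_int_0)
  then show ?thesis by simp
qed

text \<open>Arithmetic-geometric mean inequality for the squared absolute values of the conjugates,
  obtained by multiplying the inequalities t \<le> exp (t - 1) for t = |sg k x|^2 / B.\<close>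

lemma NN_less_1:
  assumes "(\<Sum>k=1..12. (norm (sg k x))\<^sup>2) < 12 * B" "B > 0"
  shows "norm (NN x) < sqrt B ^ 12"
proof -
  have "(norm (NN x))\<^sup>2 = (\<Prod>k=1..12. (norm (sg k x))\<^sup>2)"
    by (simp add: NN_def prod_norm[symmetric] prod_power_distrib)
  also have "\<dots> = (\<Prod>k=(1::nat)..12. B) * (\<Prod>k=1..12. (norm (sg k x))\<^sup>2 / B)"
    using assms(2) unfolding prod.distrib[symmetric] by (intro prod.cong) auto
  also have "(\<Prod>k=1..12. (norm (sg k x))\<^sup>2 / B) \<le> (\<Prod>k=1..12. exp ((norm (sg k x))\<^sup>2 / B - 1))"
    using exp_ge_add_one_self[of "_ - 1"] assms(2) by (intro prod_mono) (auto simp: add.commute)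
  also have "\<dots> = exp (\<Sum>k=1..12. (norm (sg k x))\<^sup>2 / B - 1)" by (simp add: exp_sum)
  also have "(\<Sum>k=1..12. (norm (sg k x))\<^sup>2 / B - 1) = (\<Sum>k=1..12. (norm (sg k x))\<^sup>2) / B - 12"
    by (simp add: sum_subtractf sum_divide_distrib)
  also have "exp \<dots> < exp 0" using assms by (simp add: field_simps)
  finally have "(norm (NN x))\<^sup>2 < B ^ 12" using assms(2) by simp
  also have "B ^ 12 = ((sqrt B)\<^sup>2) ^ 12" using assms(2) by simp
  also have "\<dots> = (sqrt B ^ 12)\<^sup>2" by (simp only: power_mult[symmetric] mult.commute)
  finally show ?thesis by (rule power_less_imp_less_base) (use assms(2) in simp)
qed

text \<open>Parseval's identity for Z/13. The index k = 0 completes the character sums; it is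
  removed again in \<open>trace_form\<close>.\<close>

lemma sum_norm_val: "(\<Sum>k=0..12. (norm (val c k))\<^sup>2) = 13 * (\<Sum>j=1..12. (of_int (c j))\<^sup>2)"
proof -
  have 1: "(\<Sum>k=0..12. om ^ (i * k) * om ^ (12 * (j * k))) = (if i = j then 13 else 0)"
    if "i \<in> {1..12}" "j \<in> {1..12}" for i j :: nat
  proof -
    have "(\<Sum>k=0..12. om ^ (i * k) * om ^ (12 * (j * k))) = (\<Sum>k=0..12. om ^ (k * (i + 12 * j)))"
      by (intro sum.cong) (auto simp: power_add[symmetric] algebra_simps)
    also have "\<dots> = (if i = j then 13 else 0)"
    proof (cases "i = j")
      case True
      have "om ^ (k * (i + 12 * j)) = 1" for k by (subst om_pow_eq_1_iff) (auto simp: True)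
      then show ?thesis using True by simp
    next
      case False
      have "\<not> 13 dvd (i + 12 * j)"
      proof
        assume "13 dvd (i + 12 * j)"
        then obtain q where "i + 12 * j = 13 * q" by blast
        then have "int (i + 12 * j) = int (13 * q)" by simp
        then have "int i - int j = 13 * (int q - int j)" by simp
        moreover have "\<bar>int i - int j\<bar> < 13" using that by auto
        ultimately have "13 * \<bar>int q - int j\<bar> < 13" by (simp add: abs_mult)
        then have "int q - int j = 0" by simp
        then show False using \<open>int i - int j = 13 * (int q - int j)\<close> False by simp
      qed
      then show ?thesis using om_pow_sum False by simp
    qed
    finally show ?thesis .
  qed
  have "complex_of_real (\<Sum>k=0..12. (norm (val c k))\<^sup>2) = (\<Sum>k=0..12. val c k * cnj (val c k))"
    by (simp only: of_real_sum complex_norm_square)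
  also have "\<dots> = (\<Sum>k=0..12. \<Sum>i=1..12. \<Sum>j=1..12. of_int (c i * c j) * (om ^ (i * k) * om ^ (12 * (j * k))))"
    by (simp add: val_def sum_product cnj_om_pow mult_ac del: complex_cnj_power)
  also have "\<dots> = (\<Sum>i=1..12. \<Sum>j=1..12. of_int (c i * c j) * (\<Sum>k=0..12. om ^ (i * k) * om ^ (12 * (j * k))))"
    by (subst sum.swap, rule sum.cong[OF refl], subst sum.swap) (simp add: sum_distrib_left)
  also have "\<dots> = (\<Sum>i=1..12. \<Sum>j=1..12. if i = j then of_int (c i * c j) * 13 else 0)"
    by (intro sum.cong refl) (auto simp: 1)
  also have "\<dots> = complex_of_real (13 * (\<Sum>j=1..12. (of_int (c j))\<^sup>2))"
    by (simp add: sum_distrib_left sum_distrib_right power2_eq_square mult_ac)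
  finally show ?thesis by (simp only: of_real_eq_iff)
qed

lemma trace_form:
  "(\<Sum>k=1..12. (norm (sg k (val c 1)))\<^sup>2) = 13 * (\<Sum>j=1..12. (of_int (c j))\<^sup>2) - (\<Sum>j=1..12. of_int (c j))\<^sup>2"
proof -
  have "(\<Sum>k=1..12. (norm (sg k (val c 1)))\<^sup>2) = (\<Sum>k=1..12. (norm (val c k))\<^sup>2)"
    by (intro sum.cong refl) (metis not_dvd_13 sg_val)
  also have "\<dots> = (\<Sum>k=0..12. (norm (val c k))\<^sup>2) - (norm (val c 0))\<^sup>2"
    by (simp add: sum.atLeast_Suc_atMost[of 0])
  also have "val c 0 = of_real (\<Sum>j=1..12. of_int (c j))" by (simp add: val_def)
  also have "(norm (complex_of_real (\<Sum>j=1..12. of_int (c j))))\<^sup>2 = (\<Sum>j=1..12. of_int (c j))\<^sup>2"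
    by (simp only: norm_of_real power2_abs)
  finally show ?thesis by (simp only: sum_norm_val)
qed

text \<open>RR 12 is the ring of integers of the real subfield of degree 6, RR 3 that of the quartic subfield.\<close>

definition RR :: "nat \<Rightarrow> complex set" where "RR h = {x \<in> Zom. sg h x = x}"

lemma RR_Zom: "x \<in> RR h \<Longrightarrow> x \<in> Zom" by (simp add: RR_def)
lemma RR_add: "\<not> 13 dvd h \<Longrightarrow> x \<in> RR h \<Longrightarrow> y \<in> RR h \<Longrightarrow> x + y \<in> RR h" by (simp add: RR_def)
lemma RR_diff: "\<not> 13 dvd h \<Longrightarrow> x \<in> RR h \<Longrightarrow> y \<in> RR h \<Longrightarrow> x - y \<in> RR h" by (simp add: RR_def)
lemma RR_mult: "\<not> 13 dvd h \<Longrightarrow> x \<in> RR h \<Longrightarrow> y \<in> RR h \<Longrightarrow> x * y \<in> RR h" by (simp add: RR_def)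
lemma RR_uminus: "\<not> 13 dvd h \<Longrightarrow> x \<in> RR h \<Longrightarrow> - x \<in> RR h" by (simp add: RR_def)
lemma RR_of_int: "\<not> 13 dvd h \<Longrightarrow> of_int n \<in> RR h" by (simp add: RR_def)
lemma RR_of_nat: "\<not> 13 dvd h \<Longrightarrow> of_nat n \<in> RR h" by (simp add: RR_def)
lemma RR_numeral: "\<not> 13 dvd h \<Longrightarrow> numeral n \<in> RR h" by (simp add: RR_def)
lemma RR_1: "\<not> 13 dvd h \<Longrightarrow> 1 \<in> RR h" by (simp add: RR_def)
lemma RR_0: "\<not> 13 dvd h \<Longrightarrow> 0 \<in> RR h" by (simp add: RR_def)
lemma RR_power: "\<not> 13 dvd h \<Longrightarrow> x \<in> RR h \<Longrightarrow> x ^ n \<in> RR h" by (simp add: RR_def)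
lemma RR_prod: "\<not> 13 dvd h \<Longrightarrow> (\<And>i. i \<in> I \<Longrightarrow> f i \<in> RR h) \<Longrightarrow> prod f I \<in> RR h"
  by (induction I rule: infinite_finite_induct) (auto intro: RR_mult RR_1)
lemma RR_sg: "\<not> 13 dvd h \<Longrightarrow> \<not> 13 dvd k \<Longrightarrow> x \<in> RR h \<Longrightarrow> sg k x \<in> RR h"
  by (simp add: RR_def sg_sg) (metis sg_sg mult.commute)

lemmas RR_intros = RR_add RR_diff RR_mult RR_uminus RR_of_int RR_of_nat RR_numeral RR_1 RR_0 RR_power RR_sg

text \<open>The Galois group is abelian, so the conjugates of x stay in \<open>RR h\<close>, and so
  does the product of all but x itself. Division by x thereby becomes division by an
  integer.\<close>

lemma RR_cofactor:
  assumes h: "\<not> 13 dvd h" and x: "x \<in> RR h"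
  shows "\<exists>y\<in>RR h. NN x = x * y"
proof -
  have "{1..12::nat} = insert 1 {2..12}" by auto
  then have "NN x = x * (\<Prod>k=2..12. sg k x)" using RR_Zom[OF x] by (simp add: NN_def)
  moreover have "(\<Prod>k=2..12. sg k x) \<in> RR h"
    using h x not_dvd_13 by (intro RR_prod RR_sg) auto
  ultimately show ?thesis by blast
qed

lemma RR_coeff:
  assumes "\<not> 13 dvd h" "val c 1 \<in> RR h" "j \<in> {1..12}"
  shows "c (h * j mod 13) = c j"
proof -
  define inv where "inv = inv_into {1..12} (\<lambda>k. h * k mod 13)"
  have inv: "inv (h * k mod 13) = k" if "k \<in> {1..12}" for k
    using bij_mult_mod_13[OF assms(1)] that unfolding inv_def bij_betw_def by (intro inv_into_f_f) auto
  have "val (\<lambda>i. c (inv i)) 1 = (\<Sum>i=1..12. of_int (c (inv i)) * om ^ i)" by (simp add: val_def)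
  also have "\<dots> = (\<Sum>k=1..12. of_int (c (inv (h * k mod 13))) * om ^ (h * k mod 13))"
    by (rule sum_mult_mod_13[OF assms(1), symmetric])
  also have "\<dots> = val c h" unfolding val_def
    by (intro sum.cong refl) (simp only: inv om_pow_mod, simp add: mult.commute)
  also have "\<dots> = val c 1" using assms(2) sg_val[OF assms(1), of c] by (simp add: RR_def)
  finally have "c (inv (h * j mod 13)) = c (h * j mod 13)"
    using val_inj[of "\<lambda>i. c (inv i)" c "h * j mod 13"] bij_mult_mod_13[OF assms(1)] assms(3)
    unfolding bij_betw_def by blast
  then show ?thesis using inv[OF assms(3)] by simp
qed

lemma RR_valI:
  assumes "\<not> 13 dvd h" "\<And>j. j \<in> {1..12} \<Longrightarrow> c (h * j mod 13) = c j"
  shows "val c 1 \<in> RR h"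
proof -
  have "sg h (val c 1) = val c h" using sg_val assms(1) by blast
  also have "\<dots> = (\<Sum>k=1..12. of_int (c (h * k mod 13)) * om ^ (h * k mod 13))"
    unfolding val_def by (intro sum.cong refl) (simp only: assms(2) om_pow_mod, simp add: mult.commute)
  also have "\<dots> = val c 1" using sum_mult_mod_13[OF assms(1), of "\<lambda>i. of_int (c i) * om ^ i"] by (simp add: val_def)
  finally show ?thesis by (simp add: RR_def)
qed

section \<open>The Frobenius congruence\<close>

text \<open>Horner's scheme reduces the claim to additivity of p-th powers modulo p, Fermat's
  theorem for the coefficients, and the fact that om^p is the image of om.\<close>

lemma frobenius:
  assumes "prime p" "\<not> 13 dvd p" "x \<in> Zom"
  shows "\<exists>y\<in>Zom. x ^ p - sg p x = of_nat p * y"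
proof -
  have binom: "\<exists>y\<in>Zom. (u + v) ^ p = u ^ p + v ^ p + of_nat p * y" if "u \<in> Zom" "v \<in> Zom" for u v
  proof -
    have p: "p \<ge> 2" using assms(1) by (rule prime_ge_2_nat)
    have "\<exists>d. p choose k = p * d" if "k \<in> {1..p-1}" for k
      using dvd_choose_prime[of k p] that assms(1) p by (auto simp: dvd_def)
    then obtain d where d: "\<And>k. k \<in> {1..p-1} \<Longrightarrow> p choose k = p * d k" by metis
    have "{..p} = insert 0 (insert p {1..p-1})" using p by auto
    then have "(u + v) ^ p = v ^ p + (u ^ p + (\<Sum>k\<in>{1..p-1}. of_nat (p choose k) * u ^ k * v ^ (p - k)))"
      using p by (simp add: binomial_ring)
    also have "(\<Sum>k\<in>{1..p-1}. of_nat (p choose k) * u ^ k * v ^ (p - k)) =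
        of_nat p * (\<Sum>k\<in>{1..p-1}. of_nat (d k) * u ^ k * v ^ (p - k))"
      unfolding sum_distrib_left by (intro sum.cong refl) (simp add: d mult_ac)
    finally show ?thesis using that
      by (intro bexI[of _ "\<Sum>k\<in>{1..p-1}. of_nat (d k) * u ^ k * v ^ (p - k)"]) (auto simp: algebra_simps)
  qed
  have nat: "\<exists>y\<in>Zom. of_nat n ^ p = of_nat n + of_nat p * y" for n
  proof (induction n)
    case 0
    then show ?case using assms(1) by (auto intro!: bexI[of _ 0] simp: prime_gt_0_nat)
  next
    case (Suc n)
    then obtain y where y: "y \<in> Zom" "of_nat n ^ p = of_nat n + of_nat p * y" by blast
    obtain z where z: "z \<in> Zom" "(of_nat n + 1) ^ p = of_nat n ^ p + 1 ^ p + of_nat p * z"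
      using binom[of "of_nat n" 1] by auto
    have "of_nat (Suc n) ^ p = of_nat (Suc n) + of_nat p * (y + z)"
      using y z by (simp add: algebra_simps)
    then show ?case using y z by blast
  qed
  have int: "\<exists>y\<in>Zom. of_int a ^ p = of_int a + of_nat p * y" for a
  proof -
    obtain n where n: "a = int n + int p * (a div int p)"
      by (metis mod_mult_div_eq mod_int_pos_iff nonneg_int_cases assms(1) of_nat_0_le_iff pos_mod_sign prime_gt_0_nat of_nat_0_less_iff)
    obtain y where y: "y \<in> Zom" "of_nat n ^ p = of_nat n + of_nat p * y" using nat by blast
    obtain z where z: "z \<in> Zom" "(of_nat n + of_nat p * of_int (a div int p)) ^ p = of_nat n ^ p + (of_nat p * of_int (a div int p)) ^ p + of_nat p * z"
      using binom[of "of_nat n" "of_nat p * of_int (a div int p)"] by auto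
    define e where "e = complex_of_int (a div int p)"
    have ea: "of_int a = of_nat n + of_nat p * e"
      by (metis (no_types, opaque_lifting) n e_def of_int_add of_int_mult of_int_of_nat_eq)
    have "p \<ge> 1" using assms(1) prime_gt_0_nat by (simp add: Suc_leI)
    then have "(of_nat p * e) ^ p = of_nat p * (e * (of_nat p * e) ^ (p - 1))"
      by (metis (no_types, lifting) mult.assoc not_less_eq_eq power_eq_if le_zero_eq One_nat_def zero_neq_one)
    then have "of_int a ^ p = of_int a + of_nat p * (y + e * (of_nat p * e) ^ (p - 1) + z - e)"
      using z(2) y(2) unfolding ea e_def[symmetric] by (simp add: algebra_simps)
    moreover have "y + e * (of_nat p * e) ^ (p - 1) + z - e \<in> Zom" using y z by (auto simp: e_def)
    ultimately show ?thesis by blast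
  qed
  have main: "\<exists>y\<in>Zom. ev q om ^ p - ev q (om ^ p) = of_nat p * y" for q
  proof (induction q)
    case 0
    then show ?case using assms(1) by (auto intro!: bexI[of _ 0] simp: prime_gt_0_nat)
  next
    case (pCons a q)
    then obtain y where y: "y \<in> Zom" "ev q om ^ p = ev q (om ^ p) + of_nat p * y" by (auto simp: algebra_simps)
    obtain z where z: "z \<in> Zom" "(of_int a + om * ev q om) ^ p = of_int a ^ p + (om * ev q om) ^ p + of_nat p * z"
      using binom[of "of_int a" "om * ev q om"] by auto
    obtain w where w: "w \<in> Zom" "of_int a ^ p = of_int a + of_nat p * w" using int by blast
    have "ev (pCons a q) om ^ p - ev (pCons a q) (om ^ p) = of_nat p * (w + om ^ p * y + z)"
      unfolding ev_pCons z(2) by (simp add: power_mult_distrib w y algebra_simps)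
    moreover have "w + om ^ p * y + z \<in> Zom" using y z w by auto
    ultimately show ?case by blast
  qed
  obtain q where "x = ev q om" using assms(3) by (auto simp: Zom_def)
  then show ?thesis using main[of q] assms(2) by (simp add: sg_ev)
qed

lemma RR_divide_nat:
  assumes "\<not> 13 dvd h" "y \<in> Zom" "of_nat p * y \<in> RR h" "p > 0"
  shows "y \<in> RR h"
  using assms by (simp add: RR_def)

section \<open>Geometry of numbers\<close>

text \<open>If no two points are related in this way, the sets E + v a, shifted further by the grid
  points of {0, ..., M - 1}^n, are m M^n pairwise disjoint sets of equal volume in a box of side M +
  2 R. Letting M tend to infinity bounds m vol(E) by 1.\<close>

lemma blichfeldt:
  fixes E :: "(real^'n::finite) set" and v :: "nat \<Rightarrow> real^'n"
  assumes E: "E \<in> lmeasurable" "bounded E" and m: "measure lebesgue E * real m > 1"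
  shows "\<exists>a<m. \<exists>b<m. \<exists>x\<in>E. \<exists>y\<in>E. \<exists>z :: 'n \<Rightarrow> int. (a \<noteq> b \<or> (\<exists>i. z i \<noteq> 0)) \<and>
    x + v a = y + v b + (\<chi> i. of_int (z i))"
proof (rule ccontr)
  assume neg: "\<not> ?thesis"
  then have neg': "\<And>a b x y z. a < m \<Longrightarrow> b < m \<Longrightarrow> x \<in> E \<Longrightarrow> y \<in> E \<Longrightarrow> a \<noteq> b \<or> (\<exists>i. z i \<noteq> 0) \<Longrightarrow>
    x + v a \<noteq> y + v b + (\<chi> i. of_int (z i))" by blast
  define n where "n = CARD('n)"
  have "bounded ((\<Union>a<m. (+) (v a) ` E))"
    using E by (auto intro!: bounded_UN bounded_translation)
  then obtain R where R: "R > 0" "\<And>a x. a < m \<Longrightarrow> x \<in> E \<Longrightarrow> norm (v a + x) \<le> R"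
    unfolding bounded_pos by blast
  define Z :: "nat \<Rightarrow> ('n \<Rightarrow> nat) set" where "Z M = (UNIV \<rightarrow>\<^sub>E {..<M})" for M
  define T :: "nat \<times> ('n \<Rightarrow> nat) \<Rightarrow> (real^'n) set" where "T p = (+) (v (fst p) + (\<chi> i. real (snd p i))) ` E" for p
  have finZ: "finite (Z M)" "card (Z M) = M ^ n" for M
    by (auto simp: Z_def n_def card_PiE intro!: finite_PiE)
  have disj: "disjoint_family_on T ({..<m} \<times> Z M)" for M
    unfolding disjoint_family_on_def
  proof (intro ballI impI)
    fix p q assume pq: "p \<in> {..<m} \<times> Z M" "q \<in> {..<m} \<times> Z M" "p \<noteq> q"
    show "T p \<inter> T q = {}"
    proof (rule ccontr)
      assume "T p \<inter> T q \<noteq> {}"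
      then obtain x y where xy: "x \<in> E" "y \<in> E" and
        eq: "v (fst p) + (\<chi> i. real (snd p i)) + x = v (fst q) + (\<chi> i. real (snd q i)) + y"
        by (auto simp: T_def)
      have "x + v (fst p) = y + v (fst q) + (\<chi> i. of_int (int (snd q i) - int (snd p i)))"
        using eq by (simp add: vec_eq_iff algebra_simps)
      moreover have "fst p \<noteq> fst q \<or> (\<exists>i. int (snd q i) - int (snd p i) \<noteq> 0)"
      proof -
        have "fst p \<noteq> fst q \<or> (\<exists>i. snd p i \<noteq> snd q i)" using pq(3) by (auto simp: prod_eq_iff fun_eq_iff)
        then show ?thesis
        proof (elim disjE exE)
          fix i assume "snd p i \<noteq> snd q i"
          then have "int (snd q i) - int (snd p i) \<noteq> 0" by simp
          then show ?thesis by blast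
        qed simp
      qed
      ultimately show False
        using neg'[of "fst p" "fst q" x y "\<lambda>i. int (snd q i) - int (snd p i)"] xy pq(1,2) by auto
    qed
  qed
  have meas: "T p \<in> lmeasurable" "measure lebesgue (T p) = measure lebesgue E" for p
    unfolding T_def using E by (auto simp: measurable_translation measure_translation)
  have main: "(real m * measure lebesgue E) * real M ^ n \<le> (real M + 2 * R) ^ n" for M
  proof -
    have "(real m * measure lebesgue E) * real M ^ n = (\<Sum>p\<in>{..<m} \<times> Z M. measure lebesgue (T p))"
      by (simp add: meas card_cartesian_product finZ)
    also have "\<dots> = measure lebesgue (\<Union>p\<in>{..<m} \<times> Z M. T p)"
    proof (rule measure_finite_Union[symmetric])
      show "emeasure lebesgue (T p) \<noteq> \<infinity>" for p
        unfolding infinity_ennreal_def by (rule fmeasurableD2[OF meas(1)])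
    qed (use disj finZ meas in \<open>auto simp: fmeasurable_def\<close>)
    also have "\<dots> \<le> measure lebesgue (cbox (\<chi> i. - R) (\<chi> i. real M + R) :: (real^'n) set)"
    proof (rule measure_mono_fmeasurable)
      show "(\<Union>p\<in>{..<m} \<times> Z M. T p) \<in> sets lebesgue"
        using meas finZ by (intro sets.finite_UN) (auto simp: fmeasurable_def)
      show "(\<Union>p\<in>{..<m} \<times> Z M. T p) \<subseteq> cbox (\<chi> i. - R) (\<chi> i. real M + R)"
      proof (clarsimp simp: T_def mem_box_cart)
        fix a f x i assume h: "a < m" "f \<in> Z M" "x \<in> E"
        have "\<bar>v a $ i + x $ i\<bar> \<le> R"
          using R(2)[OF h(1,3)] component_le_norm_cart[of "v a + x" i] by simp
        moreover have "f i < M" using h by (auto simp: Z_def)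
        ultimately show "- R \<le> v a $ i + real (f i) + x $ i \<and> v a $ i + real (f i) + x $ i \<le> real M + R"
          by (simp add: abs_le_iff)
      qed
    qed simp
    also have "\<dots> = (real M + 2 * R) ^ n"
    proof -
      have "cbox (\<chi> i. - R) (\<chi> i. real M + R) \<noteq> ({} :: (real^'n) set)"
        using R(1) by (auto simp: box_ne_empty interval_eq_empty_cart not_less)
      then show ?thesis using content_cbox_cart[of "\<chi> i. - R" "\<chi> i. real M + R :: real^'n"]
        by (simp add: n_def add.commute)
    qed
    finally show ?thesis .
  qed
  have "real m * measure lebesgue E \<le> (1 + 2 * R / real (Suc M)) ^ n" for M
  proof -
    have "(1 + 2 * R / real (Suc M)) ^ n * real (Suc M) ^ n = (real (Suc M) + 2 * R) ^ n"
      by (simp add: power_mult_distrib[symmetric] field_simps)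
    then have "(real m * measure lebesgue E) * real (Suc M) ^ n \<le> (1 + 2 * R / real (Suc M)) ^ n * real (Suc M) ^ n"
      using main[of "Suc M"] by simp
    then show ?thesis by (rule mult_right_le_imp_le) simp
  qed
  moreover have "(\<lambda>M. (1 + 2 * R / real (Suc M)) ^ n) \<longlonglongrightarrow> (1 + 0) ^ n"
    by (intro tendsto_power tendsto_add tendsto_const LIMSEQ_Suc[OF lim_const_over_n])
  ultimately have "real m * measure lebesgue E \<le> (1 + 0) ^ n"
    by (intro LIMSEQ_le_const) auto
  then show False using m by (simp add: mult.commute)
qed

lemma det_rank_one:
  fixes c :: real
  shows "det ((\<chi> i j. (if i = j then 1 else 0) - c) :: real^'n^'n::finite) = 1 - c * CARD('n)"
proof -
  define M :: "real^'n^'n" where "M = (\<chi> i j. (if i = j then 1 else 0) - c)"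
  obtain i0 :: 'n where True by blast
  \<comment> \<open>The columns of P are eigenvectors: the all-one vector in column i0 and e_j -
    e_i0 in column j. The eigenvalues are the diagonal of D.\<close>
  define P :: "real^'n^'n" where "P = (\<chi> i j. if j = i0 then 1 else (if i = j then 1 else 0) - (if i = i0 then 1 else 0))"
  define D :: "real^'n^'n" where "D = (\<chi> i j. if i = j then (if i = i0 then 1 - c * CARD('n) else 1) else 0)"
  have "M ** P = P ** D"
  proof -
    have "(M ** P) $ i $ j = (P ** D) $ i $ j" for i j
    proof -
      have "(M ** P) $ i $ j = P $ i $ j - c * (\<Sum>k\<in>UNIV. P $ k $ j)"
        by (simp add: matrix_matrix_mult_def M_def left_diff_distrib sum_subtractf sum_distrib_left
            if_distrib[of "\<lambda>x. x * _"] cong: if_cong)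
      also have "(\<Sum>k\<in>UNIV. P $ k $ j) = (if j = i0 then CARD('n) else 0)"
        by (simp add: P_def sum_subtractf)
      also have "P $ i $ j - c * real (if j = i0 then CARD('n) else 0) = (P ** D) $ i $ j"
        by (simp add: matrix_matrix_mult_def D_def if_distrib[of "\<lambda>x. _ * x"] cong: if_cong) (simp add: P_def)
      finally show ?thesis .
    qed
    then show ?thesis by (simp add: vec_eq_iff)
  qed
  then have "det M * det P = det P * det D" by (metis det_mul)
  moreover have "det P \<noteq> 0"
  proof -
    have "x = 0" if "P *v x = 0" for x
    proof -
      have e: "(P *v x) $ i = (if i = i0 then 2 * x $ i0 - (\<Sum>j\<in>UNIV. x $ j) else x $ i0 + x $ i)" for i
      proof -
        have "(P *v x) $ i = (\<Sum>j\<in>UNIV. (if j = i0 then x $ i0 else 0) + (if j = i then x $ i else 0) - (if i = i0 then x $ j else 0)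
             - (if j = i0 then (if i = i0 then 0 else 0) else 0))"
          unfolding matrix_vector_mult_def by (auto simp: P_def intro!: sum.cong)
        then show ?thesis by (simp add: sum.distrib sum_subtractf)
      qed
      have "(P *v x) $ i = 0" for i using that by simp
      then have h: "\<And>i. i \<noteq> i0 \<Longrightarrow> x $ i = - x $ i0" "2 * x $ i0 = (\<Sum>j\<in>UNIV. x $ j)"
        unfolding e by (smt (verit))+
      have "(\<Sum>j\<in>UNIV. x $ j) = x $ i0 + (\<Sum>j\<in>UNIV - {i0}. x $ j)"
        by (simp add: sum.remove)
      also have "(\<Sum>j\<in>UNIV - {i0}. x $ j) = (\<Sum>j\<in>UNIV - {i0}. - x $ i0)"
        by (rule sum.cong) (auto simp: h)
      also have "\<dots> = - (real (CARD('n) - 1) * x $ i0)" by (simp add: card_Diff_singleton)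
      finally have "(1 + real (CARD('n) - 1)) * x $ i0 = 0" using h(2) by (simp add: algebra_simps)
      then have "x $ i0 = 0" by (simp add: add_nonneg_eq_0_iff)
      then show ?thesis using h(1) by (auto simp: vec_eq_iff) (metis neg_equal_0_iff_equal)
    qed
    then have "invertible P" by (simp add: invertible_left_inverse matrix_left_invertible_ker)
    then show ?thesis by (simp add: invertible_det_nz)
  qed
  moreover have "det D = 1 - c * CARD('n)"
  proof -
    have "det D = (\<Prod>i\<in>UNIV. D $ i $ i)" by (rule det_diagonal) (simp add: D_def)
    also have "\<dots> = (\<Prod>i\<in>UNIV. if i = i0 then 1 - c * CARD('n) else 1)" by (simp add: D_def)
    also have "\<dots> = 1 - c * CARD('n)" by simp
    finally show ?thesis .
  qed
  ultimately show ?thesis by (simp add: M_def)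
qed

text \<open>On coefficient vectors constant on orbits of size h, the quadratic form of
  \<open>trace_form\<close> is h times this form in the orbit values.\<close>

definition qf :: "real \<Rightarrow> real^'n::finite \<Rightarrow> real"
  where "qf h x = 13 * (\<Sum>i\<in>UNIV. (x $ i)\<^sup>2) - h * (\<Sum>i\<in>UNIV. x $ i)\<^sup>2"

text \<open>Blichfeldt, applied to the ellipsoid E and its translates by the multiples of \<xi>: E is half of the ellipsoid
  qf h < n, so two points of E differ by a vector with qf h < n.\<close>

lemma lattice_multiples:
  fixes \<xi> :: "real^'n::{finite,wellorder}" and h :: real
  assumes n: "h * CARD('n) = 12"
    and vol: "unit_ball_vol CARD('n) * sqrt (CARD('n) / 52) ^ CARD('n) * sqrt 13 * real m > 1"
    and pos: "\<And>r :: 'n \<Rightarrow> int. (\<exists>i. r i \<noteq> 0) \<Longrightarrow> qf h (\<chi> i. of_int (r i)) \<ge> CARD('n)"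
  shows "\<exists>k\<in>{1..<m}. \<exists>r :: 'n \<Rightarrow> int. qf h (real k *\<^sub>R \<xi> - (\<chi> i. of_int (r i))) < CARD('n)"
proof -
  define N where "N = real CARD('n)"
  have N: "N > 0" by (simp add: N_def)
  \<comment> \<open>L is the identity minus c times the all-one matrix, with c chosen so that 1 - c
    N = 1 / sqrt 13. This makes |L x|^2 equal to qf h x / 13 and the determinant 1 / sqrt 13. The
    radius \<rho> satisfies (2 \<rho>)^2 = N / 13, the bound that corresponds to qf h < N.\<close>
  define c where "c = (1 - 1 / sqrt 13) / N"
  define L :: "(real, 'n) vec \<Rightarrow> (real, 'n) vec" where "L x = (\<chi> i. x $ i - c * (\<Sum>j\<in>UNIV. x $ j))" for x
  define \<rho> where "\<rho> = sqrt (N / 52)"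
  have lin: "linear L"
    by (rule linearI) (auto simp: L_def vec_eq_iff sum.distrib sum_distrib_left[symmetric] algebra_simps)
  have mat: "matrix L = (\<chi> i j. (if i = j then 1 else 0) - c)"
    by (simp add: matrix_def L_def vec_eq_iff axis_def)
  have det: "det (matrix L) = 1 / sqrt 13"
    unfolding mat det_rank_one using N by (simp add: c_def N_def)
  have "inj L" using det_nz_iff_inj[OF lin] det by simp
  then have "surj L" using lin linear_injective_imp_surjective by blast
  then have "bij L" using \<open>inj L\<close> by (simp add: bij_def)
  have normL: "(norm (L x))\<^sup>2 = qf h x / 13" for x
  proof -
    define s where "s = (\<Sum>j\<in>UNIV. x $ j)"
    have "(norm (L x))\<^sup>2 = (\<Sum>i\<in>UNIV. (x $ i - c * s)\<^sup>2)"
      by (simp add: norm_vec_def L2_set_def L_def s_def sum_nonneg)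
    also have "\<dots> = (\<Sum>i\<in>UNIV. (x $ i)\<^sup>2 - (2 * c * s) * x $ i + (c * s)\<^sup>2)"
      by (simp add: power2_eq_square algebra_simps)
    also have "\<dots> = (\<Sum>i\<in>UNIV. (x $ i)\<^sup>2) - (2 * c * s) * s + N * (c * s)\<^sup>2"
      by (simp add: sum.distrib sum_subtractf sum_distrib_left[symmetric] s_def N_def)
    also have "\<dots> = (\<Sum>i\<in>UNIV. (x $ i)\<^sup>2) - (2 * c - N * c\<^sup>2) * s\<^sup>2"
      by (simp add: power2_eq_square algebra_simps)
    also have "2 * c - N * c\<^sup>2 = (1 - (1 - c * N)\<^sup>2) / N"
      using N by (simp add: power2_eq_square field_simps)
    also have "1 - c * N = 1 / sqrt 13" using N by (simp add: c_def)
    also have "(1 - (1 / sqrt 13)\<^sup>2) / N = h / 13"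
      using n N by (simp add: power_divide N_def field_simps)
    finally show ?thesis by (simp add: qf_def s_def)
  qed
  define E where "E = {x. norm (L x) < \<rho>}"
  have LE: "L ` E = ball 0 \<rho>"
  proof (intro equalityI subsetI)
    fix y :: "(real, 'n) vec" assume "y \<in> ball 0 \<rho>"
    moreover obtain x where "y = L x" using \<open>surj L\<close> by blast
    ultimately show "y \<in> L ` E" by (auto simp: E_def)
  qed (auto simp: E_def)
  obtain g where g: "linear g" "g \<circ> L = id"
    using linear_injective_left_inverse[OF lin \<open>inj L\<close>] by blast
  have Eg: "E = g ` ball 0 \<rho>" unfolding LE[symmetric] image_comp g by simp
  have Em: "E \<in> lmeasurable" unfolding Eg by (rule measurable_linear_image[OF g(1)]) simp
  have Eb: "bounded E" unfolding Eg by (rule bounded_linear_image) (use g in \<open>auto simp: linear_linear\<close>)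
  have "measure lebesgue (ball 0 \<rho> :: (real, 'n) vec set) = 1 / sqrt 13 * measure lebesgue E"
    using measure_linear_image[OF lin Em] by (simp add: LE det)
  then have "measure lebesgue E = sqrt 13 * measure lebesgue (ball 0 \<rho> :: (real, 'n) vec set)" by simp
  also have "measure lebesgue (ball 0 \<rho> :: (real, 'n) vec set) = unit_ball_vol CARD('n) * \<rho> ^ CARD('n)"
    using content_ball[of \<rho> "0 :: (real, 'n) vec"] N by (simp add: \<rho>_def)
  finally have "measure lebesgue E * real m > 1"
    using vol by (simp add: \<rho>_def N_def mult_ac)
  from blichfeldt[OF Em Eb this, of "\<lambda>a. real a *\<^sub>R \<xi>"]
  obtain a b x y z where abz: "a < m" "b < m" "x \<in> E" "y \<in> E" "a \<noteq> b \<or> (\<exists>i. z i \<noteq> 0)"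
    "x + real a *\<^sub>R \<xi> = y + real b *\<^sub>R \<xi> + (\<chi> i. of_int (z i))" by blast
  have small: "qf h (x - y) < N" if "x \<in> E" "y \<in> E" for x y
  proof -
    have "norm (L (x - y)) < 2 * \<rho>"
      using that norm_triangle_ineq4[of "L x" "L y"] by (simp add: E_def linear_diff[OF lin])
    then have "(norm (L (x - y)))\<^sup>2 < (2 * \<rho>)\<^sup>2" by (intro power_strict_mono) auto
    then show ?thesis using N by (simp add: normL \<rho>_def power_mult_distrib)
  qed
  consider "b < a" | "a < b" | "a = b" by linarith
  then show ?thesis
  proof cases
    case 1
    then have "real (a - b) *\<^sub>R \<xi> - (\<chi> i. of_int (z i)) = y - x"
      using abz(6) by (simp add: of_nat_diff algebra_simps)
    then show ?thesis using small[of y x] abz 1 by (intro bexI[of _ "a - b"] exI[of _ z]) (auto simp: N_def)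
  next
    case 2
    have "real (b - a) *\<^sub>R \<xi> - (\<chi> i. of_int (- z i)) = x - y"
      using abz(6) 2 by (simp add: of_nat_diff algebra_simps vec_eq_iff)
    then show ?thesis using small[of x y] abz 2 by (intro bexI[of _ "b - a"] exI[of _ "\<lambda>i. - z i"]) (auto simp: N_def)
  next
    \<comment> \<open>Equal multiples of \<xi> leave a non-zero integer vector at which the form is
      less than N, contrary to \<open>pos\<close>.\<close>
    case 3
    then have "(\<chi> i. of_int (z i)) = x - y" "\<exists>i. z i \<noteq> 0" using abz by auto
    then show ?thesis using small[of x y] pos[of z] abz by (simp add: N_def)
  qed
qed

section \<open>Numerical bounds for the volumes\<close>

lemma pi_lower: "pi > 314 / 100"
proof -
  have le: "arctan x \<le> x" if "x \<ge> 0" for x :: real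
  proof -
    have "(\<lambda>x. x - arctan x) 0 \<le> (\<lambda>x. x - arctan x) x"
    proof (rule DERIV_nonneg_imp_nondecreasing[OF that], intro exI conjI)
      fix y :: real
      show "((\<lambda>x. x - arctan x) has_real_derivative (1 - inverse (1 + y\<^sup>2))) (at y)"
        by (auto intro!: derivative_eq_intros)
      show "0 \<le> 1 - inverse (1 + y\<^sup>2)"
        by (simp add: inverse_le_1_iff)
    qed
    then show ?thesis by simp
  qed
  have ge: "arctan x \<ge> x - x ^ 3 / 3" if "x \<ge> 0" for x :: real
  proof -
    have "(\<lambda>x. arctan x - (x - x ^ 3 / 3)) 0 \<le> (\<lambda>x. arctan x - (x - x ^ 3 / 3)) x"
    proof (rule DERIV_nonneg_imp_nondecreasing[OF that], intro exI conjI)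
      fix y :: real
      show "((\<lambda>x. arctan x - (x - x ^ 3 / 3)) has_real_derivative (inverse (1 + y\<^sup>2) - (1 - y\<^sup>2))) (at y)"
        by (auto intro!: derivative_eq_intros)
      have "(1 - y\<^sup>2) * (1 + y\<^sup>2) \<le> 1" by (simp add: algebra_simps)
      then show "0 \<le> inverse (1 + y\<^sup>2) - (1 - y\<^sup>2)"
        by (simp add: inverse_eq_divide pos_le_divide_eq add_pos_nonneg)
    qed
    then show ?thesis by simp
  qed
  have "pi / 4 = 4 * arctan (1 / 5) - arctan (1 / 239)" by (rule machin)
  also have "\<dots> \<ge> 4 * (1 / 5 - (1 / 5) ^ 3 / 3) - 1 / 239"
    using ge[of "1 / 5"] le[of "1 / 239"] by simp
  finally show ?thesis by (simp add: power3_eq_cube)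
qed

lemma sqrt13_lower: "sqrt 13 > 36 / 10"
  by (rule real_less_rsqrt) (simp add: power2_eq_square)

text \<open>37 is the prime following 31, so multipliers below it involve only primes up to 31. The
  bounds 3.14 for pi and 3.6 for sqrt 13 are precise enough.\<close>

lemma vol6: "unit_ball_vol 6 * sqrt (6 / 52) ^ 6 * sqrt 13 * 37 > 1"
proof -
  have "sqrt (6 / 52) ^ 6 = (sqrt (6 / 52) ^ 2) ^ 3" by (simp only: power_mult[symmetric]) simp
  also have "\<dots> = (6 / 52) ^ 3" by (subst real_sqrt_pow2) auto
  finally have e: "sqrt (6 / 52) ^ 6 = (6 / 52 :: real) ^ 3" .
  have "1 < (314 / 100) ^ 3 / 6 * (6 / 52) ^ 3 * (36 / 10) * (37 :: real)" by (simp add: power3_eq_cube)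
  also have "\<dots> \<le> pi ^ 3 / 6 * (6 / 52) ^ 3 * sqrt 13 * 37"
    by (intro mult_mono divide_right_mono power_mono) (use pi_lower sqrt13_lower in auto)
  also have "\<dots> = unit_ball_vol 6 * sqrt (6 / 52) ^ 6 * sqrt 13 * 37"
    unfolding e using unit_ball_vol_even[of 3] by (simp add: fact_numeral)
  finally show ?thesis .
qed

lemma vol4: "unit_ball_vol 4 * sqrt (4 / 52) ^ 4 * sqrt 13 * 11 > 1"
proof -
  have "sqrt (4 / 52) ^ 4 = (sqrt (4 / 52) ^ 2) ^ 2" by (simp only: power_mult[symmetric]) simp
  also have "\<dots> = (4 / 52) ^ 2" by (subst real_sqrt_pow2) auto
  finally have e: "sqrt (4 / 52) ^ 4 = (4 / 52 :: real) ^ 2" .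
  have "1 < (314 / 100) ^ 2 / 2 * (4 / 52) ^ 2 * (36 / 10) * (11 :: real)" by (simp add: power2_eq_square)
  also have "\<dots> \<le> pi ^ 2 / 2 * (4 / 52) ^ 2 * sqrt 13 * 11"
    by (intro mult_mono divide_right_mono power_mono) (use pi_lower sqrt13_lower in auto)
  also have "\<dots> = unit_ball_vol 4 * sqrt (4 / 52) ^ 4 * sqrt 13 * 11"
    unfolding e using unit_ball_vol_even[of 2] by (simp add: fact_numeral)
  finally show ?thesis .
qed

section \<open>A Dedekind--Hasse criterion\<close>

lemma qf_scaleR: "qf h (a *\<^sub>R v) = a\<^sup>2 * qf h v"
  by (simp add: qf_def power_mult_distrib sum_distrib_left[symmetric] right_diff_distrib mult.left_commute)

text \<open>The fraction y / x is written as y x' / N with N the norm of x, so it has rational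
  coordinates. Then \<open>lattice_multiples\<close> brings some multiple k y / x close to an
  element r in the trace form, and the mean inequality turns this into norm less than 1 for k y / x
  - r. The function f names the orbit of an index, and e is the orbit size.\<close>

lemma approx_RR:
  fixes f :: "nat \<Rightarrow> 'n::{finite,wellorder}"
  assumes g: "\<not> 13 dvd g" and e: "e * CARD('n) = 12"
    and fib: "\<And>i. card {j\<in>{1..12}. f j = i} = e"
    and inv: "\<And>j. j \<in> {1..12} \<Longrightarrow> f (g * j mod 13) = f j"
    and rep: "\<And>c. val c 1 \<in> RR g \<Longrightarrow> \<exists>r. \<forall>j\<in>{1..12}. c j = r (f j)"
    and vol: "unit_ball_vol CARD('n) * sqrt (CARD('n) / 52) ^ CARD('n) * sqrt 13 * real m > 1"
    and xy: "x \<in> RR g" "y \<in> RR g" "x \<noteq> 0"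
  shows "\<exists>k\<in>{1..<m}. \<exists>r\<in>RR g. norm (NN (of_nat k * y - r * x)) < norm (NN x)"
proof -
  have sumf: "(\<Sum>j=1..12. F (f j)) = real e * (\<Sum>i\<in>UNIV. F i)" for F :: "'n \<Rightarrow> real"
  proof -
    have "(\<Sum>j=1..12. F (f j)) = (\<Sum>i\<in>UNIV. \<Sum>j\<in>{j\<in>{1..12}. f j = i}. F (f j))"
      by (rule sum.group[symmetric]) auto
    also have "\<dots> = (\<Sum>i\<in>UNIV. real e * F i)"
      by (intro sum.cong refl) (use fib in simp)
    finally show ?thesis by (simp add: sum_distrib_left)
  qed
  have tr: "(\<Sum>k=1..12. (norm (sg k (val (\<lambda>j. r (f j)) 1)))\<^sup>2) = e * qf e (\<chi> i. of_int (r i))" for r :: "'n \<Rightarrow> int"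
    unfolding trace_form qf_def using sumf[of "\<lambda>i. (of_int (r i))\<^sup>2"] sumf[of "\<lambda>i. of_int (r i)"]
    by (simp add: power_mult_distrib power2_eq_square algebra_simps)
  have e0: "e > 0" using e by (cases e) auto
  have en: "real e * real CARD('n) = 12" by (metis e of_nat_mult of_nat_numeral)
  \<comment> \<open>A non-zero integral element has norm at least 1, so the mean inequality bounds
    its trace form from below.\<close>
  have pos: "qf e (\<chi> i. of_int (r i)) \<ge> CARD('n)" if ne: "\<exists>i. r i \<noteq> 0" for r :: "'n \<Rightarrow> int"
  proof (rule ccontr)
    assume "\<not> ?thesis"
    then have "real e * qf e (\<chi> i. of_int (r i)) < real e * CARD('n)" using e0 by simp
    then have "(\<Sum>k=1..12. (norm (sg k (val (\<lambda>j. r (f j)) 1)))\<^sup>2) < 12 * 1" unfolding tr en by simp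
    from NN_less_1[OF this] have "norm (NN (val (\<lambda>j. r (f j)) 1)) < 1" by simp
    then have "val (\<lambda>j. r (f j)) 1 = 0" using norm_NN_ge_1[of "val (\<lambda>j. r (f j)) 1"] by force
    then have z: "r (f j) = 0" if "j \<in> {1..12}" for j using val_eq_0_imp that by blast
    obtain i where "r i \<noteq> 0" using ne by blast
    moreover have "{j\<in>{1..12}. f j = i} \<noteq> {}" using fib[of i] e0 by (metis card.empty less_numeral_extra(3))
    ultimately show False using z by auto
  qed
  obtain x' where x': "x' \<in> RR g" "NN x = x * x'" using RR_cofactor[OF g xy(1)] by blast
  obtain N where N: "NN x = of_int N" using NN_int RR_Zom xy by blast
  have "N \<noteq> 0" using N NN_eq_0_iff[OF RR_Zom[OF xy(1)]] xy(3) by auto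
  have yx': "y * x' \<in> RR g" using g xy x' by (intro RR_mult)
  then obtain c where c: "y * x' = val c 1" using Zom_val RR_Zom by blast
  with yx' obtain r0 where "\<forall>j\<in>{1..12}. c j = r0 (f j)" using rep by metis
  then have r0: "y * x' = val (\<lambda>j. r0 (f j)) 1" unfolding c val_def by (intro sum.cong) auto
  obtain k r where kr: "k \<in> {1..<m}" "qf e (real k *\<^sub>R (\<chi> i. of_int (r0 i) / of_int N) - (\<chi> i. of_int (r i))) < CARD('n)"
    using lattice_multiples[OF en vol pos, of "\<chi> i. of_int (r0 i) / of_int N"] by blast
  define R where "R = val (\<lambda>j. r (f j)) 1"
  have R: "R \<in> RR g" unfolding R_def by (intro RR_valI[OF g]) (simp add: inv)
  \<comment> \<open>N times the approximation error. It factors as u x', after which the norm of x'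
    cancels.\<close>
  define w where "w = of_nat k * (y * x') - of_int N * R"
  have w: "w = val (\<lambda>j. int k * r0 (f j) - N * r (f j)) 1"
  proof -
    have "of_nat k = (of_int (int k) :: complex)" by simp
    then show ?thesis unfolding w_def r0 R_def by (simp only: val_smult val_diff)
  qed
  have "(\<Sum>l=1..12. (norm (sg l w))\<^sup>2) = e * qf e (\<chi> i. of_int (int k * r0 i - N * r i))"
    unfolding w using tr[of "\<lambda>i. int k * r0 i - N * r i"] by simp
  also have "((\<chi> i. of_int (int k * r0 i - N * r i)) :: (real, 'n) vec) = of_int N *\<^sub>R (real k *\<^sub>R (\<chi> i. of_int (r0 i) / of_int N) - (\<chi> i. of_int (r i)))"
    using \<open>N \<noteq> 0\<close> by (simp add: vec_eq_iff field_simps)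
  also have "qf e \<dots> = (of_int N)\<^sup>2 * qf e (real k *\<^sub>R (\<chi> i. of_int (r0 i) / of_int N) - (\<chi> i. of_int (r i)))"
    by (rule qf_scaleR)
  finally have "(\<Sum>l=1..12. (norm (sg l w))\<^sup>2) = (of_int N)\<^sup>2 * (e * qf e (real k *\<^sub>R (\<chi> i. of_int (r0 i) / of_int N) - (\<chi> i. of_int (r i))))"
    by simp
  also have "\<dots> < (real_of_int N)\<^sup>2 * (real e * real CARD('n))" using kr(2) e0 \<open>N \<noteq> 0\<close> by simp
  finally have "(\<Sum>l=1..12. (norm (sg l w))\<^sup>2) < 12 * (of_int N)\<^sup>2" unfolding en by (simp add: mult.commute)
  from NN_less_1[OF this] have 1: "norm (NN w) < \<bar>of_int N\<bar> ^ 12" using \<open>N \<noteq> 0\<close> by simp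
  define u where "u = of_nat k * y - R * x"
  have uZ: "u \<in> Zom" "x' \<in> Zom" "x \<in> Zom" using R xy x' RR_Zom by (auto simp: u_def)
  have "w = u * x'" unfolding w_def u_def N[symmetric] x'(2) by (simp add: algebra_simps)
  then have "norm (NN w) = norm (NN u) * norm (NN x')" using uZ by (simp add: NN_mult norm_mult)
  moreover have "norm (NN x) * norm (NN x') = \<bar>of_int N\<bar> ^ 12"
    using uZ NN_mult[of x x'] NN_of_int[of N] by (simp add: N[symmetric] x'(2) norm_mult[symmetric])
      (simp add: N norm_power flip: x'(2))
  ultimately have "norm (NN u) * norm (NN x') < norm (NN x) * norm (NN x')" using 1 by simp
  then have "norm (NN u) < norm (NN x)" by (rule mult_right_less_imp_less) simp
  then show ?thesis using kr(1) R by (auto simp: u_def)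
qed

text \<open>Thus \<pi> generates a maximal ideal: its norm shows that it is no unit, and each
  residue is zero or invertible.\<close>

definition good :: "nat \<Rightarrow> complex \<Rightarrow> bool" where
  "good g \<pi> \<longleftrightarrow> \<pi> \<in> RR g \<and> norm (NN \<pi>) > 1 \<and>
    (\<forall>r\<in>RR g. (\<exists>s\<in>RR g. \<exists>t\<in>RR g. r * s = 1 + \<pi> * t) \<or> (\<exists>t\<in>RR g. r = \<pi> * t))"

text \<open>Dedekind--Hasse: when z y is a multiple of a minimal element x of an ideal, the good factors of z can
  be cancelled one at a time, since x is not divisible by a good factor with quotient in the ideal.\<close>

inductive smooth :: "nat \<Rightarrow> complex \<Rightarrow> bool" for g where
  unit: "u \<in> RR g \<Longrightarrow> v \<in> RR g \<Longrightarrow> u * v = 1 \<Longrightarrow> smooth g u"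
| step: "good g \<pi> \<Longrightarrow> smooth g z \<Longrightarrow> smooth g (\<pi> * z)"

lemma smooth_1: "\<not> 13 dvd g \<Longrightarrow> smooth g 1"
  by (rule smooth.unit[of 1 g 1]) (auto intro: RR_1)

lemma smooth_mult:
  assumes g: "\<not> 13 dvd g" and "smooth g x" and y: "smooth g y"
  shows "smooth g (x * y)"
  using assms(2)
proof (induction x rule: smooth.induct)
  case (unit u v)
  from y show ?case
  proof (induction y rule: smooth.induct)
    case (unit u' v')
    then show ?case using \<open>u \<in> RR g\<close> \<open>v \<in> RR g\<close> \<open>u * v = 1\<close> g
      by (intro smooth.unit[of "u * u'" g "v * v'"] RR_mult) (auto simp: algebra_simps)
  next
    case (step \<pi> z)
    then show ?case using smooth.step[of g \<pi> "u * z"] by (simp add: mult_ac)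
  qed
next
  case (step \<pi> z)
  then show ?case using smooth.step[of g \<pi> "z * y"] by (simp add: mult_ac)
qed

lemma smooth_good: "\<not> 13 dvd g \<Longrightarrow> good g x \<Longrightarrow> smooth g x"
  using smooth.step[of g x 1] smooth_1 by simp

lemma smooth_divides:
  assumes g: "\<not> 13 dvd g"
    and J: "\<And>u v. u \<in> J \<Longrightarrow> v \<in> J \<Longrightarrow> u - v \<in> J" "\<And>u r. u \<in> J \<Longrightarrow> r \<in> RR g \<Longrightarrow> r * u \<in> J" "J \<subseteq> RR g"
    and x: "x \<in> J" "x \<noteq> 0" "\<And>y. y \<in> J \<Longrightarrow> y \<noteq> 0 \<Longrightarrow> norm (NN x) \<le> norm (NN y)"
    and y: "y \<in> J"
    and "smooth g z" "r \<in> RR g" "z * y = r * x"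
  shows "\<exists>t\<in>RR g. y = t * x"
  using assms(9-)
proof (induction z arbitrary: r rule: smooth.induct)
  case (unit u v)
  then have "y = (v * r) * x" by (metis mult.assoc mult.commute mult_1)
  then show ?case using unit g by (intro bexI[of _ "v * r"]) (auto intro: RR_mult)
next
  case (step \<pi> z)
  have zR: "z \<in> RR g" using step(2) by (induction rule: smooth.induct) (auto simp: good_def intro: RR_mult[OF g])
  have \<pi>: "\<pi> \<in> RR g" "norm (NN \<pi>) > 1" using step(1) by (auto simp: good_def)
  have "NN 0 = 0" using NN_eq_0_iff[of 0] by simp
  then have "\<pi> \<noteq> 0" using \<pi>(2) by auto
  from step(1,4) have "(\<exists>s\<in>RR g. \<exists>t\<in>RR g. r * s = 1 + \<pi> * t) \<or> (\<exists>t\<in>RR g. r = \<pi> * t)" by (auto simp: good_def)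
  then show ?case
  proof (elim disjE bexE)
    fix s t assume st: "s \<in> RR g" "t \<in> RR g" "r * s = 1 + \<pi> * t"
    \<comment> \<open>From r s = 1 + \<pi> t and r x = \<pi> z y follows x = \<pi> x', where x' lies
      in the ideal and has strictly smaller norm than the minimal x.\<close>
    define x' where "x' = (s * z) * y - t * x"
    have "x' \<in> J" unfolding x'_def using g st zR x y by (intro J RR_mult) auto
    have "x = (r * s) * x - \<pi> * t * x" by (simp add: st algebra_simps)
    also have "(r * s) * x = s * (r * x)" by simp
    also have "r * x = \<pi> * z * y" using step(5) by simp
    finally have xx: "x = \<pi> * x'" by (simp add: x'_def algebra_simps)
    then have "x' \<noteq> 0" using x by auto
    have Z: "x' \<in> Zom" "\<pi> \<in> Zom" using \<open>x' \<in> J\<close> J(3) \<pi> RR_Zom by blast+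
    have "norm (NN x) = norm (NN \<pi>) * norm (NN x')" unfolding xx using Z by (simp add: NN_mult norm_mult)
    moreover have "norm (NN x') > 0" using norm_NN_ge_1[OF Z(1) \<open>x' \<noteq> 0\<close>] by linarith
    ultimately have "norm (NN x) > norm (NN x')" using \<pi>(2) by simp
    then show ?thesis using x(3)[OF \<open>x' \<in> J\<close> \<open>x' \<noteq> 0\<close>] by simp
  next
    fix t assume t: "t \<in> RR g" "r = \<pi> * t"
    then have "z * y = t * x" using step(5) \<open>\<pi> \<noteq> 0\<close> by (simp add: mult.assoc)
    then show ?thesis using step(3) t by blast
  qed
qed

definition bezout_ring :: "nat \<Rightarrow> bool" where
  "bezout_ring g \<longleftrightarrow> (\<forall>x\<in>RR g. \<forall>y\<in>RR g. \<exists>d\<in>RR g. (\<exists>s\<in>RR g. \<exists>t\<in>RR g. d = s * x + t * y) \<and>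
     (\<exists>x'\<in>RR g. x = x' * d) \<and> (\<exists>y'\<in>RR g. y = y' * d))"

text \<open>Let d have minimal norm in the ideal. For z in the ideal, the approximation gives k z -
  r d of smaller norm, hence zero, and the smooth integer k is then removed by
  \<open>smooth_divides\<close>.\<close>

lemma bezout_RR:
  assumes g: "\<not> 13 dvd g"
    and approx: "\<And>x y. x \<in> RR g \<Longrightarrow> y \<in> RR g \<Longrightarrow> x \<noteq> 0 \<Longrightarrow>
      \<exists>k\<in>{1..<m}. \<exists>r\<in>RR g. norm (NN (of_nat k * y - r * x)) < norm (NN x)"
    and sm: "\<And>k. k \<in> {1..<m} \<Longrightarrow> smooth g (of_nat k)"
  shows "bezout_ring g"
  unfolding bezout_ring_def
proof (intro ballI)
  fix x y assume x: "x \<in> RR g" and y: "y \<in> RR g"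
  show "\<exists>d\<in>RR g. (\<exists>s\<in>RR g. \<exists>t\<in>RR g. d = s * x + t * y) \<and> (\<exists>x'\<in>RR g. x = x' * d) \<and> (\<exists>y'\<in>RR g. y = y' * d)"
  proof (cases "x = 0 \<and> y = 0")
    case True
    then show ?thesis using RR_0[OF g] by (intro bexI[of _ 0]) auto
  next
    case False
    define J where "J = {s * x + t * y | s t. s \<in> RR g \<and> t \<in> RR g}"
    have JR: "J \<subseteq> RR g" using x y g by (auto simp: J_def intro!: RR_add RR_mult)
    have xJ: "x \<in> J" unfolding J_def using RR_1[OF g] RR_0[OF g] by (intro CollectI exI[of _ 1] exI[of _ 0]) auto
    have yJ: "y \<in> J" unfolding J_def using RR_1[OF g] RR_0[OF g] by (intro CollectI exI[of _ 0] exI[of _ 1]) auto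
    have Jd: "u - v \<in> J" if "u \<in> J" "v \<in> J" for u v
    proof -
      obtain a b c d where "u = a * x + b * y" "v = c * x + d * y" "a \<in> RR g" "b \<in> RR g" "c \<in> RR g" "d \<in> RR g"
        using \<open>u \<in> J\<close> \<open>v \<in> J\<close> unfolding J_def by blast
      then show ?thesis unfolding J_def using RR_diff[OF g]
        by (intro CollectI exI[of _ "a - c"] exI[of _ "b - d"]) (auto simp: algebra_simps)
    qed
    have Jm: "r * u \<in> J" if "u \<in> J" "r \<in> RR g" for u r
    proof -
      obtain a b where "u = a * x + b * y" "a \<in> RR g" "b \<in> RR g" using \<open>u \<in> J\<close> unfolding J_def by blast
      then show ?thesis unfolding J_def using RR_mult[OF g] that
        by (intro CollectI exI[of _ "r * a"] exI[of _ "r * b"]) (auto simp: algebra_simps)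
    qed
    obtain z0 where z0: "z0 \<in> J \<and> z0 \<noteq> 0" using False xJ yJ by blast
    obtain d where d: "d \<in> J \<and> d \<noteq> 0" "\<And>z. z \<in> J \<and> z \<noteq> 0 \<Longrightarrow> nat \<lfloor>norm (NN d)\<rfloor> \<le> nat \<lfloor>norm (NN z)\<rfloor>"
      using ex_has_least_nat[of "\<lambda>z. z \<in> J \<and> z \<noteq> 0" z0 "\<lambda>z. nat \<lfloor>norm (NN z)\<rfloor>"] z0 by blast
    have NNi: "real (nat \<lfloor>norm (NN z)\<rfloor>) = norm (NN z)" if "z \<in> J" for z
    proof -
      have "z \<in> Zom" using that JR RR_Zom by blast
      then obtain n where "NN z = of_int n" using NN_int by blast
      then show ?thesis by simp
    qed
    have min: "norm (NN d) \<le> norm (NN z)" if "z \<in> J" "z \<noteq> 0" for z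
      using d that NNi by (metis of_nat_le_iff)
    have div: "\<exists>t\<in>RR g. z = t * d" if z: "z \<in> J" for z
    proof -
      obtain k r where kr: "k \<in> {1..<m}" "r \<in> RR g" "norm (NN (of_nat k * z - r * d)) < norm (NN d)"
        using approx[of d z] d z JR by blast
      have "of_nat k * z - r * d \<in> J" using d z kr g by (intro Jd Jm RR_of_nat) auto
      then have "of_nat k * z - r * d = 0" using min kr(3) by (metis not_less)
      then show ?thesis
        using smooth_divides[OF g Jd Jm JR, of d z "of_nat k" r] d min z kr sm by auto
    qed
    show ?thesis using div[OF xJ] div[OF yJ] d JR unfolding J_def by blast
  qed
qed

section \<open>Congruences in the fixed rings\<close>

definition cng :: "nat \<Rightarrow> complex \<Rightarrow> complex \<Rightarrow> complex \<Rightarrow> bool"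
  where "cng g m x y \<longleftrightarrow> (\<exists>t\<in>RR g. x - y = m * t)"

lemma cng_refl: "\<not> 13 dvd g \<Longrightarrow> cng g m x x"
  using RR_0 by (auto simp: cng_def)

lemma cng_sym: "\<not> 13 dvd g \<Longrightarrow> cng g m x y \<Longrightarrow> cng g m y x"
  unfolding cng_def using RR_uminus by (metis minus_diff_eq mult_minus_right)

lemma cng_trans: "\<not> 13 dvd g \<Longrightarrow> cng g m x y \<Longrightarrow> cng g m y z \<Longrightarrow> cng g m x z"
  unfolding cng_def
proof (elim bexE)
  fix s t assume h: "\<not> 13 dvd g" "s \<in> RR g" "t \<in> RR g" "x - y = m * s" "y - z = m * t"
  then have "x - z = m * (s + t)" by (simp add: algebra_simps)
  then show "\<exists>t\<in>RR g. x - z = m * t" using RR_add h by blast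
qed

lemma cng_add: "\<not> 13 dvd g \<Longrightarrow> cng g m x y \<Longrightarrow> cng g m x' y' \<Longrightarrow> cng g m (x + x') (y + y')"
  unfolding cng_def
proof (elim bexE)
  fix s t assume h: "\<not> 13 dvd g" "s \<in> RR g" "t \<in> RR g" "x - y = m * s" "x' - y' = m * t"
  then have "x + x' - (y + y') = m * (s + t)" by (simp add: algebra_simps)
  then show "\<exists>t\<in>RR g. x + x' - (y + y') = m * t" using RR_add h by blast
qed

lemma cng_mult: "\<not> 13 dvd g \<Longrightarrow> x' \<in> RR g \<Longrightarrow> y \<in> RR g \<Longrightarrow> cng g m x y \<Longrightarrow> cng g m x' y' \<Longrightarrow> cng g m (x * x') (y * y')"
  unfolding cng_def
proof (elim bexE)
  fix s t assume h: "\<not> 13 dvd g" "x' \<in> RR g" "y \<in> RR g" "s \<in> RR g" "t \<in> RR g" "x - y = m * s" "x' - y' = m * t"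
  have "x * x' - y * y' = (x - y) * x' + y * (x' - y')" by (simp add: algebra_simps)
  also have "\<dots> = m * (s * x' + y * t)" by (simp add: h algebra_simps)
  finally show "\<exists>t\<in>RR g. x * x' - y * y' = m * t" using RR_add RR_mult h by blast
qed

lemma cng_power: "\<not> 13 dvd g \<Longrightarrow> x \<in> RR g \<Longrightarrow> y \<in> RR g \<Longrightarrow> cng g m x y \<Longrightarrow> cng g m (x ^ n) (y ^ n)"
  by (induction n) (auto intro!: cng_mult cng_refl RR_power)

lemma cng_prod: "\<not> 13 dvd g \<Longrightarrow> (\<And>i. i \<in> I \<Longrightarrow> x i \<in> RR g \<and> y i \<in> RR g \<and> cng g m (x i) (y i)) \<Longrightarrow> cng g m (prod x I) (prod y I)"
  by (induction I rule: infinite_finite_induct) (auto intro!: cng_mult cng_refl RR_prod)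

lemma cng_uminus: "\<not> 13 dvd g \<Longrightarrow> cng g m x y \<Longrightarrow> cng g m (- x) (- y)"
  unfolding cng_def using RR_uminus by (metis minus_diff_minus mult_minus_right)

lemma cng_diff: "\<not> 13 dvd g \<Longrightarrow> cng g m x y \<Longrightarrow> cng g m x' y' \<Longrightarrow> cng g m (x - x') (y - y')"
  using cng_add[of g m x y "- x'" "- y'"] cng_uminus by simp

lemma cng_dvd: "\<not> 13 dvd g \<Longrightarrow> d \<in> RR g \<Longrightarrow> cng g (m * d) x y \<Longrightarrow> cng g m x y"
  unfolding cng_def using RR_mult by (metis mult.assoc)

lemma frob_iter:
  assumes g: "\<not> 13 dvd g" and p: "prime p" "\<not> 13 dvd p" and x: "x \<in> RR g"
  shows "cng g (of_nat p) (x ^ (p ^ i)) (sg (p ^ i) x)"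
proof (induction i)
  case 0
  then show ?case using cng_refl[OF g] RR_Zom[OF x] by simp
next
  case (Suc i)
  have pi: "\<not> 13 dvd p ^ i" using p prime_dvd_power[of "13::nat" p i] by auto
  have s: "sg (p ^ i) x \<in> RR g" using RR_sg g pi x by blast
  obtain y where y: "y \<in> Zom" "sg (p ^ i) x ^ p - sg p (sg (p ^ i) x) = of_nat p * y"
    using frobenius[OF p RR_Zom[OF s]] by blast
  have "of_nat p * y \<in> RR g" unfolding y(2)[symmetric] by (intro RR_diff RR_power RR_sg[OF g p(2) s] g s)
  then have "y \<in> RR g" using RR_divide_nat[OF g y(1)] prime_gt_0_nat[OF p(1)] by blast
  then have "cng g (of_nat p) (sg (p ^ i) x ^ p) (sg p (sg (p ^ i) x))" using y by (auto simp: cng_def)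
  moreover have "cng g (of_nat p) ((x ^ (p ^ i)) ^ p) (sg (p ^ i) x ^ p)"
    using Suc g x s by (intro cng_power RR_power)
  ultimately have "cng g (of_nat p) ((x ^ (p ^ i)) ^ p) (sg p (sg (p ^ i) x))"
    using cng_trans[OF g] by blast
  moreover have "(x ^ (p ^ i)) ^ p = x ^ (p ^ Suc i)" by (simp add: power_mult[symmetric] mult.commute)
  ultimately show ?case using sg_sg[OF p(2) pi RR_Zom[OF x]] by simp
qed

text \<open>When p does not divide n, a Bezout relation between n and p = \<pi> \<pi>' inverts r
  modulo \<pi>; the case p | n is what \<open>zero\<close> has to supply.\<close>

lemma good_int:
  assumes g: "\<not> 13 dvd g" and p: "prime p" and \<pi>: "\<pi> \<in> RR g" "\<pi>' \<in> RR g" "\<pi> * \<pi>' = of_nat p" "norm (NN \<pi>) > 1"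
    and rI: "R \<in> RR g" "r \<in> RR g" "cng g \<pi> (r * R) (of_int n)"
    and zero: "int p dvd n \<Longrightarrow> \<exists>t\<in>RR g. r = \<pi> * t"
  shows "(\<exists>s\<in>RR g. \<exists>t\<in>RR g. r * s = 1 + \<pi> * t) \<or> (\<exists>t\<in>RR g. r = \<pi> * t)"
proof (cases "int p dvd n")
  case True
  then show ?thesis using zero by blast
next
  case False
  then have "coprime n (int p)" using p prime_imp_coprime[of "int p" n] by (simp add: coprime_commute)
  then obtain u v where uv: "u * n + v * int p = 1" by (metis bezout_int coprime_iff_gcd_eq_1)
  obtain t where t: "t \<in> RR g" "r * R - of_int n = \<pi> * t" using rI by (auto simp: cng_def)
  have "of_int u * of_int n + of_int v * of_nat p = (1::complex)"
    by (metis uv of_int_1 of_int_add of_int_mult of_int_of_nat_eq)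
  then have "r * (R * of_int u) = 1 + \<pi> * (t * of_int u - of_int v * \<pi>')"
    using t(2) \<pi>(3) by algebra
  moreover have "R * of_int u \<in> RR g" "t * of_int u - of_int v * \<pi>' \<in> RR g"
    using rI t \<pi> g by (auto intro!: RR_intros)
  ultimately show ?thesis by blast
qed

text \<open>The product F of the Frobenius conjugates of r is fixed by \<open>sg p\<close>, hence an
  integer modulo \<pi>. If p divides that integer, a power of r vanishes modulo \<pi>, since the
  conjugates are powers of r modulo p. Then r^(p^f), which is r itself modulo \<pi>, vanishes as
  well.\<close>

lemma good_frob:
  assumes g: "\<not> 13 dvd g" and p: "prime p" "\<not> 13 dvd p"
    and \<pi>: "\<pi> \<in> RR g" "\<pi>' \<in> RR g" "\<pi> * \<pi>' = of_nat p" "norm (NN \<pi>) > 1"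
    and f: "f \<ge> 1" "\<And>x. x \<in> RR g \<Longrightarrow> sg (p ^ f) x = x"
    and fixed: "\<And>x. x \<in> RR g \<Longrightarrow> sg p x = x \<Longrightarrow> \<exists>n. cng g \<pi> x (of_int n)"
  shows "good g \<pi>"
  unfolding good_def
proof (intro conjI ballI \<pi>)
  fix r assume r: "r \<in> RR g"
  have pi: "\<not> 13 dvd p ^ i" for i using p prime_dvd_power[of "13::nat" p i] by auto
  define F where "F = (\<Prod>i<f. sg (p ^ i) r)"
  define R where "R = (\<Prod>i\<in>{1..<f}. sg (p ^ i) r)"
  have RR: "R \<in> RR g" "F \<in> RR g" unfolding R_def F_def using g r pi by (auto intro!: RR_prod RR_sg)
  have FR: "F = r * R"
  proof -
    have "{..<f} = insert 0 {1..<f}" using f(1) by auto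
    then show ?thesis using RR_Zom[OF r] by (simp add: F_def R_def)
  qed
  have "sg p F = (\<Prod>i<f. sg p (sg (p ^ i) r))"
    unfolding F_def using p pi RR_Zom[OF r] by (intro sg_prod) auto
  also have "\<dots> = (\<Prod>i<f. sg (p ^ Suc i) r)" using p pi RR_Zom[OF r] by (simp add: sg_sg)
  also have "\<dots> = (\<Prod>i\<in>{1..<Suc f}. sg (p ^ i) r)"
    by (rule prod.reindex_bij_witness[of _ "\<lambda>j. j - 1" Suc]) auto
  also have "{1..<Suc f} = insert f {1..<f}" using f(1) by auto
  also have "(\<Prod>i\<in>insert f {1..<f}. sg (p ^ i) r) = F" using f(2)[OF r] by (simp add: FR R_def)
  finally obtain n where n: "cng g \<pi> F (of_int n)" using fixed[OF RR(2)] by blast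
  show "(\<exists>s\<in>RR g. \<exists>t\<in>RR g. r * s = 1 + \<pi> * t) \<or> (\<exists>t\<in>RR g. r = \<pi> * t)"
  proof (rule good_int[OF g p(1) \<pi> RR(1) r])
    show "cng g \<pi> (r * R) (of_int n)" using n by (simp add: FR)
    assume "int p dvd n"
    then obtain q where "n = int p * q" by blast
    then have "of_int n = \<pi> * (\<pi>' * of_int q)" by (simp add: \<pi>(3) flip: mult.assoc)
    then have "cng g \<pi> (of_int n) 0" unfolding cng_def using \<pi>(2) g
      by (intro bexI[of _ "\<pi>' * of_int q"]) (auto intro: RR_intros)
    then have F0: "cng g \<pi> F 0" using n cng_trans[OF g] by blast
    have pcng: "cng g \<pi> (r ^ p ^ i) (sg (p ^ i) r)" for i
      by (rule cng_dvd[OF g \<pi>(2)]) (use frob_iter[OF g p r] in \<open>simp add: \<pi>(3)\<close>)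
    define M where "M = (\<Sum>i<f. p ^ i)"
    have "cng g \<pi> (\<Prod>i<f. r ^ (p ^ i)) F"
      unfolding F_def using pcng pi g r by (intro cng_prod) (auto intro: RR_intros)
    also have "(\<Prod>i<f. r ^ (p ^ i)) = r ^ M" by (simp add: M_def power_sum)
    finally have "cng g \<pi> (r ^ M) 0" using F0 cng_trans[OF g] by blast
    then have "cng g \<pi> (r ^ M * r ^ (p ^ f - M)) (0 * r ^ (p ^ f - M))"
      using g r by (intro cng_mult cng_refl RR_intros)
    moreover have "M \<le> p ^ f"
    proof -
      have "p \<ge> 2" using p(1) by (rule prime_ge_2_nat)
      have "(\<Sum>i<k. p ^ i) \<le> p ^ k" for k
      proof (induction k)
        case (Suc k)
        have "2 * p ^ k \<le> p * p ^ k" using \<open>p \<ge> 2\<close> by simp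
        then show ?case unfolding sum.lessThan_Suc power_Suc using Suc by linarith
      qed simp
      then show ?thesis by (simp add: M_def)
    qed
    ultimately have "cng g \<pi> (r ^ (p ^ f)) 0" by (simp flip: power_add)
    then have "cng g \<pi> (sg (p ^ f) r) 0" using pcng[of f] cng_sym[OF g] cng_trans[OF g] by blast
    then show "\<exists>t\<in>RR g. r = \<pi> * t" using f(2)[OF r] by (simp add: cng_def)
  qed
qed

lemma NN_sg:
  assumes "\<not> 13 dvd m" "x \<in> Zom" shows "NN (sg m x) = NN x"
proof -
  have "NN (sg m x) = (\<Prod>k=1..12. sg (m * k mod 13) x)" unfolding NN_def
    by (intro prod.cong refl) (simp add: sg_mod sg_sg assms not_dvd_13 mult.commute)
  also have "\<dots> = NN x" unfolding NN_def by (rule prod_mult_mod_13[OF assms(1)])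
  finally show ?thesis .
qed

lemma good_sg:
  assumes g: "\<not> 13 dvd g" and k: "\<not> 13 dvd k" and "good g \<pi>"
  shows "good g (sg k \<pi>)"
proof -
  obtain l where l: "\<not> 13 dvd l" "\<And>x. x \<in> Zom \<Longrightarrow> sg l (sg k x) = x" using sg_inverse_ex[OF k] by blast
  have lk: "sg k (sg l x) = x" if "x \<in> Zom" for x using l that k by (metis sg_sg mult.commute)
  have \<pi>: "\<pi> \<in> RR g" "norm (NN \<pi>) > 1" using assms by (auto simp: good_def)
  show ?thesis unfolding good_def
  proof (intro conjI ballI)
    show "sg k \<pi> \<in> RR g" using \<pi> g k by (intro RR_sg)
    show "norm (NN (sg k \<pi>)) > 1" using NN_sg[OF k] \<pi> RR_Zom by simp
    fix r assume r: "r \<in> RR g"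
    then have "sg l r \<in> RR g" using g l RR_sg by blast
    then have "(\<exists>s\<in>RR g. \<exists>t\<in>RR g. sg l r * s = 1 + \<pi> * t) \<or> (\<exists>t\<in>RR g. sg l r = \<pi> * t)"
      using assms(3) by (auto simp: good_def)
    then show "(\<exists>s\<in>RR g. \<exists>t\<in>RR g. r * s = 1 + sg k \<pi> * t) \<or> (\<exists>t\<in>RR g. r = sg k \<pi> * t)"
    proof (elim disjE bexE)
      fix s t assume st: "s \<in> RR g" "t \<in> RR g" "sg l r * s = 1 + \<pi> * t"
      have "r * sg k s = sg k (sg l r * s)" using st(1) r k l(1) RR_Zom by (simp add: lk)
      also have "\<dots> = sg k (1 + \<pi> * t)" by (simp only: st)
      also have "\<dots> = 1 + sg k \<pi> * sg k t" using st(2) \<pi> k RR_Zom by simp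
      finally have "r * sg k s = 1 + sg k \<pi> * sg k t" .
      then show ?thesis using st g k RR_sg by blast
    next
      fix t assume st: "t \<in> RR g" "sg l r = \<pi> * t"
      have "r = sg k (sg l r)" using r RR_Zom by (simp add: lk)
      also have "\<dots> = sg k \<pi> * sg k t" unfolding st(2) using st(1) \<pi> k RR_Zom by simp
      finally have "r = sg k \<pi> * sg k t" .
      then show ?thesis using st g k RR_sg by blast
    qed
  qed
qed

section \<open>The fixed rings of degree 6 and 4 are Bezout domains\<close>

lemma set_1_12: "{1..12::nat} = {1,2,3,4,5,6,7,8,9,10,11,12}"
  by code_simp

lemma sum_1_12: "(\<Sum>j=1..12::nat. f j) = f 1 + f 2 + f 3 + f 4 + f 5 + f 6 + f 7 + f 8 + f 9 + f 10 + f 11 + (f 12 :: 'a :: comm_monoid_add)"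
  unfolding set_1_12 by (simp add: add.assoc)

lemma om_rel: "1 + om + om^2 + om^3 + om^4 + om^5 + om^6 + om^7 + om^8 + om^9 + om^10 + om^11 + om^12 = 0"
  using om_pow_sum'[of 1] unfolding sum_1_12 by (simp add: add.assoc)

text \<open>Gaussian periods: w0 generates the quadratic subfield, e0, e1, e2 the cubic one and h0, ..., h3 the quartic one.\<close>

definition w0 :: complex where "w0 = om + om^3 + om^4 + om^9 + om^10 + om^12"
definition e0 :: complex where "e0 = om + om^5 + om^8 + om^12"
definition e1 :: complex where "e1 = om^2 + om^3 + om^10 + om^11"
definition e2 :: complex where "e2 = om^4 + om^6 + om^7 + om^9"
definition h0 :: complex where "h0 = om + om^3 + om^9"
definition h1 :: complex where "h1 = om^2 + om^5 + om^6"
definition h2 :: complex where "h2 = om^4 + om^10 + om^12"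
definition h3 :: complex where "h3 = om^7 + om^8 + om^11"

lemma w0_rel: "w0 * w0 = 3 - w0"
  unfolding w0_def using om_rel by algebra

lemma e_rel: "e1 = 2 - 2 * e0 - e0 * e0" "e2 = 2 - 2 * e1 - e1 * e1" "e0 + e1 + e2 = -1"
  unfolding e0_def e1_def e2_def using om_rel by algebra+

lemma h_rel: "h0 * h3 = -1 - h1" "h0 * h1 = -1 - h2" "h0 * h2 = 3 + h1 + h3" "h0 + h1 + h2 + h3 = -1" "h1 * h3 = 3 + h0 + h2"
  "h0 * h0 = h1 + 2 * h2"
  unfolding h0_def h1_def h2_def h3_def using om_rel by algebra+

lemma pow_12_mod_13:
  assumes "\<not> 13 dvd (p::nat)" shows "p ^ 12 mod 13 = 1"
proof -
  have "\<forall>k\<in>{1..12::nat}. k ^ 12 mod 13 = 1" unfolding set_1_12 by simp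
  then have "(p mod 13) ^ 12 mod 13 = 1" using mod_13_in[OF assms] by blast
  then show ?thesis by (simp add: power_mod)
qed

lemma sg_pow_fixed:
  assumes "\<not> 13 dvd p" "x \<in> Zom" "sg p x = x"
  shows "sg (p ^ i) x = x"
proof (induction i)
  case (Suc i)
  have "\<not> 13 dvd p ^ i" using assms(1) prime_dvd_power[of "13::nat" p i] by auto
  then have "sg (p ^ Suc i) x = sg p (sg (p ^ i) x)" using assms by (simp add: sg_sg)
  then show ?case using Suc assms by simp
qed (use assms in simp)

lemma sg_gen_fixed:
  assumes "\<not> 13 dvd p" "\<not> 13 dvd g" "x \<in> RR g" "sg p x = x" "[p ^ i * g ^ j = k] (mod 13)"
  shows "sg k x = x"
proof -
  have x: "x \<in> Zom" "sg g x = x" using assms by (auto simp: RR_def)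
  have "\<not> 13 dvd p ^ i" "\<not> 13 dvd g ^ j" using assms(1,2) prime_dvd_power[of "13::nat"] by auto
  then have "sg (p ^ i * g ^ j) x = x"
    using sg_pow_fixed[OF assms(1) x(1) assms(4)] sg_pow_fixed[OF assms(2) x] x by (metis sg_sg)
  then show ?thesis using sg_cong[OF assms(5)] by simp
qed

lemma sg_pow_12: "\<not> 13 dvd p \<Longrightarrow> x \<in> Zom \<Longrightarrow> sg (p ^ 12) x = x"
  using sg_cong[of "p ^ 12" 1 x] pow_12_mod_13 by (simp add: cong_def)

text \<open>By \<open>gen\<close>, p and g generate the residues prime to 13. Frobenius-fixed
  elements of \<open>RR g\<close> are therefore rational integers, and p is inert.\<close>

lemma good_inert:
  assumes g: "\<not> 13 dvd g" and p: "prime p" "\<not> 13 dvd p"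
    and gen: "\<forall>k\<in>{1..12}. \<exists>i\<in>{0,1,2,3,4,5,6,7,8,9,10,11}. \<exists>j\<in>{0,1,2}. p ^ i * g ^ j mod 13 = k"
  shows "good g (of_nat p)"
proof (rule good_frob[OF g p, of _ 1 12])
  have "p \<ge> 2" using p(1) by (rule prime_ge_2_nat)
  then have "real p ^ 12 > 1" by (intro one_less_power) auto
  then show "norm (NN (of_nat p)) > 1" using NN_of_int[of "int p"] by (simp add: norm_power)
  fix x assume x: "x \<in> RR g"
  show "sg (p ^ 12) x = x" using sg_pow_12 p RR_Zom x by blast
  assume "sg p x = x"
  then have "sg k x = x" if "k \<in> {1..12}" for k
    using sg_gen_fixed[OF p(2) g x] gen \<open>k \<in> {1..12}\<close> by (metis cong_def mod_mod_trivial)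
  then obtain n where "x = of_int n" using sg_fixed_all RR_Zom[OF x] by blast
  then show "\<exists>n. cng g (of_nat p) x (of_int n)" using cng_refl[OF g] by blast
qed (simp_all add: RR_of_nat RR_1 g)

lemma smooth_nat:
  assumes g: "\<not> 13 dvd g" and "\<And>p. prime p \<Longrightarrow> p < m \<Longrightarrow> smooth g (of_nat p)" "k \<in> {1..<m}"
  shows "smooth g (of_nat k)"
  using assms(3)
proof (induction k rule: less_induct)
  case (less k)
  show ?case
  proof (cases "k = 1")
    case True
    then show ?thesis using smooth_1[OF g] by simp
  next
    case False
    then obtain p where p: "prime p" "p dvd k" using prime_factor_nat by blast
    then obtain q where q: "k = p * q" by blast
    have "p \<ge> 2" using p(1) by (rule prime_ge_2_nat)
    have "q \<ge> 1" "p \<le> k" using less.prems q by (auto simp: Suc_le_eq)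
    then have "q < k" using q \<open>p \<ge> 2\<close> by simp
    then have "smooth g (of_nat q)" using less \<open>q \<ge> 1\<close> by auto
    moreover have "smooth g (of_nat p)" using assms(2)[OF p(1)] \<open>p \<le> k\<close> less.prems by auto
    ultimately show ?thesis using smooth_mult[OF g] q by simp
  qed
qed

text \<open>The type 'n supplies the dimension. Orbits of g are labelled by representatives \<rho> j
  in S, and a bijection carries S to the type, so the orbit data can be checked by computation on
  numbers.\<close>

lemma approx_orbits:
  fixes \<rho> :: "nat \<Rightarrow> nat" and dummy :: "'n::{finite,wellorder} itself"
  assumes g: "\<not> 13 dvd g" and e: "e * CARD('n) = 12"
    and S: "finite S" "card S = CARD('n)" "\<forall>j\<in>{1..12}. \<rho> j \<in> S" "\<forall>s\<in>S. card {j\<in>{1..12}. \<rho> j = s} = e"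
    and inv: "\<forall>j\<in>{1..12}. \<rho> (g * j mod 13) = \<rho> j"
    and orb: "\<forall>j\<in>{1..12}. \<exists>i. \<rho> j = g ^ i * j mod 13"
    and vol: "unit_ball_vol CARD('n) * sqrt (CARD('n) / 52) ^ CARD('n) * sqrt 13 * real m > 1"
    and xy: "x \<in> RR g" "y \<in> RR g" "x \<noteq> 0"
  shows "\<exists>k\<in>{1..<m}. \<exists>r\<in>RR g. norm (NN (of_nat k * y - r * x)) < norm (NN x)"
proof -
  obtain b :: "nat \<Rightarrow> 'n" where b: "bij_betw b S UNIV"
    using finite_same_card_bij[of S "UNIV :: 'n set"] S by auto
  have bS: "b s = b t \<longleftrightarrow> s = t" if "s \<in> S" "t \<in> S" for s t
    using b that by (auto simp: bij_betw_def inj_on_def)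
  show ?thesis
  proof (rule approx_RR[of g e "\<lambda>j. b (\<rho> j)" m x y])
    fix i :: 'n
    obtain s where s: "s \<in> S" "i = b s" using b by (auto simp: bij_betw_def)
    have "{j\<in>{1..12}. b (\<rho> j) = i} = {j\<in>{1..12}. \<rho> j = s}" using S(3) s bS by auto
    then show "card {j\<in>{1..12}. b (\<rho> j) = i} = e" using S(4) s by simp
  next
    fix c assume c: "val c 1 \<in> RR g"
    have step: "c (g ^ i * j mod 13) = c j" if "j \<in> {1..12}" for i j
    proof (induction i)
      case (Suc i)
      have "\<not> 13 dvd g ^ i" using g prime_dvd_power[of "13::nat" g i] by auto
      then have "g ^ i * j mod 13 \<in> {1..12}" using mod_13_in[OF not_dvd_13_mult] not_dvd_13[OF that] by blast
      from RR_coeff[OF g c this] show ?case using Suc by (simp add: mod_mult_right_eq mult.assoc)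
    qed (use that in auto)
    have "c j = c (\<rho> j)" if "j \<in> {1..12}" for j
      using orb that step[OF that] by metis
    moreover have "c (\<rho> j) = (\<lambda>i. c (inv_into S b i)) (b (\<rho> j))" if "j \<in> {1..12}" for j
      using b S(3) that by (simp add: bij_betw_def)
    ultimately show "\<exists>r. \<forall>j\<in>{1..12}. c j = r (b (\<rho> j))"
      by (intro exI[of _ "\<lambda>i. c (inv_into S b i)"]) auto
  qed (use assms in auto)
qed

lemma approx_12:
  assumes "x \<in> RR 12" "y \<in> RR 12" "x \<noteq> 0"
  shows "\<exists>k\<in>{1..<37}. \<exists>r\<in>RR 12. norm (NN (of_nat k * y - r * x)) < norm (NN x)"
proof (rule approx_orbits[of 12 2 "{1..6}" "\<lambda>j. min j (13 - j)" 37 x y, where ?'n = 6])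
  show "\<forall>s\<in>{1..6}. card {j\<in>{1..12::nat}. min j (13 - j) = s} = 2" by code_simp
  show "\<forall>j\<in>{1..12::nat}. min j (13 - j) \<in> {1..6}" by code_simp
  show "\<forall>j\<in>{1..12::nat}. min (12 * j mod 13) (13 - 12 * j mod 13) = min j (13 - j)" by code_simp
  have "\<forall>j\<in>{1..12::nat}. \<exists>i\<in>{0,1}. min j (13 - j) = 12 ^ i * j mod 13" unfolding set_1_12 by simp
  then show "\<forall>j\<in>{1..12::nat}. \<exists>i. min j (13 - j) = 12 ^ i * j mod 13" by blast
  show "unit_ball_vol CARD(6) * sqrt (CARD(6) / 52) ^ CARD(6) * sqrt 13 * real 37 > 1" using vol6 by simp
qed (use assms in auto)

text \<open>The orbits of multiplication by 3 are {1,3,9}, {2,5,6}, {4,10,12} and {7,8,11}, labelled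
  by their least elements.\<close>

lemma approx_3:
  assumes "x \<in> RR 3" "y \<in> RR 3" "x \<noteq> 0"
  shows "\<exists>k\<in>{1..<11}. \<exists>r\<in>RR 3. norm (NN (of_nat k * y - r * x)) < norm (NN x)"
proof (rule approx_orbits[of 3 3 "{1,2,4,7}" "\<lambda>j. min j (min (3 * j mod 13) (9 * j mod 13))" 11 x y, where ?'n = 4])
  show "\<forall>s\<in>{1,2,4,7}. card {j\<in>{1..12::nat}. min j (min (3 * j mod 13) (9 * j mod 13)) = s} = 3" by code_simp
  show "\<forall>j\<in>{1..12::nat}. min j (min (3 * j mod 13) (9 * j mod 13)) \<in> {1,2,4,7}" by code_simp
  show "\<forall>j\<in>{1..12::nat}. min (3 * j mod 13) (min (3 * (3 * j mod 13) mod 13) (9 * (3 * j mod 13) mod 13))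
     = min j (min (3 * j mod 13) (9 * j mod 13))" by code_simp
  have "\<forall>j\<in>{1..12::nat}. \<exists>i\<in>{0,1,2}. min j (min (3 * j mod 13) (9 * j mod 13)) = 3 ^ i * j mod 13" unfolding set_1_12 by simp
  then show "\<forall>j\<in>{1..12::nat}. \<exists>i. min j (min (3 * j mod 13) (9 * j mod 13)) = 3 ^ i * j mod 13" by blast
  show "unit_ball_vol CARD(4) * sqrt (CARD(4) / 52) ^ CARD(4) * sqrt 13 * real 11 > 1" using vol4 by simp
qed (use assms in auto)

lemma e_mult: "e0 * e1 = e1 - 1" "e1 * e2 = e2 - 1" "e2 * e0 = e0 - 1"
  unfolding e0_def e1_def e2_def using om_rel by algebra+

lemma om_big: "13 \<le> n \<Longrightarrow> om ^ n = om ^ (n mod 13)"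
  by (simp add: om_pow_mod)

lemma om_pow_add_13: "om ^ (k + 13 * m) = om ^ k"
  by (simp only: power_add power_mult om_pow_13) simp

lemma om_red: "om ^ 24 = om ^ 11" "om ^ 36 = om ^ 10" "om ^ 48 = om ^ 9" "om ^ 60 = om ^ 8" "om ^ 72 = om ^ 7"
  by (auto intro!: om_pow_cong simp: cong_def)

section \<open>Real periods and the prime above 13\<close>

text \<open>This is 2 cos (2 pi k / 13); the exponent -k is written 12 k to remain in the natural
  numbers.\<close>

definition tt :: "nat \<Rightarrow> complex" where "tt k = om ^ k + om ^ (12 * k)"

lemma tt_mod: "tt (k mod 13) = tt k"
  unfolding tt_def using om_pow_cong[of "12 * (k mod 13)" "12 * k"] by (simp add: om_pow_mod cong_def mod_mult_right_eq)

lemma tt_cong: "[k = l] (mod 13) \<Longrightarrow> tt k = tt l"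
  by (metis tt_mod cong_def)

lemma tt_neg: "tt (12 * k) = tt k"
proof -
  have "om ^ (12 * (12 * k)) = om ^ k" using om_pow_add_13[of k "11 * k"] by simp
  then show ?thesis by (simp add: tt_def add.commute)
qed

lemma tt_mult: "tt a * tt b = tt (a + b) + tt (a + 12 * b)"
proof -
  have "om ^ (12 * (a + 12 * b)) = om ^ (12 * a) * om ^ b"
    using om_pow_add_13[of "12 * a + b" "11 * b"] by (simp add: power_add[symmetric] algebra_simps)
  then show ?thesis by (simp add: tt_def algebra_simps power_add)
qed

lemma sg_tt: "\<not> 13 dvd k \<Longrightarrow> sg k (tt j) = tt (k * j)"
  by (simp add: tt_def power_mult[symmetric] mult_ac)

lemma tt_RR [simp]: "tt j \<in> RR 12"
  by (simp add: RR_def sg_tt tt_neg) (simp add: tt_def)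

lemma tt_Zom [simp]: "tt j \<in> Zom" using RR_Zom[OF tt_RR] .

text \<open>Chebyshev relations that express every period by \<open>tt 1\<close>; the last one then
  becomes its sextic equation. They are what later calls of \<open>algebra\<close> in the real ring
  reduce by.\<close>

lemma tt_eqs: "tt 2 = tt 1 ^ 2 - 2" "tt 3 = tt 1 ^ 3 - 3 * tt 1" "tt 4 = tt 2 ^ 2 - 2" "tt 6 = tt 3 ^ 2 - 2"
  "tt 5 = tt 2 * tt 3 - tt 1" "tt 1 + tt 2 + tt 3 + tt 4 + tt 5 + tt 6 = -1"
proof -
  have one: "om ^ n = 1" if "13 dvd n" for n using that om_pow_eq_1_iff by blast
  have 0: "tt 13 = 2" "tt 26 = 2" "tt 39 = 2" by (simp_all add: tt_def one)
  have 1: "tt 2 = tt 1 * tt 1 - 2" using tt_mult[of 1 1] 0 by (simp add: numeral_2_eq_2)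
  have "tt 25 = tt 12" "tt 38 = tt 12" by (auto intro!: tt_cong simp: cong_def)
  then have "tt 25 = tt 1" "tt 38 = tt 1" using tt_neg[of 1] by simp_all
  note 2 = this
  show "tt 2 = tt 1 ^ 2 - 2" using 1 by (simp add: power2_eq_square)
  have 3: "tt 3 = tt 2 * tt 1 - tt 1" using tt_mult[of 2 1] tt_cong[of 14 1] by (simp add: cong_def)
  then show "tt 3 = tt 1 ^ 3 - 3 * tt 1" using 1 by (simp add: power3_eq_cube algebra_simps)
  show "tt 4 = tt 2 ^ 2 - 2" using tt_mult[of 2 2] 0 by (simp add: power2_eq_square)
  show "tt 6 = tt 3 ^ 2 - 2" using tt_mult[of 3 3] 0 by (simp add: power2_eq_square)
  show "tt 5 = tt 2 * tt 3 - tt 1" using tt_mult[of 2 3] 2 by simp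
  show "tt 1 + tt 2 + tt 3 + tt 4 + tt 5 + tt 6 = -1"
    using om_rel by (simp add: tt_def om_red) algebra
qed

lemma RR_12_rep:
  assumes "x \<in> RR 12"
  shows "\<exists>c :: nat \<Rightarrow> int. x = of_int (c 1) * tt 1 + of_int (c 2) * tt 2 + of_int (c 3) * tt 3 + of_int (c 4) * tt 4 + of_int (c 5) * tt 5 + of_int (c 6) * tt 6"
proof -
  obtain c where x: "x = val c 1" using Zom_val RR_Zom assms by blast
  have R: "val c 1 \<in> RR 12" using assms x by simp
  have c: "c 12 = c 1" "c 11 = c 2" "c 10 = c 3" "c 9 = c 4" "c 8 = c 5" "c 7 = c 6"
    using RR_coeff[OF _ R, of 1] RR_coeff[OF _ R, of 2] RR_coeff[OF _ R, of 3] RR_coeff[OF _ R, of 4]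
      RR_coeff[OF _ R, of 5] RR_coeff[OF _ R, of 6] by auto
  show ?thesis
    by (intro exI[of _ c]) (simp add: x val_def sum_1_12[simplified] c tt_def om_red algebra_simps)
qed

definition mu :: complex where "mu = 2 - tt 1"

lemma mu_RR [simp]: "mu \<in> RR 12" unfolding mu_def by (intro RR_diff RR_numeral tt_RR) auto

text \<open>om is 1 modulo the prime above 13, so om^j + om^-j becomes 2. Inside the real ring this
  follows from the recurrence tt (k + 2) = tt (k + 1) tt 1 - tt k.\<close>

lemma tt_cng_2: "cng 12 mu (tt j) 2"
proof -
  have n: "\<not> 13 dvd (12::nat)" by simp
  have 1: "cng 12 mu (tt 1) 2" unfolding cng_def mu_def by (intro bexI[of _ "-1"]) (auto intro!: RR_uminus RR_1)
  have c: "cng 12 mu (a + b) (c + d)" if "cng 12 mu a c" "cng 12 mu b d" for a b c d using that cng_add by simp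
  have main: "cng 12 mu (tt k) 2 \<and> cng 12 mu (tt (Suc k)) 2" for k
  proof (induction k)
    case 0
    then show ?case using 1 cng_refl[OF n] by (simp add: tt_def)
  next
    case (Suc k)
    have "tt (Suc k) * tt 1 = tt (Suc (Suc k)) + tt (Suc k + 12)" using tt_mult[of "Suc k" 1] by simp
    also have "tt (Suc k + 12) = tt k" by (rule tt_cong) (simp add: cong_def)
    finally have "tt (Suc (Suc k)) = tt (Suc k) * tt 1 - tt k" by simp
    moreover have "cng 12 mu (tt (Suc k) * tt 1 - tt k) (2 * 2 - 2)"
      using Suc 1 by (intro cng_diff cng_mult RR_numeral tt_RR n) auto
    ultimately show ?case using Suc by simp
  qed
  then show ?thesis by blast
qed

lemma RR_12_cng_int:
  assumes "x \<in> RR 12" shows "\<exists>n. cng 12 mu x (of_int n)"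
proof -
  have n: "\<not> 13 dvd (12::nat)" by simp
  obtain c :: "nat \<Rightarrow> int" where x: "x = of_int (c 1) * tt 1 + of_int (c 2) * tt 2 + of_int (c 3) * tt 3 + of_int (c 4) * tt 4 + of_int (c 5) * tt 5 + of_int (c 6) * tt 6"
    using RR_12_rep[OF assms] by blast
  have "cng 12 mu x (of_int (c 1) * 2 + of_int (c 2) * 2 + of_int (c 3) * 2 + of_int (c 4) * 2 + of_int (c 5) * 2 + of_int (c 6) * 2)"
    unfolding x by (intro cng_add cng_mult cng_refl tt_cng_2 n tt_RR RR_of_int)
  moreover have "\<dots> = of_int (c 1 * 2 + c 2 * 2 + c 3 * 2 + c 4 * 2 + c 5 * 2 + c 6 * 2)" by simp
  ultimately show ?thesis by metis
qed

lemma mu_prod: "mu * sg 2 mu * sg 3 mu * sg 4 mu * sg 5 mu * sg 6 mu = 13"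
proof -
  have s: "sg k mu = 2 - tt k" if "\<not> 13 dvd k" for k using that sg_tt[of k 1] by (simp add: mu_def)
  have "(2 - tt 1) * (2 - tt 2) * (2 - tt 3) * (2 - tt 4) * (2 - tt 5) * (2 - tt 6) = 13"
  proof -
    have t: "tt 1 = om + om^12" "tt 2 = om^2 + om^11" "tt 3 = om^3 + om^10" "tt 4 = om^4 + om^9" "tt 5 = om^5 + om^8" "tt 6 = om^6 + om^7"
      by (simp_all add: tt_def om_red)
    \<comment> \<open>The pairs {1,5}, {2,3}, {4,6} are the orbits of multiplication by 5 up to
      sign, so each product lies in the cubic subring.\<close>
    have "(2 - tt 1) * (2 - tt 5) = 4 - 2 * e0 + e2" "(2 - tt 2) * (2 - tt 3) = 4 - 2 * e1 + e0" "(2 - tt 4) * (2 - tt 6) = 4 - 2 * e2 + e1"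
      unfolding t e0_def e1_def e2_def using om_rel by algebra+
    moreover have "(4 - 2 * e0 + e2) * (4 - 2 * e1 + e0) * (4 - 2 * e2 + e1) = 13"
      using e_rel e_mult by algebra
    ultimately show ?thesis by algebra
  qed
  then show ?thesis by (simp add: s) (simp add: mu_def)
qed

lemma norm_NN_power_gt_1:
  assumes "x \<in> Zom" "NN x ^ n = of_nat m" "m > 1"
  shows "norm (NN x) > 1"
proof (rule ccontr)
  assume "\<not> ?thesis"
  then have "norm (NN x) ^ n \<le> 1" by (simp add: power_le_one)
  moreover have "norm (NN x) ^ n = real m" using assms(2) by (metis norm_power norm_of_nat)
  ultimately show False using assms(3) by simp
qed

text \<open>At the ramified prime no Frobenius automorphism is available; instead
  \<open>RR_12_cng_int\<close> shows directly that integers represent all residues modulo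
  \<open>mu\<close>.\<close>

lemma good_mu: "good 12 mu"
  unfolding good_def
proof (intro conjI ballI)
  have n: "\<not> 13 dvd (12::nat)" by simp
  define mu' where "mu' = sg 2 mu * sg 3 mu * sg 4 mu * sg 5 mu * sg 6 mu"
  have mu': "mu' \<in> RR 12" "mu * mu' = of_nat 13" unfolding mu'_def using mu_prod
    by (auto intro!: RR_mult RR_sg mu_RR simp: mult.assoc)
  have "NN mu * NN (sg 2 mu) * NN (sg 3 mu) * NN (sg 4 mu) * NN (sg 5 mu) * NN (sg 6 mu) = NN 13"
    unfolding mu_prod[symmetric] using RR_Zom[OF mu_RR] by (simp add: NN_mult)
  moreover have "NN (sg k mu) = NN mu" if "\<not> 13 dvd k" for k using NN_sg that RR_Zom[OF mu_RR] by blast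
  ultimately have "NN mu * NN mu * NN mu * NN mu * NN mu * NN mu = NN 13" by simp
  moreover have "NN mu ^ 6 = NN mu * NN mu * NN mu * NN mu * NN mu * NN mu" by algebra
  ultimately have "NN mu ^ 6 = of_nat (13 ^ 12)" using NN_of_int[of 13] by simp
  then show nn: "norm (NN mu) > 1" by (rule norm_NN_power_gt_1[OF RR_Zom[OF mu_RR]]) simp
  fix r assume r: "r \<in> RR 12"
  obtain m where m: "cng 12 mu r (of_int m)" using RR_12_cng_int r by blast
  show "(\<exists>s\<in>RR 12. \<exists>t\<in>RR 12. r * s = 1 + mu * t) \<or> (\<exists>t\<in>RR 12. r = mu * t)"
  proof (rule good_int[OF n _ mu_RR mu' nn, of 1 r m])
    show "prime (13::nat)" by simp
    show "cng 12 mu (r * 1) (of_int m)" using m by simp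
    assume "int 13 dvd m"
    then obtain q where q: "m = 13 * q" by auto
    then have "of_int m = mu * (mu' * of_int q)" using mu'(2) by (simp flip: mult.assoc)
    then have "cng 12 mu (of_int m) 0" unfolding cng_def using mu'(1) by (intro bexI[of _ "mu' * of_int q"]) (auto intro!: RR_mult RR_of_int)
    then have "cng 12 mu r 0" using m cng_trans[OF n] by blast
    then show "\<exists>t\<in>RR 12. r = mu * t" by (simp add: cng_def)
  qed (use r in \<open>auto intro: RR_1\<close>)
qed simp

lemma smooth_13: "smooth 12 (of_nat 13)"
proof -
  have "smooth 12 (mu * sg 2 mu * sg 3 mu * sg 4 mu * sg 5 mu * sg 6 mu)"
    by (intro smooth_mult smooth_good good_sg good_mu) auto
  then show ?thesis unfolding mu_prod by simp
qed

section \<open>Split primes of the real subring\<close>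

lemma w0_RR [simp]: "w0 \<in> RR 12"
  by (simp add: RR_def w0_def om_big; algebra)

lemma sg_2_w0: "sg 2 w0 = -1 - w0"
proof -
  have "sg 2 w0 = om^2 + om^6 + om^8 + om^5 + om^7 + om^11" by (simp add: w0_def om_big; algebra)
  also have "\<dots> = -1 - w0" unfolding w0_def using om_rel by algebra
  finally show ?thesis .
qed

lemma quad_rep:
  assumes "x \<in> Zom" "\<forall>k\<in>{3,4,9,10,12}. sg k x = x"
  shows "\<exists>a b. x = of_int a * w0 + of_int b"
proof -
  obtain c where x: "x = val c 1" using Zom_val assms by blast
  have R: "val c 1 \<in> RR k" if "k \<in> {3,4,9,10,12}" for k using assms that by (auto simp: RR_def x)
  have "c 3 = c 1" "c 4 = c 1" "c 9 = c 1" "c 10 = c 1" "c 12 = c 1"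
    using RR_coeff[OF _ R, of 3 1] RR_coeff[OF _ R, of 4 1] RR_coeff[OF _ R, of 9 1] RR_coeff[OF _ R, of 10 1] RR_coeff[OF _ R, of 12 1] by auto
  moreover have "c 6 = c 2" "c 8 = c 2" "c 5 = c 2" "c 7 = c 2" "c 11 = c 2"
    using RR_coeff[OF _ R, of 3 2] RR_coeff[OF _ R, of 4 2] RR_coeff[OF _ R, of 9 2] RR_coeff[OF _ R, of 10 2] RR_coeff[OF _ R, of 12 2] by auto
  ultimately have "x = of_int (c 1) * w0 + of_int (c 2) * (om^2 + om^6 + om^8 + om^5 + om^7 + om^11)"
    by (simp add: x val_def sum_1_12[simplified] w0_def algebra_simps)
  also have "om^2 + om^6 + om^8 + om^5 + om^7 + om^11 = -1 - w0" unfolding w0_def using om_rel by algebra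
  also have "of_int (c 1) * w0 + of_int (c 2) * (-1 - w0) = of_int (c 1 - c 2) * w0 + of_int (- c 2)"
    by (simp add: algebra_simps)
  finally show ?thesis by blast
qed

lemma w0_norm: "(A + B * w0) * (A + B * (-1 - w0)) = A * A - A * B - 3 * (B * B)"
proof -
  have "(A + B * w0) * (A + B * (-1 - w0)) = A * A - A * B - B * B * (w0 + w0 * w0)" by algebra
  then show ?thesis by (simp add: w0_rel)
qed

lemma e_norm: "(A - e0) * ((A - e1) * (A - e2)) = A * A * A + A * A - 4 * A + 1"
proof -
  have "(A - e0) * ((A - e1) * (A - e2)) = A * A * A - A * A * (e0 + e1 + e2) + A * (e0 * e1 + e1 * e2 + e2 * e0) - (e0 * e1) * e2" by algebra
  also have "(e0 * e1) * e2 = -1" unfolding e_mult(1) by (simp add: left_diff_distrib e_mult(2))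
  also have "e0 * e1 + e1 * e2 + e2 * e0 = (e0 + e1 + e2) - 3" by (simp add: e_mult)
  finally show ?thesis by (simp add: e_rel(3))
qed

text \<open>The squares modulo 13 lie in the group generated by p and -1, so Frobenius-fixed
  elements belong to the quadratic subring, where p is a value of the norm form a^2 - a b - 3 b^2.
  The inverse u of b modulo p gives w0 = -u a modulo \<pi>, hence integer residues.\<close>

lemma smooth_quad:
  assumes p: "prime p" "\<not> 13 dvd p"
    and gen: "\<forall>k\<in>{3,4,9,10,12}. \<exists>i\<in>{0,1,2,3,4,5}. \<exists>j\<in>{0,1}. p ^ i * 12 ^ j mod 13 = k"
    and ab: "a * a - a * b - 3 * (b * b) = int p" "u * b = 1 + v * int p"
  shows "smooth 12 (of_nat p)"
proof -
  have n: "\<not> 13 dvd (12::nat)" by simp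
  define \<pi> where "\<pi> = of_int a + of_int b * w0"
  define \<pi>' where "\<pi>' = sg 2 \<pi>"
  have \<pi>: "\<pi> \<in> RR 12" unfolding \<pi>_def by (intro RR_add RR_mult RR_of_int w0_RR n)
  have \<pi>': "\<pi>' \<in> RR 12" unfolding \<pi>'_def by (intro RR_sg \<pi> n) simp
  have e: "\<pi>' = of_int a + of_int b * (-1 - w0)"
    unfolding \<pi>'_def \<pi>_def using RR_Zom[OF w0_RR] by (simp add: sg_2_w0)
  have "of_int a * of_int a - of_int a * of_int b - 3 * (of_int b * of_int b) = (of_nat p :: complex)"
    using arg_cong[OF ab(1), of "of_int :: int \<Rightarrow> complex"] by simp
  then have pp: "\<pi> * \<pi>' = of_nat p" unfolding e unfolding \<pi>_def w0_norm .
  have "NN \<pi> * NN \<pi>' = of_nat p ^ 12" using NN_mult[of \<pi> \<pi>'] \<pi> \<pi>' RR_Zom NN_of_int[of "int p"] by (simp add: pp)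
  then have "NN \<pi> ^ 2 = of_nat (p ^ 12)" unfolding \<pi>'_def using \<pi> RR_Zom by (simp add: NN_sg power2_eq_square)
  moreover have "p ^ 12 > 1" using prime_gt_1_nat[OF p(1)] by (intro one_less_power) auto
  ultimately have nn: "norm (NN \<pi>) > 1" using norm_NN_power_gt_1[OF RR_Zom[OF \<pi>]] by blast
  have w: "cng 12 \<pi> w0 (of_int (- u * a))"
  proof -
    have "of_int u * of_int b = 1 + of_int v * (of_nat p :: complex)"
      using arg_cong[OF ab(2), of "of_int :: int \<Rightarrow> complex"] by simp
    moreover have "w0 + U * A = (A + B * w0) * U - V * P * w0" if "U * B = 1 + V * P" for U V A B P :: complex
      using that by algebra
    ultimately have "w0 - of_int (- u * a) = \<pi> * of_int u - of_int v * (\<pi> * \<pi>') * w0"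
      unfolding pp unfolding \<pi>_def by simp
    then have "w0 - of_int (- u * a) = \<pi> * (of_int u - of_int v * \<pi>' * w0)" by (simp add: algebra_simps)
    moreover have "of_int u - of_int v * \<pi>' * w0 \<in> RR 12" by (intro RR_diff RR_mult RR_of_int \<pi>' w0_RR n)
    ultimately show ?thesis unfolding cng_def by blast
  qed
  have "good 12 \<pi>"
  proof (rule good_frob[OF n p \<pi> \<pi>' pp nn, of 12])
    fix x assume x: "x \<in> RR 12"
    show "sg (p ^ 12) x = x" using sg_pow_12 p RR_Zom x by blast
    assume "sg p x = x"
    then have "\<forall>k\<in>{3,4,9,10,12}. sg k x = x"
      using sg_gen_fixed[OF p(2) n x] gen by (metis cong_def mod_mod_trivial)
    then obtain c d where "x = of_int c * w0 + of_int d" using quad_rep RR_Zom[OF x] by blast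
    moreover have "cng 12 \<pi> (of_int c * w0 + of_int d) (of_int c * of_int (- u * a) + of_int d)"
      using w by (intro cng_add cng_mult cng_refl n RR_of_int w0_RR)
    ultimately show "\<exists>n. cng 12 \<pi> x (of_int n)" by (metis of_int_add of_int_mult)
  qed simp
  then have "smooth 12 (\<pi> * \<pi>')" unfolding \<pi>'_def by (intro smooth_mult smooth_good good_sg n) auto
  then show ?thesis by (simp add: pp)
qed

lemma e_RR [simp]: "e0 \<in> RR 12" "e1 \<in> RR 12" "e2 \<in> RR 12"
  by (simp add: RR_def e0_def e1_def e2_def om_big; algebra)+

lemma sg_e0: "sg 2 e0 = e1" "sg 4 e0 = e2"
  by (simp add: e0_def e1_def e2_def om_big; algebra)+

lemma cub_rep:
  assumes "x \<in> Zom" "\<forall>k\<in>{5,8,12}. sg k x = x"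
  shows "\<exists>a b c. x = of_int a * e0 + of_int b * e1 + of_int c * e2"
proof -
  obtain c where x: "x = val c 1" using Zom_val assms by blast
  have R: "val c 1 \<in> RR k" if "k \<in> {5,8,12}" for k using assms that by (auto simp: RR_def x)
  have "c 5 = c 1" "c 8 = c 1" "c 12 = c 1" "c 10 = c 2" "c 3 = c 2" "c 11 = c 2" "c 7 = c 4" "c 6 = c 4" "c 9 = c 4"
    using RR_coeff[OF _ R, of 5 1] RR_coeff[OF _ R, of 8 1] RR_coeff[OF _ R, of 12 1]
      RR_coeff[OF _ R, of 5 2] RR_coeff[OF _ R, of 8 2] RR_coeff[OF _ R, of 12 2]
      RR_coeff[OF _ R, of 5 4] RR_coeff[OF _ R, of 8 4] RR_coeff[OF _ R, of 12 4] by auto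
  then have "x = of_int (c 1) * e0 + of_int (c 2) * e1 + of_int (c 4) * e2"
    by (simp add: x val_def sum_1_12[simplified] e0_def e1_def e2_def algebra_simps)
  then show ?thesis by blast
qed

text \<open>The powers of 5 form the subgroup {1,5,8,12} that belongs to the cubic subring, and
  there n - e0 has norm n^3 + n^2 - 4 n + 1. Modulo this element e0 is n, and the relations between
  the periods give e1 and e2.\<close>

lemma smooth_cub:
  assumes p: "prime p" "p mod 13 = 5"
    and nn: "n * n * n + n * n - 4 * n + 1 = s * int p" "s * s = 1"
  shows "smooth 12 (of_nat p)"
proof -
  have n: "\<not> 13 dvd (12::nat)" by simp
  have p13: "\<not> 13 dvd p" using p(2) by auto
  define \<pi> where "\<pi> = of_int n - e0"
  have \<pi>: "\<pi> \<in> RR 12" unfolding \<pi>_def by (intro RR_diff RR_of_int e_RR n)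
  have e: "sg 2 \<pi> = of_int n - e1" "sg 4 \<pi> = of_int n - e2"
    unfolding \<pi>_def using RR_Zom[OF e_RR(1)] by (simp_all add: sg_e0)
  define \<pi>' where "\<pi>' = of_int s * (sg 2 \<pi> * sg 4 \<pi>)"
  have \<pi>': "\<pi>' \<in> RR 12" unfolding \<pi>'_def by (intro RR_mult RR_of_int RR_sg \<pi> n) simp_all
  have 1: "of_int n * of_int n * of_int n + of_int n * of_int n - 4 * of_int n + 1 = (of_int s * of_nat p :: complex)"
    "of_int s * of_int s = (1 :: complex)"
    using arg_cong[OF nn(1), of "of_int :: int \<Rightarrow> complex"] arg_cong[OF nn(2), of "of_int :: int \<Rightarrow> complex"] by simp_all
  have p3: "\<pi> * (sg 2 \<pi> * sg 4 \<pi>) = of_int s * of_nat p" unfolding e unfolding \<pi>_def e_norm 1 ..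
  have "\<pi> * \<pi>' = of_int s * (\<pi> * (sg 2 \<pi> * sg 4 \<pi>))" by (simp add: \<pi>'_def)
  also have "\<dots> = (of_int s * of_int s) * of_nat p" unfolding p3 by simp
  finally have pp: "\<pi> * \<pi>' = of_nat p" by (simp only: 1(2) mult_1)
  have s1: "NN (of_int s) = 1" using nn(2) by (auto simp: NN_of_int zmult_eq_1_iff)
  have "NN \<pi> * NN \<pi>' = of_nat p ^ 12" using NN_mult[of \<pi> \<pi>'] \<pi> \<pi>' RR_Zom NN_of_int[of "int p"] by (simp add: pp)
  moreover have "NN \<pi>' = NN \<pi> * NN \<pi>" unfolding \<pi>'_def using \<pi> RR_Zom by (simp add: NN_mult s1 NN_sg)
  ultimately have "NN \<pi> ^ 3 = of_nat (p ^ 12)" by (simp add: power3_eq_cube mult.assoc)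
  moreover have "p ^ 12 > 1" using prime_gt_1_nat[OF p(1)] by (intro one_less_power) auto
  ultimately have nm: "norm (NN \<pi>) > 1" using norm_NN_power_gt_1[OF RR_Zom[OF \<pi>]] by blast
  have c0: "cng 12 \<pi> e0 (of_int n)" unfolding cng_def \<pi>_def by (intro bexI[of _ "-1"]) (auto intro!: RR_uminus RR_1)
  have c1: "cng 12 \<pi> e1 (of_int (2 - 2 * n - n * n))"
  proof -
    have "cng 12 \<pi> (2 - 2 * e0 - e0 * e0) (2 - 2 * of_int n - of_int n * of_int n)"
      using c0 by (intro cng_diff cng_mult cng_refl n RR_of_int RR_numeral e_RR)
    then show ?thesis by (simp flip: e_rel(1))
  qed
  have c2: "cng 12 \<pi> e2 (of_int (- 1 - n - (2 - 2 * n - n * n)))"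
  proof -
    have "cng 12 \<pi> (- 1 - e0 - e1) (- 1 - of_int n - of_int (2 - 2 * n - n * n))"
      using c0 c1 by (intro cng_diff cng_refl n)
    moreover have "e2 = - 1 - e0 - e1" using e_rel(3) by algebra
    ultimately show ?thesis by simp
  qed
  have fx: "\<forall>k\<in>{5,8,12}. \<exists>i\<in>{0,1,2,3::nat}. p ^ i mod 13 = k"
  proof -
    have "p ^ i mod 13 = 5 ^ i mod 13" for i :: nat by (metis p(2) power_mod)
    then show ?thesis by simp
  qed
  have "good 12 \<pi>"
  proof (rule good_frob[OF n p(1) p13 \<pi> \<pi>' pp nm, of 12])
    fix x assume x: "x \<in> RR 12"
    show "sg (p ^ 12) x = x" using sg_pow_12 p13 RR_Zom x by blast
    assume "sg p x = x"
    then have "\<forall>k\<in>{5,8,12}. sg k x = x"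
      using sg_gen_fixed[OF p13 n x, of _ 0] fx by (metis cong_def mod_mod_trivial mult.right_neutral power_0)
    then obtain a b c where "x = of_int a * e0 + of_int b * e1 + of_int c * e2" using cub_rep RR_Zom[OF x] by blast
    moreover have "cng 12 \<pi> (of_int a * e0 + of_int b * e1 + of_int c * e2) (of_int a * of_int n + of_int b * of_int (2 - 2 * n - n * n) + of_int c * of_int (- 1 - n - (2 - 2 * n - n * n)))"
      using c0 c1 c2 by (intro cng_add cng_mult cng_refl n RR_of_int e_RR)
    ultimately show "\<exists>n. cng 12 \<pi> x (of_int n)" by (metis of_int_add of_int_mult)
  qed simp
  moreover have su: "smooth 12 (of_int s)" using 1(2) by (intro smooth.unit[of _ _ "of_int s"] RR_of_int n)
  ultimately have "smooth 12 (of_int s * (\<pi> * (sg 2 \<pi> * sg 4 \<pi>)))"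
    by (intro smooth_mult su smooth_good[of 12 \<pi>] smooth_good[OF _ good_sg] n) auto
  then show ?thesis unfolding p3 using 1(2) by (simp flip: mult.assoc)
qed

lemma smooth_inert:
  assumes "\<not> 13 dvd g" "prime p" "\<not> 13 dvd p"
    and "\<forall>k\<in>{1..12}. \<exists>i\<in>{0,1,2,3,4,5,6,7,8,9,10,11}. \<exists>j\<in>{0,1,2}. p ^ i * g ^ j mod 13 = k"
  shows "smooth g (of_nat p)"
  using good_inert[OF assms] smooth_good assms(1) by blast

lemma primes_less_37:
  assumes "prime p" "p < (37::nat)"
  shows "p \<in> {2,3,5,7,11,13,17,19,23,29,31}"
proof -
  have "\<forall>q\<in>{..<37::nat}. q \<in> {2,3,5,7,11,13,17,19,23,29,31} \<or> q < 2 \<or> 2 dvd q \<and> q > 2 \<or> 3 dvd q \<and> q > 3 \<or> 5 dvd q \<and> q > 5"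
    by code_simp
  then show ?thesis using assms by (metis lessThan_iff prime_nat_iff less_irrefl one_less_numeral_iff prime_ge_2_nat not_less numeral_eq_one_iff semiring_norm(85) semiring_norm(86))
qed

lemma bezout_12: "bezout_ring 12"
proof (rule bezout_RR[of 12 37])
  have n: "\<not> 13 dvd (12::nat)" by simp
  show n: "\<not> 13 dvd (12::nat)" by simp
  fix k :: nat assume "k \<in> {1..<37}"
  moreover have "smooth 12 (of_nat p)" if "prime p" "p < 37" for p
  proof -
    \<comment> \<open>The class modulo 13 decides: 2, 7, 11 and 19 are primitive roots, hence inert;
      each of 3, 17, 23, 29 generates the squares together with -1; 5 and 31 have order 4; 13 is
      ramified.\<close>
    have "smooth 12 (of_nat 2)" by (rule smooth_inert, unfold set_1_12) simp_all
    moreover have "smooth 12 (of_nat 7)" by (rule smooth_inert, unfold set_1_12) simp_all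
    moreover have "smooth 12 (of_nat 11)" by (rule smooth_inert, unfold set_1_12) simp_all
    moreover have "smooth 12 (of_nat 19)" by (rule smooth_inert, unfold set_1_12) simp_all
    moreover have "smooth 12 (of_nat 3)" by (rule smooth_quad[of 3 5 2 2 1]) simp_all
    moreover have "smooth 12 (of_nat 17)" by (rule smooth_quad[of 17 5 1 1 0]) simp_all
    moreover have "smooth 12 (of_nat 23)" by (rule smooth_quad[of 23 7 2 12 1]) simp_all
    moreover have "smooth 12 (of_nat 29)" by (rule smooth_quad[of 29 11 4 22 3]) simp_all
    moreover have "smooth 12 (of_nat 5)" by (rule smooth_cub[of 5 2 1]) simp_all
    moreover have "smooth 12 (of_nat 31)" by (rule smooth_cub[of 31 "-4" "-1"]) simp_all
    moreover note smooth_13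
    ultimately show ?thesis using primes_less_37[OF \<open>prime p\<close> \<open>p < 37\<close>] by (auto simp del: of_nat_numeral)
  qed
  ultimately show "smooth 12 (of_nat k)" using smooth_nat[OF n, of 37 k] by blast
qed (use approx_12 in auto)

section \<open>The quartic subring\<close>

lemma h_RR: "h0 \<in> RR 3" "h1 \<in> RR 3" "h2 \<in> RR 3" "h3 \<in> RR 3"
  by (simp add: RR_def h0_def h1_def h2_def h3_def om_big; algebra)+

lemma sg_h0: "sg 2 h0 = h1" "sg 4 h0 = h2" "sg 8 h0 = h3"
  by (simp add: h0_def h1_def h2_def h3_def om_big; algebra)+

lemma RR_3_rep:
  assumes "x \<in> RR 3"
  shows "\<exists>a b c d. x = of_int a * h0 + of_int b * h1 + of_int c * h2 + of_int d * h3"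
proof -
  obtain c where x: "x = val c 1" using Zom_val RR_Zom assms by blast
  have R: "val c 1 \<in> RR 3" using assms x by simp
  have "c 3 = c 1" "c 9 = c 3" "c 6 = c 2" "c 5 = c 6" "c 12 = c 4" "c 10 = c 12" "c 8 = c 7" "c 11 = c 8"
    using RR_coeff[OF _ R, of 1] RR_coeff[OF _ R, of 3] RR_coeff[OF _ R, of 2] RR_coeff[OF _ R, of 6]
      RR_coeff[OF _ R, of 4] RR_coeff[OF _ R, of 12] RR_coeff[OF _ R, of 11] RR_coeff[OF _ R, of 7] by auto
  then have "x = of_int (c 1) * h0 + of_int (c 2) * h1 + of_int (c 4) * h2 + of_int (c 7) * h3"
    by (simp add: x val_def sum_1_12[simplified] h0_def h1_def h2_def h3_def algebra_simps)
  then show ?thesis by blast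
qed

lemma h_prod: "h0 * (h2 * (h1 * h3)) = 3"
proof -
  have w: "h0 + h2 = w0" unfolding h0_def h2_def w0_def by algebra
  have 1: "3 + h1 + h3 = 2 - w0" unfolding w[symmetric] using h_rel(4) by algebra
  have 2: "3 + h0 + h2 = 3 + w0" unfolding w[symmetric] by simp
  have "h0 * (h2 * (h1 * h3)) = (h0 * h2) * (h1 * h3)" by simp
  also have "\<dots> = (2 - w0) * (3 + w0)" by (simp only: h_rel(3,5) 1 2)
  also have "\<dots> = 3" using w0_rel by algebra
  finally show ?thesis .
qed

text \<open>As \<open>sg 3\<close> is trivial on \<open>RR 3\<close>, the prime 3 splits completely;
  modulo h0 the periods h0, h1, h2, h3 have the residues 0, -1, -1, 1.\<close>

lemma good_h0: "good 3 h0"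
proof -
  have n: "\<not> 13 dvd (3::nat)" by simp
  have pp: "h0 * (h2 * (h1 * h3)) = of_nat 3" using h_prod by simp
  have Z: "h0 \<in> Zom" using RR_Zom h_RR by blast
  have "NN h2 = NN h0" "NN h1 = NN h0" "NN h3 = NN h0" unfolding sg_h0[symmetric] using Z by (simp_all add: NN_sg)
  moreover have "NN (h0 * (h2 * (h1 * h3))) = NN h0 * (NN h2 * (NN h1 * NN h3))"
    using h_RR RR_Zom by (metis NN_mult Zom_mult)
  ultimately have "NN h0 ^ 4 = of_nat (3 ^ 12)" using NN_of_int[of 3] by (simp add: h_prod power4_eq_xxxx mult.assoc)
  then have nn: "norm (NN h0) > 1" by (rule norm_NN_power_gt_1[OF Z]) simp
  show ?thesis
  proof (rule good_frob[OF n _ _ h_RR(1) _ pp nn, of 1])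
    show "h2 * (h1 * h3) \<in> RR 3" by (intro RR_mult h_RR n)
    fix x assume x: "x \<in> RR 3"
    then show "sg (3 ^ 1) x = x" by (simp add: RR_def)
    obtain a b c d where xr: "x = of_int a * h0 + of_int b * h1 + of_int c * h2 + of_int d * h3" using RR_3_rep[OF x] by blast
    have c0: "cng 3 h0 h0 0" unfolding cng_def by (intro bexI[of _ 1]) (auto intro!: RR_1)
    have c1: "cng 3 h0 h1 (-1)" unfolding cng_def
      using h_rel(1) h_RR by (intro bexI[of _ "- h3"]) (auto intro!: RR_uminus)
    have c2: "cng 3 h0 h2 (-1)" unfolding cng_def
      using h_rel(2) h_RR by (intro bexI[of _ "- h1"]) (auto intro!: RR_uminus)
    have "h3 - 1 = h0 * (h3 + h1 - 1)" using h_rel(1,2,4) by algebra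
    then have c3: "cng 3 h0 h3 1" unfolding cng_def
      using h_RR by (intro bexI[of _ "h3 + h1 - 1"]) (auto intro!: RR_diff RR_add RR_1)
    have "cng 3 h0 x (of_int a * 0 + of_int b * (-1) + of_int c * (-1) + of_int d * 1)"
      unfolding xr using c0 c1 c2 c3 by (intro cng_add cng_mult cng_refl n RR_of_int h_RR)
    then show "\<exists>n. cng 3 h0 x (of_int n)" by (intro exI[of _ "- b - c + d"]) simp
  qed auto
qed

lemma bezout_3: "bezout_ring 3"
proof (rule bezout_RR[of 3 11])
  show n: "\<not> 13 dvd (3::nat)" by simp
  fix k :: nat assume "k \<in> {1..<11}"
  moreover have "smooth 3 (of_nat p)" if "prime p" "p < 11" for p
  proof -
    have "smooth 3 (of_nat 2)" by (rule smooth_inert, unfold set_1_12) simp_all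
    moreover have "smooth 3 (of_nat 7)" by (rule smooth_inert, unfold set_1_12) simp_all
    moreover have "smooth 3 (of_nat 5)" by (rule smooth_inert, unfold set_1_12) simp_all
    moreover have "smooth 3 (h0 * (h2 * (h1 * h3)))" unfolding sg_h0[symmetric]
      by (intro smooth_mult smooth_good good_sg good_h0) auto
    then have "smooth 3 (of_nat 3)" by (simp add: h_prod)
    ultimately show ?thesis using primes_less_37[OF \<open>prime p\<close>] \<open>p < 11\<close> by (auto simp del: of_nat_numeral)
  qed
  ultimately show "smooth 3 (of_nat k)" using smooth_nat[OF n, of 11 k] by blast
qed (use approx_3 in auto)

section \<open>Seventh powers up to units\<close>

text \<open>Let d be a greatest common divisor of q and v. Then q divides d^7, because d = t v
  modulo q and v^7 is a multiple of q. Conversely q = p q^2 + r v^7 can be bootstrapped: d | q gives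
  d^2 | q, then d^4 | q, then d^7 | q. So q and d^7 differ by a unit.\<close>

lemma seventh_power:
  assumes g: "\<not> 13 dvd g" "bezout_ring g"
    and R: "q \<in> RR g" "H \<in> RR g" "v \<in> RR g" "p \<in> RR g" "r \<in> RR g"
    and qH: "q * H = v ^ 7" and co: "p * q + r * H = 1" and "v \<noteq> 0"
  shows "\<exists>\<epsilon>\<in>RR g. \<exists>\<epsilon>'\<in>RR g. \<exists>\<alpha>\<in>RR g. q = \<epsilon> * \<alpha> ^ 7 \<and> \<epsilon> * \<epsilon>' = 1"
proof -
  have q0: "q \<noteq> 0" using qH \<open>v \<noteq> 0\<close> by auto
  have "\<exists>d\<in>RR g. (\<exists>s\<in>RR g. \<exists>t\<in>RR g. d = s * q + t * v) \<and> (\<exists>q'\<in>RR g. q = q' * d) \<and> (\<exists>v'\<in>RR g. v = v' * d)"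
    using g(2) R unfolding bezout_ring_def by blast
  then obtain d s t q' v' where d: "d \<in> RR g" "s \<in> RR g" "t \<in> RR g" "d = s * q + t * v"
    "q' \<in> RR g" "q = q' * d" "v' \<in> RR g" "v = v' * d" by blast
  have "cng g q d (t * v)" unfolding cng_def using d(2,4) by (intro bexI[of _ s]) (auto simp: mult.commute)
  then have "cng g q (d ^ 7) ((t * v) ^ 7)" using d R g by (intro cng_power RR_mult)
  then obtain z where z: "z \<in> RR g" "d ^ 7 - (t * v) ^ 7 = q * z" unfolding cng_def by blast
  define A where "A = z + t ^ 7 * H"
  have "A \<in> RR g" unfolding A_def by (intro RR_add RR_mult RR_power z(1) d(3) R(2) g(1))
  moreover have "d ^ 7 = q * A"
  proof -
    have "d ^ 7 = (t * v) ^ 7 + q * z" using z(2) by (simp add: diff_eq_eq add.commute)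
    also have "(t * v) ^ 7 = t ^ 7 * (q * H)" by (simp only: power_mult_distrib qH)
    finally show ?thesis unfolding A_def by algebra
  qed
  ultimately have A: "A \<in> RR g" "d ^ 7 = q * A" by auto
  have qq: "q = p * (q * q) + r * v ^ 7"
  proof -
    have "q = (p * q + r * H) * q" by (simp add: co)
    also have "\<dots> = p * (q * q) + r * (q * H)" by algebra
    finally show ?thesis by (simp only: qH)
  qed
  define q2 where "q2 = p * (q' * q') + r * d ^ 5 * v' ^ 7"
  have "q = p * ((q' * d) * (q' * d)) + r * (v' * d) ^ 7"
    using qq by (simp only: d(6)[symmetric] d(8)[symmetric])
  also have "\<dots> = d ^ 2 * q2" unfolding q2_def by algebra
  finally have e2: "q = d ^ 2 * q2" .
  have "q = p * ((d ^ 2 * q2) * (d ^ 2 * q2)) + r * (v' * d) ^ 7"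
    using qq by (simp only: e2[symmetric] d(8)[symmetric])
  also have "\<dots> = d ^ 4 * (p * (q2 * q2) + r * d ^ 3 * v' ^ 7)" by algebra
  finally have q4: "q = d ^ 4 * (p * (q2 * q2) + r * d ^ 3 * v' ^ 7)" .
  define q4 where "q4 = p * (q2 * q2) + r * d ^ 3 * v' ^ 7"
  have "q = p * ((d ^ 4 * q4) * (d ^ 4 * q4)) + r * (v' * d) ^ 7"
    using qq by (simp only: q4[folded q4_def, symmetric] d(8)[symmetric])
  also have "\<dots> = d ^ 7 * (p * d * (q4 * q4) + r * v' ^ 7)" by algebra
  finally have qB: "q = d ^ 7 * (p * d * (q4 * q4) + r * v' ^ 7)" .
  define B where "B = p * d * (q4 * q4) + r * v' ^ 7"
  have B: "B \<in> RR g" unfolding B_def q4_def q2_def using R d g by (intro RR_add RR_mult RR_power)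
  have "q * (B * A) = q" using qB A(2) by (simp add: B_def mult_ac)
  then have "B * A = 1" using q0 by simp
  moreover have "q = B * d ^ 7" using qB by (simp add: B_def mult.commute)
  ultimately show ?thesis using A(1) B d(1) by blast
qed

section \<open>Comaximality of the conjugate factors\<close>

text \<open>The element m lies in the ideal of x and y. Values other than 1 are allowed because
  conjugate factors of Phi may share the prime above 13; m is replaced by 1 only when the product is
  known to be a seventh power prime to m.\<close>

definition comax :: "nat \<Rightarrow> complex \<Rightarrow> complex \<Rightarrow> complex \<Rightarrow> bool"
  where "comax g m x y \<longleftrightarrow> (\<exists>p\<in>RR g. \<exists>r\<in>RR g. m = p * x + r * y)"

lemma comax_mult:
  assumes "\<not> 13 dvd g" "comax g m x y" "comax g n x z" "x \<in> RR g" "y \<in> RR g" "z \<in> RR g"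
  shows "comax g (m * n) x (y * z)"
proof -
  obtain p r where 1: "p \<in> RR g" "r \<in> RR g" "m = p * x + r * y" using assms by (auto simp: comax_def)
  obtain p' r' where 2: "p' \<in> RR g" "r' \<in> RR g" "n = p' * x + r' * z" using assms by (auto simp: comax_def)
  have "m * n = (p * n + r * y * p') * x + (r * r') * (y * z)"
    unfolding 1(3) 2(3) by algebra
  moreover have "n \<in> RR g" unfolding 2(3) using assms 2 by (intro RR_add RR_mult)
  ultimately show ?thesis unfolding comax_def using assms 1 2
    by (intro bexI[of _ "p * n + r * y * p'"] bexI[of _ "r * r'"]) (auto intro!: RR_add RR_mult)
qed

lemma comax_sym: "comax g m x y \<Longrightarrow> comax g m y x"
  unfolding comax_def by (metis add.commute)

lemma comax_prod:
  assumes g: "\<not> 13 dvd g" and "finite J" "x \<in> RR g" "\<And>j. j \<in> J \<Longrightarrow> y j \<in> RR g" "\<And>j. j \<in> J \<Longrightarrow> comax g m x (y j)"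
  shows "comax g (m ^ card J) x (prod y J)"
  using assms(2,4,5)
proof (induction J rule: finite_induct)
  case empty
  show ?case unfolding comax_def by (rule bexI[of _ 0], rule bexI[of _ 1]) (simp_all add: RR_0 RR_1 g)
next
  case (insert j J)
  then have "comax g (m * m ^ card J) x (y j * prod y J)"
    using g assms(3) by (intro comax_mult RR_prod) auto
  then show ?case using insert by simp
qed

lemma Zom_RR_1: "RR 1 = Zom" by (auto simp: RR_def)

definition xx :: "int \<Rightarrow> int \<Rightarrow> nat \<Rightarrow> complex" where "xx a b j = of_int a + om ^ j * of_int b"

lemma xx_Zom [simp]: "xx a b j \<in> Zom" unfolding xx_def by auto

lemma sg_xx: "\<not> 13 dvd k \<Longrightarrow> sg k (xx a b j) = xx a b (k * j)"
  by (simp add: xx_def power_mult)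

lemma xx_cong: "[j = k] (mod 13) \<Longrightarrow> xx a b j = xx a b k"
  unfolding xx_def using om_pow_cong by simp

lemma val_delta:
  assumes "j \<in> {1..12}" shows "val (\<lambda>l. if l = j then 1 else 0) 1 = om ^ j"
proof -
  have "val (\<lambda>l. if l = j then 1 else 0) 1 = (\<Sum>l=1..12. if l = j then om ^ j else 0)"
    unfolding val_def by (intro sum.cong) auto
  then show ?thesis using assms by simp
qed

text \<open>Eliminating a or b from the two linear factors leaves a multiple of om^i - om^j, so the
  Bezout relation for a and b puts om^i - om^j into the ideal; and this element divides 13.\<close>

lemma comax_xx:
  assumes "coprime a b" "i \<in> {1..12}" "j \<in> {1..12}" "i \<noteq> j"
  shows "comax 1 13 (xx a b i) (xx a b j)"
proof -
  obtain u w where uw: "u * a + w * b = 1" using assms(1) by (metis bezout_int coprime_iff_gcd_eq_1)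
  \<comment> \<open>k stands for j - i modulo 13, with 12 in the role of -1.\<close>
  define k where "k = (j + 12 * i)"
  have "\<not> 13 dvd k"
  proof
    assume "13 dvd k"
    have "om ^ k = 1" using \<open>13 dvd k\<close> om_pow_eq_1_iff by blast
    then have "om ^ (i + k) = om ^ i" by (simp add: power_add)
    moreover have "i + k = j + 13 * i" by (simp add: k_def)
    ultimately have "om ^ j = om ^ i" using om_pow_add_13[of j i] by simp
    then have "val (\<lambda>l. if l = j then 1 else 0) 1 = val (\<lambda>l. if l = i then 1 else 0) 1"
      by (simp only: val_delta assms)
    from val_inj[OF this, of j] show False using assms by simp
  qed
  obtain y0 where y0: "y0 \<in> Zom" "13 = (1 - om) * y0" using lam_dvd_13 by blast
  define y where "y = sg k y0"
  have y: "y \<in> Zom" "13 = (1 - om ^ k) * y"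
    using arg_cong[OF y0(2), of "sg k"] y0(1) \<open>\<not> 13 dvd k\<close> by (simp_all add: y_def)
  have k: "om ^ i * om ^ k = om ^ j" using om_pow_add_13[of j i] by (simp add: k_def power_add[symmetric] add_ac)
  have one: "of_int u * of_int a + of_int w * of_int b = (1 :: complex)"
    using arg_cong[OF uw, of "of_int :: int \<Rightarrow> complex"] by simp
  have e: "om ^ i - om ^ j = (of_int w - of_int u * om ^ j) * xx a b i + (of_int u * om ^ i - of_int w) * xx a b j"
  proof -
    have "(W - U * J) * (A + I * B) + (U * I - W) * (A + J * B) = (U * A + W * B) * (I - J)" for W U J A B I :: complex
      by algebra
    then show ?thesis unfolding xx_def by (simp only: one mult_1)
  qed
  have i13: "om ^ i * om ^ (12 * i) = 1" using om_pow_eq_1_iff[of "13 * i"] by (simp add: power_add[symmetric])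
  have "13 = om ^ (12 * i) * y * (om ^ i - om ^ j)"
  proof -
    have "om ^ (12 * i) * y * (om ^ i - om ^ j) = (om ^ i * om ^ (12 * i)) * ((1 - om ^ k) * y)"
      unfolding k[symmetric] by algebra
    then show ?thesis by (simp only: i13 y(2)[symmetric]) simp
  qed
  then have "13 = (om ^ (12 * i) * y * (of_int w - of_int u * om ^ j)) * xx a b i + (om ^ (12 * i) * y * (of_int u * om ^ i - of_int w)) * xx a b j"
    unfolding e by (simp add: algebra_simps)
  then show ?thesis unfolding comax_def Zom_RR_1 using y(1)
    by (intro bexI[of _ "om ^ (12 * i) * y * (of_int w - of_int u * om ^ j)"] bexI[of _ "om ^ (12 * i) * y * (of_int u * om ^ i - of_int w)"]) auto
qed

lemma comax_xx_prod:
  assumes "coprime a b" "I \<subseteq> {1..12}" "J \<subseteq> {1..12}" "I \<inter> J = {}"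
  shows "\<exists>N. comax 1 (13 ^ N) (prod (xx a b) I) (prod (xx a b) J)"
proof -
  have fin: "finite I" "finite J" using assms finite_subset by blast+
  have n: "\<not> 13 dvd (1::nat)" by simp
  have xr: "xx a b i \<in> RR 1" "prod (xx a b) I \<in> RR 1" "prod (xx a b) J \<in> RR 1" for i I J
    unfolding Zom_RR_1 by (auto intro!: Zom_prod)
  have step: "comax 1 (13 ^ card J) (prod (xx a b) J) (xx a b i)" if "i \<in> I" for i
    by (rule comax_sym, rule comax_prod[OF n fin(2) xr(1)], rule xr, rule comax_xx) (use that assms in auto)
  have "comax 1 ((13 ^ card J) ^ card I) (prod (xx a b) J) (prod (xx a b) I)"
    by (rule comax_prod[OF n fin(1) xr(3)], rule xr, rule step)
  then show ?thesis unfolding power_mult[symmetric] using comax_sym by blast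
qed

section \<open>The form Phi and the factorisation of the equation\<close>

definition Phi :: "int \<Rightarrow> int \<Rightarrow> int" where
  "Phi a b = a^12 - a^11*b + a^10*b^2 - a^9*b^3 + a^8*b^4 - a^7*b^5 + a^6*b^6 - a^5*b^7 + a^4*b^8 - a^3*b^9 + a^2*b^10 - a*b^11 + b^12"

lemma Phi_factor: "a ^ 13 + b ^ 13 = (a + b) * Phi a b"
  unfolding Phi_def by algebra

definition Q :: "int \<Rightarrow> int \<Rightarrow> nat \<Rightarrow> complex" where
  "Q a b k = of_int (a ^ 2 + b ^ 2) + tt k * of_int (a * b)"

lemma Q_xx: "Q a b k = xx a b k * xx a b (12 * k)"
proof -
  have "om ^ k * om ^ (12 * k) = 1" using om_pow_eq_1_iff[of "13 * k"] by (simp add: power_add[symmetric])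
  moreover have "(A + x * B) * (A + y * B) = A ^ 2 + B ^ 2 + (x + y) * (A * B)" if "x * y = 1" for A B x y :: complex
    using that by algebra
  ultimately show ?thesis by (simp add: Q_def xx_def tt_def)
qed

lemma Q_prod: "Q a b 1 * Q a b 2 * Q a b 3 * Q a b 4 * Q a b 5 * Q a b 6 = of_int (Phi a b)"
proof -
  have t: "tt 1 = om + om^12" "tt 2 = om^2 + om^11" "tt 3 = om^3 + om^10" "tt 4 = om^4 + om^9" "tt 5 = om^5 + om^8" "tt 6 = om^6 + om^7"
    by (simp_all add: tt_def om_red)
  \<comment> \<open>As for the norm of \<open>mu\<close>, the pairs {1,5}, {2,3}, {4,6} are
    multiplied first, which moves the computation into the cubic subring. Later P = a^2 + b^2 and R
    = a b.\<close>
  have 1: "(P + tt 1 * R) * (P + tt 5 * R) = P ^ 2 + e0 * (P * R) + e2 * R ^ 2" for P R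
    unfolding t e0_def e2_def using om_rel by algebra
  have 2: "(P + tt 2 * R) * (P + tt 3 * R) = P ^ 2 + e1 * (P * R) + e0 * R ^ 2" for P R
    unfolding t e0_def e1_def using om_rel by algebra
  have 3: "(P + tt 4 * R) * (P + tt 6 * R) = P ^ 2 + e2 * (P * R) + e1 * R ^ 2" for P R
    unfolding t e2_def e1_def using om_rel by algebra
  have sq: "e0 * e0 = 2 - 2 * e0 - e1" "e2 * e2 = 2 - 2 * e2 - e0"
  proof -
    show "e0 * e0 = 2 - 2 * e0 - e1" using e_rel(1) by algebra
    have "e2 * e2 = (-1 - e0 - e1) * e2" using e_rel(3) by algebra
    also have "\<dots> = - e2 - (e2 * e0) - (e1 * e2)" by algebra
    also have "\<dots> = 2 - 2 * e2 - e0" unfolding e_mult by algebra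
    finally show "e2 * e2 = 2 - 2 * e2 - e0" .
  qed
  have e1: "e1 = -1 - e0 - e2" using e_rel(3) by algebra
  have 4: "(P ^ 2 + e0 * (P * R) + e2 * R ^ 2) * (P ^ 2 + e1 * (P * R) + e0 * R ^ 2) =
     P^4 + (-1 - e2) * (P^3 * R) - 2 * (P^2 * R^2) + (2 - e0 + 2 * e2) * (P * R^3) + (e0 - 1) * R^4" for P R
  proof -
    have "(P ^ 2 + e0 * (P * R) + e2 * R ^ 2) * (P ^ 2 + e1 * (P * R) + e0 * R ^ 2) =
      P^4 + (e0 + e1) * (P^3 * R) + (e2 + e0 + e0 * e1) * (P^2 * R^2) + (e0 * e0 + e1 * e2) * (P * R^3) + (e2 * e0) * R^4" by algebra
    also have "\<dots> = P^4 + (e0 + e1) * (P^3 * R) + (e2 + e0 + (e1 - 1)) * (P^2 * R^2) + ((2 - 2 * e0 - e1) + (e2 - 1)) * (P * R^3) + (e0 - 1) * R^4"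
      by (simp only: e_mult sq)
    also have "\<dots> = P^4 + (-1 - e2) * (P^3 * R) - 2 * (P^2 * R^2) + (2 - e0 + 2 * e2) * (P * R^3) + (e0 - 1) * R^4"
      unfolding e1 by algebra
    finally show ?thesis .
  qed
  have 5: "(P^4 + (-1 - e2) * (P^3 * R) - 2 * (P^2 * R^2) + (2 - e0 + 2 * e2) * (P * R^3) + (e0 - 1) * R^4) * (P ^ 2 + e2 * (P * R) + e1 * R ^ 2)
    = P^6 - P^5*R - 5*(P^4*R^2) + 4*(P^3*R^3) + 6*(P^2*R^4) - 3*(P*R^5) - R^6" (is "?l = ?r") for P R
  proof -
    have "?l = P^6 - P^5*R + (e1 - e2 - e2 * e2 - 2) * (P^4*R^2) + (- e1 - e1 * e2 - 2 * e2 + 2 - e0 + 2 * e2) * (P^3*R^3)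
       + (- 2 * e1 + 2 * e2 - e2 * e0 + 2 * (e2 * e2) + e0 - 1) * (P^2*R^4)
       + (2 * e1 - e0 * e1 + 2 * (e1 * e2) + e2 * e0 - e2) * (P*R^5) + (e0 * e1 - e1) * R^6" by algebra
    also have "\<dots> = P^6 - P^5*R + (e1 - e2 - (2 - 2 * e2 - e0) - 2) * (P^4*R^2) + (- e1 - (e2 - 1) - 2 * e2 + 2 - e0 + 2 * e2) * (P^3*R^3)
       + (- 2 * e1 + 2 * e2 - (e0 - 1) + 2 * (2 - 2 * e2 - e0) + e0 - 1) * (P^2*R^4)
       + (2 * e1 - (e1 - 1) + 2 * (e2 - 1) + (e0 - 1) - e2) * (P*R^5) + ((e1 - 1) - e1) * R^6"
      by (simp only: e_mult sq)
    also have "\<dots> = ?r" unfolding e1 by algebra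
    finally show ?thesis .
  qed
  have "(P + tt 1 * R) * (P + tt 2 * R) * (P + tt 3 * R) * (P + tt 4 * R) * (P + tt 5 * R) * (P + tt 6 * R)
    = P^6 - P^5*R - 5*(P^4*R^2) + 4*(P^3*R^3) + 6*(P^2*R^4) - 3*(P*R^5) - R^6" (is "?L = ?R") for P R
  proof -
    have "?L = ((P + tt 1 * R) * (P + tt 5 * R)) * ((P + tt 2 * R) * (P + tt 3 * R)) * ((P + tt 4 * R) * (P + tt 6 * R))" by algebra
    then show ?thesis unfolding 1 2 3 4 5 .
  qed
  from this[of "of_int (a ^ 2 + b ^ 2)" "of_int (a * b)"]
  have "Q a b 1 * Q a b 2 * Q a b 3 * Q a b 4 * Q a b 5 * Q a b 6 =
    of_int ((a^2+b^2)^6 - (a^2+b^2)^5*(a*b) - 5*((a^2+b^2)^4*(a*b)^2) + 4*((a^2+b^2)^3*(a*b)^3) + 6*((a^2+b^2)^2*(a*b)^4) - 3*((a^2+b^2)*(a*b)^5) - (a*b)^6)"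
    unfolding Q_def by (simp only: of_int_diff of_int_add of_int_mult of_int_power of_int_numeral)
  also have "(a^2+b^2)^6 - (a^2+b^2)^5*(a*b) - 5*((a^2+b^2)^4*(a*b)^2) + 4*((a^2+b^2)^3*(a*b)^3) + 6*((a^2+b^2)^2*(a*b)^4) - 3*((a^2+b^2)*(a*b)^5) - (a*b)^6 = Phi a b"
    unfolding Phi_def by algebra
  finally show ?thesis .
qed

lemma Phi_cong: "[a = a'] (mod m) \<Longrightarrow> [b = b'] (mod m) \<Longrightarrow> [Phi a b = Phi a' b'] (mod m)"
  unfolding Phi_def by (intro cong_add cong_diff cong_mult cong_pow cong_refl)

lemma Phi_mod_sum: "Phi a b = 13 * a ^ 12 + (a + b) * (-12*a^11 + 11*a^10*b - 10*a^9*b^2 + 9*a^8*b^3 - 8*a^7*b^4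
   + 7*a^6*b^5 - 6*a^5*b^6 + 5*a^4*b^7 - 4*a^3*b^8 + 3*a^2*b^9 - 2*a*b^10 + b^11)"
  unfolding Phi_def by algebra

text \<open>Expansion to second order at a = -b. If 13 | a + b, the linear coefficient 78 = 6 * 13
  makes Phi congruent to 13 a^12 modulo 169, so 13 divides Phi exactly once when a is prime to
  13.\<close>

lemma Phi_mod_sum_2: "Phi a b = 13 * a ^ 12 - 78 * a ^ 11 * (a + b) + (a + b)^2 * ((66)*a^10*b^0 + (-55)*a^9*b^1 + (45)*a^8*b^2 + (-36)*a^7*b^3 + (28)*a^6*b^4 + (-21)*a^5*b^5 + (15)*a^4*b^6 + (-10)*a^3*b^7 + (6)*a^2*b^8 + (-3)*a^1*b^9 + (1)*a^0*b^10)"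
  unfolding Phi_def by algebra

lemma not_coprime_prime:
  fixes x y :: int assumes "\<not> coprime x y"
  shows "\<exists>p. prime p \<and> p dvd x \<and> p dvd y"
proof (cases "x = 0 \<and> y = 0")
  case True
  then show ?thesis by (intro exI[of _ 2]) simp
next
  case False
  then have "gcd x y \<noteq> 0" by simp
  moreover have "\<not> is_unit (gcd x y)" using assms by (simp add: coprime_iff_gcd_eq_1)
  ultimately obtain p where "p dvd gcd x y" "prime p" using prime_divisor_exists by blast
  then show ?thesis by auto
qed

lemma dvd_mult_power_7: "x dvd v \<Longrightarrow> x dvd l * v ^ 7" for x v l :: int
  by (intro dvd_mult dvd_trans[of x v "v ^ 7"] dvd_power) auto

lemma cong_Phi_sum: "m dvd a + b \<Longrightarrow> [Phi a b = 13 * a ^ 12] (mod m)"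
  unfolding Phi_mod_sum cong_iff_dvd_diff by simp

lemma seventh_power_int:
  assumes "coprime x y" "x * y = z ^ 7" "z \<noteq> 0"
  shows "\<exists>w :: int. x = w ^ 7"
proof -
  have "x \<noteq> 0" "y \<noteq> 0" using assms(2,3) by auto
  have "coprime (nat \<bar>x\<bar>) (nat \<bar>y\<bar>)" using assms(1) by (simp add: coprime_int_iff[symmetric])
  moreover have "nat \<bar>x\<bar> * nat \<bar>y\<bar> = nat \<bar>z\<bar> ^ 7"
    using arg_cong[OF assms(2), of "\<lambda>t. nat \<bar>t\<bar>"] by (simp add: abs_mult nat_mult_distrib power_abs nat_power_eq)
  ultimately obtain w where w: "nat \<bar>x\<bar> = w ^ 7"
    using is_nth_power_mult_coprime_natD(1)[of "nat \<bar>x\<bar>" "nat \<bar>y\<bar>" 7] \<open>x \<noteq> 0\<close> \<open>y \<noteq> 0\<close>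
    by (auto simp: is_nth_power_def)
  then have "\<bar>x\<bar> = int w ^ 7" by (metis int_nat_eq abs_ge_zero of_nat_power)
  then have "x = int w ^ 7 \<or> x = (- int w) ^ 7" by (auto simp: abs_if split: if_splits)
  then show ?thesis by blast
qed

text \<open>Both outcomes of the factorisation are treated together; l is 1 or 13. In the second one
  c^7 contributes at least 13^7, of which Phi takes exactly one factor, hence the 13^6 in k.\<close>

locale eqn =
  fixes a b u v k l :: int
  assumes cop: "coprime a b" and sum: "a + b = k * u ^ 7" and Ph: "Phi a b = l * v ^ 7"
    and kl: "(k, l) = (3, 1) \<and> \<not> 13 dvd a + b \<or> (k, l) = (3 * 13 ^ 6, 13)" and uv: "u \<noteq> 0" "v \<noteq> 0"
begin

lemma dvd3: "3 dvd a + b" unfolding sum using kl by auto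

text \<open>A common prime of a + b and Phi divides 13 a^12, hence is 13. And 13 does not divide v:
  for l = 1 by Fermat's theorem, for l = 13 because Phi is 13 a^12 modulo 169. The prime 3 is
  excluded since it divides a + b.\<close>

lemma v_prime: assumes "prime p" "p dvd v" shows "\<not> p dvd a + b" "\<not> p dvd 39"
proof -
  have pP: "p dvd Phi a b" using assms unfolding Ph by (intro dvd_mult_power_7)
  have main: "p = 13" if "p dvd a + b"
  proof -
    have "[Phi a b = 13 * a ^ 12] (mod p)" using that by (rule cong_Phi_sum)
    then have "p dvd 13 * a ^ 12" using pP by (simp add: cong_dvd_iff)
    moreover have "\<not> p dvd a"
    proof
      assume "p dvd a"
      then have "p dvd b" using that by (simp add: dvd_add_right_iff)
      then show False using \<open>p dvd a\<close> cop assms(1) by (metis coprime_common_divisor not_prime_unit)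
    qed
    ultimately have "p dvd 13" using assms(1) by (metis prime_dvd_mult_iff prime_dvd_power)
    then show ?thesis using assms(1) by (simp add: primes_dvd_imp_eq)
  qed
  have n13: "p \<noteq> 13"
  proof
    assume p: "p = 13"
    have 13: "prime (13::int)" by simp
    from kl show False
    proof
      assume h: "(k, l) = (3, 1) \<and> \<not> 13 dvd a + b"
      have "[a ^ 13 + b ^ 13 = a + b] (mod 13)"
      proof -
        have "[x ^ 13 = x] (mod 13)" for x :: int
        proof -
          have "\<forall>r\<in>{0..12::int}. (r ^ 13) mod 13 = r" by code_simp
          moreover have "x mod 13 \<in> {0..12}" by auto
          ultimately have "(x mod 13) ^ 13 mod 13 = x mod 13" by blast
          then show ?thesis by (simp add: cong_def power_mod)
        qed
        then show ?thesis by (intro cong_add)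
      qed
      moreover have "13 dvd a ^ 13 + b ^ 13" unfolding Phi_factor using pP p by simp
      ultimately show False using h by (simp add: cong_dvd_iff)
    next
      assume h: "(k, l) = (3 * 13 ^ 6, 13)"
      then have s: "169 dvd a + b" unfolding sum by (auto intro!: dvd_mult2)
      have "[Phi a b = 13 * a ^ 12] (mod 169)" by (rule cong_Phi_sum[OF s])
      moreover have "169 dvd Phi a b"
      proof -
        obtain w where "v = 13 * w" using assms p by blast
        then have "Phi a b = 169 * (13 ^ 6 * w ^ 7)" using h unfolding Ph by (simp add: power_mult_distrib)
        then show ?thesis by simp
      qed
      ultimately have "169 dvd 13 * a ^ 12" by (simp add: cong_dvd_iff)
      then have "13 * 13 dvd 13 * a ^ 12" by simp
      then have "13 dvd a ^ 12" by (simp only: dvd_mult_cancel_left) simp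
      then have "13 dvd a" using 13 prime_dvd_power by blast
      moreover have "13 dvd a + b" using s by (rule dvd_trans[rotated]) simp
      ultimately have "13 dvd b" by (simp add: dvd_add_right_iff)
      then show False using \<open>13 dvd a\<close> cop 13 by (metis coprime_common_divisor not_prime_unit)
    qed
  qed
  show n: "\<not> p dvd a + b" using main n13 by blast
  show "\<not> p dvd 39"
  proof
    assume "p dvd 39"
    then have "p dvd 3 * 13" by simp
    then have "p dvd 3 \<or> p dvd 13" using assms(1) by (simp only: prime_dvd_mult_iff)
    then have "p = 3 \<or> p = 13" using assms(1) by (auto simp: primes_dvd_imp_eq)
    then show False using n n13 dvd3 by auto
  qed
qed

text \<open>Since x^13 = x modulo 7, a factor 7 of v would divide a + b; then Phi = 13 a^12 modulo 7
  puts it into a, hence also into b.\<close>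

lemma not_7_v: "\<not> 7 dvd v"
proof
  assume "7 dvd v"
  then have "7 dvd Phi a b" unfolding Ph by (intro dvd_mult_power_7)
  then have "7 dvd a ^ 13 + b ^ 13" unfolding Phi_factor by simp
  moreover have "[x ^ 13 = x] (mod 7)" for x :: int
  proof -
    have "\<forall>r\<in>{0..6::int}. (r ^ 13) mod 7 = r" by code_simp
    moreover have "x mod 7 \<in> {0..6}" by auto
    ultimately have "(x mod 7) ^ 13 mod 7 = x mod 7" by blast
    then show ?thesis by (simp add: cong_def power_mod)
  qed
  then have "[a ^ 13 + b ^ 13 = a + b] (mod 7)" by (intro cong_add)
  ultimately have s7: "7 dvd a + b" by (simp add: cong_dvd_iff)
  then have "[Phi a b = 13 * a ^ 12] (mod 7)" by (rule cong_Phi_sum)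
  then have "7 dvd 13 * a ^ 12" using \<open>7 dvd Phi a b\<close> by (simp add: cong_dvd_iff)
  moreover have "prime (7::int)" by simp
  ultimately have "7 dvd (13::int) \<or> 7 dvd a ^ 12" using prime_dvd_mult_iff by blast
  then have "7 dvd a ^ 12" by simp
  then have "7 dvd a" using \<open>prime (7::int)\<close> prime_dvd_power by blast
  moreover have "7 dvd b" using \<open>7 dvd a\<close> s7 by (simp add: dvd_add_right_iff)
  ultimately have "7 dvd a" "7 dvd b" by auto
  then have "is_unit (7::int)" using cop by (metis coprime_common_divisor)
  then show False by simp
qed

lemma coprime_v: "coprime v (39 ^ N)" "coprime v (a + b)" "coprime v (7 ^ N)"
proof -
  have "coprime v 39" using v_prime not_coprime_prime by blast
  then show "coprime v (39 ^ N)" by simp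
  show "coprime v (a + b)" using v_prime not_coprime_prime by blast
  have "coprime 7 v" using not_7_v by (intro prime_imp_coprime) auto
  then show "coprime v (7 ^ N)" by (simp add: coprime_commute)
qed

end

lemma eqn_cases:
  assumes "a * b * c \<noteq> 0" "gcd a (gcd b c) = 1" "a ^ 13 + b ^ 13 = 3 * c ^ (7::nat)"
  obtains u v where "eqn a b u v 3 1" "\<not> 13 dvd a + b" | u v where "eqn a b u v (3 * 13 ^ 6) 13" "13 dvd a + b"
proof -
  have cop: "coprime a b"
  proof (rule ccontr)
    assume "\<not> coprime a b"
    then obtain p where p: "prime p" "p dvd a" "p dvd b" using not_coprime_prime by blast
    then obtain a' b' where ab: "a = p * a'" "b = p * b'" by blast
    have "p ^ 13 * (a' ^ 13 + b' ^ 13) = 3 * c ^ 7" using assms(3) unfolding ab by (simp add: power_mult_distrib algebra_simps)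
    then have d: "p ^ 13 dvd 3 * c ^ 7" by (metis dvd_triv_left)
    have "p dvd c"
    proof (rule ccontr)
      assume "\<not> p dvd c"
      then have "coprime (p ^ 13) (c ^ 7)" using p(1) by (simp add: prime_imp_coprime)
      then have "p ^ 13 dvd 3" using d by (simp add: coprime_dvd_mult_left_iff)
      then have "p ^ 13 \<le> 3" by (rule zdvd_imp_le) simp
      moreover have "p \<ge> 2" using p(1) prime_ge_2_int by blast
      then have "(2::int) ^ 13 \<le> p ^ 13" by (intro power_mono) auto
      ultimately show False by simp
    qed
    then have "p dvd gcd a (gcd b c)" using p by simp
    then have "is_unit p" unfolding assms(2) .
    then show False using p(1) not_prime_unit by blast
  qed
  have f: "(a + b) * Phi a b = 3 * c ^ 7" using assms(3) Phi_factor by simp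
  have c0: "c \<noteq> 0" using assms(1) by auto
  \<comment> \<open>x^13 = x modulo 3 places the coefficient 3 in the factor a + b.\<close>
  have s3: "3 dvd a + b"
  proof -
    have "[x ^ 13 = x] (mod 3)" for x :: int
    proof -
      have "\<forall>r\<in>{0..2::int}. (r ^ 13) mod 3 = r" by code_simp
      moreover have "x mod 3 \<in> {0..2}" by auto
      ultimately have "(x mod 3) ^ 13 mod 3 = x mod 3" by blast
      then show ?thesis by (simp add: cong_def power_mod)
    qed
    then have "[a ^ 13 + b ^ 13 = a + b] (mod 3)" by (intro cong_add)
    then show ?thesis using assms(3) by (simp add: cong_dvd_iff[symmetric])
  qed
  then obtain w where w: "a + b = 3 * w" by blast
  have wP: "w * Phi a b = c ^ 7" using f unfolding w by simp
  have pr: "p = 13" if "prime p" "p dvd w" "p dvd Phi a b" for p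
  proof -
    have ps: "p dvd a + b" using that(2) w by simp
    then have "[Phi a b = 13 * a ^ 12] (mod p)" by (rule cong_Phi_sum)
    then have "p dvd 13 * a ^ 12" using that(3) by (simp add: cong_dvd_iff)
    moreover have "\<not> p dvd a"
    proof
      assume "p dvd a"
      then have "p dvd b" using ps by (simp add: dvd_add_right_iff)
      then show False using \<open>p dvd a\<close> cop that(1) by (metis coprime_common_divisor not_prime_unit)
    qed
    ultimately have "p dvd 13" using that(1) by (metis prime_dvd_mult_iff prime_dvd_power)
    then show ?thesis using that(1) by (simp add: primes_dvd_imp_eq)
  qed
  show thesis
  proof (cases "13 dvd a + b")
    case False
    have "coprime w (Phi a b)"
    proof (rule ccontr)
      assume "\<not> coprime w (Phi a b)"
      then obtain p where p: "prime p" "p dvd w" "p dvd Phi a b" using not_coprime_prime by blast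
      then show False using pr[OF p] False w by simp
    qed
    then obtain u v where "w = u ^ 7" "Phi a b = v ^ 7"
      using seventh_power_int[OF _ wP c0] seventh_power_int[of "Phi a b" w c] wP c0 by (auto simp: coprime_commute mult.commute)
    then have "eqn a b u v 3 1" using cop w False wP c0 by (intro eqn.intro) auto
    then show thesis using that(1) False by blast
  next
    case True
    then have "[Phi a b = 13 * a ^ 12] (mod 13)" by (rule cong_Phi_sum)
    then have "13 dvd Phi a b" by (simp add: cong_dvd_iff)
    then obtain P where P: "Phi a b = 13 * P" by blast
    have "13 dvd c"
    proof -
      have "13 dvd c ^ 7" unfolding wP[symmetric] P by simp
      then show ?thesis by (rule prime_dvd_power[rotated]) simp
    qed
    then obtain c' where c': "c = 13 * c'" by blast
    have c0': "c' \<noteq> 0" using c0 c' by auto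
    have a13: "\<not> 13 dvd a"
    proof
      assume "13 dvd a"
      then have "13 dvd b" using True by (simp add: dvd_add_right_iff)
      then have "is_unit (13::int)" using \<open>13 dvd a\<close> cop by (metis coprime_common_divisor)
      then show False by simp
    qed
    have nP: "\<not> 13 dvd P"
    proof
      assume "13 dvd P"
      then have "169 dvd Phi a b" unfolding P by auto
      moreover obtain s' where s': "a + b = 13 * s'" using True by blast
      moreover have "78 * a ^ 11 * (13 * s') = 169 * (6 * a ^ 11 * s')" "(13 * s') ^ 2 = 169 * s' ^ 2"
        by (simp_all add: power_mult_distrib)
      ultimately have "169 dvd 13 * a ^ 12 - 169 * (6 * a ^ 11 * s') + 169 * s' ^ 2 * ((66)*a^10*b^0 + (-55)*a^9*b^1 + (45)*a^8*b^2 + (-36)*a^7*b^3 + (28)*a^6*b^4 + (-21)*a^5*b^5 + (15)*a^4*b^6 + (-10)*a^3*b^7 + (6)*a^2*b^8 + (-3)*a^1*b^9 + (1)*a^0*b^10)"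
        using Phi_mod_sum_2[of a b] by (simp only:)
      then have "169 dvd 13 * a ^ 12" by (simp only: mult.assoc dvd_add_left_iff[OF dvd_triv_left] dvd_diff_left_iff[OF dvd_triv_left])
      then have "13 * 13 dvd 13 * a ^ 12" by simp
      then have "13 dvd a ^ 12" by (simp only: dvd_mult_cancel_left) simp
      then have "13 dvd a" by (rule prime_dvd_power[rotated]) simp
      then show False using a13 by simp
    qed
    have "13 * (w * P) = 13 * (13 ^ 6 * c' ^ 7)" using wP unfolding P c' by (simp add: power_mult_distrib)
    then have wP2: "w * P = 13 ^ 6 * c' ^ 7" by (simp add: mult.commute)
    have "coprime 13 P" using nP by (intro prime_imp_coprime) auto
    then have "coprime (13 ^ 6) P" by (simp only: coprime_power_left_iff) simp
    moreover have "13 ^ 6 dvd w * P" unfolding wP2 by (rule dvd_triv_left)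
    ultimately have "13 ^ 6 dvd w" by (simp only: coprime_dvd_mult_left_iff)
    then obtain w' where w': "w = 13 ^ 6 * w'" by blast
    have "13 ^ 6 * (w' * P) = 13 ^ 6 * c' ^ 7" using wP2 unfolding w' by (simp only: mult.assoc)
    then have wP3: "w' * P = c' ^ 7" by (metis mult_cancel_left power_not_zero zero_neq_numeral)
    have "coprime w' P"
    proof (rule ccontr)
      assume "\<not> coprime w' P"
      then obtain p where p: "prime p" "p dvd w'" "p dvd P" using not_coprime_prime by blast
      then show False using pr[OF p(1)] nP unfolding w' P by auto
    qed
    then obtain u v where "w' = u ^ 7" "P = v ^ 7"
      using seventh_power_int[OF _ wP3 c0'] seventh_power_int[of P w' c'] wP3 c0' by (auto simp: coprime_commute mult.commute)
    then have "eqn a b u v (3 * 13 ^ 6) 13" using cop w w' P wP3 c0 c' by (intro eqn.intro) auto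
    then show thesis using that(2) True by blast
  qed
qed

section \<open>The congruence of a and -b modulo 49\<close>

text \<open>The cubic form with linear factors a + \<omega>^j b for j = 1, 3, 9; its conjugates multiply to Phi a b.\<close>

definition hh :: "int \<Rightarrow> int \<Rightarrow> complex" where
  "hh a b = of_int (a^3 + b^3) + h0 * of_int (a^2 * b) + h2 * of_int (a * b^2)"

lemma sg_h:
  "sg 2 h0 = h1" "sg 2 h1 = h2" "sg 2 h2 = h3" "sg 2 h3 = h0"
  "sg 4 h0 = h2" "sg 4 h1 = h3" "sg 4 h2 = h0" "sg 4 h3 = h1"
  "sg 8 h0 = h3" "sg 8 h1 = h0" "sg 8 h2 = h1" "sg 8 h3 = h2"
  "sg 7 h0 = h3" "sg 7 h1 = h0" "sg 7 h2 = h1" "sg 7 h3 = h2"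
  by (simp add: h0_def h1_def h2_def h3_def om_big; algebra)+

lemma h_Zom [simp]: "h0 \<in> Zom" "h1 \<in> Zom" "h2 \<in> Zom" "h3 \<in> Zom"
  using h_RR RR_Zom by blast+

lemma hh_RR: "hh a b \<in> RR 3"
  unfolding hh_def by (intro RR_add RR_mult RR_of_int h_RR) auto

lemma sg_hh:
  "sg 2 (hh a b) = of_int (a^3 + b^3) + h1 * of_int (a^2 * b) + h3 * of_int (a * b^2)"
  "sg 4 (hh a b) = of_int (a^3 + b^3) + h2 * of_int (a^2 * b) + h0 * of_int (a * b^2)"
  "sg 8 (hh a b) = of_int (a^3 + b^3) + h3 * of_int (a^2 * b) + h1 * of_int (a * b^2)"
  "sg 7 (hh a b) = of_int (a^3 + b^3) + h3 * of_int (a^2 * b) + h1 * of_int (a * b^2)"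
  unfolding hh_def by (simp_all add: sg_h del: of_int_add of_int_mult of_int_power)

lemma hh_xx: "hh a b = xx a b 1 * xx a b 3 * xx a b 9"
proof -
  have "(A + om * B) * (A + om ^ 3 * B) * (A + om ^ 9 * B) = A^3 + B^3 + h0 * (A^2 * B) + h2 * (A * B^2)" for A B
    unfolding h0_def h2_def using om_pow_13 by algebra
  then show ?thesis by (simp add: hh_def xx_def)
qed

lemma hh_rest: "sg 2 (hh a b) * sg 4 (hh a b) * sg 8 (hh a b) = prod (xx a b) {2,4,5,6,7,8,10,11,12}"
proof -
  have x: "xx a b 18 = xx a b 5" "xx a b 36 = xx a b 10" "xx a b 24 = xx a b 11" "xx a b 72 = xx a b 7"
    by (auto intro!: xx_cong simp: cong_def)
  show ?thesis unfolding hh_xx by (simp add: sg_xx x mult_ac)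
qed

lemma hh_prod: "hh a b * (sg 2 (hh a b) * sg 4 (hh a b) * sg 8 (hh a b)) = of_int (Phi a b)"
proof -
  have x: "xx a b 24 = xx a b 11" "xx a b 36 = xx a b 10" "xx a b 48 = xx a b 9" "xx a b 60 = xx a b 8" "xx a b 72 = xx a b 7"
    by (auto intro!: xx_cong simp: cong_def)
  have "hh a b * (sg 2 (hh a b) * sg 4 (hh a b) * sg 8 (hh a b)) = hh a b * prod (xx a b) {2,4,5,6,7,8,10,11,12}"
    by (simp only: hh_rest)
  then show ?thesis unfolding Q_prod[symmetric] Q_xx unfolding hh_xx[symmetric] by (simp add: x hh_xx mult_ac)
qed

text \<open>The relation for 13^N lives in the full cyclotomic ring. Adding its images under
  \<open>sg 3\<close> and \<open>sg 9\<close> replaces the coefficients by traces in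
  \<open>RR 3\<close>, at the cost of a factor 3, which is harmless because v is prime to
  39.\<close>

lemma comax_hh:
  assumes "coprime a b"
  shows "\<exists>N. comax 3 (of_int (3 * 13 ^ N)) (hh a b) (sg 2 (hh a b) * sg 4 (hh a b) * sg 8 (hh a b))"
proof -
  define x where "x = hh a b"
  define y where "y = sg 2 (hh a b) * sg 4 (hh a b) * sg 8 (hh a b)"
  have n: "\<not> 13 dvd (3::nat)" by simp
  have R: "x \<in> RR 3" "y \<in> RR 3" unfolding x_def y_def by (intro RR_mult RR_sg hh_RR; simp)+
  obtain N where "comax 1 (13 ^ N) (prod (xx a b) {1,3,9}) (prod (xx a b) {2,4,5,6,7,8,10,11,12})"
    using comax_xx_prod[OF assms, of "{1,3,9}" "{2,4,5,6,7,8,10,11,12}"] by auto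
  then have "comax 1 (13 ^ N) x y" unfolding x_def y_def hh_rest unfolding hh_xx by (simp add: mult.assoc)
  then obtain p r where pr: "p \<in> Zom" "r \<in> Zom" "13 ^ N = p * x + r * y"
    unfolding comax_def Zom_RR_1 by blast
  have Z: "x \<in> Zom" "y \<in> Zom" using R RR_Zom by blast+
  have fx: "sg 3 x = x" "sg 3 y = y" using R by (auto simp: RR_def)
  then have fx9: "sg 9 x = x" "sg 9 y = y" using sg_sg[of 3 3 x] sg_sg[of 3 3 y] Z by simp_all
  have 3: "13 ^ N = sg 3 p * x + sg 3 r * y"
    using arg_cong[OF pr(3), of "sg 3"] pr(1,2) Z fx by simp
  have 9: "13 ^ N = sg 9 p * x + sg 9 r * y"
    using arg_cong[OF pr(3), of "sg 9"] pr(1,2) Z fx9 by simp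
  have tr: "z + sg 3 z + sg 9 z \<in> RR 3" if "z \<in> Zom" for z
    using that sg_cong[of 27 1 z] by (simp add: RR_def sg_sg cong_def add_ac)
  have "3 * 13 ^ N = (p + sg 3 p + sg 9 p) * x + (r + sg 3 r + sg 9 r) * y"
  proof -
    have "3 * 13 ^ N = (p * x + r * y) + (sg 3 p * x + sg 3 r * y) + (sg 9 p * x + sg 9 r * y)"
      unfolding 3[symmetric] 9[symmetric] pr(3)[symmetric] by simp
    then show ?thesis by (simp add: algebra_simps)
  qed
  then show ?thesis unfolding comax_def y_def[symmetric] unfolding x_def[symmetric] using tr pr(1,2)
    by (intro exI[of _ N] bexI[of _ "p + sg 3 p + sg 9 p"] bexI[of _ "r + sg 3 r + sg 9 r"]) auto
qed

text \<open>As q H = v^7, a Bezout relation between the integers m and v^7 removes m.\<close>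

lemma comax_imp_one:
  assumes g: "\<not> 13 dvd g" and "comax g (of_int m) q H" "q \<in> RR g" "H \<in> RR g" "q * H = of_int v ^ 7" "coprime m v"
  shows "\<exists>p\<in>RR g. \<exists>r\<in>RR g. p * q + r * H = 1"
proof -
  obtain p r where pr: "p \<in> RR g" "r \<in> RR g" "of_int m = p * q + r * H" using assms(2) by (auto simp: comax_def)
  have "coprime m (v ^ 7)" using assms(6) by simp
  then obtain s t where "s * m + t * v ^ 7 = 1" by (metis bezout_int coprime_iff_gcd_eq_1)
  then have "of_int s * of_int m + of_int t * of_int v ^ 7 = (1 :: complex)"
    by (metis of_int_1 of_int_add of_int_mult of_int_power)
  then have "of_int s * (p * q + r * H) + of_int t * (q * H) = 1" by (simp only: pr(3) assms(5))
  then have "(of_int s * p + of_int t * H) * q + (of_int s * r) * H = 1" by (simp add: algebra_simps)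
  moreover have "of_int s * p + of_int t * H \<in> RR g" "of_int s * r \<in> RR g"
    using pr assms(4) g by (auto intro!: RR_add RR_mult RR_of_int)
  ultimately show ?thesis by blast
qed

text \<open>The value of \<open>hh\<close> at (1, -1), and a generator of the prime above 13 in the
  quartic ring. Complex conjugation, which is \<open>sg 4\<close> there, only changes its
  sign.\<close>

definition tau :: complex where "tau = h2 - h0"

lemma tau_prod: "tau * (sg 2 tau * sg 4 tau * sg 8 tau) = 13"
proof -
  have 1: "sg 2 tau = h3 - h1" "sg 4 tau = h0 - h2" "sg 8 tau = h1 - h3" unfolding tau_def by (simp_all add: sg_h)
  have w: "h0 + h2 = w0" unfolding h0_def h2_def w0_def by algebra
  have w': "h1 + h3 = -1 - w0" unfolding w[symmetric] using h_rel(4) by algebra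
  have "(h0 - h2) * (h0 - h2) = (h0 + h2) * (h0 + h2) - 4 * (h0 * h2)" by algebra
  also have "\<dots> = w0 * w0 - 4 * (3 + (h1 + h3))" by (simp only: w h_rel(3) add.assoc)
  also have "\<dots> = 3 * w0 - 5" unfolding w' w0_rel by algebra
  finally have 2: "(h0 - h2) * (h0 - h2) = 3 * w0 - 5" .
  have "(h1 - h3) * (h1 - h3) = (h1 + h3) * (h1 + h3) - 4 * (h1 * h3)" by algebra
  also have "\<dots> = (-1 - w0) * (-1 - w0) - 4 * (3 + (h0 + h2))" by (simp only: w' h_rel(5) add.assoc)
  also have "\<dots> = 1 + 2 * w0 + w0 * w0 - 4 * (3 + w0)" unfolding w by algebra
  also have "\<dots> = -8 - 3 * w0" unfolding w0_rel by algebra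
  finally have 3: "(h1 - h3) * (h1 - h3) = -8 - 3 * w0" .
  have "tau * (sg 2 tau * sg 4 tau * sg 8 tau) = ((h0 - h2) * (h0 - h2)) * ((h1 - h3) * (h1 - h3))"
    unfolding 1 unfolding tau_def by algebra
  also have "\<dots> = 40 - 9 * (w0 + w0 * w0)" unfolding 2 3 by algebra
  also have "\<dots> = 13" unfolding w0_rel by simp
  finally show ?thesis .
qed

lemma tau_RR: "tau \<in> RR 3" unfolding tau_def by (intro RR_diff h_RR) simp

lemma sg_4_tau: "sg 4 tau = - tau" unfolding tau_def by (simp add: sg_h)

context eqn
begin

lemma hh_divided_by_tau:
  "\<exists>\<kappa>\<in>RR 3. \<exists>q\<in>RR 3. hh a b = \<kappa> * q \<and> (sg 4 \<kappa> = \<kappa> \<or> sg 4 \<kappa> = - \<kappa>) \<and>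
     \<kappa> * (sg 2 \<kappa> * sg 4 \<kappa> * sg 8 \<kappa>) = of_int l"
  using kl
proof
  assume "(k, l) = (3, 1) \<and> \<not> 13 dvd a + b"
  then show ?thesis using hh_RR by (intro bexI[of _ 1] bexI[of _ "hh a b"]) (auto intro: RR_1)
next
  assume h: "(k, l) = (3 * 13 ^ 6, 13)"
  then obtain s' where s': "a + b = 13 * s'" using sum by (metis dvd_def dvd_mult2 dvd_mult dvd_power mult.commute prod.inject zero_less_numeral)
  define S A \<tau>' where "S = complex_of_int s'" and "A = complex_of_int a" and "\<tau>' = sg 2 tau * sg 4 tau * sg 8 tau"
  have B: "complex_of_int b = 13 * S - A" using arg_cong[OF s', of "of_int :: int \<Rightarrow> complex"] by (simp add: S_def A_def algebra_simps)
  \<comment> \<open>At b = -a the form is tau a^3. The substitution b = 13 S - A leaves the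
    remainder 13 S W, again a multiple of tau.\<close>
  define W where "W = 169 * S^2 - 39 * S * A + 3 * A^2 + h0 * A^2 + h2 * (13 * S * A - 2 * A^2)"
  have "hh a b = tau * A^3 + 13 * S * W"
    unfolding hh_def W_def tau_def by (simp add: B flip: A_def) algebra
  also have "\<dots> = tau * (A^3 + \<tau>' * S * W)" unfolding tau_prod[symmetric] \<tau>'_def[symmetric] by algebra
  finally have "hh a b = tau * (A^3 + \<tau>' * S * W)" .
  moreover have "A^3 + \<tau>' * S * W \<in> RR 3"
    unfolding W_def \<tau>'_def A_def S_def by (intro RR_add RR_diff RR_mult RR_power RR_sg RR_of_int RR_numeral h_RR tau_RR) simp_all
  ultimately show ?thesis using tau_RR sg_4_tau tau_prod h
    by (intro bexI[of _ tau] bexI[of _ "A^3 + \<tau>' * S * W"]) auto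
qed

end

text \<open>If p and q differ, each of r and s differs from one of them. So at least three
  differences contribute, and the left side is at least 9.\<close>

lemma four_squares_eq:
  fixes p q r s :: int
  assumes "(p^2 + q^2 + r^2 + s^2) + 3 * ((p - q)^2 + (p - r)^2 + (p - s)^2 + (q - r)^2 + (q - s)^2 + (r - s)^2) \<le> 4"
  shows "p = q"
proof (rule ccontr)
  assume "p \<noteq> q"
  have sq: "x^2 \<ge> 1" if "x \<noteq> 0" for x :: int using that by (simp add: int_one_le_iff_zero_less)
  have tri: "(p - x)^2 + (q - x)^2 \<ge> 1" for x
  proof (cases "p = x")
    case True
    then show ?thesis using sq[of "q - x"] \<open>p \<noteq> q\<close> by simp
  next
    case False
    then have "(p - x)^2 \<ge> 1" using sq by simp
    then show ?thesis using zero_le_power2[of "q - x"] by linarith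
  qed
  have "(p - q)^2 \<ge> 1" using sq[of "p - q"] \<open>p \<noteq> q\<close> by simp
  moreover have False if "P + Q + R + S + 3 * (A + B + C + D + E + F) \<le> 4" "A \<ge> 1" "B + D \<ge> 1" "C + E \<ge> 1"
    "P \<ge> 0" "Q \<ge> 0" "R \<ge> 0" "S \<ge> 0" "F \<ge> 0" for P Q R S A B C D E F :: int
    using that by presburger
  ultimately show False using assms tri[of r] tri[of s] zero_le_power2 by blast
qed

lemma four_squares:
  fixes p q r s :: int
  assumes "4 = (p^2 + q^2 + r^2 + s^2) + 3 * ((p - q)^2 + (p - r)^2 + (p - s)^2 + (q - r)^2 + (q - s)^2 + (r - s)^2)"
  shows "p = q \<and> p = r \<and> p = s \<and> (p = 1 \<or> p = -1)"
proof -
  have 1: "p = q" using four_squares_eq[of p q r s] assms by simp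
  have 2: "p = r" using four_squares_eq[of p r q s] assms by (simp add: power2_commute algebra_simps)
  have 3: "p = s" using four_squares_eq[of p s r q] assms by (simp add: power2_commute algebra_simps)
  have "p^2 = 1" using assms unfolding 1[symmetric] 2[symmetric] 3[symmetric] by simp
  then show ?thesis using 1 2 3 by (simp add: power2_eq_1_iff)
qed

text \<open>Kronecker: by the trace form the sum of the squared absolute values of the conjugates determines the coordinates.\<close>

lemma unit_abs_1_RR_3:
  assumes "e \<in> RR 3" "\<And>k. k \<in> {1..12} \<Longrightarrow> norm (sg k e) = 1"
  shows "e = 1 \<or> e = -1"
proof -
  obtain c where e: "e = val c 1" using Zom_val RR_Zom assms(1) by blast
  have R: "val c 1 \<in> RR 3" using assms e by simp
  have c: "c 3 = c 1" "c 9 = c 1" "c 6 = c 2" "c 5 = c 2" "c 12 = c 4" "c 10 = c 4" "c 8 = c 7" "c 11 = c 7"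
    using RR_coeff[OF _ R, of 1] RR_coeff[OF _ R, of 3] RR_coeff[OF _ R, of 2] RR_coeff[OF _ R, of 6]
      RR_coeff[OF _ R, of 4] RR_coeff[OF _ R, of 12] RR_coeff[OF _ R, of 11] RR_coeff[OF _ R, of 7] by auto
  have "(\<Sum>k=1..12. (norm (sg k (val c 1)))\<^sup>2) = (\<Sum>k=(1::nat)..12. 1)"
    using assms(2) e by (intro sum.cong) auto
  then have "12 = 13 * (\<Sum>j=1..12. (of_int (c j))\<^sup>2) - (\<Sum>j=1..12. real_of_int (c j))\<^sup>2"
    unfolding trace_form by simp
  also have "\<dots> = of_int (13 * (\<Sum>j=1..12. (c j)\<^sup>2) - (\<Sum>j=1..12. c j)\<^sup>2)" by simp
  finally have "(12::real) = of_int (13 * (\<Sum>j=1..12. (c j)\<^sup>2) - (\<Sum>j=1..12. c j)\<^sup>2)" .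
  then have "12 = 13 * (\<Sum>j=1..12. (c j)\<^sup>2) - (\<Sum>j=1..12. c j)\<^sup>2" by linarith
  then have "12 = 13 * (3 * ((c 1)^2 + (c 2)^2 + (c 4)^2 + (c 7)^2)) - (3 * (c 1 + c 2 + c 4 + c 7))^2"
    unfolding sum_1_12 by (simp add: c algebra_simps)
  then have 1: "4 = 13 * ((c 1)^2 + (c 2)^2 + (c 4)^2 + (c 7)^2) - 3 * (c 1 + c 2 + c 4 + c 7)^2"
  proof -
    have "4 = 13 * S - 3 * T^2" if "12 = 13 * (3 * S) - (3 * T)^2" for S T :: int
      using that by (simp add: power_mult_distrib)
    then show ?thesis using \<open>12 = 13 * (3 * _) - _\<close> .
  qed
  have 2: "4 = ((c 1)^2 + (c 2)^2 + (c 4)^2 + (c 7)^2) + 3 * ((c 1 - c 2)^2 + (c 1 - c 4)^2 + (c 1 - c 7)^2 + (c 2 - c 4)^2 + (c 2 - c 7)^2 + (c 4 - c 7)^2)"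
    using 1 by (simp add: power2_eq_square algebra_simps)
  have "c 1 = c 2 \<and> c 1 = c 4 \<and> c 1 = c 7 \<and> (c 1 = 1 \<or> c 1 = -1)" by (rule four_squares[OF 2])
  moreover have "h0 + h1 + h2 + h3 = -1" by (rule h_rel(4))
  moreover have "e = of_int (c 1) * h0 + of_int (c 2) * h1 + of_int (c 4) * h2 + of_int (c 7) * h3"
    by (simp add: e val_def sum_1_12[simplified] h0_def h1_def h2_def h3_def c algebra_simps)
  ultimately have "e = of_int (c 1) * (-1)" by (metis distrib_left)
  moreover have "c 1 = 1 \<or> c 1 = -1" using \<open>c 1 = c 2 \<and> _\<close> by blast
  ultimately show ?thesis by (elim disjE) (simp_all only: of_int_1 of_int_minus, simp_all)
qed

lemma pow7_cng_49:
  assumes g: "\<not> 13 dvd g" and "x \<in> RR g" "y \<in> RR g" "cng g 7 x y"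
  shows "cng g 49 (x ^ 7) (y ^ 7)"
proof -
  obtain t where t: "t \<in> RR g" "x - y = 7 * t" using assms(4) by (auto simp: cng_def)
  have "x = y + 7 * t" using t(2) by (simp add: algebra_simps)
  then have "x ^ 7 - y ^ 7 = 49 * (t * y^6 + 21 * t^2 * y^5 + 245 * t^3 * y^4 + 1715 * t^4 * y^3 + 7203 * t^5 * y^2 + 16807 * t^6 * y + 16807 * t^7)"
    by algebra
  moreover have "t * y^6 + 21 * t^2 * y^5 + 245 * t^3 * y^4 + 1715 * t^4 * y^3 + 7203 * t^5 * y^2 + 16807 * t^6 * y + 16807 * t^7 \<in> RR g"
    using t(1) assms by (intro RR_add RR_mult RR_power RR_numeral)
  ultimately show ?thesis unfolding cng_def by blast
qed

text \<open>The Frobenius congruence modulo 7 raised to the seventh power; in terms of z = x^7 it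
  reads z^7 = sg 7 z modulo 49.\<close>

lemma pow49:
  assumes g: "\<not> 13 dvd g" and x: "x \<in> RR g"
  shows "cng g 49 ((x ^ 7) ^ 7) (sg 7 x ^ 7)"
proof (rule pow7_cng_49[OF g])
  show "x ^ 7 \<in> RR g" "sg 7 x \<in> RR g" using x g by (auto intro: RR_power RR_sg)
  show "cng g 7 (x ^ 7) (sg 7 x)" using frob_iter[OF g, of 7 x 1] x by simp
qed

lemma sg_cng:
  assumes g: "\<not> 13 dvd g" and k: "\<not> 13 dvd k" and "x \<in> RR g" "y \<in> RR g" "cng g (of_int m) x y"
  shows "cng g (of_int m) (sg k x) (sg k y)"
proof -
  obtain t where t: "t \<in> RR g" "x - y = of_int m * t" using assms(5) by (auto simp: cng_def)
  have "sg k x - sg k y = of_int m * sg k t"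
    using arg_cong[OF t(2), of "sg k"] k t(1) assms RR_Zom by simp
  then show ?thesis unfolding cng_def using RR_sg[OF g k t(1)] by blast
qed

lemma cng_cancel_int:
  assumes g: "\<not> 13 dvd g" and "x \<in> RR g" "cng g (of_int m) (x * of_int n) 0" "coprime n m"
  shows "cng g (of_int m) x 0"
proof -
  obtain s t where "s * n + t * m = 1" using assms(4) by (metis bezout_int coprime_iff_gcd_eq_1)
  then have st: "of_int s * of_int n + of_int t * of_int m = (1 :: complex)"
    by (metis of_int_1 of_int_add of_int_mult)
  obtain z where z: "z \<in> RR g" "x * of_int n = of_int m * z" using assms(3) by (auto simp: cng_def)
  have "x = (of_int s * of_int n + of_int t * of_int m) * x" by (simp add: st)
  also have "\<dots> = of_int s * (x * of_int n) + of_int m * (of_int t * x)" by (simp add: algebra_simps)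
  also have "\<dots> = of_int m * (of_int s * z + of_int t * x)" unfolding z(2) by (simp add: algebra_simps)
  finally have "x - 0 = of_int m * (of_int s * z + of_int t * x)" by simp
  moreover have "of_int s * z + of_int t * x \<in> RR g" using z(1) assms(2) g by (intro RR_add RR_mult RR_of_int)
  ultimately show ?thesis unfolding cng_def by blast
qed

lemma sg_12_RR_3: "x \<in> RR 3 \<Longrightarrow> sg 12 x = sg 4 x"
  using sg_sg[of 4 3 x] by (simp add: RR_def)

context eqn
begin

lemma v_nz: "(of_int v :: complex) \<noteq> 0" using uv by simp

lemma l_nz: "(of_int l :: complex) \<noteq> 0" using kl by auto

lemma coprime_m: "coprime (3 * 13 ^ N) v"
proof -
  have "coprime v (3 * 13)" using coprime_v(1)[of 1] by simp
  then have "coprime v 3" "coprime v 13" by (simp_all only: coprime_mult_right_iff)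
  then show ?thesis by (simp add: coprime_commute)
qed

text \<open>The cofactor w is recorded because it makes \<alpha> invertible modulo 49, v being prime
  to 7. The sign combines that of \<kappa> under conjugation with that of the unit quotient.\<close>

lemma hh_conjugates_seventh_power:
  "\<exists>\<alpha>\<in>RR 3. \<exists>w\<in>RR 3. \<alpha> ^ 7 * w = of_int v ^ 7 \<and>
    (hh a b * sg 4 \<alpha> ^ 7 = sg 4 (hh a b) * \<alpha> ^ 7 \<or> hh a b * sg 4 \<alpha> ^ 7 = - (sg 4 (hh a b) * \<alpha> ^ 7))"
proof -
  have n: "\<not> 13 dvd (3::nat)" by simp
  obtain \<kappa> q where kq: "\<kappa> \<in> RR 3" "q \<in> RR 3" "hh a b = \<kappa> * q" "sg 4 \<kappa> = \<kappa> \<or> sg 4 \<kappa> = - \<kappa>"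
    "\<kappa> * (sg 2 \<kappa> * sg 4 \<kappa> * sg 8 \<kappa>) = of_int l" using hh_divided_by_tau by blast
  have Z: "\<kappa> \<in> Zom" "q \<in> Zom" using kq RR_Zom by blast+
  define H where "H = sg 2 q * sg 4 q * sg 8 q"
  have H: "H \<in> RR 3" unfolding H_def using kq n by (intro RR_mult RR_sg) auto
  have Heq: "sg 2 (hh a b) * sg 4 (hh a b) * sg 8 (hh a b) = (sg 2 \<kappa> * sg 4 \<kappa> * sg 8 \<kappa>) * H"
    unfolding kq(3) H_def using Z by (simp add: mult_ac)
  have "of_int l * (q * H) = of_int l * of_int v ^ 7"
  proof -
    have "of_int l * (q * H) = (\<kappa> * q) * ((sg 2 \<kappa> * sg 4 \<kappa> * sg 8 \<kappa>) * H)" unfolding kq(5)[symmetric] by (simp add: mult_ac)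
    also have "\<dots> = hh a b * (sg 2 (hh a b) * sg 4 (hh a b) * sg 8 (hh a b))" unfolding Heq by (simp add: kq(3))
    also have "\<dots> = of_int (l * v ^ 7)" unfolding hh_prod Ph ..
    finally show ?thesis by simp
  qed
  then have qH: "q * H = of_int v ^ 7" using l_nz by simp
  obtain N where "comax 3 (of_int (3 * 13 ^ N)) (hh a b) (sg 2 (hh a b) * sg 4 (hh a b) * sg 8 (hh a b))"
    using comax_hh[OF cop] by blast
  then obtain p r where pr: "p \<in> RR 3" "r \<in> RR 3" "of_int (3 * 13 ^ N) = p * hh a b + r * ((sg 2 \<kappa> * sg 4 \<kappa> * sg 8 \<kappa>) * H)"
    unfolding Heq comax_def by blast
  have "of_int (3 * 13 ^ N) = (p * \<kappa>) * q + (r * (sg 2 \<kappa> * sg 4 \<kappa> * sg 8 \<kappa>)) * H" unfolding pr(3) kq(3) by (simp add: mult_ac)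
  moreover have "p * \<kappa> \<in> RR 3" "r * (sg 2 \<kappa> * sg 4 \<kappa> * sg 8 \<kappa>) \<in> RR 3" using pr kq by (auto intro!: RR_mult RR_sg)
  ultimately have "comax 3 (of_int (3 * 13 ^ N)) q H" unfolding comax_def by blast
  then obtain p' r' where "p' \<in> RR 3" "r' \<in> RR 3" "p' * q + r' * H = 1"
    using comax_imp_one[OF n _ kq(2) H qH coprime_m] by blast
  then obtain \<epsilon> \<epsilon>' \<alpha> where e: "\<epsilon> \<in> RR 3" "\<epsilon>' \<in> RR 3" "\<alpha> \<in> RR 3" "q = \<epsilon> * \<alpha> ^ 7" "\<epsilon> * \<epsilon>' = 1"
    using seventh_power[OF n bezout_3 kq(2) H RR_of_int[OF n] _ _ qH _ v_nz] by blast
  have eZ: "\<epsilon> \<in> Zom" "\<epsilon>' \<in> Zom" "\<alpha> \<in> Zom" using e RR_Zom by blast+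
  \<comment> \<open>The quotient of \<epsilon> by its complex conjugate. Every conjugate of it has
    absolute value 1, since complex conjugation commutes with all \<open>sg i\<close>.\<close>
  define \<eta> where "\<eta> = \<epsilon> * sg 4 \<epsilon>'"
  have \<eta>: "\<eta> \<in> RR 3" unfolding \<eta>_def using e n by (intro RR_mult RR_sg) auto
  have ee: "sg 4 \<epsilon> * sg 4 \<epsilon>' = 1" using arg_cong[OF e(5), of "sg 4"] eZ by simp
  have "sg 4 (sg 4 \<epsilon>') = \<epsilon>'" using sg_cong[of 16 3 \<epsilon>'] e(2) eZ by (simp add: sg_sg RR_def cong_def)
  then have "\<eta> * sg 4 \<eta> = (\<epsilon> * \<epsilon>') * (sg 4 \<epsilon> * sg 4 \<epsilon>')" unfolding \<eta>_def using eZ by (simp add: mult_ac)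
  then have \<eta>1: "\<eta> * sg 4 \<eta> = 1" using ee e(5) by simp
  have \<eta>Z: "\<eta> \<in> Zom" using \<eta> RR_Zom by blast
  have "norm (sg i \<eta>) = 1" if "i \<in> {1..12}" for i
  proof -
    have i: "\<not> 13 dvd i" using that not_dvd_13 by blast
    have "of_real ((norm (sg i \<eta>))\<^sup>2) = sg i \<eta> * cnj (sg i \<eta>)" by (rule complex_norm_square)
    also have "cnj (sg i \<eta>) = sg i (sg 12 \<eta>)" using cnj_sg[OF i \<eta>Z] sg_sg[of i 12 \<eta>] i \<eta>Z by (simp add: mult.commute)
    also have "sg 12 \<eta> = sg 4 \<eta>" by (rule sg_12_RR_3[OF \<eta>])
    also have "sg i \<eta> * sg i (sg 4 \<eta>) = sg i (\<eta> * sg 4 \<eta>)" using i \<eta>Z by simp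
    also have "\<dots> = of_real 1" using i by (simp add: \<eta>1)
    finally have "(norm (sg i \<eta>))\<^sup>2 = 1" by (simp only: of_real_eq_iff)
    then show ?thesis by (simp add: power2_eq_1_iff) (metis norm_ge_zero not_one_le_zero neg_0_le_iff_le zero_le_one order_trans)
  qed
  then have \<eta>s: "\<eta> = 1 \<or> \<eta> = -1" using unit_abs_1_RR_3[OF \<eta>] by blast
  have e\<eta>: "\<epsilon> = \<eta> * sg 4 \<epsilon>" unfolding \<eta>_def using ee by (simp add: mult.assoc mult.commute[of "sg 4 \<epsilon>'"])
  have h: "hh a b = \<kappa> * \<epsilon> * \<alpha> ^ 7" "sg 4 (hh a b) = sg 4 \<kappa> * sg 4 \<epsilon> * sg 4 \<alpha> ^ 7"
    unfolding kq(3) e(4) using Z eZ by simp_all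
  have "hh a b * sg 4 \<alpha> ^ 7 = sg 4 (hh a b) * \<alpha> ^ 7 \<or> hh a b * sg 4 \<alpha> ^ 7 = - (sg 4 (hh a b) * \<alpha> ^ 7)"
  proof -
    have "\<kappa> * \<epsilon> = sg 4 \<kappa> * sg 4 \<epsilon> \<or> \<kappa> * \<epsilon> = - (sg 4 \<kappa> * sg 4 \<epsilon>)"
      using kq(4) \<eta>s by (subst (1 2) e\<eta>) auto
    then show ?thesis unfolding h(2) unfolding h(1) by (elim disjE) (simp_all add: mult_ac)
  qed
  moreover have "\<alpha> ^ 7 * (\<epsilon> * H) = of_int v ^ 7" unfolding qH[symmetric] e(4) by (simp add: mult_ac)
  moreover have "\<epsilon> * H \<in> RR 3" using e H by (intro RR_mult) auto
  ultimately show ?thesis using e(3) by blast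
qed

text \<open>With the form h and its complex conjugate g, this is z^7 = sg 7 z for z = h / g, written
  without denominators; z is a seventh power up to sign. The factor involving \<alpha> divides v^7
  and is cancelled at the end.\<close>

lemma hh_cng_49:
  "cng 3 49 (hh a b ^ 7 * sg 7 (sg 4 (hh a b))) (sg 4 (hh a b) ^ 7 * sg 7 (hh a b))"
proof -
  have n: "\<not> 13 dvd (3::nat)" by simp
  have n49: "of_int 49 = (49 :: complex)" by simp
  obtain \<alpha> w s where aw: "\<alpha> \<in> RR 3" "w \<in> RR 3" "\<alpha> ^ 7 * w = of_int v ^ 7" "s = 1 \<or> s = -1"
    "hh a b * sg 4 \<alpha> ^ 7 = of_int s * (sg 4 (hh a b) * \<alpha> ^ 7)"
  proof -
    obtain \<alpha> w where 1: "\<alpha> \<in> RR 3" "w \<in> RR 3" "\<alpha> ^ 7 * w = of_int v ^ 7" and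
      2: "hh a b * sg 4 \<alpha> ^ 7 = sg 4 (hh a b) * \<alpha> ^ 7 \<or> hh a b * sg 4 \<alpha> ^ 7 = - (sg 4 (hh a b) * \<alpha> ^ 7)" using hh_conjugates_seventh_power by blast
    from 2 show thesis
    proof
      assume "hh a b * sg 4 \<alpha> ^ 7 = sg 4 (hh a b) * \<alpha> ^ 7"
      then show thesis using that[of \<alpha> w 1] 1 by simp
    next
      assume "hh a b * sg 4 \<alpha> ^ 7 = - (sg 4 (hh a b) * \<alpha> ^ 7)"
      then show thesis using that[of \<alpha> w "-1"] 1 by simp
    qed
  qed
  define h where "h = hh a b"
  define g where "g = sg 4 (hh a b)"
  have R: "h \<in> RR 3" "g \<in> RR 3" "sg 4 \<alpha> \<in> RR 3" "sg 7 h \<in> RR 3" "sg 7 g \<in> RR 3" "sg 7 \<alpha> \<in> RR 3" "sg 7 (sg 4 \<alpha>) \<in> RR 3"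
    unfolding h_def g_def using aw hh_RR by (auto intro!: RR_sg)
  have Z: "h \<in> Zom" "g \<in> Zom" "\<alpha> \<in> Zom" "sg 4 \<alpha> \<in> Zom" using R aw RR_Zom by blast+
  have s7: "of_int s ^ 7 = (of_int s :: complex)" using aw(4) by auto
  have eq: "h * sg 4 \<alpha> ^ 7 = of_int s * (g * \<alpha> ^ 7)" using aw(5) by (simp add: h_def g_def)
  have "(h * sg 4 \<alpha> ^ 7) ^ 7 = (of_int s * (g * \<alpha> ^ 7)) ^ 7" by (simp only: eq)
  then have 1: "h ^ 7 * (sg 4 \<alpha> ^ 7) ^ 7 = of_int s * (g ^ 7 * (\<alpha> ^ 7) ^ 7)" by (simp only: power_mult_distrib s7)
  have "cng 3 49 (h ^ 7 * (sg 4 \<alpha> ^ 7) ^ 7) (h ^ 7 * sg 7 (sg 4 \<alpha>) ^ 7)"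
    using R by (intro cng_mult n cng_refl pow49 RR_power)
  moreover have "cng 3 49 (of_int s * (g ^ 7 * (\<alpha> ^ 7) ^ 7)) (of_int s * (g ^ 7 * sg 7 \<alpha> ^ 7))"
    using R aw(1) by (intro cng_mult n cng_refl pow49 RR_power RR_mult RR_of_int)
  ultimately have 2: "cng 3 49 (h ^ 7 * sg 7 (sg 4 \<alpha>) ^ 7) (of_int s * (g ^ 7 * sg 7 \<alpha> ^ 7))"
    unfolding 1 using cng_sym[OF n] cng_trans[OF n] by blast
  have 3: "sg 7 h * sg 7 (sg 4 \<alpha>) ^ 7 = of_int s * (sg 7 g * sg 7 \<alpha> ^ 7)"
    using arg_cong[OF eq, of "sg 7"] Z by simp
  define W where "W = sg 7 (sg 4 \<alpha>) ^ 7"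
  have W: "W \<in> RR 3" unfolding W_def using R n by (intro RR_power)
  have "cng 3 49 ((h ^ 7 * W) * sg 7 g) ((of_int s * (g ^ 7 * sg 7 \<alpha> ^ 7)) * sg 7 g)"
    unfolding W_def by (rule cng_mult[OF n R(5) _ 2 cng_refl[OF n]]) (intro RR_mult RR_power RR_of_int n R)
  moreover have "(of_int s * (g ^ 7 * sg 7 \<alpha> ^ 7)) * sg 7 g = g ^ 7 * (sg 7 h * W)" unfolding W_def 3 by (simp add: mult_ac)
  ultimately have "cng 3 49 ((h ^ 7 * W) * sg 7 g) (g ^ 7 * (sg 7 h * W))" by (simp only:)
  then have "cng 3 49 (h ^ 7 * sg 7 g * W) (g ^ 7 * sg 7 h * W)" by (simp only: mult.assoc mult.commute[of W])
  then have 4: "cng 3 49 ((h ^ 7 * sg 7 g - g ^ 7 * sg 7 h) * W) 0"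
    by (simp add: cng_def left_diff_distrib)
  define D where "D = h ^ 7 * sg 7 g - g ^ 7 * sg 7 h"
  have D: "D \<in> RR 3" unfolding D_def using R n by (intro RR_diff RR_mult RR_power)
  have ww: "W * sg 7 (sg 4 w) = of_int (v ^ 7)"
    unfolding W_def using arg_cong[OF arg_cong[OF aw(3), of "sg 4"], of "sg 7"] Z aw(2) RR_Zom[OF aw(2)] by simp
  have "cng 3 49 (D * W * sg 7 (sg 4 w)) (0 * sg 7 (sg 4 w))"
    using 4 aw(2) by (intro cng_mult n cng_refl RR_sg RR_0) (auto simp: D_def)
  then have "cng 3 (of_int 49) (D * of_int (v ^ 7)) 0" by (simp only: mult.assoc ww n49) simp
  moreover have "coprime (v ^ 7) 49" using coprime_v(3)[of 2] by simp
  ultimately have "cng 3 (of_int 49) D 0" using cng_cancel_int[OF n D] by blast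
  then show ?thesis unfolding D_def h_def g_def by (simp add: cng_def)
qed

end

text \<open>Coordinates with respect to h0, ..., h3, reduced modulo 49, make the final case distinction a computation.\<close>

type_synonym quartic = "int \<times> int \<times> int \<times> int"

fun qval :: "quartic \<Rightarrow> complex" where
  "qval (a, b, c, d) = of_int a * h0 + of_int b * h1 + of_int c * h2 + of_int d * h3"

fun qmod :: "quartic \<Rightarrow> quartic" where "qmod (a, b, c, d) = (a mod 49, b mod 49, c mod 49, d mod 49)"

fun qmul :: "quartic \<Rightarrow> quartic \<Rightarrow> quartic" where
  "qmul (a0, a1, a2, a3) (b0, b1, b2, b3) = qmod (
     2*(a2*b2) + a3*b3 + (a0*b1 + a1*b0) + (a1*b2 + a2*b1) + (a0*b3 + a3*b0) - 3*(a0*b2 + a2*b0) - 2*(a1*b3 + a3*b1),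
     a0*b0 + 2*(a3*b3) + (a0*b1 + a1*b0) + (a1*b2 + a2*b1) + (a2*b3 + a3*b2) - 2*(a0*b2 + a2*b0) - 3*(a1*b3 + a3*b1),
     2*(a0*b0) + a1*b1 + (a1*b2 + a2*b1) + (a2*b3 + a3*b2) + (a0*b3 + a3*b0) - 3*(a0*b2 + a2*b0) - 2*(a1*b3 + a3*b1),
     2*(a1*b1) + a2*b2 + (a0*b1 + a1*b0) + (a2*b3 + a3*b2) + (a0*b3 + a3*b0) - 2*(a0*b2 + a2*b0) - 3*(a1*b3 + a3*b1))"

definition qpow7 :: "quartic \<Rightarrow> quartic" where
  "qpow7 x = (let x2 = qmul x x; x3 = qmul x2 x in qmul (qmul x3 x3) x)"

text \<open>The coordinates of the image under \<open>sg 7\<close>, which sends each period to its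
  predecessor; applied twice it is complex conjugation.\<close>

fun qrot :: "quartic \<Rightarrow> quartic" where "qrot (a, b, c, d) = (b, c, d, a)"

text \<open>The form at a = t, b = 1, with the constant t^3 + 1 spread over the basis by 1 = -(h0 +
  h1 + h2 + h3).\<close>

definition qhh :: "int \<Rightarrow> quartic" where "qhh t = (- (t^3 + 1) + t^2, - (t^3 + 1), - (t^3 + 1) + t, - (t^3 + 1))"

definition qtest :: "int \<Rightarrow> bool" where
  "qtest t \<longleftrightarrow> (let x = qhh t; y = qrot (qrot x) in qmul (qpow7 x) (qrot y) = qmul (qpow7 y) (qrot x))"

lemma h_mult:
  "h0 * h0 = h1 + 2 * h2" "h1 * h1 = h2 + 2 * h3" "h2 * h2 = h3 + 2 * h0" "h3 * h3 = h0 + 2 * h1"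
  "h0 * h1 = h0 + h1 + h3" "h1 * h2 = h0 + h1 + h2" "h2 * h3 = h1 + h2 + h3" "h0 * h3 = h0 + h2 + h3"
  "h0 * h2 = - 3 * h0 - 2 * h1 - 3 * h2 - 2 * h3" "h1 * h3 = - 2 * h0 - 3 * h1 - 2 * h2 - 3 * h3"
proof -
  have 3: "(3::complex) = - 3 * h0 - 3 * h1 - 3 * h2 - 3 * h3" using h_rel(4) by algebra
  have 1: "h0 * h1 = h0 + h1 + h3" using h_rel(2,4) by algebra
  have 2: "h0 * h2 = - 3 * h0 - 2 * h1 - 3 * h2 - 2 * h3" unfolding h_rel(3) by (subst 3) (simp add: algebra_simps)
  show "h0 * h0 = h1 + 2 * h2" by (rule h_rel(6))
  show "h0 * h1 = h0 + h1 + h3" "h0 * h2 = - 3 * h0 - 2 * h1 - 3 * h2 - 2 * h3" by (rule 1, rule 2)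
  show "h1 * h1 = h2 + 2 * h3" "h2 * h2 = h3 + 2 * h0" "h3 * h3 = h0 + 2 * h1"
    using arg_cong[OF h_rel(6), of "sg 2"] arg_cong[OF h_rel(6), of "sg 4"] arg_cong[OF h_rel(6), of "sg 8"] by (simp_all add: sg_h)
  show "h1 * h2 = h0 + h1 + h2" "h2 * h3 = h1 + h2 + h3" "h0 * h3 = h0 + h2 + h3"
    using arg_cong[OF 1, of "sg 2"] arg_cong[OF 1, of "sg 4"] arg_cong[OF 1, of "sg 8"] by (simp_all add: sg_h mult.commute add_ac)
  have "h1 * h3 = - 3 * h1 - 2 * h2 - 3 * h3 - 2 * h0"
    using arg_cong[OF 2, of "sg 2"] by (simp add: sg_h)
  then show "h1 * h3 = - 2 * h0 - 3 * h1 - 2 * h2 - 3 * h3" by algebra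
qed

lemma qval_RR [simp]: "qval x \<in> RR 3"
  by (cases x) (auto intro!: RR_add RR_mult RR_of_int h_RR)

lemma qval_qmod: "cng 3 49 (qval x) (qval (qmod x))"
proof (cases x)
  case (fields a b c d)
  have m: "of_int n = of_int (n mod 49) + 49 * (of_int (n div 49) :: complex)" for n
    by (metis (no_types) mod_mult_div_eq of_int_add of_int_mult of_int_numeral)
  have "qval x - qval (qmod x) = 49 * qval (a div 49, b div 49, c div 49, d div 49)"
    unfolding fields qval.simps qmod.simps by (subst m[of a], subst m[of b], subst m[of c], subst m[of d]) (simp add: algebra_simps)
  then show ?thesis unfolding cng_def using qval_RR by blast
qed

lemma qval_qmul: "cng 3 49 (qval x * qval y) (qval (qmul x y))"
proof -
  obtain a0 a1 a2 a3 where x: "x = (a0, a1, a2, a3)" by (cases x)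
  obtain b0 b1 b2 b3 where y: "y = (b0, b1, b2, b3)" by (cases y)
  have "(A0 * h0 + A1 * h1 + A2 * h2 + A3 * h3) * (B0 * h0 + B1 * h1 + B2 * h2 + B3 * h3) =
     (2*(A2*B2) + A3*B3 + (A0*B1 + A1*B0) + (A1*B2 + A2*B1) + (A0*B3 + A3*B0) - 3*(A0*B2 + A2*B0) - 2*(A1*B3 + A3*B1)) * h0 +
     (A0*B0 + 2*(A3*B3) + (A0*B1 + A1*B0) + (A1*B2 + A2*B1) + (A2*B3 + A3*B2) - 2*(A0*B2 + A2*B0) - 3*(A1*B3 + A3*B1)) * h1 +
     (2*(A0*B0) + A1*B1 + (A1*B2 + A2*B1) + (A2*B3 + A3*B2) + (A0*B3 + A3*B0) - 3*(A0*B2 + A2*B0) - 2*(A1*B3 + A3*B1)) * h2 +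
     (2*(A1*B1) + A2*B2 + (A0*B1 + A1*B0) + (A2*B3 + A3*B2) + (A0*B3 + A3*B0) - 2*(A0*B2 + A2*B0) - 3*(A1*B3 + A3*B1)) * h3" for A0 A1 A2 A3 B0 B1 B2 B3
  proof -
    have "(A0 * h0 + A1 * h1 + A2 * h2 + A3 * h3) * (B0 * h0 + B1 * h1 + B2 * h2 + B3 * h3) =
      A0*B0*(h0*h0) + A1*B1*(h1*h1) + A2*B2*(h2*h2) + A3*B3*(h3*h3) + (A0*B1+A1*B0)*(h0*h1) + (A1*B2+A2*B1)*(h1*h2)
      + (A2*B3+A3*B2)*(h2*h3) + (A0*B3+A3*B0)*(h0*h3) + (A0*B2+A2*B0)*(h0*h2) + (A1*B3+A3*B1)*(h1*h3)"
      by (simp only: distrib_left distrib_right mult_ac add_ac)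
    then show ?thesis unfolding h_mult by (simp add: algebra_simps)
  qed
  from this[of "of_int a0" "of_int a1" "of_int a2" "of_int a3" "of_int b0" "of_int b1" "of_int b2" "of_int b3"]
  have "qval x * qval y = qval (
     2*(a2*b2) + a3*b3 + (a0*b1 + a1*b0) + (a1*b2 + a2*b1) + (a0*b3 + a3*b0) - 3*(a0*b2 + a2*b0) - 2*(a1*b3 + a3*b1),
     a0*b0 + 2*(a3*b3) + (a0*b1 + a1*b0) + (a1*b2 + a2*b1) + (a2*b3 + a3*b2) - 2*(a0*b2 + a2*b0) - 3*(a1*b3 + a3*b1),
     2*(a0*b0) + a1*b1 + (a1*b2 + a2*b1) + (a2*b3 + a3*b2) + (a0*b3 + a3*b0) - 3*(a0*b2 + a2*b0) - 2*(a1*b3 + a3*b1),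
     2*(a1*b1) + a2*b2 + (a0*b1 + a1*b0) + (a2*b3 + a3*b2) + (a0*b3 + a3*b0) - 2*(a0*b2 + a2*b0) - 3*(a1*b3 + a3*b1))"
    unfolding x y qval.simps by (simp only: of_int_add of_int_mult of_int_diff of_int_numeral)
  then show ?thesis unfolding x y qmul.simps using qval_qmod by metis
qed

lemma cng3_refl: "cng 3 49 x x" by (rule cng_refl) simp
lemma cng3_sym: "cng 3 49 x y \<Longrightarrow> cng 3 49 y x" by (rule cng_sym) simp
lemma cng3_trans: "cng 3 49 x y \<Longrightarrow> cng 3 49 y z \<Longrightarrow> cng 3 49 x z" by (rule cng_trans) simp
lemma cng3_mult: "x' \<in> RR 3 \<Longrightarrow> y \<in> RR 3 \<Longrightarrow> cng 3 49 x y \<Longrightarrow> cng 3 49 x' y' \<Longrightarrow> cng 3 49 (x * x') (y * y')"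
  by (rule cng_mult) simp

lemma qval_pow7: "cng 3 49 (qval x ^ 7) (qval (qpow7 x))"
proof -
  have 2: "cng 3 49 (qval x * qval x) (qval (qmul x x))" by (rule qval_qmul)
  have 3: "cng 3 49 (qval x * qval x * qval x) (qval (qmul (qmul x x) x))"
    by (rule cng3_trans[OF cng3_mult[OF _ _ 2 cng3_refl] qval_qmul]) simp_all
  have 6: "cng 3 49 ((qval x * qval x * qval x) * (qval x * qval x * qval x)) (qval (qmul (qmul (qmul x x) x) (qmul (qmul x x) x)))"
    by (rule cng3_trans[OF cng3_mult[OF _ _ 3 3] qval_qmul]) (simp_all add: RR_mult)
  have 7: "cng 3 49 ((qval x * qval x * qval x) * (qval x * qval x * qval x) * qval x) (qval (qpow7 x))"
    unfolding qpow7_def Let_def by (rule cng3_trans[OF cng3_mult[OF _ _ 6 cng3_refl] qval_qmul]) simp_all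
  have "qval x ^ 7 = (qval x * qval x * qval x) * (qval x * qval x * qval x) * qval x" by algebra
  then show ?thesis using 7 by simp
qed

lemma sg_7_qval: "sg 7 (qval x) = qval (qrot x)"
  by (cases x) (simp add: sg_h algebra_simps)

lemma sg_4_qval: "sg 4 (qval x) = qval (qrot (qrot x))"
  by (cases x) (simp add: sg_h algebra_simps)

lemma qval_qhh: "hh t 1 = qval (qhh t)"
proof -
  have "C + h0 * P + h2 * R = (- C + P) * h0 + (- C) * h1 + (- C + R) * h2 + (- C) * h3" for C P R
    using h_rel(4) by algebra
  from this[of "of_int (t^3 + 1)" "of_int (t^2)" "of_int t"] show ?thesis
    unfolding hh_def qhh_def qval.simps by (simp only: of_int_add of_int_minus power_one mult_1_right)
qed

lemma qval_eqD:
  assumes "qval (a, b, c, d) = qval (a', b', c', d')"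
  shows "a = a' \<and> b = b' \<and> c = c' \<and> d = d'"
proof -
  define C where "C = (\<lambda>(a::int,b::int,c::int,d::int) j::nat. if j \<in> {1,3,9} then a else if j \<in> {2,5,6} then b else if j \<in> {4,10,12} then c else d)"
  have v: "qval (a, b, c, d) = val (C (a, b, c, d)) 1" for a b c d
    unfolding val_def sum_1_12 by (simp add: C_def h0_def h1_def h2_def h3_def power2_eq_square algebra_simps)
  have "C (a, b, c, d) j = C (a', b', c', d') j" if "j \<in> {1..12}" for j
    using val_inj assms that unfolding v by blast
  from this[of 1] this[of 2] this[of 4] this[of 7] show ?thesis by (simp add: C_def)
qed

lemma qval_cngD:
  assumes "cng 3 49 (qval x) (qval y)"
  shows "qmod x = qmod y"
proof -
  obtain a b c d where x: "x = (a, b, c, d)" by (cases x)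
  obtain a' b' c' d' where y: "y = (a', b', c', d')" by (cases y)
  obtain t where t: "t \<in> RR 3" "qval x - qval y = 49 * t" using assms by (auto simp: cng_def)
  obtain p q r s where "t = of_int p * h0 + of_int q * h1 + of_int r * h2 + of_int s * h3" using RR_3_rep[OF t(1)] by blast
  then have "qval (a - a', b - b', c - c', d - d') = qval (49 * p, 49 * q, 49 * r, 49 * s)"
    using t(2) unfolding x y by (simp add: algebra_simps)
  from qval_eqD[OF this] have "a - a' = 49 * p" "b - b' = 49 * q" "c - c' = 49 * r" "d - d' = 49 * s" by auto
  then have "[a = a'] (mod 49)" "[b = b'] (mod 49)" "[c = c'] (mod 49)" "[d = d'] (mod 49)"
    by (auto simp: cong_iff_dvd_diff)
  then show ?thesis unfolding x y qmod.simps cong_def by (simp only:)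
qed

lemma qmod_qmul: "qmod (qmul x y) = qmul x y"
  by (cases x; cases y) simp

text \<open>The residues 0, 1 and 48 are absent because for a = 0, a = b and a = -b the form equals
  its complex conjugate up to sign, so the test is satisfied trivially.\<close>

lemma qtest_false:
  "\<not> qtest 2" "\<not> qtest 3" "\<not> qtest 4" "\<not> qtest 5" "\<not> qtest 6" "\<not> qtest 7" "\<not> qtest 8" "\<not> qtest 9" "\<not> qtest 10" "\<not> qtest 11" "\<not> qtest 12" "\<not> qtest 13" "\<not> qtest 14" "\<not> qtest 15" "\<not> qtest 16" "\<not> qtest 17" "\<not> qtest 18" "\<not> qtest 19" "\<not> qtest 20" "\<not> qtest 21" "\<not> qtest 22" "\<not> qtest 23" "\<not> qtest 24" "\<not> qtest 25" "\<not> qtest 26" "\<not> qtest 27" "\<not> qtest 28" "\<not> qtest 29" "\<not> qtest 30" "\<not> qtest 31" "\<not> qtest 32" "\<not> qtest 33" "\<not> qtest 34" "\<not> qtest 35" "\<not> qtest 36" "\<not> qtest 37" "\<not> qtest 38" "\<not> qtest 39" "\<not> qtest 40" "\<not> qtest 41" "\<not> qtest 42" "\<not> qtest 43" "\<not> qtest 44" "\<not> qtest 45" "\<not> qtest 46" "\<not> qtest 47"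
  by code_simp+

lemma qtest_imp:
  assumes "t \<in> {0..48}" "qtest t" shows "t = 0 \<or> t = 1 \<or> t = 48"
proof -
  have "{0..48::int} = {0,1,2,3,4,5,6,7,8,9,10,11,12,13,14,15,16,17,18,19,20,21,22,23,24,25,26,27,28,29,30,31,32,33,34,35,36,37,38,39,40,41,42,43,44,45,46,47,48}"
    by code_simp
  with assms(1) have "t \<in> {0,1,2,3,4,5,6,7,8,9,10,11,12,13,14,15,16,17,18,19,20,21,22,23,24,25,26,27,28,29,30,31,32,33,34,35,36,37,38,39,40,41,42,43,44,45,46,47,48}"
    by (simp only:)
  then show ?thesis using assms(2) qtest_false by (elim insertE) auto
qed

lemma hh_cong:
  assumes "[a = a'] (mod 49)" "[b = b'] (mod 49)"
  shows "cng 3 49 (hh a b) (hh a' b')"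
proof -
  have i: "cng 3 49 (of_int x) (of_int y)" if "[x = y] (mod 49)" for x y
  proof -
    obtain z where "x - y = 49 * z" using \<open>[x = y] (mod 49)\<close> by (auto simp: cong_iff_dvd_diff)
    then have "of_int x - of_int y = 49 * (of_int z :: complex)" by (metis of_int_diff of_int_mult of_int_numeral)
    then show ?thesis unfolding cng_def using RR_of_int[of 3 z] by auto
  qed
  have n: "\<not> 13 dvd (3::nat)" by simp
  show ?thesis unfolding hh_def
    by (intro cng_add cng_mult cng_refl i n RR_of_int h_RR cong_add cong_mult cong_pow assms)
qed

lemma sg_cng_49: "\<not> 13 dvd k \<Longrightarrow> x \<in> RR 3 \<Longrightarrow> y \<in> RR 3 \<Longrightarrow> cng 3 49 x y \<Longrightarrow> cng 3 49 (sg k x) (sg k y)"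
  using sg_cng[of 3 k x y 49] by simp

text \<open>Both sides of the congruence are homogeneous of degree 24. With a = t b modulo 49 the
  factor b^24 cancels, and only the residue t matters.\<close>

lemma hh_ratio:
  assumes F: "cng 3 49 (hh a b ^ 7 * sg 7 (sg 4 (hh a b))) (sg 4 (hh a b) ^ 7 * sg 7 (hh a b))"
    and b: "\<not> 7 dvd b"
  shows "[a = 0] (mod 49) \<or> [a = b] (mod 49) \<or> [a = - b] (mod 49)"
proof -
  have n: "\<not> 13 dvd (3::nat)" by simp
  have cb: "coprime b 49"
  proof -
    have "coprime 7 b" using b by (intro prime_imp_coprime) auto
    then have "coprime (7 ^ 2) b" by (simp only: coprime_power_left_iff) simp
    then show ?thesis by (simp add: coprime_commute)
  qed
  then obtain b' where b': "[b * b' = 1] (mod 49)" using cong_solve_coprime_int by blast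
  define t where "t = (a * b') mod 49"
  have t: "t \<in> {0..48}" by (auto simp: t_def)
  have at: "[a = t * b] (mod 49)"
  proof -
    have "[t * b = (a * b') * b] (mod 49)" unfolding t_def by (intro cong_mult) (auto simp: cong_def)
    also have "(a * b') * b = a * (b * b')" by simp
    also have "[a * (b * b') = a * 1] (mod 49)" using b' by (intro cong_mult) auto
    finally show ?thesis by (simp add: cong_sym)
  qed
  define B where "B = complex_of_int (b^3)"
  have BR: "B \<in> RR 3" unfolding B_def by (intro RR_of_int n)
  have BZ: "B \<in> Zom" using BR RR_Zom by blast
  have sgB: "sg 4 B = B" "sg 7 B = B" unfolding B_def by (rule sg_of_int; simp)+
  have hB: "hh (t * b) b = B * hh t 1" unfolding hh_def B_def by (simp add: algebra_simps power2_eq_square power3_eq_cube)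
  have c: "cng 3 49 (hh a b) (B * hh t 1)" unfolding hB[symmetric] using at by (intro hh_cong) auto
  have R: "hh a b \<in> RR 3" "B * hh t 1 \<in> RR 3" "hh t 1 \<in> RR 3" by (intro hh_RR RR_mult BR n)+
  have Z: "hh t 1 \<in> Zom" using R RR_Zom by blast
  have c4: "cng 3 49 (sg 4 (hh a b)) (B * sg 4 (hh t 1))"
    using sg_cng_49[OF _ R(1,2) c, of 4] Z BZ by (simp add: sgB)
  have R4: "sg 4 (hh a b) \<in> RR 3" "B * sg 4 (hh t 1) \<in> RR 3" "sg 4 (hh t 1) \<in> RR 3"
    by (intro RR_sg RR_mult BR n hh_RR; simp)+
  have Z4: "sg 4 (hh t 1) \<in> Zom" using R4 RR_Zom by blast
  have c7: "cng 3 49 (sg 7 (hh a b)) (B * sg 7 (hh t 1))"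
    using sg_cng_49[OF _ R(1,2) c, of 7] Z BZ by (simp add: sgB)
  have c74: "cng 3 49 (sg 7 (sg 4 (hh a b))) (B * sg 7 (sg 4 (hh t 1)))"
    using sg_cng_49[OF _ R4(1,2) c4, of 7] Z4 BZ by (simp add: sgB)
  have R7: "sg 7 (hh t 1) \<in> RR 3" "sg 7 (sg 4 (hh t 1)) \<in> RR 3" "sg 7 (hh a b) \<in> RR 3" "sg 7 (sg 4 (hh a b)) \<in> RR 3"
    by (intro RR_sg n hh_RR; simp)+
  have 1: "cng 3 49 (hh a b ^ 7 * sg 7 (sg 4 (hh a b))) ((B * hh t 1) ^ 7 * (B * sg 7 (sg 4 (hh t 1))))"
    by (intro cng_mult cng_power n R R7 c c74 RR_power)
  have 2: "cng 3 49 (sg 4 (hh a b) ^ 7 * sg 7 (hh a b)) ((B * sg 4 (hh t 1)) ^ 7 * (B * sg 7 (hh t 1)))"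
    by (intro cng_mult cng_power n R4 R7 c4 c7 RR_power)
  have 3: "cng 3 49 ((B * hh t 1) ^ 7 * (B * sg 7 (sg 4 (hh t 1)))) ((B * sg 4 (hh t 1)) ^ 7 * (B * sg 7 (hh t 1)))"
    using 1 2 F cng3_sym cng3_trans by blast
  define D where "D = hh t 1 ^ 7 * sg 7 (sg 4 (hh t 1)) - sg 4 (hh t 1) ^ 7 * sg 7 (hh t 1)"
  have DR: "D \<in> RR 3" unfolding D_def by (intro RR_diff RR_mult RR_power n R R4 R7)
  have "(B * hh t 1) ^ 7 * (B * sg 7 (sg 4 (hh t 1))) - (B * sg 4 (hh t 1)) ^ 7 * (B * sg 7 (hh t 1)) = D * B ^ 8"
    unfolding D_def by algebra
  moreover have "B ^ 8 = of_int ((b^3)^8)" unfolding B_def by (rule of_int_power[symmetric])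
  ultimately have "(B * hh t 1) ^ 7 * (B * sg 7 (sg 4 (hh t 1))) - (B * sg 4 (hh t 1)) ^ 7 * (B * sg 7 (hh t 1)) = D * of_int ((b^3)^8)"
    by (simp only:)
  then have "cng 3 (of_int 49) (D * of_int ((b^3)^8)) 0" using 3 unfolding cng_def diff_0_right of_int_numeral by (simp only:)
  moreover have "coprime ((b^3)^8) 49" using cb by simp
  ultimately have "cng 3 (of_int 49) D 0" using cng_cancel_int[OF n DR] by blast
  then have "cng 3 49 (hh t 1 ^ 7 * sg 7 (sg 4 (hh t 1))) (sg 4 (hh t 1) ^ 7 * sg 7 (hh t 1))"
    by (simp add: cng_def D_def)
  then have 4: "cng 3 49 (qval (qhh t) ^ 7 * qval (qrot (qrot (qrot (qhh t))))) (qval (qrot (qrot (qhh t))) ^ 7 * qval (qrot (qhh t)))"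
    unfolding qval_qhh sg_4_qval sg_7_qval .
  have 5: "cng 3 49 (qval x ^ 7 * qval y) (qval (qmul (qpow7 x) y))" for x y
    by (rule cng3_trans[OF cng3_mult[OF _ _ qval_pow7 cng3_refl] qval_qmul]) simp_all
  have "cng 3 49 (qval (qmul (qpow7 (qhh t)) (qrot (qrot (qrot (qhh t)))))) (qval (qmul (qpow7 (qrot (qrot (qhh t)))) (qrot (qhh t))))"
    using 4 5 cng3_sym cng3_trans by meson
  from qval_cngD[OF this] have "qtest t" unfolding qmod_qmul by (simp add: qtest_def Let_def)
  then have "t = 0 \<or> t = 1 \<or> t = 48" using qtest_imp t by blast
  then show ?thesis
  proof (elim disjE)
    assume "t = 48"
    have "[48 * b = -1 * b] (mod 49)" by (intro cong_mult) (auto simp: cong_def)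
    then show ?thesis using at \<open>t = 48\<close> cong_trans by fastforce
  qed (use at in auto)
qed

lemma pow42_cong_1:
  assumes "\<not> 7 dvd (x::int)" shows "[x ^ 42 = 1] (mod 49)"
proof -
  have "[x ^ 6 = 1] (mod 7)"
  proof -
    have "\<forall>r\<in>{1,2,3,4,5,6::int}. r ^ 6 mod 7 = 1" by simp
    moreover have "x mod 7 \<in> {1,2,3,4,5,6}" using assms by (auto simp: dvd_eq_mod_eq_0)
    ultimately have "(x mod 7) ^ 6 mod 7 = 1" by blast
    then show ?thesis by (simp add: cong_def power_mod)
  qed
  then obtain m where "x ^ 6 = 1 + 7 * m" by (metis cong_iff_lin cong_sym)
  moreover have "x ^ 42 = (x ^ 6) ^ 7" by (simp flip: power_mult)
  ultimately have "x ^ 42 = (1 + 7 * m) ^ 7" by simp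
  also have "\<dots> = 1 + 49 * (m + 21 * m^2 + 245 * m^3 + 1715 * m^4 + 7203 * m^5 + 16807 * m^6 + 16807 * m^7)" by algebra
  finally show ?thesis by (simp add: cong_iff_dvd_diff)
qed

context eqn
begin

lemma not_both_7: "\<not> (7 dvd a \<and> 7 dvd b)"
proof
  assume "7 dvd a \<and> 7 dvd b"
  then have "is_unit (7::int)" using cop by (metis coprime_common_divisor)
  then show False by simp
qed

text \<open>This excludes the residues that pass the test without giving a = -b. The sixth power of
  a seventh power prime to 7 is 1 modulo 49, so eliminating x leaves c^72 l^6 = d^6 k^72, which
  fails for the constants in question.\<close>

lemma no_local_solution:
  assumes "[c * x = a + b] (mod 49)" "[d * x ^ 12 = Phi a b] (mod 49)" "\<not> 7 dvd c * x" "(c, d) = (1, 1) \<or> (c, d) = (2, 1)"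
  shows False
proof -
  have x7: "\<not> 7 dvd x" using assms(3) by auto
  have u7: "\<not> 7 dvd u"
  proof
    assume "7 dvd u"
    then have "7 dvd a + b" unfolding sum by (rule dvd_mult_power_7)
    moreover have "[c * x = a + b] (mod 7)" using assms(1) by (rule cong_dvd_modulus) simp
    ultimately show False using assms(3) by (simp add: cong_dvd_iff)
  qed
  have 1: "[(c * x) ^ 72 = (k * u ^ 7) ^ 72] (mod 49)" using assms(1) unfolding sum by (rule cong_pow)
  have "(k * u ^ 7) ^ 72 = k ^ 72 * (u ^ 42) ^ 12" by (simp add: power_mult_distrib power_mult[symmetric])
  moreover have "[k ^ 72 * (u ^ 42) ^ 12 = k ^ 72 * 1 ^ 12] (mod 49)" using pow42_cong_1[OF u7] by (intro cong_mult cong_pow cong_refl)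
  ultimately have 2: "[c ^ 72 * x ^ 72 = k ^ 72] (mod 49)" using 1 cong_trans by (simp add: power_mult_distrib) blast
  have 3: "[(d * x ^ 12) ^ 6 = (l * v ^ 7) ^ 6] (mod 49)" using assms(2) unfolding Ph by (rule cong_pow)
  have "(l * v ^ 7) ^ 6 = l ^ 6 * v ^ 42" by (simp add: power_mult_distrib power_mult[symmetric])
  moreover have "[l ^ 6 * v ^ 42 = l ^ 6 * 1] (mod 49)" using pow42_cong_1[OF not_7_v] by (intro cong_mult cong_refl)
  moreover have "(d * x ^ 12) ^ 6 = d ^ 6 * x ^ 72" by (simp add: power_mult_distrib power_mult[symmetric])
  ultimately have 4: "[d ^ 6 * x ^ 72 = l ^ 6] (mod 49)" using 3 cong_trans by simp blast
  have A: "[c ^ 72 * (d ^ 6 * x ^ 72) = c ^ 72 * l ^ 6] (mod 49)" using 4 by (intro cong_mult cong_refl)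
  have B: "[c ^ 72 * (d ^ 6 * x ^ 72) = d ^ 6 * k ^ 72] (mod 49)"
    unfolding mult.left_commute[of "c ^ 72"] using 2 by (intro cong_mult cong_refl)
  have "[c ^ 72 * l ^ 6 = d ^ 6 * k ^ 72] (mod 49)" by (rule cong_trans[OF cong_sym[OF A] B])
  moreover have "[(k ^ 6) ^ 12 = (k ^ 6 mod 49) ^ 12] (mod 49)" "[(c ^ 6) ^ 12 = (c ^ 6 mod 49) ^ 12] (mod 49)"
    by (intro cong_pow; simp add: cong_def)+
  then have "[k ^ 72 = (k ^ 6 mod 49) ^ 12] (mod 49)" "[c ^ 72 = (c ^ 6 mod 49) ^ 12] (mod 49)"
    by (simp_all flip: power_mult)
  ultimately have "[(c ^ 6 mod 49) ^ 12 * l ^ 6 = d ^ 6 * (k ^ 6 mod 49) ^ 12] (mod 49)"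
    by (meson cong_refl cong_mult cong_sym cong_trans)
  moreover have "k = 3 \<and> l = 1 \<or> k = 3 * 13 ^ 6 \<and> l = 13" "c = 1 \<and> d = 1 \<or> c = 2 \<and> d = 1" using assms(4) kl by auto
  ultimately show False by (elim disjE conjE) (simp_all add: cong_def)
qed

lemma dvd_49: "49 dvd a + b"
proof (cases "7 dvd b")
  case True
  then have a7: "\<not> 7 dvd a" using not_both_7 by blast
  \<comment> \<open>Exchanging a and b exchanges the form with its complex conjugate, so the ratio
    can be taken with a as denominator.\<close>
  have s: "hh b a = sg 4 (hh a b)" "sg 4 (hh b a) = hh a b"
    unfolding sg_hh unfolding hh_def by (simp_all add: algebra_simps)
  have "cng 3 49 (hh b a ^ 7 * sg 7 (sg 4 (hh b a))) (sg 4 (hh b a) ^ 7 * sg 7 (hh b a))"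
    using cng3_sym[OF hh_cng_49] unfolding s(2) unfolding s(1) .
  then have "[b = 0] (mod 49) \<or> [b = a] (mod 49) \<or> [b = - a] (mod 49)" using hh_ratio a7 by blast
  then show ?thesis
  proof (elim disjE)
    assume b0: "[b = 0] (mod 49)"
    have "[1 * a = a + b] (mod 49)" using cong_add[OF cong_refl[of a] b0] by (simp add: cong_sym)
    moreover have "[1 * a ^ 12 = Phi a b] (mod 49)" using Phi_cong[OF cong_refl[of a] b0] by (simp add: Phi_def cong_sym)
    ultimately show ?thesis using no_local_solution[of 1 a 1] a7 by simp
  next
    assume "[b = a] (mod 49)"
    then have "[b = a] (mod 7)" by (rule cong_dvd_modulus) simp
    then show ?thesis using True a7 by (simp add: cong_dvd_iff)
  next
    assume "[b = - a] (mod 49)"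
    then show ?thesis by (simp add: cong_iff_dvd_diff add.commute)
  qed
next
  case False
  then have "[a = 0] (mod 49) \<or> [a = b] (mod 49) \<or> [a = - b] (mod 49)" using hh_ratio hh_cng_49 by blast
  then show ?thesis
  proof (elim disjE)
    assume a0: "[a = 0] (mod 49)"
    have "[1 * b = a + b] (mod 49)" using cong_add[OF a0 cong_refl[of b]] by (simp add: cong_sym)
    moreover have "[1 * b ^ 12 = Phi a b] (mod 49)" using Phi_cong[OF a0 cong_refl[of b]] by (simp add: Phi_def cong_sym)
    ultimately show ?thesis using no_local_solution[of 1 b 1] False by simp
  next
    assume ab: "[a = b] (mod 49)"
    have "[2 * b = a + b] (mod 49)" using cong_add[OF ab cong_refl[of b]] by (simp add: cong_sym)
    moreover have "Phi b b = b ^ 12" unfolding Phi_def by algebra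
    then have "[1 * b ^ 12 = Phi a b] (mod 49)" using Phi_cong[OF ab cong_refl[of b]] by (simp add: cong_sym)
    moreover have "\<not> 7 dvd 2 * b" using False prime_dvd_mult_iff[of 7 2 b] by simp
    ultimately show ?thesis using no_local_solution[of 2 b 1] by simp
  next
    assume "[a = - b] (mod 49)"
    then show ?thesis by (simp add: cong_iff_dvd_diff)
  qed
qed

end

section \<open>Units of the real subring\<close>

definition unit12 :: "complex \<Rightarrow> bool" where
  "unit12 x \<longleftrightarrow> x \<in> RR 12 \<and> (\<exists>y\<in>RR 12. x * y = 1)"

lemma n12: "\<not> 13 dvd (12::nat)" by simp

lemma unit12_RR: "unit12 x \<Longrightarrow> x \<in> RR 12" by (simp add: unit12_def)

lemma unit12_nz: "unit12 x \<Longrightarrow> x \<noteq> 0" by (auto simp: unit12_def)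

lemma unit12_mult: "unit12 x \<Longrightarrow> unit12 y \<Longrightarrow> unit12 (x * y)"
  unfolding unit12_def
proof (elim conjE bexE, intro conjI)
  fix x' y' assume h: "x \<in> RR 12" "y \<in> RR 12" "x' \<in> RR 12" "y' \<in> RR 12" "x * x' = 1" "y * y' = 1"
  have "(x * y) * (x' * y') = (x * x') * (y * y')" by simp
  then have "(x * y) * (x' * y') = 1" by (simp only: h) simp
  then show "\<exists>z\<in>RR 12. x * y * z = 1" using RR_mult[OF n12 h(3,4)] by blast
qed (auto intro: RR_mult)

lemma unit12_1: "unit12 1" unfolding unit12_def using RR_1[OF n12] by auto

lemma unit12_power: "unit12 x \<Longrightarrow> unit12 (x ^ n)"
  by (induction n) (auto intro: unit12_mult unit12_1)

lemma unit12_inverse: "unit12 x \<Longrightarrow> unit12 (inverse x)"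
  unfolding unit12_def by (metis inverse_unique mult.commute)

lemma unit12_powi: "unit12 x \<Longrightarrow> unit12 (x powi n)"
  unfolding power_int_def by (auto intro: unit12_power unit12_inverse)

lemma unit12_prod: "(\<And>i. i \<in> I \<Longrightarrow> unit12 (f i)) \<Longrightarrow> unit12 (prod f I)"
  by (induction I rule: infinite_finite_induct) (auto intro: unit12_mult unit12_1)

lemma unit12_uminus: "unit12 x \<Longrightarrow> unit12 (- x)"
  unfolding unit12_def using RR_uminus[OF n12] by (metis minus_mult_minus)

lemma unit12_sg:
  assumes "\<not> 13 dvd k" "unit12 x" shows "unit12 (sg k x)"
proof -
  obtain y where y: "y \<in> RR 12" "x * y = 1" "x \<in> RR 12" using assms by (auto simp: unit12_def)
  have "x \<in> Zom" "y \<in> Zom" using y RR_Zom by blast+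
  then have "sg k x * sg k y = sg k (x * y)" using assms(1) by simp
  then have "sg k x * sg k y = 1" unfolding y(2) using assms(1) by simp
  then show ?thesis unfolding unit12_def using y assms(1) RR_sg[OF n12] by blast
qed

lemma RR_12_real: "x \<in> RR 12 \<Longrightarrow> cnj x = x"
  using cnj_sg[of 1 x] RR_Zom[of x 12] by (simp add: RR_def)

lemma sg_12_mult:
  assumes "x \<in> RR 12" "\<not> 13 dvd k" shows "sg (12 * k) x = sg k x"
  using assms sg_sg[of k 12 x] by (simp add: RR_def mult.commute)

text \<open>On the real ring the conjugates k and 13 - k coincide, so the absolute norm, which is 1
  for a unit, is the square of this product.\<close>

lemma unit12_norm_prod:
  assumes "unit12 x" shows "(\<Prod>k=1..6. norm (sg k x)) = 1"
proof -
  obtain y where y: "y \<in> RR 12" "x * y = 1" "x \<in> RR 12" using assms by (auto simp: unit12_def)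
  have Z: "x \<in> Zom" "y \<in> Zom" using y RR_Zom by blast+
  obtain m n where mn: "NN x = of_int m" "NN y = of_int n" using NN_int Z by blast
  have "NN x * NN y = 1" using NN_mult[OF Z] y(2) by simp
  then have "m * n = 1" unfolding mn by (metis of_int_eq_1_iff of_int_mult)
  then have "norm (NN x) = 1" unfolding mn by (auto simp: zmult_eq_1_iff)
  then have 1: "(\<Prod>k=1..12. norm (sg k x)) = 1" by (simp add: NN_def prod_norm)
  have e: "norm (sg (12 * k) x) = norm (sg k x)" if "k \<in> {1..12}" for k
    using sg_12_mult[OF y(3)] not_dvd_13[OF that] by simp
  have m: "sg 144 x = sg 1 x" for x using sg_cong[of 144 1 x] by (simp add: cong_def)
  have r: "sg 24 x = sg 11 x" "sg 36 x = sg 10 x" "sg 48 x = sg 9 x" "sg 60 x = sg 8 x" "sg 72 x = sg 7 x"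
    by (auto intro!: sg_cong simp: cong_def)
  have "{1..12::nat} = {1..6} \<union> {7..12}" by auto
  then have "(\<Prod>k=1..12. norm (sg k x)) = (\<Prod>k=1..6. norm (sg k x)) * (\<Prod>k=7..12. norm (sg k x))"
    by (simp only:) (rule prod.union_disjoint, auto)
  also have "(\<Prod>k=7..12. norm (sg k x)) = (\<Prod>k=1..6. norm (sg (13 - k) x))"
    by (rule prod.reindex_bij_witness[of _ "\<lambda>k. 13 - k" "\<lambda>k. 13 - k"]) auto
  also have "\<dots> = (\<Prod>k=1..6. norm (sg k x))"
  proof (rule prod.cong[OF refl])
    fix k :: nat assume k: "k \<in> {1..6}"
    have "[12 * k = 13 - k] (mod 13)"
    proof -
      have "12 * k = (13 - k) + 13 * (k - 1)" using k by auto
      then show ?thesis by (simp only: cong_def mod_mult_self2)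
    qed
    then show "norm (sg (13 - k) x) = norm (sg k x)" using e[of k] k sg_cong by fastforce
  qed
  finally have "(\<Prod>k=1..6. norm (sg k x)) * (\<Prod>k=1..6. norm (sg k x)) = 1" using 1 by simp
  moreover have "(\<Prod>k=1..6. norm (sg k x)) \<ge> 0" by (intro prod_nonneg) auto
  ultimately show ?thesis by (metis abs_of_nonneg abs_1 abs_mult power2_eq_square power2_eq_1_iff neg_0_le_iff_le not_one_le_zero order_trans zero_le_one)
qed

section \<open>Multiplicative relations between units\<close>

text \<open>By Cauchy-Schwarz the trace form is at least the sum of the squares of the coordinates,
  so bounded conjugates leave finitely many coordinate vectors.\<close>

lemma finite_bounded_RR_12: "finite {x \<in> RR 12. \<forall>k\<in>{1..6}. norm (sg k x) \<le> C}"
proof -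
  define M where "M = \<lceil>12 * C^2\<rceil>"
  have "{x \<in> RR 12. \<forall>k\<in>{1..6}. norm (sg k x) \<le> C} \<subseteq> (\<lambda>c. val c 1) ` ({1..12} \<rightarrow>\<^sub>E {-M..M})"
  proof
    fix x assume "x \<in> {x \<in> RR 12. \<forall>k\<in>{1..6}. norm (sg k x) \<le> C}"
    then have x: "x \<in> RR 12" "\<And>k. k \<in> {1..6} \<Longrightarrow> norm (sg k x) \<le> C" by auto
    obtain c where c: "x = val c 1" using Zom_val RR_Zom x(1) by blast
    have b: "norm (sg k x) \<le> C" if "k \<in> {1..12}" for k
    proof (cases "k \<le> 6")
      case True
      then show ?thesis using x(2) that by simp
    next
      case False
      have k13: "\<not> 13 dvd k" using that not_dvd_13 by blast
      have "[12 * k = 13 - k] (mod 13)"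
      proof -
        have "12 * k = (13 - k) + 13 * (k - 1)" using that by auto
        then show ?thesis by (simp only: cong_def mod_mult_self2)
      qed
      then have "sg k x = sg (13 - k) x" using sg_12_mult[OF x(1) k13] sg_cong by metis
      moreover have "13 - k \<in> {1..6}" using that False by auto
      ultimately show ?thesis using x(2) by simp
    qed
    define S2 where "S2 = (\<Sum>j=1..12. (real_of_int (c j))\<^sup>2)"
    have cs: "(\<Sum>j=1..12. real_of_int (c j))\<^sup>2 \<le> 12 * S2"
      using Cauchy_Schwarz_ineq_sum[of "\<lambda>_. 1" "\<lambda>j. real_of_int (c j)" "{1..12::nat}"] by (simp add: S2_def)
    have "13 * S2 - (\<Sum>j=1..12. real_of_int (c j))\<^sup>2 = (\<Sum>k=1..12. (norm (sg k x))\<^sup>2)"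
      unfolding c trace_form S2_def ..
    also have "\<dots> \<le> (\<Sum>k=(1::nat)..12. C^2)" using b by (intro sum_mono power_mono) auto
    finally have "S2 \<le> 12 * C^2" using cs by simp
    have "c j \<in> {-M..M}" if "j \<in> {1..12}" for j
    proof -
      have "(real_of_int (c j))\<^sup>2 \<le> S2" unfolding S2_def using that by (intro member_le_sum) auto
      then have "(real_of_int (c j))\<^sup>2 \<le> 12 * C^2" using \<open>S2 \<le> 12 * C^2\<close> by simp
      then have "real_of_int ((c j)\<^sup>2) \<le> of_int M" unfolding M_def using le_of_int_ceiling order_trans by (metis of_int_power)
      then have "(c j)\<^sup>2 \<le> M" by linarith
      moreover have "\<bar>c j\<bar> \<le> (c j)\<^sup>2" by (metis abs_ge_zero abs_le_square_iff linorder_not_le power2_abs self_le_power zero_less_numeral int_one_le_iff_zero_less power2_eq_square mult_zero_left le_less pos2)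
      ultimately show ?thesis by auto
    qed
    then have "restrict c {1..12} \<in> {1..12} \<rightarrow>\<^sub>E {-M..M}" by auto
    moreover have "x = val (restrict c {1..12}) 1" unfolding c val_def by (intro sum.cong) auto
    ultimately show "x \<in> (\<lambda>c. val c 1) ` ({1..12} \<rightarrow>\<^sub>E {-M..M})" by blast
  qed
  moreover have "finite ({1..12::nat} \<rightarrow>\<^sub>E {-M..M})" by (intro finite_PiE) auto
  ultimately show ?thesis using finite_subset finite_imageI by blast
qed

text \<open>The easy half of the unit theorem, by pigeonhole: among exponent vectors of bounded size, more than the number of
  units in a fixed box have the same rounded logarithms at five places, so two of the resulting products coincide.\<close>

lemma units_dependent_nat:
  fixes u :: "nat \<Rightarrow> complex"
  assumes u: "\<And>i. i < 6 \<Longrightarrow> unit12 (u i)"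
  shows "\<exists>e e' :: nat \<Rightarrow> nat. (\<exists>i<6. e i \<noteq> e' i) \<and> (\<Prod>i<6. u i ^ e i) = (\<Prod>i<6. u i ^ e' i)"
proof -
  define l where "l j x = ln (norm (sg j x))" for j x
  have sg_nz: "sg j x \<noteq> 0" if "unit12 x" "j \<in> {1..6}" for j x
    using sg_eq_0_iff[of j x] unit12_nz[OF that(1)] RR_Zom[OF unit12_RR[OF that(1)]] not_dvd_13[of j] that(2) by auto
  have l_mult: "l j (x * y) = l j x + l j y" if "unit12 x" "unit12 y" "j \<in> {1..6}" for j x y
  proof -
    have "\<not> 13 dvd j" using that not_dvd_13[of j] by auto
    then have "sg j (x * y) = sg j x * sg j y" using RR_Zom unit12_RR that by (intro sg_mult) blast+
    then show ?thesis using sg_nz that unfolding l_def by (simp add: norm_mult ln_mult)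
  qed
  have l_1: "l j 1 = 0" if "j \<in> {1..6}" for j using that not_dvd_13[of j] by (simp add: l_def)
  have l_pow: "l j (x ^ n) = real n * l j x" if "unit12 x" "j \<in> {1..6}" for j x n
    using that by (induction n) (simp_all add: l_1 l_mult unit12_power algebra_simps)
  have l_sum: "(\<Sum>j=1..6. l j x) = 0" if "unit12 x" for x
  proof -
    have "(\<Sum>j=1..6. l j x) = ln (\<Prod>k=1..6. norm (sg k x))"
      unfolding l_def using sg_nz[OF that] by (subst ln_prod) auto
    then show ?thesis using unit12_norm_prod[OF that] by simp
  qed
  define P where "P e = (\<Prod>i<6. u i ^ e i)" for e :: "nat \<Rightarrow> nat"
  have P_unit: "unit12 (P e)" for e unfolding P_def using u by (intro unit12_prod unit12_power) auto
  have l_P: "l j (P e) = (\<Sum>i<6. real (e i) * l j (u i))" if "j \<in> {1..6}" for j e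
  proof -
    have "l j (\<Prod>i<k. u i ^ e i) = (\<Sum>i<k. real (e i) * l j (u i))" if "k \<le> 6" for k
      using that
    proof (induction k)
      case 0
      then show ?case using l_1 \<open>j \<in> {1..6}\<close> by simp
    next
      case (Suc k)
      have "unit12 (\<Prod>i<k. u i ^ e i)" "unit12 (u k)" using u Suc.prems by (auto intro!: unit12_prod unit12_power)
      then show ?case using Suc \<open>j \<in> {1..6}\<close> by (simp add: l_mult l_pow unit12_power)
    qed
    then show ?thesis by (simp add: P_def)
  qed
  define C where "C = (\<Sum>j\<in>{1..6}. \<Sum>i<6. \<bar>l j (u i)\<bar>)"
  have C: "\<bar>l j (P e)\<bar> \<le> real N * C" if "j \<in> {1..6}" "\<And>i. i < 6 \<Longrightarrow> e i \<le> N" for j e N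
  proof -
    have "\<bar>l j (P e)\<bar> \<le> (\<Sum>i<6. \<bar>real (e i) * l j (u i)\<bar>)" unfolding l_P[OF that(1)] by (rule sum_abs)
    also have "\<dots> \<le> (\<Sum>i<6. real N * \<bar>l j (u i)\<bar>)"
      using that(2) by (intro sum_mono) (auto simp: abs_mult intro!: mult_right_mono)
    also have "\<dots> = real N * (\<Sum>i<6. \<bar>l j (u i)\<bar>)" by (simp add: sum_distrib_left)
    also have "(\<Sum>i<6. \<bar>l j (u i)\<bar>) \<le> C" unfolding C_def using that(1) by (intro member_le_sum) (auto intro: sum_nonneg)
    finally show ?thesis by (simp add: mult_left_mono)
  qed
  define L where "L = nat \<lceil>C\<rceil> + 1"
  have L: "C \<le> real L" "L \<ge> 1" unfolding L_def by linarith+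
  \<comment> \<open>Five logarithms with equal integer parts differ by at most 1 each, and the six
    logarithms of a unit sum to zero, so the sixth differs by at most 5.\<close>
  define W where "W = {x \<in> RR 12. \<forall>k\<in>{1..6}. norm (sg k x) \<le> exp 5}"
  have W: "finite W" unfolding W_def by (rule finite_bounded_RR_12)
  define w where "w = card W"
  \<comment> \<open>There are (N + 1)^6 exponent vectors and at most ((N + 1) (2 L + 1))^5 vectors
    of rounded logarithms; with this N some fibre has more than w elements.\<close>
  define N where "N = w * (2 * L + 1) ^ 5"
  define E where "E = ({..<6::nat} \<rightarrow>\<^sub>E {..N})"
  define T where "T = ({1..5::nat} \<rightarrow>\<^sub>E {- int ((N + 1) * L)..int ((N + 1) * L)})"
  define F where "F e = (\<lambda>j\<in>{1..5}. \<lfloor>l j (P e)\<rfloor>)" for e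
  have cE: "finite E" "card E = (N + 1) ^ 6" unfolding E_def by (auto simp: card_PiE intro!: finite_PiE)
  have cT: "finite T" "card T = (2 * ((N + 1) * L) + 1) ^ 5" unfolding T_def by (auto simp: card_PiE intro!: finite_PiE) (simp add: nat_add_distrib nat_mult_distrib algebra_simps)
  have FT: "F ` E \<subseteq> T"
  proof
    fix y assume "y \<in> F ` E"
    then obtain e where e: "e \<in> E" "y = F e" by blast
    have "\<lfloor>l j (P e)\<rfloor> \<in> {- int ((N + 1) * L)..int ((N + 1) * L)}" if "j \<in> {1..5}" for j
    proof -
      have "\<bar>l j (P e)\<bar> \<le> real N * C" using e that by (intro C) (auto simp: E_def PiE_iff)
      also have "\<dots> \<le> real N * real L" using L by (intro mult_left_mono) auto
      finally have 1: "\<bar>l j (P e)\<bar> \<le> real (N * L)" by simp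
      have "real (N * L) + 1 \<le> real ((N + 1) * L)" using L(2) by (simp add: algebra_simps)
      then show ?thesis using 1 by (simp only: atLeastAtMost_iff) linarith
    qed
    then show "y \<in> T" unfolding e(2) F_def T_def by auto
  qed
  have "w * card T < card E"
  proof -
    have "2 * ((N + 1) * L) + 1 \<le> (N + 1) * (2 * L + 1)" by (simp add: algebra_simps)
    then have "card T \<le> ((N + 1) * (2 * L + 1)) ^ 5" unfolding cT(2) by (intro power_mono) auto
    then have "w * card T \<le> w * ((N + 1) * (2 * L + 1)) ^ 5" by (rule mult_le_mono2)
    also have "\<dots> = (w * (2 * L + 1) ^ 5) * (N + 1) ^ 5" by (simp only: power_mult_distrib mult_ac)
    also have "\<dots> = N * (N + 1) ^ 5" by (simp add: N_def)
    also have "\<dots> < (N + 1) ^ 6" by (simp add: power_Suc[of _ 5, simplified])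
    finally show ?thesis unfolding cE .
  qed
  have "\<exists>y\<in>T. card {e \<in> E. F e = y} > w"
  proof (rule ccontr)
    assume "\<not> ?thesis"
    then have le: "card {e \<in> E. F e = y} \<le> w" if "y \<in> T" for y using that by (simp add: not_less)
    have "card E = (\<Sum>y\<in>T. card {e \<in> E. F e = y})"
      using sum.group[OF cE(1) cT(1) FT, of "\<lambda>_. 1::nat"] by simp
    also have "\<dots> \<le> (\<Sum>y\<in>T. w)" using le by (intro sum_mono) auto
    finally show False using \<open>w * card T < card E\<close> by (simp add: mult.commute)
  qed
  then obtain y where y: "y \<in> T" "card {e \<in> E. F e = y} > w" by blast
  define A where "A = {e \<in> E. F e = y}"
  have "card A > w" using y by (simp add: A_def)
  then obtain e0 where e0: "e0 \<in> A" by (metis card.empty equals0I not_less_zero)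
  have ratio: "P e * inverse (P e0) \<in> W" if "e \<in> A" for e
  proof -
    have un: "unit12 (P e)" "unit12 (inverse (P e0))" "unit12 (P e * inverse (P e0))"
      using P_unit unit12_inverse unit12_mult by blast+
    have lr: "l j (P e * inverse (P e0)) = l j (P e) - l j (P e0)" if "j \<in> {1..6}" for j
    proof -
      have "l j (P e) = l j ((P e * inverse (P e0)) * P e0)" using unit12_nz[OF P_unit[of e0]]
        by (simp only: mult.assoc left_inverse mult_1_right not_False_eq_True)
      also have "\<dots> = l j (P e * inverse (P e0)) + l j (P e0)" by (rule l_mult[OF un(3) P_unit that])
      finally show ?thesis by simp
    qed
    have fl: "\<lfloor>l j (P e)\<rfloor> = \<lfloor>l j (P e0)\<rfloor>" if "j \<in> {1..5}" for j
    proof -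
      have "F e = F e0" using e0 \<open>e \<in> A\<close> by (simp add: A_def)
      then have "F e j = F e0 j" by simp
      then show ?thesis using that by (simp add: F_def)
    qed
    have 5: "\<bar>l j (P e * inverse (P e0))\<bar> \<le> 1" if "j \<in> {1..5}" for j
      using fl[OF that] lr[of j] that by (auto simp: abs_le_iff) linarith+
    have 6: "\<bar>l 6 (P e * inverse (P e0))\<bar> \<le> 5"
    proof -
      have "{1..6::nat} = insert 6 {1..5}" by auto
      then have "l 6 (P e * inverse (P e0)) = - (\<Sum>j=1..5. l j (P e * inverse (P e0)))"
        using l_sum[OF un(3)] by simp
      moreover have "\<bar>\<Sum>j=1..5. l j (P e * inverse (P e0))\<bar> \<le> (\<Sum>j=(1::nat)..5. 1)"
        using 5 by (intro order_trans[OF sum_abs] sum_mono) auto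
      ultimately show ?thesis by simp
    qed
    have "norm (sg j (P e * inverse (P e0))) \<le> exp 5" if "j \<in> {1..6}" for j
    proof -
      have "l j (P e * inverse (P e0)) \<le> 5"
      proof (cases "j = 6")
        case False
        then have "j \<in> {1..5}" using that by auto
        then show ?thesis using 5[of j] by simp
      qed (use 6 in simp)
      moreover have "norm (sg j (P e * inverse (P e0))) > 0" using sg_nz[OF un(3) that] by simp
      ultimately show ?thesis unfolding l_def by (metis exp_le_cancel_iff exp_ln)
    qed
    then show ?thesis using unit12_RR[OF un(3)] by (simp add: W_def)
  qed
  have "\<not> inj_on (\<lambda>e. P e * inverse (P e0)) A"
  proof
    assume "inj_on (\<lambda>e. P e * inverse (P e0)) A"
    then have "card A \<le> card W" using ratio W by (intro card_inj_on_le) auto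
    then show False using \<open>card A > w\<close> by (simp add: w_def)
  qed
  then obtain e1 e2 where e12: "e1 \<in> A" "e2 \<in> A" "e1 \<noteq> e2" "P e1 * inverse (P e0) = P e2 * inverse (P e0)"
    by (auto simp: inj_on_def)
  have "P e1 = P e2" using e12(4) unit12_nz[OF P_unit[of e0]] by simp
  moreover have "\<exists>i<6. e1 i \<noteq> e2 i"
  proof (rule ccontr)
    assume "\<not> ?thesis"
    then have eq: "e1 i = e2 i" if "i \<in> {..<6}" for i using that by auto
    have "e1 \<in> {..<6} \<rightarrow>\<^sub>E {..N}" "e2 \<in> {..<6} \<rightarrow>\<^sub>E {..N}" using e12(1,2) by (auto simp: A_def E_def)
    then have "e1 = e2" using eq by (rule PiE_ext)
    then show False using e12(3) by simp
  qed
  ultimately show ?thesis unfolding P_def by blast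
qed

text \<open>In a relation with minimal exponents these are not all divisible by l, because the only roots of
  unity in a real ring are 1 and -1.\<close>

lemma unit_relation:
  fixes u :: "nat \<Rightarrow> complex"
  assumes u: "\<And>i. i < 6 \<Longrightarrow> unit12 (u i)" and l: "l > 1"
  shows "\<exists>r W. (\<forall>i<6. r i < l) \<and> (\<exists>i<6. r i \<noteq> 0) \<and> unit12 W \<and> (\<Prod>i<6. u i ^ r i) * W ^ l \<in> {1, -1}"
proof -
  obtain e e' :: "nat \<Rightarrow> nat" where e: "\<exists>i<6. e i \<noteq> e' i" "(\<Prod>i<6. u i ^ e i) = (\<Prod>i<6. u i ^ e' i)"
    using units_dependent_nat[of u] u by blast
  have nz: "u i \<noteq> 0" if "i < 6" for i using unit12_nz u that by blast
  define d where "d i = int (e i) - int (e' i)" for i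
  have "(\<Prod>i<6. u i powi d i) = (\<Prod>i<6. u i ^ e i / u i ^ e' i)"
    by (rule prod.cong) (auto simp: d_def power_int_diff nz)
  also have "\<dots> = 1" unfolding prod_dividef e(2) using nz by simp
  finally have d: "(\<Prod>i<6. u i powi d i) \<in> {1, -1}" "\<exists>i<6. d i \<noteq> 0" using e(1) by (auto simp: d_def)
  define S where "S = {n. \<exists>d. (\<Prod>i<6. u i powi d i) \<in> {1, -1} \<and> (\<exists>i<6. d i \<noteq> 0) \<and> n = (\<Sum>i<6. nat \<bar>d i\<bar>)}"
  have "\<exists>n. n \<in> S" unfolding S_def using d by blast
  then have "(LEAST n. n \<in> S) \<in> S" by (rule LeastI_ex)
  then have "\<exists>d. (\<Prod>i<6. u i powi d i) \<in> {1, -1} \<and> (\<exists>i<6. d i \<noteq> 0) \<and> (LEAST n. n \<in> S) = (\<Sum>i<6. nat \<bar>d i\<bar>)"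
    by (subst (asm) (2) S_def) (rule CollectD)
  then obtain d where d: "(\<Prod>i<6. u i powi d i) \<in> {1, -1}" "\<exists>i<6. d i \<noteq> 0"
    "(LEAST n. n \<in> S) = (\<Sum>i<6. nat \<bar>d i\<bar>)" by blast
  have powi: "(\<Prod>i<6. u i powi (f i * int l)) = (\<Prod>i<6. u i powi f i) ^ l" for f
    by (simp add: power_int_mult power_int_of_nat prod_power_distrib)
  have "\<exists>i<6. \<not> int l dvd d i"
  proof (rule ccontr)
    assume "\<not> ?thesis"
    then have div: "d i = d i div int l * int l" if "i < 6" for i using that by simp
    define x where "x = (\<Prod>i<6. u i powi (d i div int l))"
    have "(\<Prod>i<6. u i powi d i) = (\<Prod>i<6. u i powi (d i div int l * int l))" using div by simp
    also have "\<dots> = x ^ l" unfolding x_def by (rule powi)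
    finally have "norm x ^ l = 1" using d(1) by (auto simp flip: norm_power)
    then have "norm x = 1" using l power_eq_1_iff[of "norm x" l] by auto
    moreover have "cnj x = x" unfolding x_def using u
      by (intro RR_12_real unit12_RR unit12_prod unit12_powi) auto
    ultimately have "x * x = 1" using complex_norm_square[of x] by simp
    then have "x \<in> {1, -1}" using square_eq_1_iff[of x] by simp
    moreover obtain i where i: "i < 6" "d i \<noteq> 0" using d(2) by blast
    then have "d i div int l \<noteq> 0" using div by fastforce
    ultimately have "(\<Sum>i<6. nat \<bar>d i div int l\<bar>) \<in> S" unfolding S_def x_def using i(1)
      by (intro CollectI exI[of _ "\<lambda>i. d i div int l"]) auto
    then have "(\<Sum>i<6. nat \<bar>d i\<bar>) \<le> (\<Sum>i<6. nat \<bar>d i div int l\<bar>)" unfolding d(3)[symmetric] by (rule Least_le)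
    moreover have lt: "\<bar>d i div int l\<bar> \<le> \<bar>d i\<bar>" "d i \<noteq> 0 \<Longrightarrow> \<bar>d i div int l\<bar> < \<bar>d i\<bar>" if "i < 6" for i
    proof -
      have *: "\<bar>d i\<bar> = \<bar>d i div int l\<bar> * int l" using div[OF that] by (metis abs_mult abs_of_nat)
      show "\<bar>d i div int l\<bar> \<le> \<bar>d i\<bar>" unfolding * using l by (simp add: mult_le_cancel_left1)
      assume "d i \<noteq> 0"
      then have "\<bar>d i div int l\<bar> > 0" using div[OF that] by fastforce
      then show "\<bar>d i div int l\<bar> < \<bar>d i\<bar>" unfolding * using l by (simp add: mult_less_cancel_left1)
    qed
    have "(\<Sum>i<6. nat \<bar>d i div int l\<bar>) < (\<Sum>i<6. nat \<bar>d i\<bar>)"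
      using lt i by (intro sum_strict_mono_ex1) (auto intro!: bexI[of _ i] nat_mono)
    ultimately show False by simp
  qed
  then obtain i0 where i0: "i0 < 6" "\<not> int l dvd d i0" by blast
  \<comment> \<open>Exponents are reduced modulo l; the quotients form the l-th power of W, where
    negative exponents are admissible because all u i are units.\<close>
  define r where "r i = nat (d i mod int l)" for i
  define W where "W = (\<Prod>i<6. u i powi (d i div int l))"
  have r: "int (r i) = d i mod int l" for i unfolding r_def using l by simp
  have "(\<Prod>i<6. u i powi d i) = (\<Prod>i<6. u i ^ r i * u i powi (d i div int l * int l))"
  proof (rule prod.cong[OF refl])
    fix i :: nat assume "i \<in> {..<6}"
    then have "u i powi (int (r i) + d i div int l * int l) = u i ^ r i * u i powi (d i div int l * int l)"
      using nz[of i] by (simp add: power_int_add power_int_of_nat)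
    moreover have "int (r i) + d i div int l * int l = d i" unfolding r by simp
    ultimately show "u i powi d i = u i ^ r i * u i powi (d i div int l * int l)" by simp
  qed
  also have "\<dots> = (\<Prod>i<6. u i ^ r i) * W ^ l" unfolding W_def by (simp only: prod.distrib powi)
  finally have "(\<Prod>i<6. u i ^ r i) * W ^ l \<in> {1, -1}" using d(1) by simp
  moreover have "unit12 W" unfolding W_def using u by (intro unit12_prod unit12_powi) auto
  moreover have "r i < l" for i using r[of i] l by (metis of_nat_0_less_iff of_nat_less_iff pos_mod_bound order_less_trans zero_less_one)
  moreover have "r i0 \<noteq> 0" using r[of i0] i0(2) by (metis dvd_eq_mod_eq_0 of_nat_0)
  ultimately show ?thesis using i0(1) by blast
qed

section \<open>Fermat quotients at 7\<close>

definition TT :: "(nat \<Rightarrow> int) \<Rightarrow> complex" where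
  "TT c = of_int (c 1) * tt 1 + of_int (c 2) * tt 2 + of_int (c 3) * tt 3 + of_int (c 4) * tt 4 + of_int (c 5) * tt 5 + of_int (c 6) * tt 6"

lemma TT_inj:
  assumes "TT c = TT d" "j \<in> {1..6}"
  shows "c j = d j"
proof -
  have v: "TT c = val (\<lambda>j. if j \<le> 6 then c j else c (13 - j)) 1" for c
  proof -
    show ?thesis unfolding TT_def val_def tt_def sum_1_12 by (simp add: om_red algebra_simps power2_eq_square)
  qed
  show ?thesis using val_inj[OF assms(1)[unfolded v], of j] assms(2) by simp
qed

lemma TT_dvd:
  assumes "cng 12 (of_int m) (TT d) 0" "j \<in> {1..6}"
  shows "m dvd d j"
proof -
  obtain t where t: "t \<in> RR 12" "TT d = of_int m * t" using assms(1) by (auto simp: cng_def)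
  obtain c :: "nat \<Rightarrow> int" where "t = TT c" using RR_12_rep[OF t(1)] unfolding TT_def by blast
  then have "TT d = TT (\<lambda>j. m * c j)" using t(2) by (simp add: TT_def algebra_simps)
  then show ?thesis using TT_inj assms(2) by fastforce
qed

text \<open>The monic sextic equation of \<open>tt 1\<close> has constant term -1, which displays
  its inverse.\<close>

lemma unit12_tt:
  assumes "\<not> 13 dvd k" shows "unit12 (tt k)"
proof -
  have "tt 1 * (tt 1^5 + tt 1^4 - 5*tt 1^3 - 4*tt 1^2 + 6*tt 1 + 3) = 1"
    using tt_eqs by algebra
  moreover have "tt 1^5 + tt 1^4 - 5*tt 1^3 - 4*tt 1^2 + 6*tt 1 + 3 \<in> RR 12"
    by (intro RR_intros n12 tt_RR)
  ultimately have "unit12 (tt 1)" unfolding unit12_def by auto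
  then show ?thesis using unit12_sg[OF assms, of "tt 1"] unfolding sg_tt[OF assms] by (simp only: mult_1_right)
qed

lemma prod_lessThan_6: "(\<Prod>i<6. f i) = f 0 * f 1 * f 2 * f 3 * f 4 * (f (5::nat)::complex)"
  by (simp add: eval_nat_numeral lessThan_Suc mult_ac)

lemma ex_less_6: "(\<exists>i<6. P i) \<longleftrightarrow> P 0 \<or> P 1 \<or> P 2 \<or> P 3 \<or> P 4 \<or> P (5::nat)"
proof -
  have "{..<6::nat} = {0,1,2,3,4,5}" by auto
  then show ?thesis by (metis (no_types, lifting) empty_iff insert_iff lessThan_iff)
qed

text \<open>The element c is a Fermat quotient of u at 7: sg 7 is the Frobenius automorphism modulo 7.\<close>

definition fq :: "complex \<Rightarrow> complex \<Rightarrow> bool" where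
  "fq u c \<longleftrightarrow> u \<in> RR 12 \<and> c \<in> RR 12 \<and> cng 12 49 (u ^ 7) (sg 7 u * (1 + 7 * c))"

text \<open>Fermat quotients add like logarithms, because the cross term 49 c d vanishes modulo
  49.\<close>

lemma fq_mult:
  assumes "fq u c" "fq v d" shows "fq (u * v) (c + d)"
proof -
  have R: "u \<in> RR 12" "v \<in> RR 12" "c \<in> RR 12" "d \<in> RR 12" and Z: "u \<in> Zom" "v \<in> Zom"
    using assms RR_Zom by (auto simp: fq_def)
  have "cng 12 49 (u ^ 7 * v ^ 7) ((sg 7 u * (1 + 7 * c)) * (sg 7 v * (1 + 7 * d)))"
    using assms R by (intro cng_mult RR_intros n12) (auto simp: fq_def)
  moreover have "cng 12 49 ((sg 7 u * (1 + 7 * c)) * (sg 7 v * (1 + 7 * d))) (sg 7 (u * v) * (1 + 7 * (c + d)))"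
    unfolding cng_def using R Z
    by (intro bexI[of _ "sg 7 u * sg 7 v * c * d"]) (auto simp: algebra_simps intro!: RR_intros n12)
  ultimately show ?thesis unfolding fq_def power_mult_distrib using cng_trans[OF n12] R by (auto intro: RR_intros n12)
qed

lemma fq_1: "fq 1 0" "fq (-1) 0"
  unfolding fq_def by (auto intro!: RR_intros cng_refl n12 simp: sg_uminus)

lemma fq_power: "fq u c \<Longrightarrow> fq (u ^ n) (of_nat n * c)"
  by (induction n) (auto simp: fq_1 algebra_simps dest: fq_mult)

lemma fq_pow7:
  assumes "W \<in> RR 12" shows "fq (W ^ 7) 0"
proof -
  have "sg 7 W ^ 7 = sg 7 (W ^ 7)" using assms RR_Zom by simp
  then show ?thesis unfolding fq_def using assms pow49[OF n12 assms] by (auto intro: RR_intros n12)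
qed

lemma fq_sg:
  assumes "\<not> 13 dvd k" "fq u c" shows "fq (sg k u) (sg k c)"
proof -
  have R: "u \<in> RR 12" "c \<in> RR 12" "u \<in> Zom" "c \<in> Zom" using assms RR_Zom by (auto simp: fq_def)
  then have "cng 12 (of_int 49) (sg k (u ^ 7)) (sg k (sg 7 u * (1 + 7 * c)))"
    using assms by (intro sg_cng RR_intros n12) (auto simp: fq_def)
  moreover have "sg k (sg 7 u) = sg 7 (sg k u)" using R assms(1) by (simp add: sg_sg mult.commute)
  ultimately show ?thesis unfolding fq_def using R assms(1) by (auto intro!: RR_intros n12)
qed

lemma tt_fold: "[k + l = 0] (mod 13) \<Longrightarrow> tt k = tt l"
proof -
  assume "[k + l = 0] (mod 13)"
  then have "[(k + l) + 12 * l = 0 + 12 * l] (mod 13)" by (intro cong_add cong_refl)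
  then have "[k + 13 * l = 12 * l] (mod 13)" by (simp add: algebra_simps)
  then show ?thesis using tt_cong[of "k + 13 * l" "12 * l"] tt_cong[of "k + 13 * l" k] tt_neg[of l]
    by (simp only: cong_def mod_mult_self2)
qed

text \<open>The seventh power is tt 7 + 7 tt 5 + 21 tt 3 + 35 tt 1, and tt 7 = tt 6 is the image
  under \<open>sg 7\<close>. The coefficients are those of (tt 5 + 3 tt 3 + 5 tt 1) / tt 6 modulo
  7.\<close>

lemma fq_tt_1: "fq (tt 1) (4 * tt 1 + 1 * tt 2 + 3 * tt 3 + 4 * tt 4 + 0 * tt 5 + 2 * tt 6)" (is "fq _ ?c")
proof -
  have s: "sg 7 (tt 1) = tt 6" using sg_tt[of 7 1] tt_fold[of 7 6] by (simp add: cong_def)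
  have "tt 1 ^ 7 - tt 6 * (1 + 7 * ?c) = 49 * tt 1" using tt_eqs by algebra
  then have "cng 12 49 (tt 1 ^ 7) (tt 6 * (1 + 7 * ?c))" unfolding cng_def by (intro bexI[of _ "tt 1"] tt_RR)
  then show ?thesis unfolding fq_def s by (intro conjI RR_intros n12 tt_RR)
qed

text \<open>The column coefficients are the coordinates of the Fermat quotients of tt 1, ..., tt 5.\<close>

lemma trivial_kernel_mod_7:
  fixes i0 i1 i2 i3 i4 :: int
  assumes "7 dvd 4 * i0 + 2 * i1 + 4 * i2 + 3 * i3 + 0 * i4"
    and "7 dvd 1 * i0 + 4 * i1 + 0 * i2 + 2 * i3 + 3 * i4"
    and "7 dvd 3 * i0 + 0 * i1 + 4 * i2 + 4 * i3 + 1 * i4"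
    and "7 dvd 4 * i0 + 1 * i1 + 3 * i2 + 4 * i3 + 2 * i4"
    and "7 dvd 0 * i0 + 4 * i1 + 2 * i2 + 1 * i3 + 4 * i4"
    and "7 dvd 2 * i0 + 3 * i1 + 1 * i2 + 0 * i3 + 4 * i4"
  shows "7 dvd i0 \<and> 7 dvd i1 \<and> 7 dvd i2 \<and> 7 dvd i3 \<and> 7 dvd i4"
proof -
  obtain k0 k1 k2 k3 k4 k5 where k: "4 * i0 + 2 * i1 + 4 * i2 + 3 * i3 + 0 * i4 = 7 * k0" "1 * i0 + 4 * i1 + 0 * i2 + 2 * i3 + 3 * i4 = 7 * k1" "3 * i0 + 0 * i1 + 4 * i2 + 4 * i3 + 1 * i4 = 7 * k2" "4 * i0 + 1 * i1 + 3 * i2 + 4 * i3 + 2 * i4 = 7 * k3" "0 * i0 + 4 * i1 + 2 * i2 + 1 * i3 + 4 * i4 = 7 * k4" "2 * i0 + 3 * i1 + 1 * i2 + 0 * i3 + 4 * i4 = 7 * k5"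
    using assms unfolding dvd_def by blast
  \<comment> \<open>The coefficients of k0, ..., k5 in these five lines form a left inverse modulo 7
    of the coefficient matrix; the terms in i0, ..., i4 compensate the multiples of 7.\<close>
  have "i0 = 7 * (0 * k0 + 5 * k1 + 3 * k2 + 2 * k3 + 5 * k4 + 0 * k5 - 3 * i0 - 6 * i1 - 4 * i2 - 5 * i3 - 6 * i4)" using k by simp
  then have e0: "7 dvd i0" by (rule dvdI)
  have "i1 = 7 * (0 * k0 + 5 * k1 + 1 * k2 + 0 * k3 + 0 * k4 + 3 * k5 - 2 * i0 - 4 * i1 - 1 * i2 - 2 * i3 - 4 * i4)" using k by simp
  then have e1: "7 dvd i1" by (rule dvdI)
  have "i2 = 7 * (0 * k0 + 3 * k1 + 5 * k2 + 0 * k3 + 2 * k4 + 5 * k5 - 4 * i0 - 5 * i1 - 4 * i2 - 4 * i3 - 6 * i4)" using k by simp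
  then have e2: "7 dvd i2" by (rule dvdI)
  have "i3 = 7 * (0 * k0 + 2 * k1 + 0 * k2 + 4 * k3 + 2 * k4 + 5 * k5 - 4 * i0 - 5 * i1 - 3 * i2 - 3 * i3 - 6 * i4)" using k by simp
  then have e3: "7 dvd i3" by (rule dvdI)
  have "i4 = 7 * (0 * k0 + 0 * k1 + 0 * k2 + 6 * k3 + 4 * k4 + 2 * k5 - 4 * i0 - 4 * i1 - 4 * i2 - 4 * i3 - 5 * i4)" using k by simp
  then have e4: "7 dvd i4" by (rule dvdI)
  show ?thesis using e0 e1 e2 e3 e4 by simp
qed

lemma fq_tt: "fq (tt 1) (4 * tt 1 + 1 * tt 2 + 3 * tt 3 + 4 * tt 4 + 0 * tt 5 + 2 * tt 6)" "fq (tt 2) (2 * tt 1 + 4 * tt 2 + 0 * tt 3 + 1 * tt 4 + 4 * tt 5 + 3 * tt 6)" "fq (tt 3) (4 * tt 1 + 0 * tt 2 + 4 * tt 3 + 3 * tt 4 + 2 * tt 5 + 1 * tt 6)" "fq (tt 4) (3 * tt 1 + 2 * tt 2 + 4 * tt 3 + 4 * tt 4 + 1 * tt 5 + 0 * tt 6)" "fq (tt 5) (0 * tt 1 + 3 * tt 2 + 1 * tt 3 + 2 * tt 4 + 4 * tt 5 + 4 * tt 6)"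
proof -
  have f: "tt 8 = tt 5" "tt 9 = tt 4" "tt 10 = tt 3" "tt 12 = tt 1" "tt 20 = tt 6" "tt 24 = tt 2"
    by (rule tt_fold, simp add: cong_def)+
  have f': "tt 15 = tt 2" "tt 16 = tt 3" "tt 18 = tt 5" "tt 30 = tt 4"
    by (rule tt_cong, simp add: cong_def)+
  have s: "fq (tt k) (4 * tt k + tt (k * 2) + 3 * tt (k * 3) + 4 * tt (k * 4) + 2 * tt (k * 6))" if "\<not> 13 dvd k" for k
    using fq_sg[OF that fq_tt_1] that by (simp add: sg_tt)
  show "fq (tt 1) (4 * tt 1 + 1 * tt 2 + 3 * tt 3 + 4 * tt 4 + 0 * tt 5 + 2 * tt 6)" by (rule fq_tt_1)
  show "fq (tt 2) (2 * tt 1 + 4 * tt 2 + 0 * tt 3 + 1 * tt 4 + 4 * tt 5 + 3 * tt 6)" using s[of 2] by (simp add: f f' algebra_simps)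
  show "fq (tt 3) (4 * tt 1 + 0 * tt 2 + 4 * tt 3 + 3 * tt 4 + 2 * tt 5 + 1 * tt 6)" using s[of 3] by (simp add: f f' algebra_simps)
  show "fq (tt 4) (3 * tt 1 + 2 * tt 2 + 4 * tt 3 + 4 * tt 4 + 1 * tt 5 + 0 * tt 6)" using s[of 4] by (simp add: f f' algebra_simps)
  show "fq (tt 5) (0 * tt 1 + 3 * tt 2 + 1 * tt 3 + 2 * tt 4 + 4 * tt 5 + 4 * tt 6)" using s[of 5] by (simp add: f f' algebra_simps)
qed

text \<open>\<open>unit_relation\<close> provides a relation between tt 1, ..., tt 5 and Z up to a
  seventh power and a sign. Since Z, W^7 and the sign have Fermat quotient 0, independence removes
  the first five exponents. So a power of Z with exponent prime to 7 is a seventh power up to sign,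
  and -1 is a seventh power itself.\<close>

lemma unit_7th_power:
  assumes Z: "unit12 Z" "cng 12 49 (Z ^ 7) (sg 7 Z)"
  shows "\<exists>z. unit12 z \<and> Z = z ^ 7"
proof -
  have "unit12 (if i < 5 then tt (i + 1) else Z)" if "i < 6" for i
  proof -
    have "\<not> 13 dvd i + 1" using that not_dvd_13[of "i + 1"] by auto
    then show ?thesis using unit12_tt Z(1) by simp
  qed
  then obtain r W where r: "\<forall>i<6. r i < 7" "\<exists>i<6. r i \<noteq> 0" "unit12 W"
    "(\<Prod>i<6. (if i < 5 then tt (i + 1) else Z) ^ r i) * W ^ 7 \<in> {1, -1}"
    using unit_relation[of "\<lambda>i. if i < 5 then tt (i + 1) else Z" 7] by auto
  define D where "D = tt 1 ^ r 0 * tt 2 ^ r 1 * tt 3 ^ r 2 * tt 4 ^ r 3 * tt 5 ^ r 4 * Z ^ r 5 * W ^ 7"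
  have "D = (\<Prod>i<6. (if i < 5 then tt (i + 1) else Z) ^ r i) * W ^ 7" unfolding prod_lessThan_6 D_def
    by (simp add: eval_nat_numeral)
  then have D: "D \<in> {1, -1}" using r(4) by simp
  define d where "d = (\<lambda>j::nat. if j = 1 then 4 * int (r 0) + 2 * int (r 1) + 4 * int (r 2) + 3 * int (r 3) + 0 * int (r 4) else if j = 2 then 1 * int (r 0) + 4 * int (r 1) + 0 * int (r 2) + 2 * int (r 3) + 3 * int (r 4) else if j = 3 then 3 * int (r 0) + 0 * int (r 1) + 4 * int (r 2) + 4 * int (r 3) + 1 * int (r 4) else if j = 4 then 4 * int (r 0) + 1 * int (r 1) + 3 * int (r 2) + 4 * int (r 3) + 2 * int (r 4) else if j = 5 then 0 * int (r 0) + 4 * int (r 1) + 2 * int (r 2) + 1 * int (r 3) + 4 * int (r 4) else 2 * int (r 0) + 3 * int (r 1) + 1 * int (r 2) + 0 * int (r 3) + 4 * int (r 4))"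
  have "fq Z 0" using Z unit12_RR by (auto simp: fq_def intro: RR_intros n12)
  then have "fq D (of_nat (r 0) * (4 * tt 1 + 1 * tt 2 + 3 * tt 3 + 4 * tt 4 + 0 * tt 5 + 2 * tt 6) + of_nat (r 1) * (2 * tt 1 + 4 * tt 2 + 0 * tt 3 + 1 * tt 4 + 4 * tt 5 + 3 * tt 6) + of_nat (r 2) * (4 * tt 1 + 0 * tt 2 + 4 * tt 3 + 3 * tt 4 + 2 * tt 5 + 1 * tt 6) + of_nat (r 3) * (3 * tt 1 + 2 * tt 2 + 4 * tt 3 + 4 * tt 4 + 1 * tt 5 + 0 * tt 6) + of_nat (r 4) * (0 * tt 1 + 3 * tt 2 + 1 * tt 3 + 2 * tt 4 + 4 * tt 5 + 4 * tt 6) + of_nat (r 5) * 0 + 0)"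
    unfolding D_def by (intro fq_mult fq_power fq_tt fq_pow7 unit12_RR r(3))
  moreover have "of_nat (r 0) * (4 * tt 1 + 1 * tt 2 + 3 * tt 3 + 4 * tt 4 + 0 * tt 5 + 2 * tt 6) + of_nat (r 1) * (2 * tt 1 + 4 * tt 2 + 0 * tt 3 + 1 * tt 4 + 4 * tt 5 + 3 * tt 6) + of_nat (r 2) * (4 * tt 1 + 0 * tt 2 + 4 * tt 3 + 3 * tt 4 + 2 * tt 5 + 1 * tt 6) + of_nat (r 3) * (3 * tt 1 + 2 * tt 2 + 4 * tt 3 + 4 * tt 4 + 1 * tt 5 + 0 * tt 6) + of_nat (r 4) * (0 * tt 1 + 3 * tt 2 + 1 * tt 3 + 2 * tt 4 + 4 * tt 5 + 4 * tt 6) + of_nat (r 5) * 0 + 0 = TT d"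
    unfolding TT_def d_def by (simp add: algebra_simps)
  ultimately have "fq D (TT d)" by simp
  then obtain t where t: "t \<in> RR 12" "D ^ 7 - sg 7 D * (1 + 7 * TT d) = 49 * t" unfolding fq_def cng_def by blast
  have "TT d = 7 * (- t) \<or> TT d = 7 * t"
  proof (cases "D = 1")
    case True
    then have "- (7 * TT d) = 49 * t" using t(2) by simp
    then have "TT d = 7 * (- t)" by algebra
    then show ?thesis by blast
  next
    case False
    then have "D = -1" using D by simp
    then have "- 1 + (1 + 7 * TT d) = 49 * t" using t(2) by simp
    then show ?thesis by simp
  qed
  then have "\<exists>t'\<in>RR 12. TT d = 7 * t'" using RR_uminus[OF n12 t(1)] t(1) by blast
  then have "cng 12 (of_int 7) (TT d) 0" by (simp add: cng_def)
  then have "7 dvd d j" if "j \<in> {1..6}" for j using TT_dvd that by blast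
  then have "7 dvd d 1" "7 dvd d 2" "7 dvd d 3" "7 dvd d 4" "7 dvd d 5" "7 dvd d 6" by simp_all
  then have "7 dvd int (r 0) \<and> 7 dvd int (r 1) \<and> 7 dvd int (r 2) \<and> 7 dvd int (r 3) \<and> 7 dvd int (r 4)"
    unfolding d_def by (intro trivial_kernel_mod_7) simp_all
  then have "7 dvd r 0" "7 dvd r 1" "7 dvd r 2" "7 dvd r 3" "7 dvd r 4" by presburger+
  moreover have "r 0 < 7" "r 1 < 7" "r 2 < 7" "r 3 < 7" "r 4 < 7" "r 5 < 7" using r(1) by simp_all
  ultimately have r0: "r 0 = 0" "r 1 = 0" "r 2 = 0" "r 3 = 0" "r 4 = 0" using nat_dvd_not_less by blast+
  then have r5: "r 5 \<noteq> 0" using r(2) unfolding ex_less_6 by simp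
  have e: "Z ^ r 5 * W ^ 7 \<in> {1, -1}" using D unfolding D_def r0 by simp
  have "\<not> 7 dvd r 5" using r5 \<open>r 5 < 7\<close> nat_dvd_not_less by blast
  then have "coprime (r 5) 7" using prime_imp_coprime[of 7 "r 5"] by (simp add: coprime_commute)
  then obtain m n where mn: "r 5 * m = 7 * n + 1" using r5 by (metis coprime_iff_gcd_eq_1 bezout_nat)
  define z where "z = inverse (Z ^ n * W ^ m)"
  have z: "unit12 z" unfolding z_def by (intro unit12_inverse unit12_mult unit12_power Z r)
  have "(Z ^ r 5 * W ^ 7) ^ m = Z ^ (r 5 * m) * (W ^ m) ^ 7" by (simp add: power_mult_distrib power_mult[symmetric] mult.commute)
  also have "\<dots> = Z * (Z ^ n * W ^ m) ^ 7" unfolding mn by (simp add: power_mult_distrib power_mult[symmetric] power_add mult.commute)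
  also have "\<dots> = Z / z ^ 7" unfolding z_def by (simp add: power_inverse field_simps)
  finally have "(Z ^ r 5 * W ^ 7) ^ m * z ^ 7 = Z" using unit12_nz[OF z] by simp
  moreover have "(Z ^ r 5 * W ^ 7) ^ m = 1 \<or> (Z ^ r 5 * W ^ 7) ^ m = -1"
    using e by (cases "even m") auto
  ultimately have "Z = z ^ 7 \<or> Z = (- z) ^ 7" by auto
  then show ?thesis using z unit12_uminus by blast
qed

section \<open>Signs at the real places\<close>

lemma Re_tt: "Re (tt j) = 2 * cos (2 * pi * real j / 13)"
proof -
  have "tt j = om ^ j + cnj (om ^ j)" by (simp add: tt_def cnj_om_pow power_mult mult_ac del: complex_cnj_power)
  moreover have "om ^ j = cis (2 * pi * real j / 13)" by (simp add: om_def Complex.DeMoivre mult_ac)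
  ultimately show ?thesis by simp
qed

lemma Re_tt_sign: "Re (tt 1) > 0" "Re (tt 2) > 0" "Re (tt 3) > 0" "Re (tt 4) < 0" "Re (tt 5) < 0" "Re (tt 6) < 0"
proof -
  have "cos (2 * pi * real j / 13) > 0" if "j \<le> 3" for j
  proof (rule cos_gt_zero_pi)
    have "0 \<le> 2 * pi * real j / 13" by simp
    then show "- (pi / 2) < 2 * pi * real j / 13" using pi_gt_zero by linarith
    show "2 * pi * real j / 13 < pi / 2" using that by (simp add: field_simps)
  qed
  then have pos: "Re (tt j) > 0" if "j \<le> 3" for j using that unfolding Re_tt by simp
  show "Re (tt 1) > 0" "Re (tt 2) > 0" "Re (tt 3) > 0" by (rule pos, simp)+
  have neg: "Re (tt j) < 0" if j: "4 \<le> j" "j \<le> 6" for j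
  proof -
    have "pi / 2 < 2 * pi * real j / 13" "2 * pi * real j / 13 \<le> pi" using j by (simp_all add: field_simps)
    then have "cos (2 * pi * real j / 13) < cos (pi / 2)" by (intro cos_monotone_0_pi) simp_all
    then show ?thesis unfolding Re_tt by simp
  qed
  show "Re (tt 4) < 0" "Re (tt 5) < 0" "Re (tt 6) < 0" by (rule neg; simp)+
qed

lemma Re_mult_RR_12:
  assumes "x \<in> RR 12" "y \<in> RR 12" shows "Re (x * y) = Re x * Re y"
proof -
  have "Im x = 0" using RR_12_real[OF assms(1)] by (simp add: complex_eq_iff)
  then show ?thesis by simp
qed

lemma Re_power_RR_12: "x \<in> RR 12 \<Longrightarrow> Re (x ^ n) = Re x ^ n"
  by (induction n) (simp_all add: Re_mult_RR_12 RR_power n12 del: times_complex.simps)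

text \<open>The signs of tt 1, ..., tt 5 and -1 at the six real places are independent.\<close>

lemma totally_positive_unit:
  assumes e: "unit12 e" "\<And>k. k \<in> {1..6} \<Longrightarrow> Re (sg k e) > 0"
  shows "\<exists>z. unit12 z \<and> e = z ^ 2"
proof -
  have "unit12 (if i < 5 then tt (i + 1) else e)" if "i < 6" for i
  proof -
    have "\<not> 13 dvd i + 1" using that not_dvd_13[of "i + 1"] by auto
    then show ?thesis using unit12_tt e(1) by simp
  qed
  then obtain r W where r: "\<forall>i<6. r i < 2" "\<exists>i<6. r i \<noteq> 0" "unit12 W"
    "(\<Prod>i<6. (if i < 5 then tt (i + 1) else e) ^ r i) * W ^ 2 \<in> {1, -1}"
    using unit_relation[of "\<lambda>i. if i < 5 then tt (i + 1) else e" 2] by auto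
  define D where "D = tt 1 ^ r 0 * tt 2 ^ r 1 * tt 3 ^ r 2 * tt 4 ^ r 3 * tt 5 ^ r 4 * e ^ r 5 * W ^ 2"
  have "D = (\<Prod>i<6. (if i < 5 then tt (i + 1) else e) ^ r i) * W ^ 2" unfolding prod_lessThan_6 D_def
    by (simp add: eval_nat_numeral)
  then have D: "D \<in> {1, -1}" using r(4) by simp
  define \<epsilon> :: "nat \<Rightarrow> real" where "\<epsilon> i = (-1) ^ r i" for i
  define \<delta> where "\<delta> = Re D"
  have \<epsilon>: "\<epsilon> i = 1 \<or> \<epsilon> i = -1" for i unfolding \<epsilon>_def by (cases "even (r i)") auto
  have \<delta>: "\<delta> = 1 \<or> \<delta> = -1" using D unfolding \<delta>_def by auto
  have ReD: "\<delta> = sgn (Re (tt k)) ^ r 0 * sgn (Re (tt (k * 2))) ^ r 1 * sgn (Re (tt (k * 3))) ^ r 2 * sgn (Re (tt (k * 4))) ^ r 3 * sgn (Re (tt (k * 5))) ^ r 4"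
    if "k \<in> {1..6}" for k
  proof -
    have k: "\<not> 13 dvd k" using that not_dvd_13[of k] by auto
    have R: "e \<in> RR 12" "W \<in> RR 12" "sg k e \<in> RR 12" "sg k W \<in> RR 12"
      using e(1) r(3) unit12_RR RR_sg n12 k by blast+
    have "sg k D = tt k ^ r 0 * tt (k * 2) ^ r 1 * tt (k * 3) ^ r 2 * tt (k * 4) ^ r 3 * tt (k * 5) ^ r 4 * sg k e ^ r 5 * sg k W ^ 2"
      unfolding D_def using R[THEN RR_Zom] k by (simp add: sg_tt)
    moreover have "sg k D = D" using D k by auto
    ultimately have "\<delta> = Re (tt k ^ r 0 * tt (k * 2) ^ r 1 * tt (k * 3) ^ r 2 * tt (k * 4) ^ r 3 * tt (k * 5) ^ r 4 * sg k e ^ r 5 * sg k W ^ 2)"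
      unfolding \<delta>_def by simp
    also have "\<dots> = Re (tt k) ^ r 0 * Re (tt (k * 2)) ^ r 1 * Re (tt (k * 3)) ^ r 2 * Re (tt (k * 4)) ^ r 3 * Re (tt (k * 5)) ^ r 4 * Re (sg k e) ^ r 5 * Re (sg k W) ^ 2"
      by (simp only: Re_mult_RR_12 Re_power_RR_12 RR_mult RR_power n12 tt_RR R not_False_eq_True)
    finally have "\<delta> = \<dots>" .
    moreover have "sgn \<delta> = \<delta>" using \<delta> by auto
    moreover have "sgn (Re (sg k W) ^ 2) = 1"
    proof -
      have "Re (sg k W) \<noteq> 0" using calculation \<delta> by auto
      then show ?thesis by (simp add: sgn_if)
    qed
    ultimately show ?thesis using e(2)[OF that] by (simp add: sgn_mult power_sgn)
  qed
  have f: "tt 8 = tt 5" "tt 9 = tt 4" "tt 10 = tt 3" "tt 12 = tt 1" "tt 20 = tt 6" "tt 24 = tt 2" "tt 25 = tt 1"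
    by (rule tt_fold, simp add: cong_def)+
  have f': "tt 15 = tt 2" "tt 16 = tt 3" "tt 18 = tt 5" "tt 30 = tt 4"
    by (rule tt_cong, simp add: cong_def)+
  note s = Re_tt_sign
  \<comment> \<open>One sign equation for each real place, after folding the indices back to 1, ...,
    6. The only solution is the trivial one, which also forces \<delta> = 1.\<close>
  have "\<epsilon> 3 * \<epsilon> 4 = \<delta>" using ReD[of 1] s by (simp add: \<epsilon>_def)
  moreover have "\<epsilon> 1 * \<epsilon> 2 * \<epsilon> 3 = \<delta>" using ReD[of 2] s by (simp add: \<epsilon>_def f f')
  moreover have "\<epsilon> 1 * \<epsilon> 2 = \<delta>" using ReD[of 3] s by (simp add: \<epsilon>_def f f')
  moreover have "\<epsilon> 0 * \<epsilon> 1 * \<epsilon> 4 = \<delta>" using ReD[of 4] s by (simp add: \<epsilon>_def f f')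
  moreover have "\<epsilon> 0 * \<epsilon> 3 = \<delta>" using ReD[of 5] s by (simp add: \<epsilon>_def f f')
  moreover have "\<epsilon> 0 * \<epsilon> 2 * \<epsilon> 4 = \<delta>" using ReD[of 6] s by (simp add: \<epsilon>_def f f')
  ultimately have "\<epsilon> 0 = 1 \<and> \<epsilon> 1 = 1 \<and> \<epsilon> 2 = 1 \<and> \<epsilon> 3 = 1 \<and> \<epsilon> 4 = 1 \<and> \<delta> = 1"
    using \<epsilon>[of 0] \<epsilon>[of 1] \<epsilon>[of 2] \<epsilon>[of 3] \<epsilon>[of 4] \<delta> by auto
  moreover have "r i = 0" if "\<epsilon> i = 1" "i < 6" for i
  proof -
    have "r i = 0 \<or> r i = 1" using r(1) that(2) by (simp add: less_2_cases)
    then show ?thesis using that(1) by (auto simp: \<epsilon>_def)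
  qed
  ultimately have r0: "r 0 = 0" "r 1 = 0" "r 2 = 0" "r 3 = 0" "r 4 = 0" and \<delta>1: "\<delta> = 1" by simp_all
  then have "r 5 \<noteq> 0" using r(2) unfolding ex_less_6 by simp
  moreover have "r 5 < 2" using r(1) by simp
  ultimately have "r 5 = 1" by simp
  moreover have "D = 1" using D \<delta>1 by (auto simp: \<delta>_def)
  ultimately have "e * W ^ 2 = 1" unfolding D_def r0 by simp
  then have "e = inverse W ^ 2" using unit12_nz[OF r(3)] by (simp add: field_simps)
  then show ?thesis using unit12_inverse[OF r(3)] by blast
qed

section \<open>The parity of a + b\<close>

lemma unit12I: "x \<in> RR 12 \<Longrightarrow> y \<in> RR 12 \<Longrightarrow> x * y = 1 \<Longrightarrow> unit12 x"
  unfolding unit12_def by blast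

text \<open>Both e x^7 and y^7 are compared under z -> z^7 and \<open>sg 7\<close>. The factor (sg 7
  x)^7 can be cancelled modulo 49 because x divides the integer n prime to 7, and what remains is
  the seventh power test for e.\<close>

lemma unit_7th_power_cng:
  assumes e: "unit12 e" and R: "x \<in> RR 12" "y \<in> RR 12" "w \<in> RR 12"
    and cg: "cng 12 49 (e * x ^ 7) (y ^ 7)" and w: "x * w = of_int n" "coprime n 7"
  shows "\<exists>z. unit12 z \<and> e = z ^ 7"
proof (rule unit_7th_power[OF e])
  have eR: "e \<in> RR 12" using e unit12_RR by blast
  note Z = eR[THEN RR_Zom] R[THEN RR_Zom]
  have s: "sg 7 e \<in> RR 12" "sg 7 x \<in> RR 12" "sg 7 y \<in> RR 12" "sg 7 w \<in> RR 12"
    using eR R by (intro RR_sg n12; simp)+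
  have "cng 12 49 ((e * x ^ 7) ^ 7) ((y ^ 7) ^ 7)" using cg eR R by (intro cng_power RR_intros n12)
  then have 1: "cng 12 49 (e ^ 7 * (x ^ 7) ^ 7) (sg 7 y ^ 7)"
    unfolding power_mult_distrib using cng_trans[OF n12 _ pow49[OF n12 R(2)]] by blast
  have "cng 12 49 (e ^ 7 * (x ^ 7) ^ 7) (e ^ 7 * sg 7 x ^ 7)"
    using eR R s by (intro cng_mult cng_refl pow49 RR_intros n12)
  then have 2: "cng 12 49 (e ^ 7 * sg 7 x ^ 7) (sg 7 y ^ 7)" using 1 cng_trans[OF n12] cng_sym[OF n12] by blast
  have "cng 12 (of_int 49) (sg 7 (e * x ^ 7)) (sg 7 (y ^ 7))"
    using cg eR R by (intro sg_cng RR_intros n12) simp_all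
  then have "cng 12 49 (sg 7 e * sg 7 x ^ 7) (sg 7 y ^ 7)" using Z by simp
  then have "cng 12 49 (e ^ 7 * sg 7 x ^ 7) (sg 7 e * sg 7 x ^ 7)" using 2 cng_trans[OF n12] cng_sym[OF n12] by blast
  then have 3: "cng 12 49 ((e ^ 7 - sg 7 e) * sg 7 x ^ 7) 0" by (simp add: cng_def left_diff_distrib)
  have "cng 12 49 ((e ^ 7 - sg 7 e) * sg 7 x ^ 7 * sg 7 w ^ 7) (0 * sg 7 w ^ 7)"
    using s R by (intro cng_mult[OF n12 _ _ 3] cng_refl RR_intros n12) simp_all
  moreover have "sg 7 x * sg 7 w = of_int n" using arg_cong[OF w(1), of "sg 7"] Z by simp
  then have "sg 7 x ^ 7 * sg 7 w ^ 7 = of_int (n ^ 7)" by (simp flip: power_mult_distrib)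
  ultimately have "cng 12 (of_int 49) ((e ^ 7 - sg 7 e) * of_int (n ^ 7)) 0" by (simp only: mult.assoc) simp
  moreover have "coprime (n ^ 7) 49" using w(2) coprime_power_right_iff[of n 7 2] by simp
  moreover have "e ^ 7 - sg 7 e \<in> RR 12" using eR s by (intro RR_diff RR_power n12)
  ultimately have "cng 12 (of_int 49) (e ^ 7 - sg 7 e) 0" using cng_cancel_int[OF n12] by blast
  then show "cng 12 49 (e ^ 7) (sg 7 e)" by (simp add: cng_def)
qed

lemma Q_RR: "Q a b k \<in> RR 12"
  unfolding Q_def by (intro RR_intros n12 tt_RR)

lemma sg_Q: "\<not> 13 dvd k \<Longrightarrow> sg k (Q a b 1) = Q a b k"
  using sg_tt[of k 1] unfolding Q_def by (simp del: of_int_add of_int_mult)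

lemma Q_mu: "Q a b 1 = of_int (a + b) ^ 2 - mu * of_int (a * b)"
  unfolding Q_def mu_def by (simp add: power2_eq_square algebra_simps)

text \<open>The descent to the real ring multiplies the relation by its complex conjugate instead of
  adding the two: no factor 2 appears, only a power of 13.\<close>

lemma comax_Q:
  assumes "coprime a b"
  shows "\<exists>N. comax 12 (of_int (13 ^ N)) (Q a b 1) (Q a b 2 * Q a b 3 * Q a b 4 * Q a b 5 * Q a b 6)"
proof -
  define x where "x = Q a b 1"
  define y where "y = Q a b 2 * Q a b 3 * Q a b 4 * Q a b 5 * Q a b 6"
  have R: "x \<in> RR 12" "y \<in> RR 12" unfolding x_def y_def by (intro RR_mult n12 Q_RR)+
  have c: "xx a b 24 = xx a b 11" "xx a b 36 = xx a b 10" "xx a b 48 = xx a b 9" "xx a b 60 = xx a b 8" "xx a b 72 = xx a b 7"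
    by (auto intro!: xx_cong simp: cong_def)
  obtain N where "comax 1 (13 ^ N) (prod (xx a b) {1,12}) (prod (xx a b) {2,3,4,5,6,7,8,9,10,11})"
    using comax_xx_prod[OF assms, of "{1,12}" "{2,3,4,5,6,7,8,9,10,11}"] by auto
  then have "comax 1 (13 ^ N) x y" unfolding x_def y_def Q_xx by (simp add: c mult_ac)
  then obtain p r where pr: "p \<in> Zom" "r \<in> Zom" "13 ^ N = p * x + r * y"
    unfolding comax_def Zom_RR_1 by blast
  have Z: "x \<in> Zom" "y \<in> Zom" using R RR_Zom by blast+
  have fx: "sg 12 x = x" "sg 12 y = y" using R by (auto simp: RR_def)
  have 2: "13 ^ N = sg 12 p * x + sg 12 r * y"
    using arg_cong[OF pr(3), of "sg 12"] pr(1,2) Z fx by simp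
  have ss: "sg 12 (sg 12 z) = z" if "z \<in> Zom" for z
    using that sg_cong[of 144 1 z] by (simp add: sg_sg cong_def)
  have "13 ^ (N + N) = (p * x + r * y) * (sg 12 p * x + sg 12 r * y)" by (simp add: power_add flip: pr(3) 2)
  also have "\<dots> = (p * sg 12 p * x + (p * sg 12 r + sg 12 p * r) * y) * x + (r * sg 12 r * y) * y" by algebra
  finally have "of_int (13 ^ (N + N)) = (p * sg 12 p * x + (p * sg 12 r + sg 12 p * r) * y) * x + (r * sg 12 r * y) * y" by simp
  moreover have "p * sg 12 p * x + (p * sg 12 r + sg 12 p * r) * y \<in> RR 12" "r * sg 12 r * y \<in> RR 12"
    unfolding RR_def using pr(1,2) Z fx ss by (auto simp: mult_ac add_ac)
  ultimately show ?thesis unfolding comax_def x_def[symmetric] y_def[symmetric] by blast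
qed

context eqn
begin

text \<open>The greatest common divisor of Q a b 1 and 13.\<close>

definition kap :: complex where "kap = (if l = 1 then 1 else mu)"

definition kap' :: complex where "kap' = sg 2 kap * sg 3 kap * sg 4 kap * sg 5 kap * sg 6 kap"

lemma kap_RR: "kap \<in> RR 12" "kap' \<in> RR 12"
  unfolding kap'_def kap_def by (auto intro!: RR_intros n12)

lemma kap_prod: "kap * kap' = of_int l"
proof (cases "l = 1")
  case True
  then have kap: "kap = 1" unfolding kap_def by (rule if_P)
  show ?thesis unfolding kap'_def kap unfolding True by simp
next
  case False
  then have kap: "kap = mu" unfolding kap_def by (rule if_not_P)
  have "l = 13" using False kl by auto
  then show ?thesis unfolding kap'_def kap using mu_prod by (simp add: mult_ac)
qed

lemma kap_dvd_Q: "\<exists>q\<in>RR 12. Q a b 1 = kap * q"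
  using kl
proof
  assume "(k, l) = (3, 1) \<and> \<not> 13 dvd a + b"
  then have "l = 1" by simp
  then have "kap = 1" unfolding kap_def by (rule if_P)
  then show ?thesis using Q_RR by (intro bexI[of _ "Q a b 1"]) simp_all
next
  assume h: "(k, l) = (3 * 13 ^ 6, 13)"
  then have "13 dvd a + b" unfolding sum by auto
  then obtain s where s: "a + b = 13 * s" by blast
  have "l \<noteq> 1" using h by simp
  then have kap: "kap = mu" unfolding kap_def by (rule if_not_P)
  have m: "mu * kap' = 13" using kap_prod h by (simp add: kap)
  have "Q a b 1 = 13 * (13 * of_int s ^ 2) - mu * of_int (a * b)"
    unfolding Q_mu s by (simp add: power_mult_distrib)
  also have "\<dots> = mu * (kap' * (13 * of_int s ^ 2) - of_int (a * b))"
    unfolding m[symmetric] by (simp add: algebra_simps)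
  finally show ?thesis unfolding kap using kap_RR by (auto intro!: RR_intros n12)
qed

text \<open>Besides the factorisation, w shows that \<alpha> divides v^7 and so is invertible modulo
  49; the last relation preserves comaximality of q with its conjugates for the case l = 1.\<close>

lemma q_power:
  obtains q \<epsilon> \<alpha> w p r where "q \<in> RR 12" "Q a b 1 = kap * q" "unit12 \<epsilon>" "\<alpha> \<in> RR 12" "q = \<epsilon> * \<alpha> ^ 7"
    "w \<in> RR 12" "\<alpha> ^ 7 * w = of_int v ^ 7" "p \<in> RR 12" "r \<in> RR 12"
    "p * q + r * (sg 2 q * sg 3 q * sg 4 q * sg 5 q * sg 6 q) = 1"
proof -
  obtain q where q: "q \<in> RR 12" "Q a b 1 = kap * q" using kap_dvd_Q by blast
  define H where "H = sg 2 q * sg 3 q * sg 4 q * sg 5 q * sg 6 q"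
  have H: "H \<in> RR 12" unfolding H_def using q by (intro RR_mult RR_sg n12) simp_all
  have Z: "q \<in> Zom" "kap \<in> Zom" using q kap_RR RR_Zom by blast+
  have Qk: "Q a b k = sg k kap * sg k q" if "\<not> 13 dvd k" for k
    unfolding sg_Q[OF that, symmetric] q(2) using Z that by simp
  have QH: "Q a b 2 * Q a b 3 * Q a b 4 * Q a b 5 * Q a b 6 = kap' * H"
    unfolding kap'_def H_def by (simp add: Qk mult_ac)
  have "of_int l * (q * H) = of_int l * of_int v ^ 7"
  proof -
    have "of_int l * (q * H) = Q a b 1 * (kap' * H)" unfolding kap_prod[symmetric] q(2) by (simp add: mult_ac)
    also have "\<dots> = of_int (Phi a b)" unfolding QH[symmetric] Q_prod[symmetric] by (simp add: mult_ac)
    finally show ?thesis unfolding Ph by simp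
  qed
  then have qH: "q * H = of_int v ^ 7" using l_nz by simp
  obtain N p r where pr: "p \<in> RR 12" "r \<in> RR 12" "of_int (13 ^ N) = p * Q a b 1 + r * (kap' * H)"
    using comax_Q[OF cop] unfolding QH comax_def by blast
  have "of_int (13 ^ N) = (p * kap) * q + (r * kap') * H" unfolding pr(3) q(2) by (simp add: mult_ac)
  moreover have "p * kap \<in> RR 12" "r * kap' \<in> RR 12" using pr kap_RR by (intro RR_mult n12; simp)+
  ultimately have "comax 12 (of_int (13 ^ N)) q H" unfolding comax_def by blast
  moreover have "coprime (13 ^ N) v" using coprime_m[of N] by (simp add: coprime_mult_left_iff)
  ultimately obtain p' r' where pr': "p' \<in> RR 12" "r' \<in> RR 12" "p' * q + r' * H = 1"
    using comax_imp_one[OF n12 _ q(1) H qH] by blast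
  then obtain \<epsilon> \<epsilon>' \<alpha> where e: "\<epsilon> \<in> RR 12" "\<epsilon>' \<in> RR 12" "\<alpha> \<in> RR 12" "q = \<epsilon> * \<alpha> ^ 7" "\<epsilon> * \<epsilon>' = 1"
    using seventh_power[OF n12 bezout_12 q(1) H RR_of_int[OF n12] _ _ qH _ v_nz] by blast
  have "\<alpha> ^ 7 * (\<epsilon> * H) = of_int v ^ 7" unfolding qH[symmetric] e(4) by (simp add: mult_ac)
  moreover have "\<epsilon> * H \<in> RR 12" using e H by (intro RR_mult n12)
  ultimately show thesis using that[OF q unit12I[OF e(1,2,5)] e(3,4)] pr' unfolding H_def by blast
qed

lemma Q_cng_49: "cng 12 (of_int 49) (Q a b 1) (mu * of_int (a ^ 2))"
proof -
  obtain s where s: "a + b = 49 * s" using dvd_49 by blast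
  then have b: "of_int b = 49 * of_int s - (of_int a :: complex)"
  proof -
    have "b = 49 * s - a" using s by simp
    then show ?thesis by simp
  qed
  have "Q a b 1 - mu * of_int (a ^ 2) = of_int 49 * (49 * of_int s ^ 2 - mu * of_int (s * a))"
    unfolding Q_mu s by (simp add: b) algebra
  moreover have "49 * of_int s ^ 2 - mu * of_int (s * a) \<in> RR 12" by (intro RR_intros n12 mu_RR)
  ultimately show ?thesis unfolding cng_def by blast
qed

lemma v_cng_49: "49 dvd l * v ^ 7 - 13 * a ^ 12"
  using cong_Phi_sum[OF dvd_49] unfolding Ph cong_iff_dvd_diff .

end

text \<open>A non-zero element of the residue field with 64 elements is a seventh power exactly if
  its ninth power is 1. Modulo 2, \<open>mu\<close> is -tt 1, and (-tt 1)^9 - 1 has an odd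
  coordinate.\<close>

lemma mu_power_9: "\<not> cng 12 2 (mu ^ 9) 1"
proof
  assume "cng 12 2 (mu ^ 9) 1"
  moreover have "mu - (- tt 1) = 2 * 1" by (simp add: mu_def)
  then have "cng 12 2 mu (- tt 1)" unfolding cng_def using RR_1[OF n12] by blast
  then have "cng 12 2 (mu ^ 9) ((- tt 1) ^ 9)" by (intro cng_power RR_intros n12 mu_RR tt_RR)
  ultimately have "cng 12 2 ((- tt 1) ^ 9) 1" using cng_sym[OF n12] cng_trans[OF n12] by blast
  moreover have "(- tt 1) ^ 9 - 1 = - 125 * tt 1 + tt 2 - 83 * tt 3 - 35 * tt 5 - 8 * tt 6"
    using tt_eqs by algebra
  then have "(- tt 1) ^ 9 - 1 = TT (\<lambda>j. if j = 1 then -125 else if j = 2 then 1 else if j = 3 then -83 else if j = 4 then 0 else if j = 5 then -35 else -8)"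
    unfolding TT_def by simp
  ultimately have "cng 12 (of_int 2) (TT (\<lambda>j. if j = 1 then -125 else if j = 2 then 1 else if j = 3 then -83 else if j = 4 then 0 else if j = 5 then -35 else -8)) 0"
    by (simp add: cng_def)
  from TT_dvd[OF this, of 1] show False by simp
qed

lemma coprime_13_49: "coprime (13::int) 49"
proof (rule coprimeI)
  fix c :: int assume "c dvd 13" "c dvd 49"
  then have "c dvd 4 * 49 - 15 * 13" by (intro dvd_diff dvd_mult)
  then show "is_unit c" by simp
qed

lemma mu_nz: "mu \<noteq> 0" using mu_prod by auto

context eqn
begin

lemma q_cng_49:
  assumes l: "l = 13" and q: "q \<in> RR 12" "Q a b 1 = mu * q"
  shows "cng 12 49 q (of_int (a ^ 2))"
proof -
  define m where "m = sg 2 mu * sg 3 mu * sg 4 mu * sg 5 mu * sg 6 mu"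
  have m: "m * mu = of_int 13" "m \<in> RR 12" using mu_prod unfolding m_def by (simp_all add: mult_ac RR_mult RR_sg n12)
  have "cng 12 (of_int 49) (m * Q a b 1) (m * (mu * of_int (a ^ 2)))"
    using m by (intro cng_mult cng_refl Q_cng_49 Q_RR RR_intros n12 mu_RR)
  then have "cng 12 (of_int 49) ((q - of_int (a ^ 2)) * of_int 13) 0"
    unfolding q(2) by (simp only: mult.assoc[symmetric] m(1)) (simp add: cng_def algebra_simps)
  moreover have "q - of_int (a ^ 2) \<in> RR 12" using q by (intro RR_intros n12)
  ultimately have "cng 12 (of_int 49) (q - of_int (a ^ 2)) 0" using cng_cancel_int[OF n12 _ _ coprime_13_49] by blast
  then show ?thesis by (simp add: cng_def)
qed

lemma even_sum:
  assumes l: "l = 13"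
  shows "even (a + b)"
proof (rule ccontr)
  assume odd: "odd (a + b)"
  have "kap = mu" unfolding kap_def using l by simp
  then obtain q \<epsilon> \<alpha> w where q: "q \<in> RR 12" "Q a b 1 = mu * q" "unit12 \<epsilon>" "\<alpha> \<in> RR 12" "q = \<epsilon> * \<alpha> ^ 7"
    "w \<in> RR 12" "\<alpha> ^ 7 * w = of_int v ^ 7" using q_power by metis
  have eR: "\<epsilon> \<in> RR 12" using q(3) unit12_RR by blast
  have "[v ^ 7 = a ^ 12] (mod 49)"
  proof -
    have "49 dvd 13 * (v ^ 7 - a ^ 12)" using v_cng_49 l by (simp add: algebra_simps)
    then have "49 dvd v ^ 7 - a ^ 12"
      using coprime_13_49 by (metis coprime_commute coprime_dvd_mult_right_iff)
    then show ?thesis by (simp add: cong_iff_dvd_diff)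
  qed
  then obtain t where "v ^ 7 - a ^ 12 = 49 * t" by (auto simp: cong_iff_dvd_diff)
  then have "of_int v ^ 7 - of_int a ^ 12 = 49 * of_int t" by (metis of_int_diff of_int_mult of_int_numeral of_int_power)
  then have v7: "cng 12 49 (of_int v ^ 7) (of_int a ^ 12)" unfolding cng_def using RR_of_int[OF n12] by blast
  have "cng 12 49 (q * of_int v ^ 7) (of_int (a ^ 2) * of_int a ^ 12)"
    using q_cng_49[OF l q(1,2)] v7 q by (intro cng_mult RR_intros n12)
  moreover have "q * of_int v ^ 7 = \<epsilon> * (\<alpha> * of_int v) ^ 7" unfolding q(5) by (simp add: power_mult_distrib)
  moreover have "of_int (a ^ 2) * of_int a ^ 12 = of_int (a ^ 2) ^ 7" by (simp flip: power_mult power_add)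
  ultimately have cg: "cng 12 49 (\<epsilon> * (\<alpha> * of_int v) ^ 7) (of_int (a ^ 2) ^ 7)" by simp
  have "(\<alpha> * of_int v) * (\<alpha> ^ 6 * w) = (\<alpha> ^ 7 * w) * of_int v" by algebra
  then have w: "(\<alpha> * of_int v) * (\<alpha> ^ 6 * w) = of_int (v ^ 8)" unfolding q(7) by (simp flip: power_Suc2)
  have "coprime (v ^ 8) 7" using coprime_v(3)[of 1] by simp
  then obtain z where z: "unit12 z" "\<epsilon> = z ^ 7"
    using unit_7th_power_cng[OF q(3) _ _ _ cg w] q eR by (auto intro!: RR_intros n12)
  define \<gamma> where "\<gamma> = z * \<alpha>"
  have \<gamma>: "\<gamma> \<in> RR 12" unfolding \<gamma>_def using z unit12_RR q by (intro RR_mult n12) auto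
  have Q1: "Q a b 1 = mu * \<gamma> ^ 7" unfolding q(2,5) z \<gamma>_def by (simp add: power_mult_distrib)
  \<comment> \<open>a + b odd makes a b even, so Q is 1 modulo 2.\<close>
  obtain i where i: "(a + b) ^ 2 - 1 = 2 * i"
  proof -
    have "even ((a + b) ^ 2 - 1)" using odd by simp
    then show thesis using that unfolding dvd_def by blast
  qed
  obtain j where j: "a * b = 2 * j"
  proof -
    have "even (a * b)" using odd by auto
    then show thesis using that unfolding dvd_def by blast
  qed
  have "Q a b 1 - 1 = of_int ((a + b) ^ 2 - 1) - mu * of_int (a * b)" unfolding Q_mu by simp
  also have "\<dots> = 2 * (of_int i - mu * of_int j)" unfolding i j by (simp add: algebra_simps)
  finally have 1: "cng 12 2 (mu * \<gamma> ^ 7) 1" unfolding cng_def Q1[symmetric]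
    by (intro bexI[of _ "of_int i - mu * of_int j"]) (auto intro!: RR_intros n12)
  \<comment> \<open>2^6 = 64 is -1 modulo 13, so the sixth iterate of Frobenius is trivial on the
    real ring.\<close>
  have fr: "cng 12 2 (\<gamma> ^ 64) \<gamma>"
  proof -
    have "cng 12 (of_nat 2) (\<gamma> ^ (2 ^ 6)) (sg (2 ^ 6) \<gamma>)" by (rule frob_iter[OF n12 _ _ \<gamma>]) auto
    moreover have "sg 64 \<gamma> = sg 12 \<gamma>" by (rule sg_cong) (simp add: cong_def)
    ultimately show ?thesis using \<gamma> by (simp add: RR_def)
  qed
  \<comment> \<open>The tenth power of mu \<gamma>^7 contains \<gamma>^70 = \<gamma>^6 \<gamma>^64;
    replacing \<gamma>^64 by \<gamma> isolates mu^9 without inverting \<gamma>.\<close>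
  have "cng 12 2 ((mu * \<gamma> ^ 7) ^ 9 * (mu * \<gamma> ^ 7)) (1 ^ 9 * 1)" using 1 \<gamma> by (intro cng_mult cng_power RR_intros n12 mu_RR)
  moreover have "(mu * \<gamma> ^ 7) ^ 9 * (mu * \<gamma> ^ 7) = mu ^ 10 * \<gamma> ^ 6 * \<gamma> ^ 64" by algebra
  ultimately have 2: "cng 12 2 (mu ^ 10 * \<gamma> ^ 6 * \<gamma> ^ 64) 1" by simp
  have "cng 12 2 (mu ^ 10 * \<gamma> ^ 6 * \<gamma> ^ 64) (mu ^ 10 * \<gamma> ^ 6 * \<gamma>)" using fr \<gamma> by (intro cng_mult cng_refl RR_intros n12 mu_RR)
  moreover have "mu ^ 10 * \<gamma> ^ 6 * \<gamma> = mu ^ 9 * (mu * \<gamma> ^ 7)" by algebra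
  ultimately have 3: "cng 12 2 (mu ^ 9 * (mu * \<gamma> ^ 7)) 1" using 2 cng_sym[OF n12] cng_trans[OF n12] by metis
  have "cng 12 2 (mu ^ 9 * (mu * \<gamma> ^ 7)) (mu ^ 9 * 1)" using 1 \<gamma> by (intro cng_mult cng_refl RR_intros n12 mu_RR)
  then have "cng 12 2 (mu ^ 9) 1" using 3 cng_sym[OF n12] cng_trans[OF n12] by (metis mult_1_right)
  then show False using mu_power_9 by blast
qed

lemma four_dvd:
  assumes "l = 13"
  shows "4 dvd a + b"
proof -
  have k: "k = 3 * 13 ^ 6" using kl assms by auto
  have "even u" using even_sum[OF assms] unfolding sum k by simp
  then obtain u' where "u = 2 * u'" by blast
  then have "a + b = 4 * (3 * 13 ^ 6 * 32 * u' ^ 7)" unfolding sum k by (simp add: power_mult_distrib)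
  then show ?thesis by (rule dvdI)
qed

end

section \<open>Divisibility of a + b by 13\<close>

text \<open>The analogue of \<open>seventh_power\<close> for squares up to a unit \<rho>. As the
  bootstrapping starts with the exponent 2, a single pass suffices.\<close>

lemma square_factor:
  assumes g: "\<not> 13 dvd g" "bezout_ring g"
    and R: "q \<in> RR g" "H \<in> RR g" "w \<in> RR g" "p \<in> RR g" "r \<in> RR g" "\<rho> \<in> RR g" "\<rho>' \<in> RR g"
    and qH: "q * H = \<rho> * w ^ 2" and co: "p * q + r * H = 1" and \<rho>: "\<rho> * \<rho>' = 1" and "q \<noteq> 0"
  shows "\<exists>\<epsilon>\<in>RR g. \<exists>\<epsilon>'\<in>RR g. \<exists>d\<in>RR g. q = \<epsilon> * d ^ 2 \<and> \<epsilon> * \<epsilon>' = 1"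
proof -
  have "\<exists>d\<in>RR g. (\<exists>s\<in>RR g. \<exists>t\<in>RR g. d = s * q + t * w) \<and> (\<exists>q'\<in>RR g. q = q' * d) \<and> (\<exists>w'\<in>RR g. w = w' * d)"
    using g(2) R unfolding bezout_ring_def by blast
  then obtain d s t q' w' where d: "d \<in> RR g" "s \<in> RR g" "t \<in> RR g" "d = s * q + t * w"
    "q' \<in> RR g" "q = q' * d" "w' \<in> RR g" "w = w' * d" by blast
  define A where "A = s ^ 2 * q + 2 * s * t * w + t ^ 2 * \<rho>' * H"
  define B where "B = p * q' ^ 2 + r * \<rho> * w' ^ 2"
  have A: "A \<in> RR g" unfolding A_def using R d by (intro RR_intros g(1))
  have B: "B \<in> RR g" unfolding B_def using R d by (intro RR_intros g(1))
  have dA: "d ^ 2 = q * A"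
  proof -
    have "q * (\<rho>' * H) = w ^ 2" using qH \<rho> by algebra
    then show ?thesis unfolding A_def d(4) by algebra
  qed
  have qB: "q = B * d ^ 2"
  proof -
    have "q = (p * q + r * H) * q" by (simp add: co)
    also have "\<dots> = p * q ^ 2 + r * (\<rho> * w ^ 2)" unfolding qH[symmetric] by algebra
    also have "\<dots> = p * (q' * d) ^ 2 + r * (\<rho> * (w' * d) ^ 2)" by (simp only: d(6)[symmetric] d(8)[symmetric])
    also have "\<dots> = B * d ^ 2" unfolding B_def by algebra
    finally show ?thesis .
  qed
  have "q * (B * A) = q" using qB unfolding dA by (simp add: mult_ac)
  then have "B * A = 1" using \<open>q \<noteq> 0\<close> by simp
  then show ?thesis using qB A B d(1) by blast
qed

section \<open>Units and residues at the prime above 13\<close>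

text \<open>Cyclotomic units: 2 + tt 1 is the quotient of \<open>sg 2 mu\<close> by
  \<open>mu\<close>, and 1 + tt 1 = (om^3 - 1) / (om (om - 1)). The inverses come from the sextic
  equation of \<open>tt 1\<close>.\<close>

lemma unit12_two_plus_tt: "unit12 (2 + tt 1)" and unit12_one_plus_tt: "unit12 (1 + tt 1)"
proof -
  have m: "tt 1^6 + tt 1^5 - 5*tt 1^4 - 4*tt 1^3 + 6*tt 1^2 + 3*tt 1 = 1" using tt_eqs by algebra
  have "(2 + tt 1) * (- (tt 1^5 - tt 1^4 - 3*tt 1^3 + 2*tt 1^2 + 2*tt 1 - 1)) = 1" using m by algebra
  then show "unit12 (2 + tt 1)" by (rule unit12I[rotated 2]) (intro RR_intros n12 tt_RR)+
  have "(1 + tt 1) * (- (tt 1^5 - 5*tt 1^3 + tt 1^2 + 5*tt 1 - 2)) = 1" using m by algebra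
  then show "unit12 (1 + tt 1)" by (rule unit12I[rotated 2]) (intro RR_intros n12 tt_RR)+
qed

lemma sg_2_mu: "sg 2 mu = (2 + tt 1) * mu"
proof -
  have "sg 2 mu = 2 - tt 2" using sg_tt[of 2 1] by (simp add: mu_def)
  also have "\<dots> = (2 + tt 1) * mu" unfolding mu_def tt_eqs(1) by algebra
  finally show ?thesis .
qed

text \<open>2 is a primitive root modulo 13, so iterating sg 2 mu = (2 + tt 1) mu reaches all
  conjugates of \<open>mu\<close>: each is a unit times \<open>mu\<close>, and their product is
  13.\<close>

lemma thirteen_mu: "\<exists>e. unit12 e \<and> 13 = e * mu ^ 6"
proof -
  have u: "\<exists>e. unit12 e \<and> sg (2 ^ i) mu = e * mu" for i
  proof (induction i)
    case 0
    then show ?case using unit12_1 RR_Zom[OF mu_RR] by (intro exI[of _ 1]) simp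
  next
    case (Suc i)
    then obtain e where e: "unit12 e" "sg (2 ^ i) mu = e * mu" by blast
    have ez: "e \<in> Zom" "mu \<in> Zom" using e(1) unit12_RR RR_Zom mu_RR by blast+
    have "\<not> 13 dvd (2::nat) ^ i" using prime_dvd_power[of "13::nat" 2 i] by auto
    then have "sg (2 ^ Suc i) mu = sg 2 (sg (2 ^ i) mu)" using ez by (simp add: sg_sg)
    also have "\<dots> = (sg 2 e * (2 + tt 1)) * mu" using ez by (simp add: e(2) sg_2_mu mult.assoc)
    finally show ?case using e(1) unit12_two_plus_tt by (blast intro: unit12_mult unit12_sg[of 2, simplified])
  qed
  have c: "sg 3 mu = sg (2 ^ 4) mu" "sg 5 mu = sg (2 ^ 3) mu" "sg 6 mu = sg (2 ^ 5) mu"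
  proof -
    have "tt 3 = tt 16" "tt 5 = tt 8" "tt 6 = tt 32"
      using tt_cong[of 3 16] tt_fold[of 5 8] tt_cong[of 6 32] by (simp_all add: cong_def)
    then show "sg 3 mu = sg (2 ^ 4) mu" "sg 5 mu = sg (2 ^ 3) mu" "sg 6 mu = sg (2 ^ 5) mu"
      unfolding mu_def by (simp_all add: sg_tt)
  qed
  obtain e2 e4 e3 e5 e6 where e: "unit12 e2" "sg 2 mu = e2 * mu" "unit12 e4" "sg 4 mu = e4 * mu"
    "unit12 e3" "sg 3 mu = e3 * mu" "unit12 e5" "sg 5 mu = e5 * mu" "unit12 e6" "sg 6 mu = e6 * mu"
    unfolding c using u[of 1] u[of 2] u[of 4] u[of 3] u[of 5] by auto
  have "13 = e2 * e3 * e4 * e5 * e6 * mu ^ 6" unfolding mu_prod[symmetric] e by algebra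
  moreover have "unit12 (e2 * e3 * e4 * e5 * e6)" by (intro unit12_mult e)
  ultimately show ?thesis by blast
qed

text \<open>Total ramification of 13: all \<open>tt j\<close> have the same residue, so the Galois
  group acts trivially modulo \<open>mu\<close>.\<close>

lemma sg_cng_mu:
  assumes "x \<in> RR 12" "\<not> 13 dvd k" shows "cng 12 mu (sg k x) x"
proof -
  obtain c :: "nat \<Rightarrow> int" where x: "x = of_int (c 1) * tt 1 + of_int (c 2) * tt 2 + of_int (c 3) * tt 3 + of_int (c 4) * tt 4 + of_int (c 5) * tt 5 + of_int (c 6) * tt 6"
    using RR_12_rep[OF assms(1)] by blast
  have t: "cng 12 mu (tt i) (tt j)" for i j using tt_cng_2 cng_sym[OF n12] cng_trans[OF n12] by blast
  have s: "sg k x = of_int (c 1) * tt (k * 1) + of_int (c 2) * tt (k * 2) + of_int (c 3) * tt (k * 3) + of_int (c 4) * tt (k * 4) + of_int (c 5) * tt (k * 5) + of_int (c 6) * tt (k * 6)"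
    unfolding x using assms(2) by (simp add: sg_tt)
  show ?thesis unfolding s by (subst x) (intro cng_add cng_mult cng_refl t n12 tt_RR RR_of_int)
qed

lemma cng_mu_int: "cng 12 mu (of_int n) 0 \<Longrightarrow> 13 dvd n"
proof -
  assume "cng 12 mu (of_int n) 0"
  then obtain t where t: "t \<in> RR 12" "of_int n = mu * t" by (auto simp: cng_def)
  have "om * om ^ 12 = 1" using om_pow_eq_1_iff[of 13] by (simp flip: power_Suc)
  then have "mu = (1 - om) * (1 - om ^ 12)" unfolding mu_def tt_def by (simp add: algebra_simps)
  then have "of_int n = (1 - om) * ((1 - om ^ 12) * t)" using t(2) by (simp add: mult.assoc)
  moreover have "(1 - om ^ 12) * t \<in> Zom" using RR_Zom[OF t(1)] by simp
  ultimately show ?thesis using lam_dvd_int by blast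
qed

text \<open>The form (x^7 - y^7) / (x - y), displayed as a sum of squares.\<close>

lemma sextic_form_nonneg:
  fixes x y :: real
  shows "x^6 + x^5*y + x^4*y^2 + x^3*y^3 + x^2*y^4 + x*y^5 + y^6 \<ge> 0"
proof -
  have "x^6 + x^5*y + x^4*y^2 + x^3*y^3 + x^2*y^4 + x*y^5 + y^6 =
    (x^2*(x + y/2))^2 + (y^2*(y + x/2))^2 + ((x*y*(x + y))^2 / 2 + (x^2*y)^2 / 4 + (x*y^2)^2 / 4)"
    by (simp add: power2_eq_square eval_nat_numeral field_simps)
  then show ?thesis by simp
qed

lemma residues_13: assumes "r \<in> {0..12::int}"
  shows "(7 * r ^ 2) mod 13 \<noteq> 1 \<and> (7 * r ^ 2) mod 13 \<noteq> 12" "r ^ 6 mod 13 = 1 \<or> r ^ 6 mod 13 = 12 \<or> r = 0"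
proof -
  have "r = 0 \<or> r = 1 \<or> r = 2 \<or> r = 3 \<or> r = 4 \<or> r = 5 \<or> r = 6 \<or> r = 7 \<or> r = 8 \<or> r = 9 \<or> r = 10 \<or> r = 11 \<or> r = 12"
    using assms by simp presburger
  then show "(7 * r ^ 2) mod 13 \<noteq> 1 \<and> (7 * r ^ 2) mod 13 \<noteq> 12" "r ^ 6 mod 13 = 1 \<or> r ^ 6 mod 13 = 12 \<or> r = 0"
    by (elim disjE; simp)+
qed

text \<open>5461 = 1 + 4 + ... + 4^6 is 1 modulo 13. A non-zero sixth power is 1 or -1, both squares
  modulo 13, whereas 7 is not a square.\<close>

lemma not_square_mod_13:
  assumes "13 dvd 7 * n ^ 2 - 5461 * m ^ (6::nat)" shows "13 dvd (m::int)"
proof -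
  have "[7 * n ^ 2 = 5461 * m ^ 6] (mod 13)" using assms by (simp only: cong_iff_dvd_diff)
  moreover have "[5461 * m ^ 6 = 1 * m ^ 6] (mod 13)" by (rule cong_scalar_right) (simp add: cong_def)
  ultimately have "[7 * n ^ 2 = m ^ 6] (mod 13)" using cong_trans[of "7 * n ^ 2"] by simp
  moreover have "[7 * (n mod 13) ^ 2 = 7 * n ^ 2] (mod 13)" "[m ^ 6 = (m mod 13) ^ 6] (mod 13)"
    by (intro cong_mult cong_refl cong_pow; simp add: cong_def)+
  ultimately have "[7 * (n mod 13) ^ 2 = (m mod 13) ^ 6] (mod 13)" using cong_trans by blast
  then have "7 * (n mod 13) ^ 2 mod 13 = (m mod 13) ^ 6 mod 13" by (simp only: cong_def)
  moreover have "n mod 13 \<in> {0..12}" "m mod 13 \<in> {0..12}" by auto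
  ultimately have "m mod 13 = 0" using residues_13 by metis
  then show ?thesis by auto
qed

context eqn
begin

text \<open>Modulo 49 the product Q v^7 is mu a^2 times 13 a^12, that is e (mu a^2)^7 with the unit
  e = 13 / mu^6. Hence the unit of Q divided by e passes the test for seventh powers.\<close>

lemma Q_eq_unit_seventh_power:
  assumes l: "l = 1"
  obtains e \<beta> p r where "unit12 e" "13 = e * mu ^ 6" "\<beta> \<in> RR 12" "Q a b 1 = e * \<beta> ^ 7"
    "p \<in> RR 12" "r \<in> RR 12" "p * Q a b 1 + r * Q a b 2 = 1"
proof -
  have kap: "kap = 1" unfolding kap_def using l by (rule if_P)
  obtain q \<epsilon> \<alpha> w p r where q: "q \<in> RR 12" "Q a b 1 = kap * q" "unit12 \<epsilon>" "\<alpha> \<in> RR 12" "q = \<epsilon> * \<alpha> ^ 7"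
    "w \<in> RR 12" "\<alpha> ^ 7 * w = of_int v ^ 7" and pr: "p \<in> RR 12" "r \<in> RR 12"
    "p * q + r * (sg 2 q * sg 3 q * sg 4 q * sg 5 q * sg 6 q) = 1" by (rule q_power)
  have qQ: "q = Q a b 1" using q(2) unfolding kap by simp
  have eR: "\<epsilon> \<in> RR 12" using q(3) unit12_RR by blast
  obtain e where e: "unit12 e" "13 = e * mu ^ 6" using thirteen_mu by blast
  obtain e' where e': "e' \<in> RR 12" "e * e' = 1" using e(1) unfolding unit12_def by blast
  have ue': "unit12 e'" using e(1) e' unit12_RR unit12I[of e' e] by (simp add: mult.commute)
  obtain t where "v ^ 7 - 13 * a ^ 12 = 49 * t" using v_cng_49 unfolding l by (auto simp: dvd_def)
  then have "of_int v ^ 7 - 13 * of_int a ^ 12 = 49 * of_int t"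
    by (metis of_int_diff of_int_mult of_int_numeral of_int_power)
  then have v7: "cng 12 49 (of_int v ^ 7) (13 * of_int a ^ 12)" unfolding cng_def using RR_of_int[OF n12] by blast
  have "cng 12 49 (Q a b 1) (mu * of_int (a ^ 2))" using Q_cng_49 by simp
  then have "cng 12 49 (e' * (Q a b 1 * of_int v ^ 7)) (e' * (mu * of_int (a ^ 2) * (13 * of_int a ^ 12)))"
    using v7 e' by (intro cng_mult cng_refl RR_intros Q_RR n12 mu_RR)
  moreover have "e' * (Q a b 1 * of_int v ^ 7) = (\<epsilon> * e') * (\<alpha> * of_int v) ^ 7" unfolding qQ[symmetric] q(5) by algebra
  moreover have "e' * (mu * of_int (a ^ 2) * (13 * of_int a ^ 12)) = (mu * of_int (a ^ 2)) ^ 7"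
  proof -
    have "e' * (m * A ^ 2 * ((e * m ^ 6) * A ^ 12)) = (m * A ^ 2) ^ 7" for m A :: complex
      using e'(2) by algebra
    then show ?thesis unfolding e(2) by simp
  qed
  ultimately have cg: "cng 12 49 ((\<epsilon> * e') * (\<alpha> * of_int v) ^ 7) ((mu * of_int (a ^ 2)) ^ 7)" by (simp only:)
  have "(\<alpha> * of_int v) * (\<alpha> ^ 6 * w) = (\<alpha> ^ 7 * w) * of_int v" by algebra
  then have w: "(\<alpha> * of_int v) * (\<alpha> ^ 6 * w) = of_int (v ^ 8)" unfolding q(7) by (simp flip: power_Suc2)
  have "coprime (v ^ 8) 7" using coprime_v(3)[of 1] by simp
  then obtain z where z: "unit12 z" "\<epsilon> * e' = z ^ 7"
    using unit_7th_power_cng[OF unit12_mult[OF q(3) ue'] _ _ _ cg w] q eR by (auto intro!: RR_intros n12 mu_RR)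
  have "\<epsilon> = e * z ^ 7" using z(2) e'(2) by algebra
  then have "Q a b 1 = e * (z * \<alpha>) ^ 7" unfolding qQ[symmetric] q(5) by (simp add: power_mult_distrib)
  moreover have "z * \<alpha> \<in> RR 12" using z unit12_RR q by (intro RR_mult n12) auto
  moreover have "p * Q a b 1 + (r * (sg 3 q * sg 4 q * sg 5 q * sg 6 q)) * Q a b 2 = 1"
    using pr(3) sg_Q[of 2 a b] unfolding qQ by (simp add: mult_ac)
  moreover have "r * (sg 3 q * sg 4 q * sg 5 q * sg 6 q) \<in> RR 12" using pr q by (intro RR_mult RR_sg n12) simp_all
  ultimately show thesis using that e pr(1) by blast
qed

lemma thirteen_dvd_sum:
  assumes l: "l = 1" and nd: "\<not> 13 dvd a + b" and k: "k = 3"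
  shows False
proof -
  obtain e \<beta> p r where e: "unit12 e" "13 = e * mu ^ 6" and \<beta>: "\<beta> \<in> RR 12" "Q a b 1 = e * \<beta> ^ 7"
    and pr: "p \<in> RR 12" "r \<in> RR 12" "p * Q a b 1 + r * Q a b 2 = 1" using Q_eq_unit_seventh_power[OF l] .
  \<comment> \<open>The multiplier sg 2 mu / mu, for which \<kappa> Q - sg 2 Q loses its term in a b
    and becomes (\<kappa> - 1) (a + b)^2; here \<kappa> - 1 = 1 + tt 1 is a unit too.\<close>
  define \<kappa> where "\<kappa> = 2 + tt 1"
  have \<kappa>: "unit12 \<kappa>" "\<kappa> \<in> RR 12" "sg 2 mu = \<kappa> * mu" unfolding \<kappa>_def using unit12_two_plus_tt unit12_RR sg_2_mu by auto
  obtain \<kappa>' where \<kappa>': "\<kappa>' \<in> RR 12" "\<kappa> * \<kappa>' = 1" using \<kappa>(1) unfolding unit12_def by blast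
  define e2 where "e2 = sg 2 e"
  have e2: "unit12 e2" "e2 \<in> RR 12" unfolding e2_def using unit12_sg[of 2 e] e(1) unit12_RR by auto
  obtain e2' where e2': "e2' \<in> RR 12" "e2 * e2' = 1" using e2(1) unfolding unit12_def by blast
  have eR: "e \<in> RR 12" using e(1) unit12_RR by blast
  define A B where "A = \<kappa> * \<beta>" and "B = sg 2 \<beta>"
  have AB: "A \<in> RR 12" "B \<in> RR 12" unfolding A_def B_def using \<beta> \<kappa> by (auto intro!: RR_mult RR_sg n12)
  \<comment> \<open>\<open>sg 2\<close> applied to 13 = e mu^6. Thus \<kappa> e = e2 \<kappa>^7, and
    the multiplier \<kappa> is absorbed into the seventh power.\<close>
  have e\<kappa>: "e = e2 * \<kappa> ^ 6"
  proof -
    have "13 = e2 * (\<kappa> * mu) ^ 6" using arg_cong[OF e(2), of "sg 2"] RR_Zom[OF eR] RR_Zom[OF mu_RR]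
      by (simp add: e2_def \<kappa>(3)[symmetric])
    then have "e * mu ^ 6 = e2 * (\<kappa> * mu) ^ 6" by (rule trans[OF e(2)[symmetric]])
    then have "e * mu ^ 6 = (e2 * \<kappa> ^ 6) * mu ^ 6" by (simp add: power_mult_distrib mult_ac)
    then show ?thesis using mu_nz by simp
  qed
  have QA: "\<kappa> * Q a b 1 = e2 * A ^ 7" unfolding \<beta>(2) e\<kappa> A_def by algebra
  have QB: "Q a b 2 = e2 * B ^ 7"
    using sg_Q[of 2 a b] RR_Zom[OF eR] RR_Zom[OF \<beta>(1)] unfolding \<beta>(2) e2_def B_def by simp
  have Q2: "Q a b 2 = of_int (a + b) ^ 2 - \<kappa> * mu * of_int (a * b)"
  proof -
    have "Q a b 2 = sg 2 (Q a b 1)" using sg_Q[of 2 a b] by simp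
    also have "\<dots> = of_int (a + b) ^ 2 - sg 2 mu * of_int (a * b)"
      unfolding Q_mu using RR_Zom[OF mu_RR] by (simp del: of_int_mult of_int_add)
    finally show ?thesis unfolding \<kappa>(3) .
  qed
  have "7 dvd u"
  proof -
    have "7 dvd a + b" using dvd_49 by (rule dvd_trans[rotated]) simp
    then have "7 dvd 3 * u ^ 7" unfolding sum k .
    moreover have p7: "prime (7::int)" by simp
    ultimately have "7 dvd (3::int) \<or> 7 dvd u ^ 7" using prime_dvd_mult_iff by blast
    then have "7 dvd u ^ 7" by simp
    then show ?thesis using p7 prime_dvd_power by blast
  qed
  then obtain u' where u': "u = 7 * u'" by blast
  define U where "U = complex_of_int u'"
  have U0: "U \<noteq> 0" unfolding U_def using uv u' by simp
  have sU: "of_int (a + b) = 3 * (7 * U) ^ 7" unfolding sum k u' U_def by simp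
  define \<rho> where "\<rho> = e2' * (1 + tt 1)"
  have main: "A ^ 7 - B ^ 7 = \<rho> * (3 * (7 * U) ^ 7) ^ 2"
  proof -
    have "e2 * A ^ 7 - e2 * B ^ 7 = (1 + tt 1) * of_int (a + b) ^ 2"
      unfolding QA[symmetric] QB[symmetric] unfolding Q2 Q_mu unfolding \<kappa>_def by algebra
    then show ?thesis unfolding sU \<rho>_def using e2'(2) by algebra
  qed
  obtain \<rho>' where \<rho>: "\<rho> \<in> RR 12" "\<rho>' \<in> RR 12" "\<rho> * \<rho>' = 1"
  proof -
    have "unit12 \<rho>" unfolding \<rho>_def using unit12I[of e2' e2] e2 e2' unit12_one_plus_tt
      by (intro unit12_mult) (simp_all add: mult.commute)
    then show thesis using that unfolding unit12_def by blast
  qed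
  have UR: "U \<in> RR 12" unfolding U_def by (rule RR_of_int[OF n12])
  \<comment> \<open>7 | u gives A^7 = B^7 modulo 7, and x^7 is sg 7 x modulo 7; \<open>sg 2\<close>
    then undoes \<open>sg 7\<close>, since 2 * 7 = 14 is 1 modulo 13.\<close>
  have "\<exists>C\<in>RR 12. A = B + 7 * C"
  proof -
    have f: "cng 12 7 (x ^ 7) (sg 7 x)" if "x \<in> RR 12" for x
      using frob_iter[OF n12 _ _ that, of 7 1] by simp
    have "A ^ 7 - B ^ 7 = 7 * (\<rho> * 9 * 7 ^ 13 * U ^ 14)" unfolding main by algebra
    moreover have "\<rho> * 9 * 7 ^ 13 * U ^ 14 \<in> RR 12" using \<rho> UR by (intro RR_intros n12)
    ultimately have c: "cng 12 7 (A ^ 7) (B ^ 7)" unfolding cng_def by blast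
    have "cng 12 7 (sg 7 A) (sg 7 B)"
      by (rule cng_trans[OF n12 cng_trans[OF n12 cng_sym[OF n12 f[OF AB(1)]] c] f[OF AB(2)]])
    then have c2: "cng 12 (of_int 7) (sg 7 A) (sg 7 B)" by simp
    have "cng 12 (of_int 7) (sg 2 (sg 7 A)) (sg 2 (sg 7 B))" by (rule sg_cng[OF n12 _ _ _ c2]) (simp_all add: AB RR_sg)
    moreover have "sg 2 (sg 7 x) = x" if "x \<in> RR 12" for x
      using sg_cong[of 14 1 x] RR_Zom[OF that] by (simp add: sg_sg cong_def)
    ultimately obtain t where "t \<in> RR 12" "A - B = 7 * t" using AB unfolding cng_def by auto
    then show ?thesis by (intro bexI[of _ t]) (simp_all add: algebra_simps)
  qed
  then obtain C where C: "C \<in> RR 12" "A = B + 7 * C" by blast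
  \<comment> \<open>T is (A^7 - B^7) / (7 (A - B)), and C y is the part of it divisible by
    C.\<close>
  define y where "y = 21 * B^5 + 245 * C * B^4 + 1715 * C^2 * B^3 + 7203 * C^3 * B^2 + 16807 * C^4 * B + 16807 * C^5"
  define T where "T = B^6 + C * y"
  have yR: "y \<in> RR 12" unfolding y_def using AB C by (intro RR_intros n12)
  have TR: "T \<in> RR 12" unfolding T_def using AB C yR by (intro RR_intros n12)
  have T7: "7 * T = A^6 + A^5*B + A^4*B^2 + A^3*B^3 + A^2*B^4 + A*B^5 + B^6"
    unfolding C(2) T_def y_def by algebra
  have AT: "A ^ 7 - B ^ 7 = 49 * (C * T)" unfolding C(2) T_def y_def by algebra
  then have TC: "T * C = \<rho> * (3 * 7 ^ 6 * U ^ 7) ^ 2" using main by algebra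
  have \<rho>0: "\<rho> \<noteq> 0" using \<rho>(3) by auto
  have T0: "T \<noteq> 0"
  proof
    assume "T = 0"
    then have "\<rho> * (3 * 7 ^ 6 * U ^ 7) ^ 2 = 0" using TC by simp
    then show False using \<rho>0 U0 by simp
  qed
  define P R where "P = p * e2 * \<kappa>'" and "R = r * e2"
  have PR: "P \<in> RR 12" "R \<in> RR 12" unfolding P_def R_def using pr e2 \<kappa>' by (auto intro!: RR_mult n12)
  have "P * A ^ 7 + R * B ^ 7 = 1"
  proof -
    have "P * A ^ 7 + R * B ^ 7 = p * (\<kappa>' * (e2 * A ^ 7)) + r * (e2 * B ^ 7)" unfolding P_def R_def by algebra
    also have "\<dots> = p * Q a b 1 * (\<kappa> * \<kappa>') + r * Q a b 2" unfolding QA[symmetric] QB[symmetric] by algebra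
    finally show ?thesis using \<kappa>'(2) pr(3) by simp
  qed
  \<comment> \<open>Since B^7 = B (T - C y) and A^7 = B^7 + 49 C T, comaximality of A^7 and B^7
    passes to T and C.\<close>
  then have "(P + R) * B * T + (49 * P * T - (P + R) * y * B) * C = 1" using AT unfolding T_def by algebra
  moreover have "(P + R) * B \<in> RR 12" "49 * P * T - (P + R) * y * B \<in> RR 12"
    using PR AB TR yR by (auto intro!: RR_intros n12)
  moreover have "3 * 7 ^ 6 * U ^ 7 \<in> RR 12" using UR by (intro RR_intros n12)
  ultimately obtain \<epsilon> \<epsilon>' d where \<epsilon>: "\<epsilon> \<in> RR 12" "\<epsilon>' \<in> RR 12" "d \<in> RR 12" "T = \<epsilon> * d ^ 2" "\<epsilon> * \<epsilon>' = 1"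
    using square_factor[OF n12 bezout_12 TR C(1) _ _ _ \<rho>(1,2) TC _ \<rho>(3) T0] by blast
  have "Re (sg k \<epsilon>) > 0" if "k \<in> {1..6}" for k
  proof -
    have k: "\<not> 13 dvd k" using that not_dvd_13[of k] by auto
    have sR: "sg k A \<in> RR 12" "sg k B \<in> RR 12" "sg k T \<in> RR 12" "sg k \<epsilon> \<in> RR 12" "sg k d \<in> RR 12"
      using AB TR \<epsilon> k by (auto intro!: RR_sg n12)
    note Z = AB[THEN RR_Zom] TR[THEN RR_Zom] \<epsilon>(1,3)[THEN RR_Zom]
    define x y where "x = Re (sg k A)" and "y = Re (sg k B)"
    have "7 * sg k T = sg k A^6 + sg k A^5* sg k B + sg k A^4* sg k B^2 + sg k A^3* sg k B^3 + sg k A^2* sg k B^4 + sg k A* sg k B^5 + sg k B^6"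
      using arg_cong[OF T7, of "sg k"] Z k by simp
    then have "Re (7 * sg k T) = Re (sg k A^6 + sg k A^5* sg k B + sg k A^4* sg k B^2 + sg k A^3* sg k B^3 + sg k A^2* sg k B^4 + sg k A* sg k B^5 + sg k B^6)"
      by (rule arg_cong)
    also have "\<dots> = x^6 + x^5*y + x^4*y^2 + x^3*y^3 + x^2*y^4 + x*y^5 + y^6"
      unfolding x_def y_def by (simp only: plus_complex.simps Re_mult_RR_12 Re_power_RR_12 RR_power n12 sR not_False_eq_True)
    also have "\<dots> \<ge> 0" by (rule sextic_form_nonneg)
    finally have "Re (sg k T) \<ge> 0" by simp
    moreover have "Re (sg k T) = Re (sg k \<epsilon>) * Re (sg k d) ^ 2"
    proof -
      have "sg k T = sg k \<epsilon> * sg k d ^ 2" unfolding \<epsilon>(4) using Z k by simp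
      then show ?thesis by (simp only: Re_mult_RR_12 Re_power_RR_12 RR_power n12 sR not_False_eq_True)
    qed
    moreover have "Re (sg k T) \<noteq> 0"
    proof
      assume "Re (sg k T) = 0"
      moreover have "Im (sg k T) = 0" using RR_12_real[OF sR(3)] by (simp add: complex_eq_iff)
      ultimately have "sg k T = 0" by (simp add: complex_eq_iff)
      then show False using sg_eq_0_iff[OF k Z(3)] T0 by simp
    qed
    ultimately show ?thesis by (metis less_eq_real_def linorder_not_less mult_eq_0_iff mult_nonneg_nonneg mult_nonpos_nonneg order_antisym zero_le_power2)
  qed
  moreover have "unit12 \<epsilon>" by (rule unit12I[OF \<epsilon>(1,2,5)])
  ultimately obtain z where z: "unit12 z" "\<epsilon> = z ^ 2" using totally_positive_unit by blast
  define g where "g = z * d"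
  have g: "g \<in> RR 12" "T = g ^ 2" unfolding g_def \<epsilon>(4) z(2) using z(1) unit12_RR \<epsilon>(3)
    by (auto intro!: RR_mult n12 simp: power_mult_distrib)
  obtain n m where nm: "cng 12 mu g (of_int n)" "cng 12 mu \<beta> (of_int m)" using RR_12_cng_int g(1) \<beta>(1) by meson
  have B: "cng 12 mu B (of_int m)" unfolding B_def by (rule cng_trans[OF n12 sg_cng_mu[OF \<beta>(1)] nm(2)]) simp
  \<comment> \<open>\<kappa> is 4 modulo mu, so A and B have the residues 4 m and m; their sextic
    form is 5461 m^6.\<close>
  have "cng 12 mu \<kappa> (2 + 2)" unfolding \<kappa>_def by (intro cng_add cng_refl n12 tt_cng_2)
  then have A: "cng 12 mu A (4 * of_int m)" unfolding A_def using nm(2) \<beta> by (intro cng_mult RR_intros n12) simp_all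
  have "cng 12 mu (7 * g ^ 2) (7 * of_int n ^ 2)" using nm(1) g by (intro cng_mult cng_refl cng_power RR_intros n12)
  moreover have "cng 12 mu (A^6 + A^5*B + A^4*B^2 + A^3*B^3 + A^2*B^4 + A*B^5 + B^6)
    ((4* of_int m)^6 + (4* of_int m)^5* of_int m + (4* of_int m)^4* of_int m^2 + (4* of_int m)^3* of_int m^3 + (4* of_int m)^2* of_int m^4 + (4* of_int m)* of_int m^5 + of_int m^6)"
    using A B AB by (intro cng_add cng_mult cng_power RR_intros n12)
  moreover have "(4*M)^6 + (4*M)^5*M + (4*M)^4*M^2 + (4*M)^3*M^3 + (4*M)^2*M^4 + (4*M)*M^5 + M^6 = 5461 * M ^ 6" for M :: complex by algebra
  ultimately have "cng 12 mu (7 * of_int n ^ 2) (5461 * of_int m ^ 6)"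
    unfolding T7[symmetric] g(2) using cng_sym[OF n12] cng_trans[OF n12] by metis
  then have "cng 12 mu (of_int (7 * n ^ 2 - 5461 * m ^ 6)) 0" by (simp add: cng_def)
  then have "13 dvd m" using cng_mu_int not_square_mod_13 by blast
  then obtain m' where m': "m = 13 * m'" by blast
  have "cng 12 mu (of_int m) 0" unfolding m' e(2) of_int_mult of_int_numeral cng_def using eR
    by (intro bexI[of _ "e * mu ^ 5 * of_int m'"] RR_intros n12 mu_RR) (simp add: eval_nat_numeral mult_ac)
  \<comment> \<open>A zero residue of \<beta> makes mu divide Q, hence (a + b)^2, and so 13 divides
    a + b.\<close>
  then have "cng 12 mu \<beta> 0" using nm(2) cng_trans[OF n12] by blast
  then have "cng 12 mu (e * \<beta> ^ 7) (e * 0 ^ 7)" using eR \<beta>(1) by (intro cng_mult cng_refl cng_power RR_intros n12)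
  then have "cng 12 mu (Q a b 1) 0" unfolding \<beta>(2) by simp
  moreover have "cng 12 mu (of_int ((a + b) ^ 2)) (Q a b 1)" unfolding cng_def Q_mu
    by (intro bexI[of _ "of_int (a * b)"] RR_of_int n12) simp
  ultimately have "cng 12 mu (of_int ((a + b) ^ 2)) 0" using cng_trans[OF n12] by blast
  then have "13 dvd (a + b) ^ 2" by (rule cng_mu_int)
  then have "13 dvd a + b" by (rule prime_dvd_power[rotated]) simp
  then show False using nd by blast
qed

end

theorem theorem1p2:
  fixes a b c :: int
  assumes "a * b * c \<noteq> 0"
    and "gcd a (gcd b c) = 1"
    and "a ^ 13 + b ^ 13 = 3 * c ^ 7"
  shows "13 dvd a + b \<and> 4 dvd a + b"
  using assms
proof (cases rule: eqn_cases)
  case (1 u v)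
  then show ?thesis using eqn.thirteen_dvd_sum by blast
next
  case (2 u v)
  then show ?thesis using eqn.four_dvd by blast
qed

end
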